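(* Let $\mathbb{X}$ be $\mathbb{R}^n$, $\mathbb{S}^n$ or $\mathbb{H}^n$. Let $F:\mathbb{R}^m_+\to\mathbb{R}$ be a supermodular Borel measurable function with $F(\mathbf{0})=0$, for each pair $1\le i<j\le m$ let $K_{ij}$ be a nonincreasing nonnegative function on $\mathbb{R}_+$, and let $u_1,\dots,u_m$ be nonnegative measurable functions on $\mathbb{X}$ that vanish at infinity. Assume that the negative part $F_-$ of $F$ satisfies $$\int_{\mathbb{X}}\cdots\int_{\mathbb{X}} F_-\bigl(u_\ell(x_\ell)\,\mathbf{e}_\ell\bigr)\prod_{i<j}K_{ij}(d(x_i,x_j))\,dx_1\dots dx_m<\infty\qquad\text{for }\ell=1,\dots,m.$$ Then $$\int_{\mathbb{X}}\cdots\int_{\mathbb{X}} F(u_1(x_1),\dots,u_m(x_m))\prod_{i<j}K_{ij}(d(x_i,x_j))\,dx_1\dots dx_m\ \le\ \int_{\mathbb{X}}\cdots\int_{\mathbb{X}} F(u_1^*(x_1),\dots,u_m^*(x_m))\prod_{i<j}K_{ij}(d(x_i,x_j))\,dx_1\dots dx_m .$$ Suppose moreover that this inequality holds with equality, that the integrals are finite, and that $K_{ij}(t)>0$ for all $i<j$ and all $t<\operatorname{diam}\mathbb{X}$. Let $\Gamma_0$ be the graph on the vertex set $\{1,\dots,m\}$ which has an edge between $i$ and $j$ ($i<j$) whenever $K_{ij}$ is a strictly decreasing function, and let $i\neq j$ be from the same connected component of $\Gamma_0$. If $$F(\mathbf{y}+h\mathbf{e}_i+k\mathbf{e}_j)+F(\mathbf{y})>F(\mathbf{y}+h\mathbf{e}_i)+F(\mathbf{y}+k\mathbf{e}_j)$$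 for all $\mathbf{y}\in\mathbb{R}^m_+$ and all $h,k>0$, and if $u_i$ and $u_j$ are non-constant, then $u_i=u_i^*\circ\tau$ and $u_j=u_j^*\circ\tau$ for some translation $\tau$ on $\mathbb{X}$.
   Context: $\mathbb{X}$ is the Euclidean space $\mathbb{R}^n$, the sphere $\mathbb{S}^n$, or the hyperbolic space $\mathbb{H}^n$, with its standard distance $d(\cdot,\cdot)$ and uniform (Riemannian) volume measure $\lambda$; $dx$ denotes integration with respect to $\lambda$. $\operatorname{diam}\mathbb{X}$ is the diameter of $\mathbb{X}$ ($+\infty$ for $\mathbb{R}^n$ and $\mathbb{H}^n$). A distinguished point $x^*\in\mathbb{X}$ (origin or north pole) is fixed. A translation on $\mathbb{X}$ is an ordinary translation if $\mathbb{X}=\mathbb{R}^n$, and an isometry of $\mathbb{X}$ if $\mathbb{X}=\mathbb{S}^n$ or $\mathbb{H}^n$. $\mathbb{R}_+=[0,\infty)$, $\mathbb{R}^m_+$ is the closed positive cone, $\mathbf{e}_i$ is the $i$-th standard basis vector of $\mathbb{R}^m$, and $F_-=\max\{-F,0\}$. A function $F:\mathbb{R}^m_+\to\mathbb{R}$ is supermodular if $F(\mathbf{y}+h\mathbf{e}_i+k\mathbf{e}_j)+F(\mathbf{y})\ge F(\mathbf{y}+h\mathbf{e}_i)+F(\mathbf{y}+k\mathbf{e}_j)$ for all $\mathbf{y}\in\mathbb{R}^m_+$, all $i\ne j$ and all $h,k>0$. A nonnegative measurable function $u$ on $\mathbb{R}^n$ or $\mathbb{H}^n$ vanishes at infinity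 if $\lambda(\{x: u(x)>t\})<\infty$ for all $t>0$; on $\mathbb{S}^n$ the requirement is void. The symmetric decreasing rearrangement $u^*$ of $u$ is the upper semicontinuous, nonincreasing function of $d(x,x^* )$ that is equimeasurable with $u$; explicitly $u^*(x)=\sup\{t\ge 0:\ \rho(t)\ge\lambda(B_{d(x,x^* )})\}$, where $\rho(t)=\lambda(\{x\in\mathbb{X}:u(x)>t\})$ and $B_r$ is the open ball of radius $r$ centered at $x^*$ (the value at the single point $x=x^*$ is immaterial). Equalities between functions are understood almost everywhere; "non-constant" means not almost everywhere equal to a constant. The hypotheses ensure that both integrals in the inequality are well-defined, with values in $(-\infty,+\infty]$. *)

theory Defs
  imports "HOL-Analysis.Analysis"
begin

section \<open>Euclidean, spherical and hyperbolic space\<close>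

text \<open>
  The point set of a space is the space of its volume measure. All volume measures are completed,
  so that measurable means Lebesgue measurable.
\<close>

record 'a model_space =
  vol :: "'a measure"
  distance :: "'a \<Rightarrow> 'a \<Rightarrow> real"
  base :: 'a
  translation_maps :: "('a \<Rightarrow> 'a) set"

abbreviation points :: "'a model_space \<Rightarrow> 'a set" where
  "points X \<equiv> space (vol X)"

definition isometries :: "'a set \<Rightarrow> ('a \<Rightarrow> 'a \<Rightarrow> real) \<Rightarrow> ('a \<Rightarrow> 'a) set" where
  "isometries S d = {\<tau>. bij_betw \<tau> S S \<and> (\<forall>x\<in>S. \<forall>y\<in>S. d (\<tau> x) (\<tau> y) = d x y)}"

definition euclidean_model :: "'a::euclidean_space model_space" where
  "euclidean_model =
    \<lparr> vol = lebesgue,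
      distance = dist,
      base = 0,
      translation_maps = range (\<lambda>v x. x + v) \<rparr>"

text \<open>
  The unit sphere of an \<open>N\<close>-dimensional space, of dimension \<open>n = N - 1\<close>. Its surface measure is
  given by the cone formula: the area of \<open>A\<close> is \<open>N\<close> times the Lebesgue measure of the cone
  \<open>{r a | 0 < r < 1, a \<in> A}\<close>, since \<open>sgn x = x / norm x\<close>.
\<close>

definition sphere_area :: "'a::euclidean_space measure" where
  "sphere_area =
    scale_measure (of_nat DIM('a))
      (distr (restrict_space lborel (ball 0 1 - {0})) (restrict_space borel (sphere 0 1)) sgn)"

definition spherical_distance :: "'a::euclidean_space \<Rightarrow> 'a \<Rightarrow> real" where
  "spherical_distance x y = arccos (x \<bullet> y)"

text \<open>The parameter \<open>p\<close> is the north pole.\<close>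

definition spherical_model :: "'a::euclidean_space \<Rightarrow> 'a model_space" where
  "spherical_model p =
    \<lparr> vol = completion sphere_area,
      distance = spherical_distance,
      base = p,
      translation_maps = isometries (sphere 0 1) spherical_distance \<rparr>"

text \<open>
  Hyperbolic space of curvature \<open>-1\<close> in the Poincare ball model, that is, the open unit ball with
  the Riemannian metric \<open>4 |dx|^2 / (1 - |x|^2)^2\<close>.
\<close>

definition hyperbolic_volume :: "'a::euclidean_space measure" where
  "hyperbolic_volume =
    density (restrict_space lborel (ball 0 1)) (\<lambda>x. ennreal ((2 / (1 - (norm x)\<^sup>2)) ^ DIM('a)))"

definition hyperbolic_distance :: "'a::euclidean_space \<Rightarrow> 'a \<Rightarrow> real" where
  "hyperbolic_distance x y =
    arcosh (1 + 2 * (norm (x - y))\<^sup>2 / ((1 - (norm x)\<^sup>2) * (1 - (norm y)\<^sup>2)))"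

definition hyperbolic_model :: "'a::euclidean_space model_space" where
  "hyperbolic_model =
    \<lparr> vol = completion hyperbolic_volume,
      distance = hyperbolic_distance,
      base = 0,
      translation_maps = isometries (ball 0 1) hyperbolic_distance \<rparr>"

lemma points_euclidean_model [simp]: "points euclidean_model = UNIV"
  by (simp add: euclidean_model_def)

lemma points_spherical_model [simp]: "points (spherical_model p) = sphere 0 1"
  by (simp add: spherical_model_def sphere_area_def space_scale_measure space_restrict_space)

lemma points_hyperbolic_model [simp]: "points hyperbolic_model = ball 0 1"
  by (simp add: hyperbolic_model_def hyperbolic_volume_def space_restrict_space)

lemma emeasure_sphere_area:
  fixes A :: "'a::euclidean_space set"
  assumes "A \<in> sets borel" "A \<subseteq> sphere 0 1"
  shows "emeasure sphere_area A =
    of_nat DIM('a) * emeasure lborel {x \<in> ball 0 1 - {0}. sgn x \<in> A}"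
proof -
  have m: "(sgn :: 'a \<Rightarrow> 'a) \<in> measurable (restrict_space lborel (ball 0 1 - {0}))
      (restrict_space borel (sphere 0 1))"
  proof (rule measurable_restrict_space3)
    have "(\<lambda>x::'a. x /\<^sub>R norm x) \<in> borel_measurable lborel"
      by measurable
    then show "(sgn :: 'a \<Rightarrow> 'a) \<in> borel_measurable lborel"
      by (simp add: sgn_div_norm[abs_def])
  qed (auto simp: norm_sgn)
  have A: "A \<in> sets (restrict_space borel (sphere 0 1))"
    using assms by (auto simp: sets_restrict_space_iff)
  have "sgn -` A \<inter> (ball 0 1 - {0}) = {x \<in> ball 0 1 - {0}. sgn x \<in> A}"
    by blast
  then show ?thesis
    unfolding sphere_area_def emeasure_scale_measure emeasure_distr[OF m A]
    by (subst emeasure_restrict_space) (auto simp: space_restrict_space)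
qed

definition diam :: "'a model_space \<Rightarrow> ereal" where
  "diam X = (SUP x\<in>points X. SUP y\<in>points X. ereal (distance X x y))"


section \<open>Rearrangement\<close>

definition model_ball :: "'a model_space \<Rightarrow> real \<Rightarrow> 'a set" where
  "model_ball X r = {y \<in> points X. distance X (base X) y < r}"

definition distribution :: "'a model_space \<Rightarrow> ('a \<Rightarrow> real) \<Rightarrow> real \<Rightarrow> ennreal" where
  "distribution X u t = emeasure (vol X) {x \<in> points X. u x > t}"

text \<open>On the sphere this holds for every measurable function, as the sphere has finite volume.\<close>

definition vanishes_at_infinity :: "'a model_space \<Rightarrow> ('a \<Rightarrow> real) \<Rightarrow> bool" where
  "vanishes_at_infinity X u \<longleftrightarrow> (\<forall>t>0. distribution X u t < \<infinity>)"

text \<open>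
  The supremum is taken in \<open>ennreal\<close>, where the supremum of the empty set is \<open>0\<close>. For measurable
  functions vanishing at infinity it is infinite only at the base point, where the rearrangement is
  then \<open>0\<close>.
\<close>

definition symm_decr_rearrangement :: "'a model_space \<Rightarrow> ('a \<Rightarrow> real) \<Rightarrow> 'a \<Rightarrow> real" where
  "symm_decr_rearrangement X u x =
    enn2real (SUP t\<in>{t. 0 \<le> t \<and>
      distribution X u t \<ge> emeasure (vol X) (model_ball X (distance X x (base X)))}. ennreal t)"

definition nonconstant :: "'a model_space \<Rightarrow> ('a \<Rightarrow> real) \<Rightarrow> bool" where
  "nonconstant X u \<longleftrightarrow> \<not> (\<exists>c. AE x in vol X. u x = c)"


section \<open>The functional\<close>

definition nonneg_cone :: "(real ^ 'm) set" where
  "nonneg_cone = {y. \<forall>i. 0 \<le> y $ i}"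

definition supermodular :: "(real ^ 'm \<Rightarrow> real) \<Rightarrow> bool" where
  "supermodular F \<longleftrightarrow>
    (\<forall>y\<in>nonneg_cone. \<forall>i j h k. i \<noteq> j \<longrightarrow> 0 < h \<longrightarrow> 0 < k \<longrightarrow>
      F (y + h *\<^sub>R axis i 1 + k *\<^sub>R axis j 1) + F y
        \<ge> F (y + h *\<^sub>R axis i 1) + F (y + k *\<^sub>R axis j 1))"

definition neg_part :: "('b \<Rightarrow> real) \<Rightarrow> 'b \<Rightarrow> real" where
  "neg_part f x = max (- f x) 0"

definition pos_part :: "('b \<Rightarrow> real) \<Rightarrow> 'b \<Rightarrow> real" where
  "pos_part f x = max (f x) 0"

text \<open>
  The integral as an extended real number. It is meaningful if \<open>f\<close> is measurable with an integrable
  negative part; note that \<open>\<infinity> - \<infinity> = \<infinity>\<close> for \<open>ereal\<close>.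
\<close>

definition ext_integral :: "'b measure \<Rightarrow> ('b \<Rightarrow> real) \<Rightarrow> ereal" where
  "ext_integral M f =
    enn2ereal (\<integral>\<^sup>+x. ennreal (pos_part f x) \<partial>M) - enn2ereal (\<integral>\<^sup>+x. ennreal (neg_part f x) \<partial>M)"

definition ext_integral_exists :: "'b measure \<Rightarrow> ('b \<Rightarrow> real) \<Rightarrow> bool" where
  "ext_integral_exists M f \<longleftrightarrow>
    f \<in> borel_measurable M \<and> (\<integral>\<^sup>+x. ennreal (neg_part f x) \<partial>M) < \<infinity>"

definition vol_power :: "'a model_space \<Rightarrow> ('m::finite \<Rightarrow> 'a) measure" where
  "vol_power X = PiM UNIV (\<lambda>_. vol X)"

definition kernel_product ::
  "'a model_space \<Rightarrow> ('m::{finite,linorder} \<Rightarrow> 'm \<Rightarrow> real \<Rightarrow> real) \<Rightarrow> ('m \<Rightarrow> 'a) \<Rightarrow> real" where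
  "kernel_product X K x = (\<Prod>(i, j)\<in>{(i, j). i < j}. K i j (distance X (x i) (x j)))"

definition integrand ::
  "'a model_space \<Rightarrow> (real ^ 'm::{finite,linorder} \<Rightarrow> real) \<Rightarrow> ('m \<Rightarrow> 'm \<Rightarrow> real \<Rightarrow> real)
    \<Rightarrow> ('m \<Rightarrow> 'a \<Rightarrow> real) \<Rightarrow> ('m \<Rightarrow> 'a) \<Rightarrow> real" where
  "integrand X F K u x = F (\<chi> i. u i (x i)) * kernel_product X K x"

definition strict_edges :: "('m::linorder \<Rightarrow> 'm \<Rightarrow> real \<Rightarrow> real) \<Rightarrow> ('m \<times> 'm) set" where
  "strict_edges K = {(i, j). i < j \<and> strict_antimono_on {0..} (K i j)}"

definition same_component :: "('m \<times> 'm) set \<Rightarrow> 'm \<Rightarrow> 'm \<Rightarrow> bool" where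
  "same_component E i j \<longleftrightarrow> (i, j) \<in> (E \<union> E\<inverse>)\<^sup>*"

end

theory Submission imports Defs begin

text \<open>
 Subtracting the one-variable parts \<open>F (y\<^sub>l e\<^sub>l)\<close>, whose integrals rearrangement does not change, makes \<open>F\<close>
 nonnegative and monotone. Folding all variables into the half-space of points closer to \<open>x\<close> than to \<open>y\<close>
 turns the integrand into a sum over the subsets \<open>E\<close> of the index set (those variables that are reflected), with
 Ising-type weights. Expanding the weights over edge sets and swapping connected components shows that the two-point
 rearrangement exchanging \<open>x\<close> and \<open>y\<close> increases the functional. Suitable sequences of such polarizations
 converge to the rearrangement; the joint law of the values is the same along the sequence, so that no continuity
 of \<open>F\<close> is needed in the limit.

 In the case of equality no polarization, with any pair \<open>(x, y)\<close>, changes the functional, so \<open>u\<^sub>i\<close> and \<open>u\<^sub>j\<close>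
 are never moved in opposite directions. A level set \<open>B\<close> of \<open>u\<^sub>j\<close> has a center \<open>a\<close>, a maximum of the potential
 \<open>\<integral>\<^sub>B exp (- d a w) dw\<close>. If \<open>u\<^sub>i\<close> were not radially decreasing about \<open>a\<close>, all reflections exchanging some \<open>x\<close>
 with the points of a small ball would preserve \<open>B\<close>; they generate a transitive group, so \<open>B\<close> would be trivial.
\<close>

section \<open>Supermodular set functions\<close>

text \<open>Positivity and monotonicity are arranged because little else is available for limits:
  \<open>F\<close> is only Borel, the kernels need not be integrable and the integrals may be
  infinite. With them Tonelli, truncation and Fatou apply directly. The geometry enters mainly
  through one sign rule for reflections: \<open>refl x y w\<close> is farther from \<open>z\<close>
  than \<open>w\<close> exactly when \<open>z\<close> and \<open>w\<close> lie strictly on the same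
  side of the bisector. The three spaces have to supply it together with volume invariance, null
  bisectors and elementary topology; null spheres, homogeneity and the density arguments are then
  derived once for all of them. In the equality case a barycenter would need a linear structure. The
  potential of \<open>exp (- d a w)\<close> replaces it: it is strictly decreasing in the distance
  and tends to 0, so it attains a maximum for every set of finite positive measure. There the pairs
  \<open>(x, y)\<close> may lie anywhere relative to the base point, because a function and its
  polarization have the same rearrangement.\<close>

definition supermodular_set_function :: "('m set => real) => bool" where
 "supermodular_set_function g \<longleftrightarrow> (\<forall>A i j. i ~= j --> i \<notin> A --> j \<notin> A -->
   g (insert i A) + g (insert j A) <= g A + g (insert i (insert j A)))"

lemma supermodular_set_functionD:
 assumes "supermodular_set_function g" "i ~= j" "i \<notin> A" "j \<notin> A"
 shows "g (insert i A) + g (insert j A) <= g A + g (insert i (insert j A))"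
 using assms unfolding supermodular_set_function_def by blast

text \<open>Increasing differences: each application of the pair condition enlarges the base set by
  one element of \<open>Q\<close>, and elements already in \<open>A\<close> change nothing.\<close>

lemma supermodular_increment_mono:
 assumes g: "supermodular_set_function g" and "finite Q" "l \<notin> A" "l \<notin> Q"
 shows "g (insert l A) - g A <= g (insert l (A \<union> Q)) - g (A \<union> Q)"
 using \<open>finite Q\<close> \<open>l \<notin> Q\<close>
proof (induction Q)
 case empty
 then show ?case by simp
next
 case (insert q Q)
 show ?case
 proof (cases "q \<in> A")
  case True
  then have "A \<union> insert q Q = A \<union> Q" by auto
  then show ?thesis using insert by auto
 next
  case False
  then have "g (insert l (A \<union> Q)) + g (insert q (A \<union> Q))
    <= g (A \<union> Q) + g (insert l (insert q (A \<union> Q)))"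
   using insert assms by (intro supermodular_set_functionD[OF g]) auto
  then show ?thesis using insert by simp
 qed
qed

lemma supermodular_disjoint:
 assumes g: "supermodular_set_function g" and fin: "finite P" "finite Q"
  and disj: "P \<inter> Q = {}" "A \<inter> P = {}" "A \<inter> Q = {}"
 shows "g (A \<union> P) + g (A \<union> Q) <= g A + g (A \<union> P \<union> Q)"
 using \<open>finite P\<close> disj
proof (induction P)
 case empty
 then show ?case by simp
next
 case (insert p P)
 then have "g (insert p (A \<union> P)) - g (A \<union> P) <= g (insert p (A \<union> P \<union> Q)) - g (A \<union> P \<union> Q)"
  by (intro supermodular_increment_mono[OF g fin(2)]) auto
 with insert show ?case by auto
qed

text \<open>Removing \<open>i\<close> from \<open>P\<close> isolates one strict comparison: the
  increment of \<open>i\<close> grows strictly when \<open>j\<close> joins and does not shrink when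
  the rest of \<open>Q\<close> joins. The remaining \<open>P - {i}\<close> is covered by the weak
  inequality.\<close>

lemma supermodular_disjoint_strict:
 assumes g: "supermodular_set_function g" and fin: "finite P" "finite Q"
  and disj: "P \<inter> Q = {}" "A \<inter> P = {}" "A \<inter> Q = {}"
  and ij: "i \<in> P" "j \<in> Q"
  and strict: "!!B. i \<notin> B ==> j \<notin> B ==>
   g (insert i B) + g (insert j B) < g B + g (insert i (insert j B))"
 shows "g (A \<union> P) + g (A \<union> Q) < g A + g (A \<union> P \<union> Q)"
proof -
 define B where "B = A \<union> (P - {i})"
 have AP: "A \<union> P = insert i B" and APQ: "A \<union> P \<union> Q = insert i (insert j B \<union> (Q - {j}))"
  using ij by (auto simp: B_def)
 have iB: "i \<notin> B" "j \<notin> B" "i ~= j" "i \<notin> insert j B"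
  using ij disj by (auto simp: B_def)
 have "g (insert i B) - g B < g (insert i (insert j B)) - g (insert j B)" using strict[OF iB(1,2)] by simp
 also have "... <= g (insert i (insert j B \<union> (Q - {j}))) - g (insert j B \<union> (Q - {j}))"
  using iB fin ij disj by (intro supermodular_increment_mono[OF g]) auto
 also have "insert j B \<union> (Q - {j}) = A \<union> (P - {i}) \<union> Q" using ij by (auto simp: B_def)
 finally have 1: "g (A \<union> P) - g B < g (A \<union> P \<union> Q) - g (A \<union> (P - {i}) \<union> Q)"
  using AP ij(1) by (metis Un_insert_left insert_Diff Un_insert_right)
 have "g B + g (A \<union> Q) <= g A + g (A \<union> (P - {i}) \<union> Q)"
  unfolding B_def using fin disj by (intro supermodular_disjoint[OF g]) auto
 with 1 show ?thesis by linarith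
qed

section \<open>Sets saturated by a graph and the swapping of its components\<close>

definition saturated :: "('m \<times> 'm) set => 'm set => bool" where
 "saturated S E \<longleftrightarrow> (\<forall>(i, j)\<in>S. i \<in> E \<longleftrightarrow> j \<in> E)"

lemma saturated_component:
 assumes "saturated S E" "same_component S i j"
 shows "i \<in> E \<longleftrightarrow> j \<in> E"
proof -
 have "(i, j) \<in> (S \<union> S\<inverse>)\<^sup>*" using assms(2) by (simp add: same_component_def)
 then show ?thesis
  by (induction rule: rtrancl_induct) (use assms(1) in \<open>auto simp: saturated_def\<close>)
qed

lemma same_component_sym: "same_component S i j ==> same_component S j i"
 unfolding same_component_def by (rule symD[OF sym_rtrancl[OF sym_Un_converse]])

lemma saturated_class:
 "saturated S {j. same_component S i j}"
proof -
 have "same_component S i k ==> (k, l) \<in> S \<union> S\<inverse> ==> same_component S i l" for k l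
  unfolding same_component_def by (rule rtrancl_into_rtrancl)
 then show ?thesis unfolding saturated_def by blast
qed

text \<open>Swapping one component at a time reduces the comparison to two disjoint sets.\<close>

lemma swap_component:
 fixes g :: "'m::finite set => real" and S :: "('m \<times> 'm) set" and i :: 'm
 assumes g: "supermodular_set_function g"
 defines "C \<equiv> {j. same_component S i j}"
 shows "(\<Sum>E | saturated S E. g (sym_diff E D)) <= (\<Sum>E | saturated S E. g (sym_diff E (D - C)))"
  and "\<lbrakk>k \<in> C - D; l \<in> C \<inter> D; !!B. k \<notin> B ==> l \<notin> B ==>
   g (insert k B) + g (insert l B) < g B + g (insert k (insert l B))\<rbrakk> \<Longrightarrow>
   (\<Sum>E | saturated S E. g (sym_diff E D)) < (\<Sum>E | saturated S E. g (sym_diff E (D - C)))"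
proof -
 let ?sat = "{E. saturated S E}"
 have satC: "saturated S C" unfolding C_def by (rule saturated_class)
 have bij: "bij_betw (\<lambda>E. sym_diff E C) ?sat ?sat"
  by (rule bij_betw_byWitness[of _ "\<lambda>E. sym_diff E C"])
    (use satC in \<open>auto simp: saturated_def\<close>)
 \<comment> \<open>Flipping \<open>E\<close> along the component permutes the saturated sets, so the
   sums may be evaluated on the pairs \<open>E\<close>, \<open>sym_diff E C\<close>.\<close>
 have double: "2 * (\<Sum>E\<in>?sat. g (sym_diff E D')) =
   (\<Sum>E\<in>?sat. g (sym_diff E D') + g (sym_diff (sym_diff E C) D'))" for D'
  using sum.reindex_bij_betw[OF bij, of "\<lambda>E. g (sym_diff E D')"] by (simp add: sum.distrib)
 \<comment> \<open>A saturated \<open>E\<close> contains \<open>C\<close> or misses it. All four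
   sets therefore agree outside \<open>C\<close> with one set \<open>A\<close>; inside
   \<open>C\<close> the shift by \<open>D\<close> leaves the complementary pieces
   \<open>C - D\<close> and \<open>C \<inter> D\<close>, the shift by \<open>D - C\<close> leaves
   the empty set and all of \<open>C\<close>.\<close>
 have shape: "\<exists>A. A \<inter> C = {} \<and>
   g (sym_diff E D) + g (sym_diff (sym_diff E C) D) = g (A \<union> (C - D)) + g (A \<union> (C \<inter> D)) \<and>
   g (sym_diff E (D - C)) + g (sym_diff (sym_diff E C) (D - C)) = g A + g (A \<union> (C - D) \<union> (C \<inter> D))"
  if E: "saturated S E" for E
 proof -
  have "C \<subseteq> E \<or> C \<inter> E = {}" using saturated_component[OF E] by (auto simp: C_def)
  then show ?thesis
  proof
   assume CE: "C \<subseteq> E"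
   define A where "A = sym_diff (E - C) (D - C)"
   have "sym_diff E D = A \<union> (C - D)" "sym_diff (sym_diff E C) D = A \<union> (C \<inter> D)"
    "sym_diff E (D - C) = A \<union> (C - D) \<union> (C \<inter> D)"
    "sym_diff (sym_diff E C) (D - C) = A" "A \<inter> C = {}" using CE by (auto simp: A_def)
   then show ?thesis by (intro exI[of _ A]) simp
  next
   assume CE: "C \<inter> E = {}"
   define A where "A = sym_diff E (D - C)"
   have "sym_diff E D = A \<union> (C \<inter> D)" "sym_diff (sym_diff E C) D = A \<union> (C - D)"
    "sym_diff E (D - C) = A"
    "sym_diff (sym_diff E C) (D - C) = A \<union> (C - D) \<union> (C \<inter> D)" "A \<inter> C = {}"
    using CE by (auto simp: A_def)
   then show ?thesis by (intro exI[of _ A]) simp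
  qed
 qed
 have le: "g (sym_diff E D) + g (sym_diff (sym_diff E C) D)
   <= g (sym_diff E (D - C)) + g (sym_diff (sym_diff E C) (D - C))" if E: "E \<in> ?sat" for E
 proof -
  obtain A where A: "A \<inter> C = {}" 
   "g (sym_diff E D) + g (sym_diff (sym_diff E C) D) = g (A \<union> (C - D)) + g (A \<union> (C \<inter> D))"
   "g (sym_diff E (D - C)) + g (sym_diff (sym_diff E C) (D - C)) = g A + g (A \<union> (C - D) \<union> (C \<inter> D))"
   using shape E by blast
  have "g (A \<union> (C - D)) + g (A \<union> (C \<inter> D)) <= g A + g (A \<union> (C - D) \<union> (C \<inter> D))"
   using A(1) by (intro supermodular_disjoint[OF g]) auto
  with A show ?thesis by simp
 qed
 have "2 * (\<Sum>E\<in>?sat. g (sym_diff E D)) <= 2 * (\<Sum>E\<in>?sat. g (sym_diff E (D - C)))"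
  unfolding double by (intro sum_mono le)
 then show "(\<Sum>E | saturated S E. g (sym_diff E D)) <= (\<Sum>E | saturated S E. g (sym_diff E (D - C)))"
  by simp
 assume kl: "k \<in> C - D" "l \<in> C \<inter> D"
  and strict: "!!B. k \<notin> B ==> l \<notin> B ==>
   g (insert k B) + g (insert l B) < g B + g (insert k (insert l B))"
 have lt: "g (sym_diff E D) + g (sym_diff (sym_diff E C) D)
   < g (sym_diff E (D - C)) + g (sym_diff (sym_diff E C) (D - C))" if E: "E \<in> ?sat" for E
 proof -
  obtain A where A: "A \<inter> C = {}" 
   "g (sym_diff E D) + g (sym_diff (sym_diff E C) D) = g (A \<union> (C - D)) + g (A \<union> (C \<inter> D))"
   "g (sym_diff E (D - C)) + g (sym_diff (sym_diff E C) (D - C)) = g A + g (A \<union> (C - D) \<union> (C \<inter> D))"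
   using shape E by blast
  have "g (A \<union> (C - D)) + g (A \<union> (C \<inter> D)) < g A + g (A \<union> (C - D) \<union> (C \<inter> D))"
   using A(1) kl strict by (intro supermodular_disjoint_strict[OF g, of _ _ _ k l]) auto
  with A show ?thesis by simp
 qed
 have "C \<in> ?sat" using satC by simp
 then have "2 * (\<Sum>E\<in>?sat. g (sym_diff E D)) < 2 * (\<Sum>E\<in>?sat. g (sym_diff E (D - C)))"
  unfolding double by (intro sum_strict_mono lt) auto
 then show "(\<Sum>E | saturated S E. g (sym_diff E D)) < (\<Sum>E | saturated S E. g (sym_diff E (D - C)))"
  by simp
qed

text \<open>Taking the component of one element out of \<open>D\<close> does not decrease the sum
  and makes \<open>D\<close> smaller, so finitely many swaps reach the empty shift.\<close>

lemma sum_saturated_le: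
 fixes g :: "'m::finite set => real"
 assumes g: "supermodular_set_function g"
 shows "(\<Sum>E | saturated S E. g (sym_diff E D)) <= (\<Sum>E | saturated S E. g E)"
proof (induction "card D" arbitrary: D rule: less_induct)
 case less
 show ?case
 proof (cases "D = {}")
  case False
  then obtain i where i: "i \<in> D" by blast
  define C where "C = {j. same_component S i j}"
  have "i \<in> C" by (simp add: C_def same_component_def)
  with i have "card (D - C) < card D" by (intro psubset_card_mono) auto
  from less[OF this] swap_component(1)[OF g, where S = S and D = D and i = i] show ?thesis
   unfolding C_def by linarith
 qed simp
qed

text \<open>One strict swap is enough: the component of \<open>k\<close> contains \<open>l\<close>
  as well, so it meets both \<open>D\<close> and its complement.\<close>

lemma sum_saturated_less:
 fixes g :: "'m::finite set => real"
 assumes g: "supermodular_set_function g" and "same_component S k l" "k \<notin> D" "l \<in> D"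
  and strict: "!!B. k \<notin> B ==> l \<notin> B ==>
   g (insert k B) + g (insert l B) < g B + g (insert k (insert l B))"
 shows "(\<Sum>E | saturated S E. g (sym_diff E D)) < (\<Sum>E | saturated S E. g E)"
proof -
 have "k \<in> {j. same_component S k j} - D" "l \<in> {j. same_component S k j} \<inter> D"
  using assms(2-4) by (auto simp: same_component_def)
 from swap_component(2)[OF g this strict] sum_saturated_le[OF g, where S = S and D = "D - {j. same_component S k j}"]
 show ?thesis by linarith
qed

section \<open>Random-cluster expansion of the Ising weights\<close>

text \<open>
 The weights are expanded over edge sets \<open>S\<close>; each term only charges the sets saturated by \<open>S\<close>.
\<close>

context
 fixes p q :: "'m::{finite,linorder} => 'm => real"
begin

text \<open>Ising weight of the configuration whose minus spins are \<open>E\<close>: an aligned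
  pair carries \<open>p\<close>, a split pair \<open>q\<close>. The assumption \<open>q <= p\<close>
  made below is ferromagnetism.\<close>

definition ising_weight :: "'m set => real" where
 "ising_weight E = (\<Prod>(i, j)\<in>{(i, j). i < j}. if i \<in> E \<longleftrightarrow> j \<in> E then p i j else q i j)"

definition edge_coefficient :: "('m \<times> 'm) set => real" where
 "edge_coefficient S =
   (\<Prod>(i, j)\<in>S. p i j - q i j) * (\<Prod>(i, j)\<in>{(i, j). i < j} - S. q i j)"

context
 assumes pq: "!!i j. i < j ==> 0 <= q i j \<and> q i j <= p i j"
begin

lemma edge_coefficient_nonneg: "S \<subseteq> {(i, j). i < j} ==> 0 <= edge_coefficient S"
 unfolding edge_coefficient_def using pq by (intro mult_nonneg_nonneg prod_nonneg) auto

text \<open>Every factor is \<open>q + (p - q) * [aligned]\<close>, and choosing the second summand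
  on the edges in \<open>S\<close> leaves exactly the sets that separate no edge of
  \<open>S\<close>. The coefficients no longer depend on \<open>E\<close>, so the swap argument
  applies to each \<open>S\<close> separately.\<close>

lemma sum_ising_weight:
 "(\<Sum>E\<in>UNIV. ising_weight E * f E) =
  (\<Sum>S\<in>Pow {(i, j). i < j}. edge_coefficient S * (\<Sum>E | saturated S E. f E))"
proof -
 let ?P = "{(i::'m, j). i < j}"
 have w: "ising_weight E = (\<Sum>S\<in>Pow ?P. edge_coefficient S * of_bool (saturated S E))" for E
 proof -
  have "ising_weight E =
   (\<Prod>x\<in>?P. (case x of (i, j) => (p i j - q i j) * of_bool (i \<in> E \<longleftrightarrow> j \<in> E)) + (case x of (i, j) => q i j))"
   unfolding ising_weight_def by (intro prod.cong) auto
  also have "... = (\<Sum>S\<in>Pow ?P. (\<Prod>x\<in>S. case x of (i, j) => (p i j - q i j) * of_bool (i \<in> E \<longleftrightarrow> j \<in> E))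
    * (\<Prod>x\<in>?P - S. case x of (i, j) => q i j))"
   by (rule prod_add) simp
  also have "... = (\<Sum>S\<in>Pow ?P. edge_coefficient S * of_bool (saturated S E))"
  proof (intro sum.cong refl)
   fix S assume "S \<in> Pow ?P"
   have "(\<Prod>x\<in>S. case x of (i, j) => (p i j - q i j) * of_bool (i \<in> E \<longleftrightarrow> j \<in> E)) =
    (\<Prod>x\<in>S. (case x of (i, j) => p i j - q i j)) * (\<Prod>x\<in>S. of_bool (fst x \<in> E \<longleftrightarrow> snd x \<in> E))"
    unfolding prod.distrib[symmetric] by (intro prod.cong) auto
   also have "(\<Prod>x\<in>S. of_bool (fst x \<in> E \<longleftrightarrow> snd x \<in> E)) = (of_bool (saturated S E) :: real)"
    using finite[of S] unfolding saturated_def by (induction S rule: finite_induct) auto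
   finally show "(\<Prod>x\<in>S. case x of (i, j) => (p i j - q i j) * of_bool (i \<in> E \<longleftrightarrow> j \<in> E))
    * (\<Prod>x\<in>?P - S. case x of (i, j) => q i j) = edge_coefficient S * of_bool (saturated S E)"
    by (simp add: edge_coefficient_def)
  qed
  finally show ?thesis .
 qed
 have "(\<Sum>E\<in>UNIV. ising_weight E * f E) =
   (\<Sum>S\<in>Pow ?P. \<Sum>E\<in>UNIV. edge_coefficient S * of_bool (saturated S E) * f E)"
  unfolding w sum_distrib_right by (rule sum.swap)
 also have "... = (\<Sum>S\<in>Pow ?P. edge_coefficient S * (\<Sum>E | saturated S E. f E))"
 proof (intro sum.cong refl)
  fix S
  have "(\<Sum>E | saturated S E. f E) = (\<Sum>E\<in>UNIV. of_bool (saturated S E) * f E)"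
   by (intro sum.mono_neutral_cong_left) auto
  then show "(\<Sum>E\<in>UNIV. edge_coefficient S * of_bool (saturated S E) * f E) =
    edge_coefficient S * (\<Sum>E | saturated S E. f E)"
   by (simp only: sum_distrib_left mult.assoc)
 qed
 finally show ?thesis .
qed

lemma ising_sum_le:
 assumes "supermodular_set_function g"
 shows "(\<Sum>E\<in>UNIV. ising_weight E * g (sym_diff E D)) <= (\<Sum>E\<in>UNIV. ising_weight E * g E)"
 unfolding sum_ising_weight[of "\<lambda>E. g (sym_diff E D)"] sum_ising_weight[of g]
 by (intro sum_mono mult_left_mono sum_saturated_le assms edge_coefficient_nonneg) auto

text \<open>A single edge set with positive coefficient suffices: \<open>p - q\<close> is positive
  on \<open>S\<close> and \<open>q\<close> is positive off \<open>S\<close>, while all other terms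
  obey the weak inequality.\<close>

lemma ising_sum_less:
 assumes g: "supermodular_set_function g"
  and S: "S \<subseteq> {(i, j). i < j}" "!!i j. (i, j) \<in> S ==> q i j < p i j"
  and q: "!!i j. i < j ==> 0 < q i j"
  and kl: "same_component S k l" "k \<notin> D" "l \<in> D"
  and strict: "!!B. k \<notin> B ==> l \<notin> B ==>
   g (insert k B) + g (insert l B) < g B + g (insert k (insert l B))"
 shows "(\<Sum>E\<in>UNIV. ising_weight E * g (sym_diff E D)) < (\<Sum>E\<in>UNIV. ising_weight E * g E)"
 unfolding sum_ising_weight[of "\<lambda>E. g (sym_diff E D)"] sum_ising_weight[of g]
proof (rule sum_strict_mono_ex1)
 have "0 < edge_coefficient S" unfolding edge_coefficient_def using S q by (intro mult_pos_pos prod_pos) auto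
 then show "\<exists>S\<in>Pow {(i, j). i < j}. edge_coefficient S * (\<Sum>E | saturated S E. g (sym_diff E D))
   < edge_coefficient S * (\<Sum>E | saturated S E. g E)"
  using S(1) sum_saturated_less[OF g kl strict] by (intro bexI[of _ S]) auto
qed (auto intro!: mult_left_mono sum_saturated_le g edge_coefficient_nonneg)

end

end

section \<open>Supermodular functions on the positive cone\<close>

lemma supermodularD:
 assumes "supermodular F" "y \<in> nonneg_cone" "i ~= j" "0 <= h" "0 <= k"
 shows "F (y + h *\<^sub>R axis i 1) + F (y + k *\<^sub>R axis j 1) <= F (y + h *\<^sub>R axis i 1 + k *\<^sub>R axis j 1) + F y"
proof (cases "h = 0 \<or> k = 0")
 case False
 then show ?thesis using assms(1)[unfolded supermodular_def, rule_format, OF assms(2,3)] assms(4,5) by simp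
qed auto

text \<open>The values seen by \<open>F\<close> after the variables in \<open>E\<close> have been
  reflected: \<open>\<alpha>\<close> at the points themselves, \<open>\<beta>\<close> at their
  mirror images.\<close>

definition between :: "('m => real) => ('m => real) => 'm set => real ^ 'm::finite" where
 "between \<alpha> \<beta> E = (\<chi> l. if l \<in> E then \<beta> l else \<alpha> l)"

text \<open>Inserting an index lowers a coordinate, but supermodularity survives the reversal of all
  coordinates. The increments are measured from the lowest corner
  \<open>between \<alpha> \<beta> (insert i (insert j A))\<close>.\<close>

lemma between_supermodular:
 fixes F :: "real ^ 'm::finite => real"
 assumes F: "supermodular F" and \<alpha>\<beta>: "!!l. 0 <= \<beta> l \<and> \<beta> l <= \<alpha> l"
 shows "supermodular_set_function (\<lambda>E. F (between \<alpha> \<beta> E))"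
  and "\<lbrakk>i ~= j; \<beta> i < \<alpha> i; \<beta> j < \<alpha> j; i \<notin> A; j \<notin> A;
   \<forall>y\<in>nonneg_cone. \<forall>h>0. \<forall>k>0.
       F (y + h *\<^sub>R axis i 1 + k *\<^sub>R axis j 1) + F y
        > F (y + h *\<^sub>R axis i 1) + F (y + k *\<^sub>R axis j 1)\<rbrakk> \<Longrightarrow>
   F (between \<alpha> \<beta> (insert i A)) + F (between \<alpha> \<beta> (insert j A))
    < F (between \<alpha> \<beta> A) + F (between \<alpha> \<beta> (insert i (insert j A)))"
proof -
 have eqs: "between \<alpha> \<beta> (insert i A) = y + (\<alpha> j - \<beta> j) *\<^sub>R axis j 1"
  "between \<alpha> \<beta> (insert j A) = y + (\<alpha> i - \<beta> i) *\<^sub>R axis i 1"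
  "between \<alpha> \<beta> A = y + (\<alpha> i - \<beta> i) *\<^sub>R axis i 1 + (\<alpha> j - \<beta> j) *\<^sub>R axis j 1"
  if "i ~= j" "i \<notin> A" "j \<notin> A" "y = between \<alpha> \<beta> (insert i (insert j A))" for i j :: 'm and A y
  using that by (auto simp: between_def vec_eq_iff axis_def)
 have cone: "between \<alpha> \<beta> E \<in> nonneg_cone" for E
 proof -
  have "0 <= \<alpha> l" for l using \<alpha>\<beta>[of l] by linarith
  then show ?thesis using \<alpha>\<beta> by (auto simp: nonneg_cone_def between_def)
 qed
 show "supermodular_set_function (\<lambda>E. F (between \<alpha> \<beta> E))"
  unfolding supermodular_set_function_def
 proof (intro allI impI)
  fix A and i j :: 'm assume ij: "i ~= j" "i \<notin> A" "j \<notin> A"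
  show "F (between \<alpha> \<beta> (insert i A)) + F (between \<alpha> \<beta> (insert j A))
   <= F (between \<alpha> \<beta> A) + F (between \<alpha> \<beta> (insert i (insert j A)))"
   unfolding eqs[OF ij refl]
   using supermodularD[OF F cone[of "insert i (insert j A)"] ij(1), of "\<alpha> i - \<beta> i" "\<alpha> j - \<beta> j"] \<alpha>\<beta>
   by (simp add: algebra_simps)
 qed
 assume ij: "i ~= j" "\<beta> i < \<alpha> i" "\<beta> j < \<alpha> j" "i \<notin> A" "j \<notin> A"
  and strict: "\<forall>y\<in>nonneg_cone. \<forall>h>0. \<forall>k>0.
       F (y + h *\<^sub>R axis i 1 + k *\<^sub>R axis j 1) + F y
        > F (y + h *\<^sub>R axis i 1) + F (y + k *\<^sub>R axis j 1)"
 show "F (between \<alpha> \<beta> (insert i A)) + F (between \<alpha> \<beta> (insert j A))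
    < F (between \<alpha> \<beta> A) + F (between \<alpha> \<beta> (insert i (insert j A)))"
  unfolding eqs[OF ij(1,4,5) refl]
  using strict[rule_format, OF cone[of "insert i (insert j A)"], of "\<alpha> i - \<beta> i" "\<alpha> j - \<beta> j"] ij
  by (simp add: algebra_simps)
qed

text \<open>Sorting each pair of values and shifting \<open>E\<close> by the set of wrongly sorted
  indices undo each other. This turns polarization into the shift \<open>D\<close> of the Ising
  sums.\<close>

lemma between_sym_diff:
 "between a b E = between (\<lambda>l. max (a l) (b l)) (\<lambda>l. min (a l) (b l)) (sym_diff E {l. a l < b l})"
 by (auto simp: between_def vec_eq_iff)

lemma two_point_sum_le:
 fixes p q :: "'m::{finite,linorder} => 'm => real"
 assumes F: "supermodular F" and ab: "!!l. 0 <= a l" "!!l. 0 <= b l"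
  and pq: "!!i j. i < j ==> 0 <= q i j \<and> q i j <= p i j"
 shows "(\<Sum>E\<in>UNIV. ising_weight p q E * F (between a b E))
  <= (\<Sum>E\<in>UNIV. ising_weight p q E * F (between (\<lambda>l. max (a l) (b l)) (\<lambda>l. min (a l) (b l)) E))"
 unfolding between_sym_diff[of a b]
 by (rule ising_sum_le[OF pq between_supermodular(1)[OF F]]) (use ab in auto)

lemma two_point_sum_less:
 fixes p q :: "'m::{finite,linorder} => 'm => real"
 assumes F: "supermodular F" and ab: "!!l. 0 <= a l" "!!l. 0 <= b l"
  and pq: "!!i j. i < j ==> 0 < q i j \<and> q i j <= p i j"
  and S: "S \<subseteq> {(i, j). i < j}" "!!i j. (i, j) \<in> S ==> q i j < p i j"
  and ij: "same_component S i j" "b i < a i" "a j < b j"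
  and strict: "\<forall>y\<in>nonneg_cone. \<forall>h>0. \<forall>k>0.
       F (y + h *\<^sub>R axis i 1 + k *\<^sub>R axis j 1) + F y
        > F (y + h *\<^sub>R axis i 1) + F (y + k *\<^sub>R axis j 1)"
 shows "(\<Sum>E\<in>UNIV. ising_weight p q E * F (between a b E))
  < (\<Sum>E\<in>UNIV. ising_weight p q E * F (between (\<lambda>l. max (a l) (b l)) (\<lambda>l. min (a l) (b l)) E))"
 unfolding between_sym_diff[of a b]
proof (rule ising_sum_less[OF _ between_supermodular(1)[OF F] S])
 show "0 <= q i j \<and> q i j <= p i j" "0 < q i j" if "i < j" for i j using pq[OF that] by auto
 fix B assume "i \<notin> B" "j \<notin> B"
 then show "F (between (\<lambda>l. max (a l) (b l)) (\<lambda>l. min (a l) (b l)) (insert i B)) +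
   F (between (\<lambda>l. max (a l) (b l)) (\<lambda>l. min (a l) (b l)) (insert j B))
   < F (between (\<lambda>l. max (a l) (b l)) (\<lambda>l. min (a l) (b l)) B) +
    F (between (\<lambda>l. max (a l) (b l)) (\<lambda>l. min (a l) (b l)) (insert i (insert j B)))"
  using ij ab by (intro between_supermodular(2)[OF F _ _ _ _ _ _ strict]) auto
qed (use ab ij in auto)

section \<open>Splitting off the one-variable parts\<close>

definition vanishing_part :: "(real ^ 'm::finite => real) => real ^ 'm => real" where
 "vanishing_part F y = F y - (\<Sum>l\<in>UNIV. F (y $ l *\<^sub>R axis l 1))"

text \<open>The subtracted sum is additive over the coordinates, so it drops out of every mixed
  second difference.\<close>

lemma vanishing_part_supermodular_gap:
 assumes ij: "i ~= j"
 shows "vanishing_part F (y + h *\<^sub>R axis i 1 + k *\<^sub>R axis j 1) + vanishing_part F y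
   - vanishing_part F (y + h *\<^sub>R axis i 1) - vanishing_part F (y + k *\<^sub>R axis j 1)
  = F (y + h *\<^sub>R axis i 1 + k *\<^sub>R axis j 1) + F y - F (y + h *\<^sub>R axis i 1) - F (y + k *\<^sub>R axis j 1)"
proof -
 have "(\<Sum>l\<in>UNIV. F ((y + h *\<^sub>R axis i 1 + k *\<^sub>R axis j 1) $ l *\<^sub>R axis l 1)) + (\<Sum>l\<in>UNIV. F (y $ l *\<^sub>R axis l 1))
  = (\<Sum>l\<in>UNIV. F ((y + h *\<^sub>R axis i 1) $ l *\<^sub>R axis l 1)) + (\<Sum>l\<in>UNIV. F ((y + k *\<^sub>R axis j 1) $ l *\<^sub>R axis l 1))"
  unfolding sum.distrib[symmetric]
 proof (intro sum.cong refl)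
  fix l
  show "F ((y + h *\<^sub>R axis i 1 + k *\<^sub>R axis j 1) $ l *\<^sub>R axis l 1) + F (y $ l *\<^sub>R axis l 1)
   = F ((y + h *\<^sub>R axis i 1) $ l *\<^sub>R axis l 1) + F ((y + k *\<^sub>R axis j 1) $ l *\<^sub>R axis l 1)"
   using ij by (cases "l = i"; cases "l = j") (auto simp: axis_def)
 qed
 then show ?thesis unfolding vanishing_part_def by linarith
qed

lemma supermodular_vanishing_part:
 assumes "supermodular F" shows "supermodular (vanishing_part F)" unfolding supermodular_def
proof (intro ballI allI impI)
 fix y :: "real^'a" and i j :: 'a and h k :: real
 assume "y \<in> nonneg_cone" "i ~= j" "0 < h" "0 < k"
 then show "vanishing_part F (y + h *\<^sub>R axis i 1) + vanishing_part F (y + k *\<^sub>R axis j 1)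
  <= vanishing_part F (y + h *\<^sub>R axis i 1 + k *\<^sub>R axis j 1) + vanishing_part F y"
  using vanishing_part_supermodular_gap[of i j F y h k] supermodularD[OF assms, of y i j h k] by simp
qed

lemma vanishing_part_axis:
 fixes F :: "real ^ 'm::finite => real"
 assumes "F 0 = 0" shows "vanishing_part F (t *\<^sub>R axis l 1) = 0"
proof -
 have "(\<Sum>k\<in>UNIV. F ((t *\<^sub>R axis l 1) $ k *\<^sub>R axis k 1)) = (\<Sum>k\<in>UNIV. if k = l then F (t *\<^sub>R axis l 1) else 0)"
  using assms by (intro sum.cong) (auto simp: axis_def)
 then show ?thesis by (simp add: vanishing_part_def)
qed

text \<open>The increment in direction \<open>l\<close> grows with the other coordinates and is zero
  when these are zero, because the function vanishes on the axes.\<close>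

lemma vanishing_part_mono:
 fixes F :: "real ^ 'm::finite => real"
 assumes F: "supermodular F" "F 0 = 0" and yz: "!!l. 0 <= y $ l" "!!l. y $ l <= z $ l"
 shows "vanishing_part F y <= vanishing_part F z"
proof -
 let ?G = "vanishing_part F"
 have G: "supermodular ?G" by (rule supermodular_vanishing_part[OF F(1)])
 have step: "?G y <= ?G (y + h *\<^sub>R axis l 1)" if y: "y \<in> nonneg_cone" and h: "0 <= h" for y h l
 proof -
  \<comment> \<open>The other coordinates are switched on one at a time, starting from the point on
    axis \<open>l\<close>.\<close>
  define r where "r A = (\<chi> k. if k \<in> A then y $ k else 0)" for A
  have *: "?G (r {l} + h *\<^sub>R axis l 1) - ?G (r {l}) <= ?G (r (insert l A) + h *\<^sub>R axis l 1) - ?G (r (insert l A))"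
   if "finite A" for A using that
  proof (induction A)
   case (insert k A)
   show ?case
   proof (cases "k \<in> insert l A")
    case True
    then show ?thesis using insert by (simp add: insert_absorb)
   next
    case False
    have eq: "r (insert l (insert k A)) = r (insert l A) + (y $ k) *\<^sub>R axis k 1"
     using False by (auto simp: r_def vec_eq_iff axis_def)
    have 1: "r (insert l A) \<in> nonneg_cone" "l ~= k" "0 <= y $ k"
     using y False by (auto simp: r_def nonneg_cone_def)
    from supermodularD[OF G 1(1,2) h 1(3)] insert.IH
    have "?G (r {l} + h *\<^sub>R axis l 1) - ?G (r {l})
     <= ?G (r (insert l A) + h *\<^sub>R axis l 1 + (y $ k) *\<^sub>R axis k 1) - ?G (r (insert l A) + (y $ k) *\<^sub>R axis k 1)"
     by simp
    then show ?thesis unfolding eq by (simp add: add_ac)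
   qed
  qed simp
  have "r {l} + h *\<^sub>R axis l 1 = (y $ l + h) *\<^sub>R axis l 1" "r {l} = (y $ l) *\<^sub>R axis l 1"
   by (auto simp: r_def vec_eq_iff axis_def)
  moreover have "r (insert l UNIV) = y" by (simp add: r_def vec_eq_iff)
  ultimately show ?thesis using *[of UNIV] vanishing_part_axis[where F = F, OF F(2)] by simp
 qed
 define r where "r A = (\<chi> k. if k \<in> A then z $ k else y $ k)" for A
 have "?G y <= ?G (r A)" if "finite A" for A using that
 proof (induction A)
  case empty
  then show ?case by (simp add: r_def)
 next
  case (insert k A)
  have "r (insert k A) = r A + (z $ k - y $ k) *\<^sub>R axis k 1"
   using insert(2) by (auto simp: r_def vec_eq_iff axis_def)
  moreover have "r A \<in> nonneg_cone"
  proof -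
   have "0 <= z $ l" for l using yz[of l] by linarith
   then show ?thesis using yz by (auto simp: r_def nonneg_cone_def)
  qed
  ultimately have "?G (r A) <= ?G (r (insert k A))" using step[of "r A" "z $ k - y $ k" k] yz by simp
  with insert show ?case by simp
 qed
 from this[of UNIV] show ?thesis by (simp add: r_def)
qed

lemma vanishing_part_nonneg:
 fixes F :: "real ^ 'm::finite => real"
 assumes F: "supermodular F" "F 0 = 0" and y: "!!l. 0 <= y $ l"
 shows "0 <= vanishing_part F y"
 using vanishing_part_mono[OF F, of 0 y] vanishing_part_axis[where F = F, OF F(2), of 0] y by simp

text \<open>Each increment of a coordinate becomes another nonnegative increment, and
  \<open>\<phi> 0 = 0\<close> keeps the image in the cone. The intended \<open>\<phi>\<close> is the
  truncation \<open>min t n\<close>.\<close>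

lemma supermodular_compose_mono:
 fixes F :: "real ^ 'm::finite => real"
 assumes F: "supermodular F" and \<phi>: "!!s t. 0 <= s ==> s <= t ==> \<phi> s <= \<phi> t" "\<phi> 0 = 0"
 shows "supermodular (\<lambda>y. F (\<chi> l. \<phi> (y $ l)))" unfolding supermodular_def
proof (intro ballI allI impI)
 fix y :: "real^'m" and i j :: 'm and h k :: real
 assume y: "y \<in> nonneg_cone" and ij: "i ~= j" and hk: "0 < h" "0 < k"
 define y' where "y' = (\<chi> l. \<phi> (y $ l))"
 define h' where "h' = \<phi> (y $ i + h) - \<phi> (y $ i)"
 define k' where "k' = \<phi> (y $ j + k) - \<phi> (y $ j)"
 have "y' \<in> nonneg_cone" using y \<phi>(1)[of 0] \<phi>(2) by (auto simp: y'_def nonneg_cone_def)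
 moreover have "0 <= h'" "0 <= k'" using \<phi>(1) y hk by (auto simp: h'_def k'_def nonneg_cone_def)
 moreover have "(\<chi> l. \<phi> ((y + h *\<^sub>R axis i 1) $ l)) = y' + h' *\<^sub>R axis i 1"
  "(\<chi> l. \<phi> ((y + k *\<^sub>R axis j 1) $ l)) = y' + k' *\<^sub>R axis j 1"
  "(\<chi> l. \<phi> ((y + h *\<^sub>R axis i 1 + k *\<^sub>R axis j 1) $ l)) = y' + h' *\<^sub>R axis i 1 + k' *\<^sub>R axis j 1"
  using ij by (auto simp: y'_def h'_def k'_def vec_eq_iff axis_def)
 ultimately show "F (\<chi> l. \<phi> ((y + h *\<^sub>R axis i 1) $ l)) + F (\<chi> l. \<phi> ((y + k *\<^sub>R axis j 1) $ l))
  <= F (\<chi> l. \<phi> ((y + h *\<^sub>R axis i 1 + k *\<^sub>R axis j 1) $ l)) + F (\<chi> l. \<phi> (y $ l))"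
  using supermodularD[OF F, of y' i j h' k'] ij by (simp add: y'_def)
qed

section \<open>Spaces with enough reflections\<close>

text \<open>
 \<open>refl x y\<close> is the reflection exchanging \<open>x\<close> and \<open>y\<close>; its half-spaces consist of the points closer to
 \<open>x\<close> and of those closer to \<open>y\<close>.
\<close>

locale reflection_model =
 fixes X :: "'a::euclidean_space model_space"
  and refl :: "'a => 'a => 'a => 'a"
 assumes base_in: "base X \<in> points X"
  and dist_nonneg: "!!x y. x \<in> points X ==> y \<in> points X ==> 0 <= distance X x y"
  and dist_zero: "!!x y. x \<in> points X ==> y \<in> points X ==> distance X x y = 0 \<longleftrightarrow> x = y"
  and dist_sym: "!!x y. x \<in> points X ==> y \<in> points X ==> distance X x y = distance X y x"
  and dist_triangle: "!!x y z. x \<in> points X ==> y \<in> points X ==> z \<in> points X ==>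
   distance X x z <= distance X x y + distance X y z"
  and dist_continuous: "continuous_on (points X \<times> points X) (\<lambda>(x, y). distance X x y)"
  and compact_cball: "!!r. compact {y \<in> points X. distance X (base X) y <= r}"
  and connected_points: "connected (points X)"
  and infinite_ball: "!!r. 0 < r ==> infinite (model_ball X r)"
  and sets_vol: "!!A. A \<in> sets borel ==> A \<inter> points X \<in> sets (vol X)"
  and sigma_finite_vol: "sigma_finite_measure (vol X)"
  and finite_cball: "!!r. emeasure (vol X) {y \<in> points X. distance X (base X) y <= r} < \<infinity>"
  and positive_ball: "!!r. 0 < r ==> 0 < emeasure (vol X) (model_ball X r)"
  and inner_regular_vol: "!!A e. A \<in> sets (vol X) ==> emeasure (vol X) A < \<infinity> ==> 0 < e ==>
   \<exists>C\<subseteq>A. compact C \<and> emeasure (vol X) (A - C) < ennreal e"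
  and refl_in: "!!x y z. x \<in> points X ==> y \<in> points X ==> x ~= y ==> z \<in> points X ==> refl x y z \<in> points X"
  and refl_refl: "!!x y z. x \<in> points X ==> y \<in> points X ==> x ~= y ==> z \<in> points X ==>
   refl x y (refl x y z) = z"
  and refl_dist: "!!x y z w. x \<in> points X ==> y \<in> points X ==> x ~= y ==> z \<in> points X ==> w \<in> points X ==>
   distance X (refl x y z) (refl x y w) = distance X z w"
  and refl_swap: "!!x y. x \<in> points X ==> y \<in> points X ==> x ~= y ==> refl x y x = y"
  and refl_measurable: "!!x y. x \<in> points X ==> y \<in> points X ==> x ~= y ==> refl x y \<in> vol X \<rightarrow>\<^sub>M vol X"
  and refl_distr: "!!x y. x \<in> points X ==> y \<in> points X ==> x ~= y ==> distr (vol X) (vol X) (refl x y) = vol X"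
  and refl_side: "!!x y z w. x \<in> points X ==> y \<in> points X ==> x ~= y ==> z \<in> points X ==> w \<in> points X ==>
   sgn (distance X z (refl x y w) - distance X z w) =
   sgn ((distance X z y - distance X z x) * (distance X w y - distance X w x))"
  and bisector_null: "!!x y. x \<in> points X ==> y \<in> points X ==> x ~= y ==>
   {z \<in> points X. distance X z x = distance X z y} \<in> null_sets (vol X)"
  and translation_to_base: "!!a. a \<in> points X ==> \<exists>\<tau>\<in>translation_maps X.
   \<forall>x\<in>points X. \<tau> x \<in> points X \<and> distance X (base X) (\<tau> x) = distance X a x"
begin

abbreviation d :: "'a => 'a => real" where "d \<equiv> distance X"
abbreviation M :: "'a measure" where "M \<equiv> vol X"
abbreviation b :: 'a where "b \<equiv> base X"
abbreviation pts :: "'a set" where "pts \<equiv> space M"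
abbreviation \<mu> :: "'a set => ennreal" where "\<mu> \<equiv> emeasure M"
abbreviation integral_M :: "('a => ennreal) => ennreal" (binder "\<integral>M" 10) where "integral_M \<equiv> nn_integral M"

sublocale sigma_finite_measure M by (rule sigma_finite_vol)

definition cell :: "'a => real => 'a set" where "cell x r = {z \<in> pts. d x z < r}"

lemma measurable_into_borel: "(\<lambda>x. x) \<in> M \<rightarrow>\<^sub>M borel"
 using sets_vol by (auto intro!: measurableI)

text \<open>Continuity of \<open>d\<close> is known only on \<open>pts \<times> pts\<close>, and
  \<open>M\<close> is not a Borel measure, so the composition passes through the Borel trace on that
  set.\<close>

lemma dist_measurable [measurable]:
 assumes f[measurable]: "f \<in> N \<rightarrow>\<^sub>M M" and g[measurable]: "g \<in> N \<rightarrow>\<^sub>M M"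
 shows "(\<lambda>x. d (f x) (g x)) \<in> borel_measurable N"
proof -
 have fg: "f \<in> borel_measurable N" "g \<in> borel_measurable N"
  using measurable_compose[OF f measurable_into_borel] measurable_compose[OF g measurable_into_borel] by auto
 have "(\<lambda>x. (f x, g x)) \<in> N \<rightarrow>\<^sub>M restrict_space borel (pts \<times> pts)"
  using measurable_space[OF f] measurable_space[OF g] fg by (intro measurable_restrict_space2) auto
 from measurable_compose[OF this borel_measurable_continuous_on_restrict[OF dist_continuous]]
 show ?thesis by simp
qed

lemma cell_sets [measurable]: "x \<in> pts ==> cell x r \<in> sets M"
 unfolding cell_def by measurable

lemma model_ball_eq_cell: "model_ball X r = cell b r"
 by (simp add: model_ball_def cell_def)

lemma dist_self [simp]: "x \<in> pts ==> d x x = 0"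
 using dist_zero by auto

lemma dist_Lipschitz: "x \<in> pts ==> y \<in> pts ==> z \<in> pts ==> \<bar>d x y - d x z\<bar> <= d y z"
 using dist_triangle[of x y z] dist_triangle[of x z y] dist_sym[of y z] by auto

context
 fixes x y :: 'a
 assumes x: "x \<in> pts" and y: "y \<in> pts" and xy: "x ~= y"
begin

lemma refl_measurable' [measurable]: "refl x y \<in> M \<rightarrow>\<^sub>M M"
 by (rule refl_measurable[OF x y xy])

lemma nn_integral_refl:
 assumes [measurable]: "h \<in> borel_measurable M"
 shows "(\<integral>M z. h (refl x y z)) = (\<integral>M z. h z)"
 by (subst (2) refl_distr[OF x y xy, symmetric], subst nn_integral_distr) auto

lemma emeasure_refl:
 assumes [measurable]: "A \<in> sets M"
 shows "\<mu> {z \<in> pts. refl x y z \<in> A} = \<mu> A"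
proof -
 have "{z \<in> pts. refl x y z \<in> A} = refl x y -` A \<inter> pts" by auto
 then show ?thesis by (subst (2) refl_distr[OF x y xy, symmetric], subst emeasure_distr) auto
qed

text \<open>Reflection preserves volume, so twice an integral is the integral of the sum over mirror
  pairs. Comparing pairs is enough, and no half-space has to be cut out.\<close>

lemma nn_integral_pair_le:
 assumes [measurable]: "h1 \<in> borel_measurable M" "h2 \<in> borel_measurable M"
  and le: "!!z. z \<in> pts ==> h1 z + h1 (refl x y z) <= h2 z + h2 (refl x y z)"
 shows "(\<integral>M z. h1 z) <= (\<integral>M z. h2 z)"
proof -
 have *: "2 * (\<integral>M z. h z) = (\<integral>M z. h z + h (refl x y z))"
  if [measurable]: "h \<in> borel_measurable M" for h
  by (subst nn_integral_add) (auto simp: nn_integral_refl mult_2)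
 have "2 * (\<integral>M z. h1 z) <= 2 * (\<integral>M z. h2 z)" using le by (simp add: * nn_integral_mono)
 then show ?thesis by (simp add: ennreal_mult_le_mult_iff)
qed

lemma nn_integral_pair_eq:
 assumes [measurable]: "h1 \<in> borel_measurable M" "h2 \<in> borel_measurable M"
  and eq: "!!z. z \<in> pts ==> h1 z + h1 (refl x y z) = h2 z + h2 (refl x y z)"
 shows "(\<integral>M z. h1 z) = (\<integral>M z. h2 z)"
 by (intro antisym nn_integral_pair_le) (auto simp: eq)

lemma refl_dist1: "z \<in> pts ==> w \<in> pts ==> d (refl x y z) w = d z (refl x y w)"
 using refl_dist[OF x y xy, of z "refl x y w"] refl_refl[OF x y xy, of w] refl_in[OF x y xy, of w] by auto

lemma refl_swap': "refl x y y = x"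
 using refl_refl[OF x y xy x] refl_swap[OF x y xy] by simp

lemma refl_dist_ends: "z \<in> pts ==> d (refl x y z) x = d z y" "z \<in> pts ==> d (refl x y z) y = d z x"
 using refl_dist1[of z] refl_swap[OF x y xy] refl_swap' x y by auto

text \<open>For \<open>w = z\<close> the sign rule compares the distance between \<open>z\<close>
  and its image with the square of \<open>d z y - d z x\<close>.\<close>

lemma refl_fixes_bisector: "z \<in> pts ==> d z x = d z y ==> refl x y z = z"
 using refl_side[OF x y xy, of z z] dist_zero[of z "refl x y z"] refl_in[OF x y xy, of z]
 by (auto simp: sgn_zero_iff)

lemma refl_cell:
 assumes "p \<in> pts" "z \<in> pts"
 shows "refl x y z \<in> cell (refl x y p) r \<longleftrightarrow> z \<in> cell p r"
 using assms refl_in[OF x y xy, of z] refl_dist[OF x y xy, of p z] by (auto simp: cell_def)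

lemma refl_farther: "z \<in> pts ==> w \<in> pts ==> d z x < d z y ==> d w x <= d w y ==> d z w <= d z (refl x y w)"
 using refl_side[OF x y xy, of z w] by (cases "d w x = d w y") (auto simp: sgn_if split: if_splits)

lemma refl_strictly_farther: "z \<in> pts ==> w \<in> pts ==> d z x < d z y ==> d w x < d w y ==> d z w < d z (refl x y w)"
 using refl_side[OF x y xy, of z w] by (auto simp: sgn_if split: if_splits)

end

section \<open>Volumes of balls and spheres\<close>

lemma emeasure_cell:
 assumes x: "x \<in> pts" and y: "y \<in> pts"
 shows "\<mu> (cell x r) = \<mu> (cell y r)"
proof (cases "x = y")
 case False
 have "{z \<in> pts. refl x y z \<in> cell y r} = cell x r"
  using refl_cell[OF x y False x] refl_swap[OF x y False] by (auto simp: cell_def)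
 then show ?thesis using emeasure_refl[OF x y False, of "cell y r"] cell_sets[OF y] by simp
qed simp

lemma emeasure_cell_pos: "x \<in> pts ==> 0 < r ==> 0 < \<mu> (cell x r)"
 using positive_ball[of r] emeasure_cell[of x b] base_in by (simp add: model_ball_eq_cell)

lemma emeasure_cell_finite: "x \<in> pts ==> \<mu> (cell x r) < \<infinity>"
proof -
 assume x: "x \<in> pts"
 have "\<mu> (cell b r) <= \<mu> {y \<in> points X. d b y <= r}"
  using base_in by (intro emeasure_mono) (auto simp: cell_def)
 then show ?thesis using finite_cball[of r] emeasure_cell[OF x base_in] by (simp add: order_le_less_trans)
qed

text \<open>By homogeneity all spheres of radius \<open>r\<close> have the same measure, and two of
  them meet only inside a null bisector. Arbitrarily many centers fit into the unit ball, so
  arbitrarily many almost disjoint spheres fit into a ball of finite volume.\<close>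

lemma sphere_null:
 assumes x: "x \<in> pts"
 shows "{z \<in> pts. d x z = r} \<in> null_sets M"
proof -
 define N where "N p = {z \<in> pts. d p z = r}" for p
 have [measurable]: "N p \<in> sets M" if "p \<in> pts" for p using that unfolding N_def by measurable
 have same: "\<mu> (N p) = \<mu> (N x)" if p: "p \<in> pts" for p
 proof (cases "p = x")
  case False
  have "{z \<in> pts. refl p x z \<in> N x} = N p"
   using refl_dist[OF p x False p] refl_swap[OF p x False] refl_in[OF p x False] by (auto simp: N_def)
  then show ?thesis using emeasure_refl[OF p x False, of "N x"] x by simp
 qed simp
 have "\<mu> (N x) = 0"
 proof (rule ccontr)
  assume "\<mu> (N x) ~= 0"
  define V where "V = \<mu> {y \<in> points X. d b y <= r + 1}"
  have bound: "of_nat n * \<mu> (N x) <= V" for n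
  proof -
   obtain P where P: "finite P" "card P = n" "P \<subseteq> cell b 1"
    using infinite_ball[of 1] infinite_arbitrarily_large[of "cell b 1" n] by (auto simp: model_ball_eq_cell)
   have PM: "P \<subseteq> pts" using P(3) by (auto simp: cell_def)
   have "of_nat n * \<mu> (N x) = (\<Sum>p\<in>P. \<mu> (N p))"
    using PM by (subst sum.cong[OF refl same]) (auto simp: P)
   also have "... = (\<integral>M z. (\<Sum>p\<in>P. indicator (N p) z))"
    using PM P(1) by (subst nn_integral_sum) (auto intro!: sum.cong simp: subset_eq)
   also have "... <= (\<integral>M z. indicator {y \<in> points X. d b y <= r + 1} z)"
   proof (rule nn_integral_mono_AE)
    have "AE z in M. \<forall>p\<in>P. \<forall>q\<in>P. p ~= q --> d z p ~= d z q"
    proof (intro AE_finite_allI P(1))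
     fix p q assume pq: "p \<in> P" "q \<in> P"
     show "AE z in M. p ~= q --> d z p ~= d z q"
      using AE_not_in[OF bisector_null[of p q]] pq PM by (cases "p = q") auto
    qed
    then show "AE z in M. (\<Sum>p\<in>P. indicator (N p) z) <= (indicator {y \<in> points X. d b y <= r + 1} z :: ennreal)"
    proof (rule AE_mp, intro AE_I2 impI)
     fix z assume z: "z \<in> pts" and ne: "\<forall>p\<in>P. \<forall>q\<in>P. p ~= q --> d z p ~= d z q"
     show "(\<Sum>p\<in>P. indicator (N p) z) <= (indicator {y \<in> points X. d b y <= r + 1} z :: ennreal)"
     proof (cases "\<exists>p\<in>P. z \<in> N p")
      case False
      then show ?thesis by (simp add: indicator_def)
     next
      case True
      then obtain p where p: "p \<in> P" "z \<in> N p" by auto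
      have "(\<Sum>q\<in>P. indicator (N q) z :: ennreal) = (\<Sum>q\<in>P. if q = p then 1 else 0)"
       using p ne PM z dist_sym by (intro sum.cong) (auto simp: N_def indicator_def subset_eq)
      also have "... = 1" using p P(1) by simp
      finally have "(\<Sum>q\<in>P. indicator (N q) z :: ennreal) = 1" .
      moreover have "d b z <= r + 1"
       using dist_triangle[of b p z] p P(3) PM base_in z by (auto simp: cell_def N_def subset_eq)
      ultimately show ?thesis using z by simp
     qed
    qed
   qed
   also have "... = V" unfolding V_def using base_in by (intro nn_integral_indicator) measurable
   finally show ?thesis .
  qed
  have "V < \<infinity>" unfolding V_def by (rule finite_cball)
  have "\<mu> (N x) < \<infinity>" using bound[of 1] \<open>V < \<infinity>\<close> by (simp add: order_le_less_trans)
  then obtain e where e: "\<mu> (N x) = ennreal e" "0 < e"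
   using \<open>\<mu> (N x) ~= 0\<close> by (cases "\<mu> (N x)") (auto simp: less_le)
  obtain v where v: "V = ennreal v" "0 <= v" using \<open>V < \<infinity>\<close> by (cases V) auto
  obtain n where "v < real n * e" using reals_Archimedean3[OF e(2)] by blast
  moreover have "real n * e <= v"
   using bound[of n] v e by (simp add: ennreal_of_nat_eq_real_of_nat ennreal_mult[symmetric])
  ultimately show False by simp
 qed
 then show ?thesis using x by (auto simp: N_def[symmetric])
qed

lemma AE_dist_ne: "x \<in> pts ==> AE z in M. d x z ~= r"
 using AE_not_in[OF sphere_null[of x r]] by auto

section \<open>Two-point rearrangement\<close>

text \<open>The two-point rearrangement exchanging \<open>x\<close> and \<open>y\<close>. Points of
  the bisector are fixed by the reflection, so counting them to the side of \<open>x\<close> is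
  harmless.\<close>

definition polarize :: "'a \<times> 'a => ('a => real) => 'a => real" where
 "polarize p f z = (case p of (x, y) =>
   if d z x <= d z y then max (f z) (f (refl x y z)) else min (f z) (f (refl x y z)))"

definition toward_base :: "('a \<times> 'a) set" where
 "toward_base = {(x, y). x \<in> pts \<and> y \<in> pts \<and> d b x < d b y}"

text \<open>The head of the list acts last, so that a further polarization is a
  \<open>Cons\<close>.\<close>

definition polarizes :: "('a \<times> 'a) list => ('a => real) => 'a => real" where
 "polarizes ps f = foldr polarize ps f"

lemma polarizes_simps [simp]: "polarizes [] f = f" "polarizes (p # ps) f = polarize p (polarizes ps f)"
 by (simp_all add: polarizes_def)

lemma polarize_pair:
 assumes "x \<in> pts" "y \<in> pts" "x ~= y" "z \<in> pts"
 shows "(polarize (x, y) f z = f z \<and> polarize (x, y) f (refl x y z) = f (refl x y z)) \<or>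
  (polarize (x, y) f z = f (refl x y z) \<and> polarize (x, y) f (refl x y z) = f z)"
 using refl_dist_ends[OF assms] refl_refl[OF assms] refl_fixes_bisector[OF assms]
 by (auto simp: polarize_def max_def min_def)

lemma polarize_cong:
 assumes "x \<in> pts" "y \<in> pts" "x ~= y" "!!z. z \<in> pts ==> f z = g z" "z \<in> pts"
 shows "polarize (x, y) f z = polarize (x, y) g z" using assms refl_in[of x y z] by (simp add: polarize_def)

lemma polarize_measurable:
 assumes "x \<in> pts" "y \<in> pts" "x ~= y" and [measurable]: "f \<in> borel_measurable M"
 shows "polarize (x, y) f \<in> borel_measurable M"
 using refl_measurable[OF assms(1-3)] assms(1,2) unfolding polarize_def by simp

lemma polarize_equimeasurable:
 assumes "x \<in> pts" "y \<in> pts" "x ~= y"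
  and [measurable]: "f \<in> borel_measurable M" and "h \<in> borel_measurable borel"
 shows "(\<integral>M z. h (polarize (x, y) f z)) = (\<integral>M z. h (f z))"
proof (rule nn_integral_pair_eq[OF assms(1-3)])
 show "(\<lambda>z. h (polarize (x, y) f z)) \<in> borel_measurable M" "(\<lambda>z. h (f z)) \<in> borel_measurable M"
  using measurable_compose[OF polarize_measurable[OF assms(1-4)] assms(5)]
   measurable_compose[OF assms(4,5)] by auto
 show "h (polarize (x, y) f z) + h (polarize (x, y) f (refl x y z)) = h (f z) + h (f (refl x y z))"
  if "z \<in> pts" for z using polarize_pair[OF assms(1-3) that, of f] by (auto simp: add.commute)
qed

text \<open>On a mirror pair both functions are sorted, and sorting two pairs of numbers does not
  increase the sum of their absolute differences.\<close>

lemma polarize_contraction: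
 assumes "x \<in> pts" "y \<in> pts" "x ~= y"
  and [measurable]: "f \<in> borel_measurable M" "g \<in> borel_measurable M"
 shows "(\<integral>M z. ennreal \<bar>polarize (x, y) f z - polarize (x, y) g z\<bar>) <= (\<integral>M z. ennreal \<bar>f z - g z\<bar>)"
proof (rule nn_integral_pair_le[OF assms(1-3)])
 fix z assume z: "z \<in> pts"
 have "\<bar>polarize (x, y) f z - polarize (x, y) g z\<bar> +
   \<bar>polarize (x, y) f (refl x y z) - polarize (x, y) g (refl x y z)\<bar>
   <= \<bar>f z - g z\<bar> + \<bar>f (refl x y z) - g (refl x y z)\<bar>"
  using refl_dist_ends[OF assms(1-3) z] refl_refl[OF assms(1-3) z] refl_fixes_bisector[OF assms(1-3) z]
  by (cases "d z x" "d z y" rule: linorder_cases) (auto simp: polarize_def max_def min_def)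
 then show "ennreal \<bar>polarize (x, y) f z - polarize (x, y) g z\<bar> +
   ennreal \<bar>polarize (x, y) f (refl x y z) - polarize (x, y) g (refl x y z)\<bar>
   <= ennreal \<bar>f z - g z\<bar> + ennreal \<bar>f (refl x y z) - g (refl x y z)\<bar>"
  by (simp add: ennreal_plus[symmetric] ennreal_leI del: ennreal_plus)
qed (use polarize_measurable[OF assms(1-3)] in measurable)

lemma polarize_compose_mono:
 assumes "!!s t. s <= t ==> \<phi> s <= \<phi> t"
 shows "polarize p (\<lambda>z. \<phi> (f z)) z = \<phi> (polarize p f z)"
 using assms by (auto simp: polarize_def max_def min_def split: prod.splits intro: antisym)

lemma polarize_Lipschitz:
 assumes xy: "x \<in> pts" "y \<in> pts" "x ~= y"
  and f: "!!z w. z \<in> pts ==> w \<in> pts ==> \<bar>f z - f w\<bar> <= L * d z w" and L: "0 <= L"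
  and zw: "z \<in> pts" "w \<in> pts"
 shows "\<bar>polarize (x, y) f z - polarize (x, y) f w\<bar> <= L * d z w"
proof -
 let ?s = "refl x y"
 note in' = refl_in[OF xy zw(1)] refl_in[OF xy zw(2)]
 have mm: "d z (?s w) = d (?s z) w" "d (?s z) (?s w) = d z w"
  using refl_dist1[OF xy zw] refl_dist[OF xy zw] by auto
 have b1: "\<bar>f z - f w\<bar> <= L * d z w" "\<bar>f (?s z) - f (?s w)\<bar> <= L * d z w"
  using f[OF zw] f[OF in'] mm by auto
 have b2: "\<bar>f z - f (?s w)\<bar> <= L * d z (?s w)" "\<bar>f (?s z) - f w\<bar> <= L * d z (?s w)"
  using f[OF zw(1) in'(2)] f[OF in'(1) zw(2)] mm by auto
 show ?thesis
 proof (cases "(d z x <= d z y) = (d w x <= d w y)")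
  case True
  then show ?thesis using b1 by (auto simp: polarize_def max_def min_def)
 next
  case False
  \<comment> \<open>If exactly one of the points is on the side of \<open>x\<close>, the mirror
    image of \<open>w\<close> is at least as close to \<open>z\<close> as \<open>w\<close> itself,
    so differences across the mirror obey the same bound.\<close>
  have "d z (?s w) <= d z w" using refl_side[OF xy zw] False
   by (cases "d z x = d z y"; cases "d w x = d w y") (auto simp: sgn_if not_le mult_less_0_iff zero_less_mult_iff split: if_splits)
  then have "L * d z (?s w) <= L * d z w" using L by (rule mult_left_mono)
  with b1 b2 False show ?thesis by (auto simp: polarize_def max_def min_def)
 qed
qed

end

context reflection_model begin

lemma toward_baseD:
 "(x, y) \<in> toward_base ==> x \<in> pts" "(x, y) \<in> toward_base ==> y \<in> pts"
 "(x, y) \<in> toward_base ==> x ~= y" "(x, y) \<in> toward_base ==> d b x < d b y"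
 by (auto simp: toward_base_def)

lemma polarizes_induct [consumes 1, case_names Nil Cons]:
 assumes "set ps \<subseteq> toward_base"
  and "P []" "!!x y ps. \<lbrakk>(x, y) \<in> toward_base; x \<in> pts; y \<in> pts; x ~= y; d b x < d b y;
   set ps \<subseteq> toward_base; P ps\<rbrakk> \<Longrightarrow> P ((x, y) # ps)"
 shows "P ps" using assms(1)
proof (induction ps)
 case (Cons p ps)
 then show ?case using toward_baseD[of "fst p" "snd p"] assms(3)[of "fst p" "snd p" ps] by auto
qed (rule assms(2))

lemma polarizes_measurable:
 assumes "set ps \<subseteq> toward_base" and f: "f \<in> borel_measurable M"
 shows "polarizes ps f \<in> borel_measurable M"
 using assms(1) by (induction ps rule: polarizes_induct) (auto intro: polarize_measurable f)

lemma polarizes_equimeasurable: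
 assumes "set ps \<subseteq> toward_base" and f: "f \<in> borel_measurable M" "h \<in> borel_measurable borel"
 shows "(\<integral>M z. h (polarizes ps f z)) = (\<integral>M z. h (f z))"
 using assms(1) by (induction ps rule: polarizes_induct)
  (auto simp: polarize_equimeasurable polarizes_measurable f)

lemma polarizes_contraction:
 assumes "set ps \<subseteq> toward_base" and f: "f \<in> borel_measurable M" "g \<in> borel_measurable M"
 shows "(\<integral>M z. ennreal \<bar>polarizes ps f z - polarizes ps g z\<bar>) <= (\<integral>M z. ennreal \<bar>f z - g z\<bar>)"
 using assms(1) by (induction ps rule: polarizes_induct)
  (auto intro: order_trans[OF polarize_contraction] polarizes_measurable f)

lemma polarizes_Lipschitz:
 assumes "set ps \<subseteq> toward_base" "0 <= L"
  and "!!z w. z \<in> pts ==> w \<in> pts ==> \<bar>f z - f w\<bar> <= L * d z w"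
 shows "\<forall>z\<in>pts. \<forall>w\<in>pts. \<bar>polarizes ps f z - polarizes ps f w\<bar> <= L * d z w"
 using assms(1)
proof (induction ps rule: polarizes_induct)
 case (Cons x y ps)
 then show ?case using polarize_Lipschitz[OF Cons(2-4), of "polarizes ps f" L] assms(2) by simp
qed (use assms(3) in auto)

lemma polarizes_compose_mono:
 assumes "!!s t. s <= t ==> \<phi> s <= \<phi> t"
 shows "polarizes ps (\<lambda>z. \<phi> (f z)) = (\<lambda>z. \<phi> (polarizes ps f z))"
proof (induction ps)
 case (Cons p ps)
 show ?case unfolding polarizes_simps Cons by (rule ext) (rule polarize_compose_mono[OF assms])
qed simp

lemma polarizes_range:
 assumes "set ps \<subseteq> toward_base" "!!z. z \<in> pts ==> f z \<in> R"
 shows "\<forall>z\<in>pts. polarizes ps f z \<in> R" using assms(1)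
proof (induction ps rule: polarizes_induct)
 case (Cons x y ps)
 show ?case
 proof
  fix z assume z: "z \<in> pts"
  show "polarizes ((x, y) # ps) f z \<in> R"
   using polarize_pair[OF Cons(2-4) z, of "polarizes ps f"] refl_in[OF Cons(2-4) z] Cons(7) z by auto
 qed
qed (use assms(2) in auto)

text \<open>On the near side a point outside the ball has its image at least as far out, where the
  function vanishes too; on the far side the smaller of two nonnegative values is taken.\<close>

lemma polarizes_support:
 assumes "set ps \<subseteq> toward_base" "!!z. z \<in> pts ==> 0 <= f z" "!!z. z \<in> pts ==> R <= d b z ==> f z = 0"
 shows "\<forall>z\<in>pts. R <= d b z --> polarizes ps f z = 0" using assms(1)
proof (induction ps rule: polarizes_induct)
 case (Cons x y ps)
 show ?case
 proof (intro ballI impI)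
  fix z assume z: "z \<in> pts" "R <= d b z"
  have pos: "0 <= polarizes ps f w" if "w \<in> pts" for w
   using polarizes_range[OF Cons(6), of f "{0..}"] assms(2) that by auto
  have r: "refl x y z \<in> pts" using refl_in[OF Cons(2-4) z(1)] .
  have z0: "polarizes ps f z = 0" using Cons(7) z by auto
  show "polarizes ((x, y) # ps) f z = 0"
  proof (cases "d z x <= d z y")
   case True
   then have "R <= d b (refl x y z)"
    using refl_farther[OF Cons(2-4) base_in z(1)] Cons(5) z dist_sym Cons(2-3) base_in by auto
   then show ?thesis using Cons(7) r z0 by (simp add: polarize_def)
  next
   case False
   then show ?thesis using z0 pos[OF r] by (simp add: polarize_def)
  qed
 qed
qed (use assms(3) in auto)

section \<open>Approximation of the rearrangement by polarizations\<close>

text \<open>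
 A polarization toward the base point moves mass inward, so it increases the integral against a
 radially decreasing weight; the gain is quantitative for Lipschitz functions.
\<close>

lemma polarize_weight_gain:
 assumes xy: "(x, y) \<in> toward_base" and f: "f \<in> borel_measurable M" "!!z. z \<in> pts ==> 0 <= f z"
  and L: "0 <= L" "!!z w. z \<in> pts ==> w \<in> pts ==> \<bar>f z - f w\<bar> <= L * d z w"
  and \<epsilon>: "0 < \<epsilon>" "f x + \<epsilon> <= f y" and \<eta>: "0 < \<eta>" "d b x + \<eta> <= d b y" and R: "d b y + 1 <= R"
  and \<rho>: "0 < \<rho>" "\<rho> <= 1" "\<rho> <= \<eta> / 4" "L * \<rho> <= \<epsilon> / 4"
 shows "(\<integral>M z. ennreal (f z * max 0 (R - d b z))) + ennreal (\<epsilon> / 2 * (\<eta> / 2)) * \<mu> (cell b \<rho>)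
  <= (\<integral>M z. ennreal (polarize (x, y) f z * max 0 (R - d b z)))"
proof -
 note p = toward_baseD[OF xy]
 let ?s = "refl x y" and ?w = "\<lambda>z. max 0 (R - d b z)" and ?c = "\<epsilon> / 2 * (\<eta> / 2)"
 let ?f' = "polarize (x, y) f"
 note [measurable] = f(1) polarize_measurable[OF p(1-3) f(1)]
 have [measurable]: "(\<lambda>z. d b z) \<in> borel_measurable M" "cell x \<rho> \<in> sets M" using base_in p by measurable
 have pos': "0 <= ?f' z" if "z \<in> pts" for z
  using f(2)[OF that] f(2)[OF refl_in[OF p(1-3) that]] by (auto simp: polarize_def)
 \<comment> \<open>On a mirror pair the gain is a product of two differences, one of values and one
   of weights. The indicator charges only the member near \<open>x\<close>, which is what
   \<open>out\<close> records.\<close>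
 have key: "f z * ?w z + f (?s z) * ?w (?s z) + ?c * indicator (cell x \<rho>) z <= ?f' z * ?w z + ?f' (?s z) * ?w (?s z)"
  and out: "indicator (cell x \<rho>) (?s z) = (0::real)"
  if z: "z \<in> pts" and side: "d z x <= d z y" for z
 proof -
  have sz: "?s z \<in> pts" using refl_in[OF p(1-3) z] .
  have far: "d b z <= d b (?s z)" using refl_farther[OF p(1-3) base_in z] p side dist_sym base_in by auto
  have s1: "?f' z = max (f z) (f (?s z))" using side by (simp add: polarize_def)
  have s2: "?f' (?s z) = min (f z) (f (?s z))"
   using side refl_dist_ends[OF p(1-3) z] refl_refl[OF p(1-3) z] refl_fixes_bisector[OF p(1-3) z]
   by (auto simp: polarize_def max_def min_def)
  have w: "?w (?s z) <= ?w z" using far by auto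
  \<comment> \<open>The bounds on \<open>\<rho>\<close> cost at most half of the gaps
    \<open>\<epsilon>\<close> and \<open>\<eta>\<close> between \<open>x\<close> and
    \<open>y\<close>, and \<open>d b y + 1 <= R\<close> keeps both weights away from the
    cutoff.\<close>
  have near: "d z x < d z y" "f z + \<epsilon> / 2 <= f (?s z)" "\<eta> / 2 <= ?w z - ?w (?s z)" if zc: "z \<in> cell x \<rho>"
  proof -
   have zx: "d x z < \<rho>" using zc by (simp add: cell_def)
   have "d x y >= \<eta>" using dist_triangle[of b x y] \<eta> p base_in by auto
   then show "d z x < d z y" using dist_triangle[of x z y] zx \<rho> \<eta> p z dist_sym[of x z] by auto
   have szy: "d (?s z) y < \<rho>" using refl_dist_ends[OF p(1-3) z] zx p z dist_sym by auto
   have "\<bar>f z - f x\<bar> <= \<epsilon> / 4" "\<bar>f (?s z) - f y\<bar> <= \<epsilon> / 4"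
   proof -
    have "L * d z x <= L * \<rho>" "L * d (?s z) y <= L * \<rho>"
     using zx szy L(1) dist_sym[of x z] p z by (auto intro!: mult_left_mono)
    then show "\<bar>f z - f x\<bar> <= \<epsilon> / 4" "\<bar>f (?s z) - f y\<bar> <= \<epsilon> / 4"
     using L(2)[OF z p(1)] L(2)[OF sz p(2)] \<rho>(4) by linarith+
   qed
   then show "f z + \<epsilon> / 2 <= f (?s z)" using \<epsilon> by linarith
   have "d b z <= d b x + \<rho>" using dist_triangle[of b x z] zx base_in p z by auto
   moreover have "d b y - \<rho> <= d b (?s z)" "d b (?s z) <= d b y + \<rho>"
    using dist_triangle[of b "?s z" y] dist_triangle[of b y "?s z"] szy base_in p sz dist_sym[of y "?s z"] by auto
   ultimately show "\<eta> / 2 <= ?w z - ?w (?s z)" using \<rho> \<eta> R by auto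
  qed
  show "indicator (cell x \<rho>) (?s z) = (0::real)"
  proof (rule ccontr)
   assume "indicator (cell x \<rho>) (?s z) ~= (0::real)"
   then have "d x (?s z) < \<rho>" by (auto simp: cell_def indicator_def split: if_splits)
   then have "d (?s z) x < \<rho>" using dist_sym p sz by simp
   moreover have "d (?s z) y <= d (?s z) x" using refl_dist_ends[OF p(1-3) z] side by simp
   moreover have "d x y >= \<eta>" using dist_triangle[of b x y] \<eta> p base_in by auto
   ultimately show False using dist_triangle[of x "?s z" y] \<rho> \<eta> p sz dist_sym[of x "?s z"] by auto
  qed
  have "?f' z * ?w z + ?f' (?s z) * ?w (?s z) - (f z * ?w z + f (?s z) * ?w (?s z))
   = (max (f z) (f (?s z)) - f z) * (?w z - ?w (?s z))"
   unfolding s1 s2 by (auto simp: max_def min_def algebra_simps)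
  moreover have "?c * indicator (cell x \<rho>) z <= (max (f z) (f (?s z)) - f z) * (?w z - ?w (?s z))"
  proof (cases "z \<in> cell x \<rho>")
   case True
   then have "\<epsilon> / 2 * (\<eta> / 2) <= (max (f z) (f (?s z)) - f z) * (?w z - ?w (?s z))"
    using near[OF True] \<epsilon> \<eta> by (intro mult_mono) auto
   then show ?thesis using True by simp
  next
   case False
   have "0 <= (max (f z) (f (?s z)) - f z) * (?w z - ?w (?s z))" using w by (intro mult_nonneg_nonneg) auto
   then show ?thesis using False by simp
  qed
  ultimately show "f z * ?w z + f (?s z) * ?w (?s z) + ?c * indicator (cell x \<rho>) z
    <= ?f' z * ?w z + ?f' (?s z) * ?w (?s z)" by linarith
 qed
 have key': "f z * ?w z + ?c * indicator (cell x \<rho>) z + (f (?s z) * ?w (?s z) + ?c * indicator (cell x \<rho>) (?s z))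
   <= ?f' z * ?w z + ?f' (?s z) * ?w (?s z)" if z: "z \<in> pts" for z
 proof (cases "d z x <= d z y")
  case True
  then show ?thesis using key[OF z True] out[OF z True] by simp
 next
  case False
  have sz: "?s z \<in> pts" using refl_in[OF p(1-3) z] .
  have "d (?s z) x <= d (?s z) y" using False refl_dist_ends[OF p(1-3) z] by simp
  then show ?thesis using key[OF sz] out[OF sz] refl_refl[OF p(1-3) z] by simp
 qed
 have "(\<integral>M z. ennreal (f z * ?w z)) + ennreal ?c * \<mu> (cell b \<rho>)
  = (\<integral>M z. ennreal (f z * ?w z)) + (\<integral>M z. ennreal ?c * indicator (cell x \<rho>) z)"
  using emeasure_cell[OF p(1) base_in] by (simp add: nn_integral_cmult)
 also have "... = (\<integral>M z. ennreal (f z * ?w z) + ennreal ?c * indicator (cell x \<rho>) z)"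
  by (intro nn_integral_add[symmetric]) measurable
 also have "... = (\<integral>M z. ennreal (f z * ?w z + ?c * indicator (cell x \<rho>) z))"
 proof (rule nn_integral_cong)
  fix z assume z: "z \<in> pts"
  have "0 <= f z * ?w z" using f(2)[OF z] by simp
  then show "ennreal (f z * ?w z) + ennreal ?c * indicator (cell x \<rho>) z = ennreal (f z * ?w z + ?c * indicator (cell x \<rho>) z)"
   using \<epsilon> \<eta> by (cases "z \<in> cell x \<rho>") (simp_all add: ennreal_plus)
 qed
 also have "... <= (\<integral>M z. ennreal (?f' z * ?w z))"
 proof (rule nn_integral_pair_le[OF p(1-3)])
  fix z assume z: "z \<in> pts"
  have sz: "?s z \<in> pts" using refl_in[OF p(1-3) z] .
  have "0 <= f z * ?w z + ?c * indicator (cell x \<rho>) z" if "z \<in> pts" for z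
   using f(2)[OF that] \<epsilon> \<eta> by (intro add_nonneg_nonneg mult_nonneg_nonneg) auto
  moreover have "0 <= ?f' z * ?w z" if "z \<in> pts" for z using pos'[OF that] by simp
  ultimately show "ennreal (f z * ?w z + ?c * indicator (cell x \<rho>) z) +
    ennreal (f (?s z) * ?w (?s z) + ?c * indicator (cell x \<rho>) (?s z))
    <= ennreal (?f' z * ?w z) + ennreal (?f' (?s z) * ?w (?s z))"
   using key'[OF z] z sz by (simp only: ennreal_plus[symmetric] ennreal_leI)
 qed measurable
 finally show ?thesis .
qed

text \<open>A near-maximizer of the total radial moment \<open>J\<close> over all finite sequences
  works: a violation would allow one more polarization with gain at least \<open>\<gamma>\<close>.
  Summing over \<open>K\<close> lets one sequence serve all functions, as no summand
  decreases.\<close>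

lemma almost_radially_decreasing:
 fixes f :: "'k => 'a => real"
 assumes K: "finite K" and f: "!!k. k \<in> K ==> f k \<in> borel_measurable M"
   "!!k z. k \<in> K ==> z \<in> pts ==> 0 <= f k z \<and> f k z <= 1"
  and supp: "!!k z. k \<in> K ==> z \<in> pts ==> R <= d b z ==> f k z = 0"
  and L: "0 <= L" "!!k z w. k \<in> K ==> z \<in> pts ==> w \<in> pts ==> \<bar>f k z - f k w\<bar> <= L * d z w"
  and \<epsilon>: "0 < \<epsilon>" and \<eta>: "0 < \<eta>"
 obtains ps where "set ps \<subseteq> toward_base"
  "!!k x y. k \<in> K ==> x \<in> pts ==> y \<in> pts ==> d b x + \<eta> <= d b y ==>
   polarizes ps (f k) y < polarizes ps (f k) x + \<epsilon>"
proof -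
 \<comment> \<open>The cutoff is \<open>R + 1\<close> because the gain lemma wants distance 1
   between the point \<open>y\<close> of the support and the zero set of the weight.\<close>
 define w where "w z = max 0 (R + 1 - d b z)" for z
 have [measurable]: "w \<in> borel_measurable M" unfolding w_def using base_in by measurable
 define J where "J ps = (\<Sum>k\<in>K. \<integral>\<^sup>+z. ennreal (polarizes ps (f k) z * w z) \<partial>M)" for ps
 define S where "S = (SUP ps\<in>{ps. set ps \<subseteq> toward_base}. J ps)"
 define \<rho> where "\<rho> = Min {1, \<eta> / 4, \<epsilon> / (4 * (L + 1))}"
 have \<rho>: "0 < \<rho>" "\<rho> <= 1" "\<rho> <= \<eta> / 4" "L * \<rho> <= \<epsilon> / 4"
 proof -
  show "0 < \<rho>" using \<epsilon> \<eta> L by (auto simp: \<rho>_def)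
  show "\<rho> <= 1" "\<rho> <= \<eta> / 4" unfolding \<rho>_def by (rule Min_le; simp)+
  have "\<rho> <= \<epsilon> / (4 * (L + 1))" unfolding \<rho>_def by (rule Min_le) auto
  then have "\<rho> * (4 * (L + 1)) <= \<epsilon>" using L(1) by (simp add: pos_le_divide_eq)
  then show "L * \<rho> <= \<epsilon> / 4" using \<open>0 < \<rho>\<close> by (simp add: algebra_simps)
 qed
 \<comment> \<open>The gain of one polarization. It is independent of the sequence, since
   polarizations keep the Lipschitz constant \<open>L\<close>.\<close>
 define \<gamma> where "\<gamma> = ennreal (\<epsilon> / 2 * (\<eta> / 2)) * \<mu> (cell b \<rho>)"
 have \<gamma>: "0 < \<gamma>" using emeasure_cell_pos[OF base_in \<rho>(1)] \<epsilon> \<eta> by (simp add: \<gamma>_def ennreal_zero_less_mult_iff)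
 have f01: "0 <= polarizes ps (f k) z \<and> polarizes ps (f k) z <= 1" if "set ps \<subseteq> toward_base" "k \<in> K" "z \<in> pts" for ps k z
  using polarizes_range[OF that(1), of "f k" "{0..1}"] f(2) that by auto
 have fsupp: "polarizes ps (f k) z = 0" if "set ps \<subseteq> toward_base" "k \<in> K" "z \<in> pts" "R <= d b z" for ps k z
  using polarizes_support[OF that(1), of "f k" R] f(2) supp that by auto
 have "J ps <= of_nat (card K) * (ennreal (R + 1) * \<mu> (cell b R))" if ps: "set ps \<subseteq> toward_base" for ps
 proof -
  have "J ps <= (\<Sum>k\<in>K. ennreal (R + 1) * \<mu> (cell b R))" unfolding J_def
  proof (rule sum_mono)
   fix k assume k: "k \<in> K"
   have "(\<integral>M z. ennreal (polarizes ps (f k) z * w z)) <= (\<integral>M z. ennreal (R + 1) * indicator (cell b R) z)"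
   proof (rule nn_integral_mono)
    fix z assume z: "z \<in> pts"
    show "ennreal (polarizes ps (f k) z * w z) <= ennreal (R + 1) * indicator (cell b R) z"
    proof (cases "R <= d b z")
     case False
     have "polarizes ps (f k) z * w z <= 1 * (R + 1)"
      using f01[OF ps k z] dist_nonneg[OF base_in z] False by (intro mult_mono) (auto simp: w_def)
     then show ?thesis using False z by (simp add: cell_def ennreal_leI)
    qed (simp add: fsupp[OF ps k z])
   qed
   also have "... = ennreal (R + 1) * \<mu> (cell b R)" using cell_sets[OF base_in] by (simp add: nn_integral_cmult)
   finally show "(\<integral>M z. ennreal (polarizes ps (f k) z * w z)) <= ennreal (R + 1) * \<mu> (cell b R)" .
  qed
  then show ?thesis by simp
 qed
 then have "S <= of_nat (card K) * (ennreal (R + 1) * \<mu> (cell b R))"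
  unfolding S_def by (intro SUP_least) auto
 also have "... < \<infinity>" using emeasure_cell_finite[OF base_in, of R] by (simp add: ennreal_mult_less_top of_nat_less_top)
 finally have "S < \<infinity>" .
 have "\<gamma> < \<infinity>" using emeasure_cell_finite[OF base_in, of \<rho>] by (simp add: \<gamma>_def ennreal_mult_less_top)
 then obtain c where c: "\<gamma> = ennreal c" "0 < c" using \<gamma> by (cases \<gamma>) auto
 have "{ps. set ps \<subseteq> toward_base} ~= {}" by (intro ex_in_conv[THEN iffD1] exI[of _ "[]"]) simp
 from SUP_approx_ennreal[OF c(2) this S_def] \<open>S < \<infinity>\<close>
 obtain ps where ps: "set ps \<subseteq> toward_base" "S < J ps + \<gamma>" using c by auto
 show thesis
 proof (rule that[OF ps(1)], rule ccontr)
  fix k x y assume k: "k \<in> K" and xy: "x \<in> pts" "y \<in> pts" "d b x + \<eta> <= d b y"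
   and "\<not> polarizes ps (f k) y < polarizes ps (f k) x + \<epsilon>"
  then have big: "polarizes ps (f k) x + \<epsilon> <= polarizes ps (f k) y" by simp
  have tb: "(x, y) \<in> toward_base" using xy \<eta> by (auto simp: toward_base_def)
  note p = toward_baseD[OF tb]
  have ps': "set ((x, y) # ps) \<subseteq> toward_base" using ps tb by auto
  have "d b y < R" using fsupp[OF ps(1) k xy(2)] big \<epsilon> f01[OF ps(1) k xy(1)] by force
  then have gain: "(\<integral>M z. ennreal (polarizes ps (f k) z * w z)) + \<gamma>
    <= (\<integral>M z. ennreal (polarizes ((x, y) # ps) (f k) z * w z))"
   unfolding w_def \<gamma>_def polarizes_simps
   using polarizes_measurable[OF ps(1) f(1)[OF k]] f01[OF ps(1) k] polarizes_Lipschitz[OF ps(1) L(1), of "f k"] L(2)[OF k] xy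
   by (intro polarize_weight_gain[OF tb _ _ L(1) _ \<epsilon> big \<eta> _ _ \<rho>]) auto
  have mono: "(\<integral>M z. ennreal (polarizes ps (f j) z * w z))
    <= (\<integral>M z. ennreal (polarizes ((x, y) # ps) (f j) z * w z))" if j: "j \<in> K" for j
  proof (rule nn_integral_pair_le[OF p(1-3)])
   fix z assume z: "z \<in> pts"
   let ?s = "refl x y" and ?g = "polarizes ps (f j)" and ?g' = "polarize (x, y) (polarizes ps (f j))"
   have main: "?g z * w z + ?g (?s z) * w (?s z) <= ?g' z * w z + ?g' (?s z) * w (?s z)"
    if z: "z \<in> pts" and side: "d z x <= d z y" for z
   proof -
    have far: "d b z <= d b (?s z)" using refl_farther[OF p(1-3) base_in z] p side dist_sym base_in by auto
    have s1: "?g' z = max (?g z) (?g (?s z))" using side by (simp add: polarize_def)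
    have s2: "?g' (?s z) = min (?g z) (?g (?s z))"
     using side refl_dist_ends[OF p(1-3) z] refl_refl[OF p(1-3) z] refl_fixes_bisector[OF p(1-3) z]
     by (auto simp: polarize_def max_def min_def)
    have "0 <= (max (?g z) (?g (?s z)) - ?g z) * (w z - w (?s z))"
     using far by (intro mult_nonneg_nonneg) (auto simp: w_def)
    also have "... = ?g' z * w z + ?g' (?s z) * w (?s z) - (?g z * w z + ?g (?s z) * w (?s z))"
     unfolding s1 s2 by (auto simp: max_def min_def algebra_simps)
    finally show ?thesis by simp
   qed
   have sz: "?s z \<in> pts" using refl_in[OF p(1-3) z] .
   have main': "?g z * w z + ?g (?s z) * w (?s z) <= ?g' z * w z + ?g' (?s z) * w (?s z)"
   proof (cases "d z x <= d z y")
    case False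
    then show ?thesis using main[OF sz] refl_dist_ends[OF p(1-3) z] refl_refl[OF p(1-3) z] by simp
   qed (rule main[OF z])
   have "0 <= ?g z * w z" "0 <= ?g' z * w z" if "z \<in> pts" for z
    using f01[OF ps(1) j that] f01[OF ps' j that] by (auto simp: w_def)
   then show "ennreal (?g z * w z) + ennreal (?g (?s z) * w (?s z))
    <= ennreal (polarizes ((x, y) # ps) (f j) z * w z) + ennreal (polarizes ((x, y) # ps) (f j) (?s z) * w (?s z))"
    using main' z sz by (simp only: ennreal_plus[symmetric] ennreal_leI polarizes_simps)
  qed (use polarizes_measurable[OF ps(1) f(1)[OF j]] polarizes_measurable[OF ps' f(1)[OF j]] in measurable)
  have "J ps + \<gamma> = (\<integral>M z. ennreal (polarizes ps (f k) z * w z)) + \<gamma>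
    + (\<Sum>j\<in>K - {k}. \<integral>\<^sup>+z. ennreal (polarizes ps (f j) z * w z) \<partial>M)"
   unfolding J_def using K k by (subst sum.remove[of K k]) (auto simp: ac_simps)
  also have "... <= J ((x, y) # ps)"
   unfolding J_def using K k by (subst sum.remove[of K k]) (auto intro!: add_mono gain[unfolded polarizes_simps] sum_mono mono[unfolded polarizes_simps])
  also have "... <= S" unfolding S_def by (intro SUP_upper) (use ps' in simp)
  finally show False using ps(2) by simp
 qed
qed

text \<open>Covers centered balls, open or closed, the empty set and the whole space at once, so
  that no choice between open and closed has to be made.\<close>

definition downset :: "'a set => bool" where
 "downset D \<longleftrightarrow> D \<in> sets M \<and> (\<forall>z\<in>D. \<forall>w\<in>pts. d b w <= d b z --> w \<in> D)"

lemma downset_nested: "downset D ==> downset E ==> D \<subseteq> E \<or> E \<subseteq> D"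
 unfolding downset_def by (metis linear sets.sets_into_space subset_eq)

lemma downset_cell: "downset (cell b r)"
 using base_in cell_sets[OF base_in] by (auto simp: downset_def cell_def)

text \<open>A jump of the volume function would be a sphere of positive measure.\<close>

lemma volume_function_continuous: "continuous_on UNIV (\<lambda>t. measure M {z \<in> pts. d b z <= t})"
 unfolding continuous_on_eq_continuous_at[OF open_UNIV]
proof (intro ballI, unfold continuous_at_sequentially, intro allI impI)
 have [measurable]: "(\<lambda>z. d b z) \<in> borel_measurable M" using base_in by measurable
 fix t :: real and s assume s: "s \<longlonglongrightarrow> t"
 obtain T where T: "!!n. s n <= T"
  using convergent_imp_Bseq[of s] s by (auto simp: convergent_def Bseq_def abs_le_iff)
 have "(\<lambda>n. LINT z|M. indicator {z \<in> pts. d b z <= s n} z :: real) \<longlonglongrightarrow> (LINT z|M. indicator {z \<in> pts. d b z <= t} z)"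
 proof (rule integral_dominated_convergence[where w = "indicator {z \<in> pts. d b z <= T}"])
  show "AE z in M. (\<lambda>n. indicator {z \<in> pts. d b z <= s n} z) \<longlonglongrightarrow> (indicator {z \<in> pts. d b z <= t} z :: real)"
   using AE_dist_ne[OF base_in, of t]
  proof (rule AE_mp, intro AE_I2 impI)
   fix z assume z: "z \<in> pts" "d b z ~= t"
   have "\<forall>\<^sub>F n in sequentially. (d b z <= s n) = (d b z <= t)"
   proof (cases "d b z < t")
    case True
    then show ?thesis using order_tendstoD(1)[OF s True] by (auto elim: eventually_mono)
   next
    case False
    then have "t < d b z" using z by simp
    from order_tendstoD(2)[OF s this] show ?thesis using \<open>t < d b z\<close> by (auto elim!: eventually_mono)
   qed
   then show "(\<lambda>n. indicator {z \<in> pts. d b z <= s n} z) \<longlonglongrightarrow> (indicator {z \<in> pts. d b z <= t} z :: real)"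
    by (intro tendsto_eventually) (auto elim!: eventually_mono simp: indicator_def)
  qed
  show "AE z in M. norm (indicator {z \<in> pts. d b z <= s n} z :: real) <= indicator {z \<in> pts. d b z <= T} z" for n
   using T[of n] by (auto simp: indicator_def)
  show "integrable M (indicator {z \<in> pts. d b z <= T} :: 'a => real)"
   using finite_cball[of T] by (intro integrable_real_indicator) auto
 qed auto
 then show "((\<lambda>t. measure M {z \<in> pts. d b z <= t}) \<circ> s) \<longlonglongrightarrow> measure M {z \<in> pts. d b z <= t}"
  by (simp add: o_def)
qed

lemma annulus_small:
 assumes "0 < e"
 obtains \<eta> where "0 < \<eta>" "!!r. 0 <= r ==> r <= R ==> \<mu> {z \<in> pts. r - \<eta> <= d b z \<and> d b z <= r} <= ennreal e"
proof -
 have [measurable]: "(\<lambda>z. d b z) \<in> borel_measurable M" using base_in by measurable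
 define V where "V t = measure M {z \<in> pts. d b z <= t}" for t
 have "uniformly_continuous_on {-1..R} V"
  unfolding V_def by (intro compact_uniformly_continuous continuous_on_subset[OF volume_function_continuous]) auto
 then obtain \<delta> where \<delta>: "0 < \<delta>" "!!s t. s \<in> {-1..R} ==> t \<in> {-1..R} ==> dist s t < \<delta> ==> dist (V s) (V t) < e"
  using assms unfolding uniformly_continuous_on_def by metis
 \<comment> \<open>\<open>2 * \<eta> < \<delta>\<close> is for uniform continuity,
   \<open>2 * \<eta> < 1\<close> keeps \<open>r - 2 * \<eta>\<close> above \<open>- 1\<close>. The
   doubled width fits the annulus, closed on its inner side, into a difference of closed
   balls.\<close>
 define \<eta> where "\<eta> = min \<delta> 1 / 3"
 show thesis
 proof
  show "0 < \<eta>" using \<delta> by (simp add: \<eta>_def)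
  fix r assume r: "0 <= r" "r <= R"
  let ?B = "\<lambda>t. {z \<in> pts. d b z <= t}"
  have fin: "?B t \<in> fmeasurable M" for t using finite_cball[of t] by (auto simp: fmeasurable_def)
  have "\<mu> {z \<in> pts. r - \<eta> <= d b z \<and> d b z <= r} <= \<mu> (?B r - ?B (r - 2 * \<eta>))"
   using \<open>0 < \<eta>\<close> by (intro emeasure_mono) auto
  also have "... = ennreal (measure M (?B r - ?B (r - 2 * \<eta>)))"
   using fin by (intro emeasure_eq_measure2 fmeasurable.Diff) auto
  also have "measure M (?B r - ?B (r - 2 * \<eta>)) = V r - V (r - 2 * \<eta>)"
   unfolding V_def using \<open>0 < \<eta>\<close> fin by (intro measurable_measure_Diff) auto
  also have "... <= e"
   using \<delta>(2)[of r "r - 2 * \<eta>"] r \<open>0 < \<eta>\<close> \<delta>(1) by (auto simp: \<eta>_def dist_real_def abs_less_iff min_def split: if_splits)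
  finally show "\<mu> {z \<in> pts. r - \<eta> <= d b z \<and> d b z <= r} <= ennreal e" by (simp add: ennreal_leI)
 qed
qed

end

lemma ennreal_diff_leI: "a <= b + c ==> b < \<infinity> ==> a - b <= (c::ennreal)"
 by (auto simp: ennreal_minus_le_iff)

context reflection_model begin

section \<open>Lipschitz approximation of indicator functions\<close>

lemma Lipschitz_measurable:
 assumes f: "!!z w. z \<in> pts ==> w \<in> pts ==> \<bar>f z - f w\<bar> <= L * d z w"
 shows "f \<in> borel_measurable M"
proof -
 have "continuous_on (pts) f" unfolding continuous_on_def
 proof
  fix z assume z: "z \<in> pts"
  have "continuous_on (pts) (\<lambda>w. (\<lambda>(x, y). d x y) (w, z))"
   using z by (intro continuous_on_compose2[OF dist_continuous] continuous_intros) auto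
  from this[unfolded continuous_on_def, rule_format, OF z]
  have "((\<lambda>w. d w z) \<longlongrightarrow> d z z) (at z within pts)" by simp
  then have "((\<lambda>w. L * d w z) \<longlongrightarrow> L * 0) (at z within pts)"
   using z by (intro tendsto_intros) simp
  then have "((\<lambda>w. f w - f z) \<longlongrightarrow> 0) (at z within pts)"
   by (intro Lim_null_comparison[of "\<lambda>w. f w - f z" "\<lambda>w. L * d w z"])
     (use f z in \<open>auto simp: eventually_at_filter\<close>)
  then show "(f \<longlongrightarrow> f z) (at z within pts)" by (simp add: LIM_zero_iff)
 qed
 moreover have "(\<lambda>x. x) \<in> M \<rightarrow>\<^sub>M restrict_space borel (pts)"
  using measurable_into_borel by (intro measurable_restrict_space2) auto
 ultimately show ?thesis using measurable_compose borel_measurable_continuous_on_restrict by blast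
qed

text \<open>The function is the distance to \<open>C\<close>, attained by compactness. Its sublevel
  sets decrease to \<open>C\<close> inside a ball of finite volume, so their volumes
  converge.\<close>

lemma compact_distance_function:
 assumes C: "compact C" and CM: "C \<subseteq> pts" and CR: "C \<subseteq> cell b R" and False: "C ~= {}"
 obtains g where "!!z w. z \<in> pts ==> w \<in> pts ==> \<bar>g z - g w\<bar> <= d z w"
  "!!z c. z \<in> pts ==> c \<in> C ==> g z <= d z c" "!!z. z \<in> pts ==> 0 <= g z"
  "!!z. z \<in> C ==> g z = 0" "g \<in> borel_measurable M"
  "!!n. {z \<in> pts. g z < 1 / real (Suc n)} \<subseteq> cell b (R + 1)"
  "(\<lambda>n. \<mu> {z \<in> pts. g z < 1 / real (Suc n)}) \<longlonglongrightarrow> \<mu> C"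
proof -
 define g where "g z = (INF c\<in>C. d z c)" for z
 have bdd: "bdd_below (d z ` C)" if "z \<in> pts" for z
  using dist_nonneg that CM by (intro bdd_belowI2[of _ 0]) auto
 have g_le: "g z <= d z c" if "z \<in> pts" "c \<in> C" for z c
  unfolding g_def using bdd[OF that(1)] that(2) by (rule cINF_lower)
 have g0: "0 <= g z" if "z \<in> pts" for z
  unfolding g_def using False dist_nonneg that CM by (intro cINF_greatest) auto
 have attained: "\<exists>c\<in>C. d z c = g z" if z: "z \<in> pts" for z
 proof -
  have "continuous_on C (\<lambda>w. (\<lambda>(x, y). d x y) (z, w))"
   using z CM by (intro continuous_on_compose2[OF dist_continuous] continuous_intros) auto
  then obtain c where c: "c \<in> C" "\<forall>w\<in>C. d z c <= d z w"
   using continuous_attains_inf[OF C False, of "d z"] by auto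
  then have "d z c <= g z" unfolding g_def using False by (intro cINF_greatest) auto
  then show ?thesis using c g_le[OF z c(1)] by (intro bexI[of _ c]) auto
 qed
 have g_Lip: "g z <= g w + d z w" if zw: "z \<in> pts" "w \<in> pts" for z w
 proof -
  obtain c where c: "c \<in> C" "d w c = g w" using attained[OF zw(2)] by auto
  then show ?thesis using g_le[OF zw(1) c(1)] dist_triangle[OF zw, of c] CM by auto
 qed
 have g_Lip': "\<bar>g z - g w\<bar> <= d z w" if "z \<in> pts" "w \<in> pts" for z w
  using g_Lip[OF that] g_Lip[OF that(2,1)] dist_sym[OF that] by auto
 have [measurable]: "g \<in> borel_measurable M"
  using g_Lip' by (intro Lipschitz_measurable[where L = 1]) auto
 have gC: "g z = 0 \<longleftrightarrow> z \<in> C" if z: "z \<in> pts" for z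
 proof
  assume "g z = 0"
  then show "z \<in> C" using attained[OF z] dist_zero[OF z] CM by (metis subsetD)
 next
  assume "z \<in> C"
  then show "g z = 0" using g_le[OF z, of z] g0[OF z] z by simp
 qed
 have C0: "g z = 0" if "z \<in> C" for z using gC[of z] CM that by auto
 define U where "U n = {z \<in> pts. g z < 1 / real (Suc n)}" for n
 have [measurable]: "U n \<in> sets M" for n unfolding U_def by measurable
 have Ub: "U n \<subseteq> cell b (R + 1)" for n
 proof
  fix z assume z: "z \<in> U n"
  then obtain c where c: "c \<in> C" "d z c = g z" using attained by (auto simp: U_def)
  have "1 / real (Suc n) <= 1" by simp
  moreover have "g z < 1 / real (Suc n)" using z unfolding U_def by (simp del: of_nat_Suc)
  ultimately have "g z < 1" by linarith
  moreover have "c \<in> pts" "d b c < R" using c(1) CR by (auto simp: cell_def)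
  ultimately show "z \<in> cell b (R + 1)"
   using c(2) dist_triangle[of b c z] dist_sym[of z c] base_in z by (auto simp: cell_def U_def)
 qed
 have finU: "\<mu> (U n) ~= \<infinity>" for n
  using emeasure_mono[OF Ub cell_sets[OF base_in]] emeasure_cell_finite[OF base_in, of "R + 1"]
  by (metis infinity_ennreal_def less_irrefl order_le_less_trans)
 have "decseq U"
 proof (rule decseq_SucI, rule subsetI)
  fix n z assume "z \<in> U (Suc n)"
  moreover have "1 / real (Suc (Suc n)) <= 1 / real (Suc n)" by (intro divide_left_mono) auto
  ultimately show "z \<in> U n" by (auto simp: U_def simp del: of_nat_Suc)
 qed
 then have "(\<lambda>n. \<mu> (U n)) \<longlonglongrightarrow> \<mu> (\<Inter>n. U n)"
  using finU by (intro Lim_emeasure_decseq) auto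
 also have "(\<Inter>n. U n) = C"
 proof (intro set_eqI iffI)
  fix z assume z: "z \<in> (\<Inter>n. U n)"
  then have "g z <= 1 / real (Suc n)" for n by (auto simp: U_def less_imp_le simp del: of_nat_Suc)
  then have "g z <= 0" using LIMSEQ_le_const[OF LIMSEQ_inverse_real_of_nat, of "g z"]
   by (auto simp: inverse_eq_divide simp del: of_nat_Suc)
  then show "z \<in> C" using gC g0 z by (auto simp: U_def intro: antisym)
 qed (use C0 CM in \<open>auto simp: U_def\<close>)
 finally have lim: "(\<lambda>n. \<mu> (U n)) \<longlonglongrightarrow> \<mu> C" .
 show thesis by (rule that[of g]) (use g_Lip' g_le g0 C0 Ub lim in \<open>auto simp: U_def\<close>)
qed

lemma compact_neighbourhood:
 assumes C: "compact C" "C \<subseteq> pts" "C \<subseteq> cell b R" and e: "0 < e"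
 obtains V \<eta> where "0 < \<eta>" "V \<in> sets M" "!!z. z \<in> pts ==> (\<exists>c\<in>C. d z c < \<eta>) ==> z \<in> V"
  "\<mu> V < \<mu> C + ennreal e"
proof (cases "C = {}")
 case True
 then show ?thesis using e by (intro that[of 1 "{}"]) auto
next
 case False
 obtain g where g0: "!!z w. z \<in> pts ==> w \<in> pts ==> \<bar>g z - g w\<bar> <= d z w"
  and g1: "!!z c. z \<in> pts ==> c \<in> C ==> g z <= d z c" and g2: "!!z. z \<in> pts ==> 0 <= g z"
  and g3: "!!z. z \<in> C ==> g z = 0" and g4: "g \<in> borel_measurable M"
  and g5: "!!n. {z \<in> pts. g z < 1 / real (Suc n)} \<subseteq> cell b (R + 1)"
  and g6: "(\<lambda>n. \<mu> {z \<in> pts. g z < 1 / real (Suc n)}) \<longlonglongrightarrow> \<mu> C"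
  by (rule compact_distance_function[OF C False]) (rule that)
 note g = g1 g4 g6
 have "\<mu> C <= \<mu> (cell b R)" using C(3) cell_sets[OF base_in] by (intro emeasure_mono)
 then have "\<mu> C < \<infinity>" using emeasure_cell_finite[OF base_in, of R] by (simp add: order_le_less_trans)
 then have "\<mu> C < \<mu> C + ennreal e"
  using e by (cases "\<mu> C") (auto simp: ennreal_plus[symmetric] ennreal_less_iff simp del: ennreal_plus)
 from order_tendstoD(2)[OF g(3) this] obtain n where n: "\<mu> {z \<in> pts. g z < 1 / real (Suc n)} < \<mu> C + ennreal e"
  by (auto simp: eventually_sequentially)
 show ?thesis
 proof (rule that[of "1 / real (Suc n)" "{z \<in> pts. g z < 1 / real (Suc n)}"])
  show "{z \<in> pts. g z < 1 / real (Suc n)} \<in> sets M" using g(2) by measurable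
  fix z assume z: "z \<in> pts" and "\<exists>c\<in>C. d z c < 1 / real (Suc n)"
  then obtain c where "c \<in> C" "d z c < 1 / real (Suc n)" by blast
  with g(1)[OF z] have "g z < 1 / real (Suc n)" by (blast intro: order_le_less_trans)
  then show "z \<in> {z \<in> pts. g z < 1 / real (Suc n)}" using z by simp
 qed (use n in auto)
qed

text \<open>Inner regularity gives a compact \<open>C\<close> with little of \<open>A\<close> left
  over. With \<open>g\<close> the distance to \<open>C\<close>, the function
  \<open>1 - real (Suc n) * g z\<close>, cut off to values between 0 and 1, is 1 on \<open>C\<close>
  and vanishes off a slightly larger set.\<close>

lemma indicator_Lipschitz_approximation:
 assumes A: "A \<in> sets M" "A \<subseteq> cell b R" and e: "0 < e"
 obtains f L where "0 <= L" "!!z w. z \<in> pts ==> w \<in> pts ==> \<bar>f z - f w\<bar> <= L * d z w"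
  "!!z. 0 <= f z \<and> f z <= 1" "!!z. z \<in> pts ==> R + 1 <= d b z ==> f z = 0"
  "(\<integral>M z. ennreal \<bar>indicator A z - f z\<bar>) <= ennreal e"
proof -
 have "\<mu> A <= \<mu> (cell b R)" using A cell_sets[OF base_in] by (intro emeasure_mono) auto
 then have finA: "\<mu> A < \<infinity>" using emeasure_cell_finite[OF base_in, of R] by (simp add: order_le_less_trans)
 obtain C where C: "C \<subseteq> A" "compact C" "\<mu> (A - C) < ennreal (e / 2)"
  using inner_regular_vol[OF A(1) finA, of "e / 2"] e by auto
 have CM: "C \<subseteq> pts" using C(1) A(1) sets.sets_into_space by blast
 have [measurable]: "C \<in> sets M" "A \<in> sets M"
  using sets_vol[of C] C(2) CM borel_compact[of C] A by (auto simp: Int_absorb2)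
 show thesis
 proof (cases "C = {}")
  case True
  have "(\<integral>M z. ennreal \<bar>indicator A z - 0\<bar>) = (\<integral>M z. indicator A z)"
   by (intro nn_integral_cong) (auto simp: indicator_def)
  also have "... = \<mu> A" by simp
  also have "... <= ennreal e" using C(3) True e by (simp add: order.trans[OF less_imp_le] ennreal_leI)
  finally show ?thesis by (intro that[of 0 "\<lambda>_. 0"]) auto
 next
  case False
  have CR: "C \<subseteq> cell b R" using C(1) A(2) by auto
  obtain g where g_Lip': "!!z w. z \<in> pts ==> w \<in> pts ==> \<bar>g z - g w\<bar> <= d z w"
   and g_le: "!!z c. z \<in> pts ==> c \<in> C ==> g z <= d z c" and g0: "!!z. z \<in> pts ==> 0 <= g z"
   and C0: "!!z. z \<in> C ==> g z = 0" and [measurable]: "g \<in> borel_measurable M"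
   and Ub': "!!n. {z \<in> pts. g z < 1 / real (Suc n)} \<subseteq> cell b (R + 1)"
   and lim': "(\<lambda>n. \<mu> {z \<in> pts. g z < 1 / real (Suc n)}) \<longlonglongrightarrow> \<mu> C"
   by (rule compact_distance_function[OF C(2) CM CR False]) (rule that)
  define U where "U n = {z \<in> pts. g z < 1 / real (Suc n)}" for n
  have [measurable]: "U n \<in> sets M" for n unfolding U_def by measurable
  have Ub: "U n \<subseteq> cell b (R + 1)" for n using Ub' unfolding U_def .
  have lim: "(\<lambda>n. \<mu> (U n)) \<longlonglongrightarrow> \<mu> C" using lim' unfolding U_def .
  have finC: "\<mu> C < \<infinity>" using emeasure_mono[OF C(1) A(1)] finA by (rule order_le_less_trans)
  then have "\<mu> C < \<mu> C + ennreal (e / 2)"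
   using e by (cases "\<mu> C") (auto simp: ennreal_plus[symmetric] ennreal_less_iff simp del: ennreal_plus)
  from order_tendstoD(2)[OF lim this] obtain n where n: "\<mu> (U n) < \<mu> C + ennreal (e / 2)"
   by (auto simp: eventually_sequentially)
  have CU: "C \<subseteq> U n" using C0 CM by (auto simp: U_def)
  have UC: "\<mu> (U n - C) <= ennreal (e / 2)"
  proof -
   have "\<mu> (U n - C) = \<mu> (U n) - \<mu> C" using finC CU by (intro emeasure_Diff) auto
   then show ?thesis using ennreal_diff_leI[OF less_imp_le[OF n] finC] by simp
  qed
  define f where "f z = max 0 (min 1 (1 - real (Suc n) * g z))" for z
  show ?thesis
  proof (rule that[of "real (Suc n)" f])
   fix z w assume zw: "z \<in> pts" "w \<in> pts"
   have "\<bar>real (Suc n) * g z - real (Suc n) * g w\<bar> = real (Suc n) * \<bar>g z - g w\<bar>"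
    by (simp add: right_diff_distrib[symmetric] abs_mult del: of_nat_Suc)
   also have "... <= real (Suc n) * d z w" using g_Lip'[OF zw] by (intro mult_left_mono) auto
   finally show "\<bar>f z - f w\<bar> <= real (Suc n) * d z w" unfolding f_def by linarith
  next
   fix z assume z: "z \<in> pts" "R + 1 <= d b z"
   then have "1 / real (Suc n) <= g z" using Ub[of n] by (auto simp: U_def cell_def subset_eq not_less)
   then have "1 <= real (Suc n) * g z" by (simp add: pos_divide_le_eq mult.commute del: of_nat_Suc)
   then show "f z = 0" by (simp add: f_def)
  next
   have "(\<integral>M z. ennreal \<bar>indicator A z - f z\<bar>) <= (\<integral>M z. indicator (A - C) z + indicator (U n - C) z)"
   proof (rule nn_integral_mono)
    fix z assume z: "z \<in> pts"
    have 1: "f z = 1" if "z \<in> C" using C0[OF that] by (simp add: f_def)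
    have 2: "f z = 0" if "z \<notin> U n"
    proof -
     have "1 <= real (Suc n) * g z" using that z by (auto simp: U_def not_less pos_divide_le_eq mult.commute simp del: of_nat_Suc)
     then show ?thesis by (simp add: f_def)
    qed
    have "0 <= f z" "f z <= 1" by (auto simp: f_def)
    then have "\<bar>indicator A z - f z\<bar> <= indicator (A - C) z + indicator (U n - C) z"
     using 1 2 C(1) CU by (cases "z \<in> C"; cases "z \<in> U n"; cases "z \<in> A") (auto simp: subset_eq)
    then have "ennreal \<bar>indicator A z - f z\<bar> <= ennreal (indicator (A - C) z + indicator (U n - C) z)"
     by (rule ennreal_leI)
    then show "ennreal \<bar>indicator A z - f z\<bar> <= indicator (A - C) z + indicator (U n - C) z"
     by (simp add: ennreal_plus ennreal_indicator)
   qed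
   also have "... = \<mu> (A - C) + \<mu> (U n - C)" by (subst nn_integral_add) auto
   also have "... <= ennreal (e / 2) + ennreal (e / 2)" using C(3) UC by (intro add_mono) auto
   also have "... = ennreal e" using e by (simp add: ennreal_plus[symmetric] del: ennreal_plus)
   finally show "(\<integral>M z. ennreal \<bar>indicator A z - f z\<bar>) <= ennreal e" .
  qed (auto simp: f_def)
 qed
qed

text \<open>Polarization is a contraction, so a Lipschitz approximant stays close to the polarized
  indicator \<open>U\<close> while becoming almost radially decreasing. This forces the two-valued
  \<open>U\<close> to be close to the indicator of a ball. The ball and \<open>D k\<close> are
  nested and have nearly the same volume, so they are close as well.\<close>

lemma polarizes_approximate_downsets:
 fixes A D :: "'k => 'a set"
 assumes K: "finite K" and A: "!!k. k \<in> K ==> A k \<in> sets M" "!!k. k \<in> K ==> A k \<subseteq> cell b R"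
  and D: "!!k. k \<in> K ==> downset (D k)" "!!k. k \<in> K ==> \<mu> (D k) = \<mu> (A k)"
  and e: "0 < e"
 obtains ps where "set ps \<subseteq> toward_base"
  "!!k. k \<in> K ==> (\<integral>M z. ennreal \<bar>polarizes ps (indicator (A k)) z - indicator (D k) z\<bar>) <= ennreal e"
proof -
 have "\<forall>k\<in>K. \<exists>f L. 0 <= L \<and> (\<forall>z\<in>pts. \<forall>w\<in>pts. \<bar>f z - f w\<bar> <= L * d z w) \<and>
  (\<forall>z. 0 <= f z \<and> f z <= 1) \<and> (\<forall>z\<in>pts. R + 1 <= d b z --> f z = 0) \<and>
  (\<integral>M z. ennreal \<bar>indicator (A k) z - f z\<bar>) <= ennreal (e / 16)"
 proof
  fix k assume k: "k \<in> K"
  have "0 < e / 16" using e by simp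
  then obtain f L where
   "0 <= L" "!!z w. z \<in> pts ==> w \<in> pts ==> \<bar>f z - f w\<bar> <= L * d z w"
   "!!z. 0 <= f z \<and> f z <= 1" "!!z. z \<in> pts ==> R + 1 <= d b z ==> f z = 0"
   "(\<integral>M z. ennreal \<bar>indicator (A k) z - f z\<bar>) <= ennreal (e / 16)"
   by (rule indicator_Lipschitz_approximation[OF A(1)[OF k] A(2)[OF k]]) (rule that)
  then show "\<exists>f L. 0 <= L \<and> (\<forall>z\<in>pts. \<forall>w\<in>pts. \<bar>f z - f w\<bar> <= L * d z w) \<and>
   (\<forall>z. 0 <= f z \<and> f z <= 1) \<and> (\<forall>z\<in>pts. R + 1 <= d b z --> f z = 0) \<and>
   (\<integral>M z. ennreal \<bar>indicator (A k) z - f z\<bar>) <= ennreal (e / 16)"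
   by (intro exI[of _ f] exI[of _ L]) simp
 qed
 from bchoice[OF this] obtain f where "\<forall>k\<in>K. \<exists>L. 0 <= L \<and>
  (\<forall>z\<in>pts. \<forall>w\<in>pts. \<bar>f k z - f k w\<bar> <= L * d z w) \<and>
  (\<forall>z. 0 <= f k z \<and> f k z <= 1) \<and> (\<forall>z\<in>pts. R + 1 <= d b z --> f k z = 0) \<and>
  (\<integral>M z. ennreal \<bar>indicator (A k) z - f k z\<bar>) <= ennreal (e / 16)" ..
 from bchoice[OF this] obtain L where "\<forall>k\<in>K. 0 <= L k \<and>
  (\<forall>z\<in>pts. \<forall>w\<in>pts. \<bar>f k z - f k w\<bar> <= L k * d z w) \<and>
  (\<forall>z. 0 <= f k z \<and> f k z <= 1) \<and> (\<forall>z\<in>pts. R + 1 <= d b z --> f k z = 0) \<and>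
  (\<integral>M z. ennreal \<bar>indicator (A k) z - f k z\<bar>) <= ennreal (e / 16)" ..
 then have fL: "!!k. k \<in> K ==> 0 <= L k"
  "!!k z w. k \<in> K ==> z \<in> pts ==> w \<in> pts ==> \<bar>f k z - f k w\<bar> <= L k * d z w"
  "!!k z. k \<in> K ==> 0 <= f k z \<and> f k z <= 1" "!!k z. k \<in> K ==> z \<in> pts ==> R + 1 <= d b z ==> f k z = 0"
  "!!k. k \<in> K ==> (\<integral>M z. ennreal \<bar>indicator (A k) z - f k z\<bar>) <= ennreal (e / 16)"
  by simp_all
 have fmeas: "f k \<in> borel_measurable M" if "k \<in> K" for k
  using fL(2)[OF that] by (rule Lipschitz_measurable)
 define L' where "L' = sum L K"
 have L': "0 <= L'" "!!k. k \<in> K ==> L k <= L'"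
  using fL(1) K by (auto simp: L'_def sum_nonneg intro: member_le_sum)
 have Lip: "\<bar>f k z - f k w\<bar> <= L' * d z w" if "k \<in> K" "z \<in> pts" "w \<in> pts" for k z w
  using fL(2)[OF that] mult_right_mono[OF L'(2)[OF that(1)] dist_nonneg[OF that(2,3)]] by linarith
 obtain \<eta> where \<eta>: "0 < \<eta>"
  "!!r. 0 <= r ==> r <= max 0 (R + 1) ==> \<mu> {z \<in> pts. r - \<eta> <= d b z \<and> d b z <= r} <= ennreal (e / 4)"
  using annulus_small[of "e / 4" "max 0 (R + 1)"] e by auto
 obtain ps where ps: "set ps \<subseteq> toward_base"
  "!!k x y. k \<in> K ==> x \<in> pts ==> y \<in> pts ==> d b x + \<eta> <= d b y ==>
   polarizes ps (f k) y < polarizes ps (f k) x + 1 / 4"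
  using almost_radially_decreasing[of K f "R + 1" L' "1/4" \<eta>] K fmeas fL(3,4) L'(1) Lip \<eta>(1) by auto
 have [measurable]: "(\<lambda>z. d b z) \<in> borel_measurable M" using base_in by measurable
 show thesis
 proof (rule that[OF ps(1)])
  fix k assume k: "k \<in> K"
  define g where "g = polarizes ps (f k)"
  define U :: "'a => real" where "U = polarizes ps (indicator (A k))"
  note [measurable] = A(1)[OF k]
  have [measurable]: "g \<in> borel_measurable M" "U \<in> borel_measurable M"
   unfolding g_def U_def using fmeas[OF k] by (intro polarizes_measurable[OF ps(1)]; measurable)+
  have U01: "U z = 0 \<or> U z = 1" if "z \<in> pts" for z
   using polarizes_range[OF ps(1), of "indicator (A k)" "{0, 1}"] that unfolding U_def by (auto simp: indicator_def)
  have g01: "0 <= g z \<and> g z <= 1" if "z \<in> pts" for z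
   using polarizes_range[OF ps(1), of "f k" "{0..1}"] fL(3)[OF k] that unfolding g_def by auto
  have gsupp: "g z = 0" if "z \<in> pts" "R + 1 <= d b z" for z
   using polarizes_support[OF ps(1), of "f k" "R + 1"] fL(3,4)[OF k] that unfolding g_def by auto
  have Ug: "(\<integral>M z. ennreal \<bar>U z - g z\<bar>) <= ennreal (e / 16)"
   unfolding U_def g_def using fmeas[OF k] fL(5)[OF k]
   by (intro order_trans[OF polarizes_contraction[OF ps(1)]]) auto
  have intU: "(\<integral>M z. ennreal (U z)) = \<mu> (A k)"
  proof -
   have "(\<integral>M z. ennreal (U z)) = (\<integral>M z. ennreal (indicator (A k) z))"
    unfolding U_def by (rule polarizes_equimeasurable[OF ps(1)]) measurable
   also have "... = \<mu> (A k)" by (simp add: ennreal_indicator)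
   finally show ?thesis .
  qed
  \<comment> \<open>The element 0 makes \<open>S\<close> nonempty and \<open>r\<close> nonnegative
    even if \<open>g\<close> never exceeds \<open>1 / 2\<close>.\<close>
  define S where "S = insert 0 (d b ` {z \<in> pts. 1 / 2 < g z})"
  define r where "r = Sup S"
  have Sb: "s <= max 0 (R + 1)" if "s \<in> S" for s
  proof (rule ccontr)
   assume "\<not> s <= max 0 (R + 1)"
   with that obtain z where "z \<in> pts" "1 / 2 < g z" "R + 1 <= d b z" by (auto simp: S_def)
   with gsupp show False by force
  qed
  then have bdd: "bdd_above S" by (rule bdd_aboveI)
  have r: "0 <= r" "r <= max 0 (R + 1)"
  proof -
   have "0 \<in> S" by (simp add: S_def)
   then show "0 <= r" "r <= max 0 (R + 1)"
    unfolding r_def using cSup_upper[OF _ bdd] cSup_least[of S, OF _ Sb] by blast+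
  qed
  define N where "N = {z \<in> pts. r - \<eta> <= d b z \<and> d b z <= r}"
  have [measurable]: "N \<in> sets M" "cell b r \<in> sets M" unfolding N_def using cell_sets[OF base_in] by measurable
  \<comment> \<open>Off the annulus a wrong value of \<open>U\<close> differs from \<open>g\<close>
    by at least \<open>1 / 4\<close>, since \<open>g <= 1 / 2\<close> outside the ball and
    \<open>g > 1 / 4\<close> inside. Hence the factor 4, and
    \<open>4 * (e / 16) + e / 4 = e / 2\<close>.\<close>
  have pw: "\<bar>U z - indicator (cell b r) z\<bar> <= 4 * \<bar>U z - g z\<bar> + indicator N z" if z: "z \<in> pts" for z
  proof (cases "r < d b z \<or> d b z < r - \<eta>")
   case False
   then show ?thesis using U01[OF z] z by (auto simp: N_def cell_def indicator_def)
  next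
   case True
   then show ?thesis
   proof
    assume far: "r < d b z"
    have "g z <= 1 / 2"
    proof (rule ccontr)
     assume "\<not> g z <= 1 / 2"
     then have "d b z <= r" unfolding r_def using z by (intro cSup_upper bdd) (auto simp: S_def)
     then show False using far by simp
    qed
    then show ?thesis using U01[OF z] far \<eta>(1) by (auto simp: N_def cell_def indicator_def)
   next
    assume near: "d b z < r - \<eta>"
    then have "d b z + \<eta> < Sup S" by (simp add: r_def)
    then obtain s where s: "s \<in> S" "d b z + \<eta> < s" using less_cSupD[of S] by (auto simp: S_def)
    then obtain z' where z': "z' \<in> pts" "1 / 2 < g z'" "d b z + \<eta> < d b z'"
     using dist_nonneg[OF base_in z] \<eta>(1) by (auto simp: S_def)
    have "1 / 4 < g z" using ps(2)[OF k z z'(1)] z' by (simp add: g_def)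
    then show ?thesis using U01[OF z] near \<eta>(1) z by (auto simp: N_def cell_def indicator_def)
   qed
  qed
  have UB: "(\<integral>M z. ennreal \<bar>U z - indicator (cell b r) z\<bar>) <= ennreal (e / 2)"
  proof -
   have "(\<integral>M z. ennreal \<bar>U z - indicator (cell b r) z\<bar>) <= (\<integral>M z. 4 * ennreal \<bar>U z - g z\<bar> + indicator N z)"
   proof (rule nn_integral_mono)
    fix z assume z: "z \<in> pts"
    have "ennreal \<bar>U z - indicator (cell b r) z\<bar> <= ennreal (4 * \<bar>U z - g z\<bar> + indicator N z)"
     by (rule ennreal_leI[OF pw[OF z]])
    also have "... = 4 * ennreal \<bar>U z - g z\<bar> + indicator N z"
     by (simp add: ennreal_plus ennreal_mult ennreal_indicator)
    finally show "ennreal \<bar>U z - indicator (cell b r) z\<bar> <= 4 * ennreal \<bar>U z - g z\<bar> + indicator N z" .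
   qed
   also have "... = 4 * (\<integral>M z. ennreal \<bar>U z - g z\<bar>) + \<mu> N"
    by (subst nn_integral_add) (auto simp: nn_integral_cmult)
   also have "... <= 4 * ennreal (e / 16) + ennreal (e / 4)"
    using Ug \<eta>(2)[OF r] unfolding N_def by (intro add_mono mult_left_mono) auto
   also have "... = ennreal (4 * (e / 16)) + ennreal (e / 4)" by (subst ennreal_mult) (use e in auto)
   also have "... = ennreal (e / 2)" using e by (subst ennreal_plus[symmetric]) auto
   finally show ?thesis .
  qed
  have Dm[measurable]: "D k \<in> sets M" using D(1)[OF k] by (simp add: downset_def)
  have finD: "\<mu> (D k) < \<infinity>"
   using emeasure_mono[OF A(2)[OF k] cell_sets[OF base_in]] emeasure_cell_finite[OF base_in, of R] D(2)[OF k]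
   by (simp add: order_le_less_trans)
  have finB: "\<mu> (cell b r) < \<infinity>" by (rule emeasure_cell_finite[OF base_in])
  have intB: "(\<integral>M z. ennreal (indicator (cell b r) z)) = \<mu> (cell b r)" by (simp add: ennreal_indicator)
  \<comment> \<open>For nested sets the integral is a difference of volumes, and \<open>U\<close>
    has the same integral as the indicator of \<open>D k\<close>.\<close>
  have BD: "(\<integral>M z. ennreal \<bar>indicator (cell b r) z - indicator (D k) z\<bar>) <= ennreal (e / 2)"
   using downset_nested[OF downset_cell[of r] D(1)[OF k]]
  proof
   assume sub: "cell b r \<subseteq> D k"
   have "(\<integral>M z. ennreal \<bar>indicator (cell b r) z - indicator (D k) z\<bar>) = (\<integral>M z. indicator (D k - cell b r) z)"
    using sub by (intro nn_integral_cong) (auto simp: indicator_def)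
   also have "... = \<mu> (D k) - \<mu> (cell b r)" using sub finB by (simp add: emeasure_Diff)
   also have "... <= ennreal (e / 2)"
   proof -
    have "\<mu> (D k) = (\<integral>M z. ennreal (U z))" using intU D(2)[OF k] by simp
    also have "... <= (\<integral>M z. ennreal (indicator (cell b r) z) + ennreal \<bar>U z - indicator (cell b r) z\<bar>)"
     by (intro nn_integral_mono) (auto simp: ennreal_plus[symmetric] ennreal_leI simp del: ennreal_plus)
    also have "... = \<mu> (cell b r) + (\<integral>M z. ennreal \<bar>U z - indicator (cell b r) z\<bar>)"
     by (subst nn_integral_add) (auto simp: intB)
    also have "... <= \<mu> (cell b r) + ennreal (e / 2)" using UB by (rule add_left_mono)
    finally show ?thesis using finB by (rule ennreal_diff_leI)
   qed
   finally show ?thesis .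
  next
   assume sub: "D k \<subseteq> cell b r"
   have "(\<integral>M z. ennreal \<bar>indicator (cell b r) z - indicator (D k) z\<bar>) = (\<integral>M z. indicator (cell b r - D k) z)"
    using sub by (intro nn_integral_cong) (auto simp: indicator_def)
   also have "... = \<mu> (cell b r) - \<mu> (D k)" using sub finD by (simp add: emeasure_Diff)
   also have "... <= ennreal (e / 2)"
   proof -
    have "\<mu> (cell b r) <= (\<integral>M z. ennreal (U z) + ennreal \<bar>U z - indicator (cell b r) z\<bar>)"
     unfolding intB[symmetric]
    proof (rule nn_integral_mono)
     fix z assume z: "z \<in> pts"
     have "ennreal (indicator (cell b r) z) <= ennreal (U z + \<bar>U z - indicator (cell b r) z\<bar>)"
      by (rule ennreal_leI) linarith
     moreover have "0 <= U z" using U01[OF z] by auto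
     ultimately show "ennreal (indicator (cell b r) z) <= ennreal (U z) + ennreal \<bar>U z - indicator (cell b r) z\<bar>"
      by (simp add: ennreal_plus)
    qed
    also have "... = \<mu> (D k) + (\<integral>M z. ennreal \<bar>U z - indicator (cell b r) z\<bar>)"
     by (subst nn_integral_add) (auto simp: intU D(2)[OF k])
    also have "... <= \<mu> (D k) + ennreal (e / 2)" using UB by (rule add_left_mono)
    finally show ?thesis using finD by (rule ennreal_diff_leI)
   qed
   finally show ?thesis .
  qed
  have "(\<integral>M z. ennreal \<bar>U z - indicator (D k) z\<bar>)
    <= (\<integral>M z. ennreal \<bar>U z - indicator (cell b r) z\<bar> + ennreal \<bar>indicator (cell b r) z - indicator (D k) z\<bar>)"
   by (intro nn_integral_mono) (auto simp: ennreal_plus[symmetric] ennreal_leI simp del: ennreal_plus)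
  also have "... = (\<integral>M z. ennreal \<bar>U z - indicator (cell b r) z\<bar>)
    + (\<integral>M z. ennreal \<bar>indicator (cell b r) z - indicator (D k) z\<bar>)"
   by (rule nn_integral_add) measurable
  also have "... <= ennreal (e / 2) + ennreal (e / 2)" using UB BD by (rule add_mono)
  also have "... = ennreal e" using e by (subst ennreal_plus[symmetric]) auto
  finally show "(\<integral>M z. ennreal \<bar>polarizes ps (indicator (A k)) z - indicator (D k) z\<bar>) <= ennreal e"
   by (simp add: U_def)
 qed
qed

end

context reflection_model begin

section \<open>Level sets of the rearrangement\<close>

lemma distribution_antimono: "u \<in> borel_measurable M ==> s <= t ==> distribution X u t <= distribution X u s"
 unfolding distribution_def by (intro emeasure_mono) auto

text \<open>The superlevel set written through the radius alone; \<open>t > c\<close> because a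
  strict inequality for a supremum is witnessed by one of its elements.\<close>

definition star_level :: "('a => real) => real => 'a set" where
 "star_level u c = {z \<in> pts. \<exists>t>c. \<mu> (cell b (d b z)) <= distribution X u t}"

text \<open>The rearrangement before its conversion to \<open>real\<close>: an infinite value at the
  base point is still visible here.\<close>

definition star :: "('a => real) => 'a => ennreal" where
 "star u z = (SUP t\<in>{t. 0 <= t \<and> distribution X u t >= \<mu> (model_ball X (d z b))}. ennreal t)"

lemma rearrangement_star: "symm_decr_rearrangement X u z = enn2real (star u z)"
 by (simp add: symm_decr_rearrangement_def star_def)

lemma cell_mono: "r <= s ==> cell x r \<subseteq> cell x s"
 by (auto simp: cell_def)

lemma less_star_iff:
 assumes "z \<in> pts" "0 <= c"
 shows "ennreal c < star u z \<longleftrightarrow> z \<in> star_level u c" using assms base_in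
 by (auto simp: star_def less_SUP_iff star_level_def model_ball_eq_cell dist_sym ennreal_less_iff)
   (metis dist_sym order.trans less_imp_le)+

lemma downset_star_level: "downset (star_level u c)"
proof -
 have [measurable]: "(\<lambda>z. d b z) \<in> borel_measurable M" using base_in by measurable
 define J where "J = {r. \<exists>t>c. \<mu> (cell b r) <= distribution X u t}"
 have mono: "r \<in> J" if "s \<in> J" "r <= s" for r s
  using that emeasure_mono[OF cell_mono[OF that(2), of b] cell_sets[OF base_in]] order_trans unfolding J_def by blast
 have "is_interval J" unfolding is_interval_1 using mono by blast
 then have [measurable]: "J \<in> sets borel" by (rule real_interval_borel_measurable)
 have "star_level u c = {z \<in> pts. d b z \<in> J}" by (auto simp: star_level_def J_def)
 moreover have "{z \<in> pts. d b z \<in> J} \<in> sets M" by measurable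
 ultimately show ?thesis using mono by (auto simp: downset_def)
qed

lemma star_measurable: "star u \<in> borel_measurable M"
proof (rule borel_measurableI_greater)
 fix y :: ennreal
 show "{z \<in> pts. y < star u z} \<in> sets M"
 proof (cases y)
  case (real c)
  then have "{z \<in> pts. y < star u z} = star_level u c" using less_star_iff by (auto simp: star_level_def)
  then show ?thesis using downset_star_level by (simp add: downset_def)
 qed simp
qed

lemma rearrangement_measurable: "symm_decr_rearrangement X u \<in> borel_measurable M"
 using star_measurable[of u] unfolding rearrangement_star[abs_def] by measurable

lemma rearrangement_nonneg: "0 <= symm_decr_rearrangement X u z"
 by (simp add: rearrangement_star)

lemma distribution_tendsto_zero:
 assumes [measurable]: "u \<in> borel_measurable M" and v: "vanishes_at_infinity X u"
 shows "(\<lambda>n. distribution X u (real n)) \<longlonglongrightarrow> 0"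
proof -
 let ?A = "\<lambda>n. {x \<in> pts. u x > real (Suc n)}"
 have "(\<lambda>n. \<mu> (?A n)) \<longlonglongrightarrow> \<mu> (\<Inter>n. ?A n)"
  using v unfolding vanishes_at_infinity_def distribution_def
  by (intro Lim_emeasure_decseq) (auto simp: decseq_def less_top[symmetric])
 moreover have "(\<Inter>n. ?A n) = {}"
 proof -
  have "\<exists>n. \<not> real (Suc n) < u x" for x
   using reals_Archimedean2[of "u x"] by (meson less_SucI not_less_iff_gr_or_eq of_nat_less_iff order_less_trans)
  then show ?thesis by auto
 qed
 ultimately have "(\<lambda>n. distribution X u (real (Suc n))) \<longlonglongrightarrow> 0" by (simp add: distribution_def)
 then show ?thesis by (rule LIMSEQ_imp_Suc)
qed

lemma star_levelD:
 assumes "u \<in> borel_measurable M" "z \<in> star_level u c"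
 shows "\<mu> (cell b (d b z)) <= distribution X u c"
proof -
 obtain t where t: "c < t" "\<mu> (cell b (d b z)) <= distribution X u t"
  using assms(2) by (auto simp: star_level_def)
 note t(2)
 also have "distribution X u t <= distribution X u c" using distribution_antimono[OF assms(1)] t(1) by simp
 finally show ?thesis .
qed

text \<open>A ball of positive radius has positive volume, whereas the distribution function tends
  to 0.\<close>

lemma star_finite:
 assumes u: "u \<in> borel_measurable M" "vanishes_at_infinity X u" and z: "z \<in> pts" "z ~= b"
 shows "star u z < \<infinity>"
proof (rule ccontr)
 assume "\<not> star u z < \<infinity>"
 then have "z \<in> star_level u (real n)" for n
  using less_star_iff[OF z(1), of "real n" u] by (auto simp: less_top[symmetric])
 then have "\<mu> (cell b (d b z)) <= distribution X u (real n)" for n using star_levelD[OF u(1)] by blast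
 then have "\<mu> (cell b (d b z)) <= 0"
  by (intro LIMSEQ_le_const[OF distribution_tendsto_zero[OF u]] exI[of _ 0]) simp
 moreover have "0 < d b z" using dist_zero[OF base_in z(1)] dist_nonneg[OF base_in z(1)] z(2) by auto
 ultimately show False using emeasure_cell_pos[OF base_in, of "d b z"] by simp
qed

lemma less_rearrangement_iff:
 assumes u: "u \<in> borel_measurable M" "vanishes_at_infinity X u" and z: "z \<in> pts" "z ~= b" and c: "0 <= c"
 shows "c < symm_decr_rearrangement X u z \<longleftrightarrow> z \<in> star_level u c"
proof -
 have "c < enn2real (star u z) \<longleftrightarrow> ennreal c < star u z"
  using star_finite[OF u z] c by (cases "star u z") (auto simp: ennreal_less_iff)
 then show ?thesis using less_star_iff[OF z(1) c] by (simp add: rearrangement_star)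
qed

lemma base_null: "{b} \<in> null_sets M"
proof -
 have "{z \<in> pts. d b z = 0} = {b}" using base_in dist_zero[OF base_in] by auto
 then show ?thesis using sphere_null[OF base_in, of 0] by simp
qed

lemma AE_less_rearrangement_iff:
 assumes u: "u \<in> borel_measurable M" "vanishes_at_infinity X u" and c: "0 <= c"
 shows "AE z in M. c < symm_decr_rearrangement X u z \<longleftrightarrow> z \<in> star_level u c"
 using AE_not_in[OF base_null] by (rule AE_mp, intro AE_I2) (use less_rearrangement_iff[OF u _ _ c] in auto)

lemma volume_finite: "\<mu> {z \<in> pts. d b z <= r} = ennreal (measure M {z \<in> pts. d b z <= r})"
 using finite_cball[of r] by (simp add: emeasure_eq_ennreal_measure)

lemma emeasure_cell_eq_volume: "\<mu> (cell b r) = ennreal (measure M {z \<in> pts. d b z <= r})"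
proof -
 have [measurable]: "(\<lambda>z. d b z) \<in> borel_measurable M" using base_in by measurable
 have "\<mu> (cell b r) = \<mu> {z \<in> pts. d b z <= r}"
  using AE_dist_ne[OF base_in, of r] cell_sets[OF base_in, of r]
  by (intro emeasure_eq_AE) (auto simp: cell_def elim!: eventually_mono)
 then show ?thesis using volume_finite by simp
qed

lemma volume_isCont: "isCont (\<lambda>t. measure M {z \<in> pts. d b z <= t}) t"
 using volume_function_continuous by (simp add: continuous_on_eq_continuous_at)

text \<open>The open balls through points of \<open>D\<close> approach the ball of radius
  \<open>r\<close>, the supremum of the radii in \<open>D\<close>, and the volume function is
  continuous. If the radii are unbounded, \<open>D\<close> is exhausted by balls.\<close>

lemma emeasure_downset_le:
 assumes D: "downset D" and v: "!!z. z \<in> D ==> \<mu> (cell b (d b z)) <= v"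
 shows "\<mu> D <= v"
proof (cases "bdd_above (d b ` D)")
 case False
 have [measurable]: "D \<in> sets M" using D by (simp add: downset_def)
 have cD: "cell b (real n) \<subseteq> D" and cv: "\<mu> (cell b (real n)) <= v" for n
 proof -
  obtain z where z: "z \<in> D" "real n < d b z" using False by (auto simp: bdd_above_def not_le)
  then show "cell b (real n) \<subseteq> D" using D by (force simp: downset_def cell_def)
  show "\<mu> (cell b (real n)) <= v"
   using emeasure_mono[OF cell_mono[of "real n" "d b z" b]] z v[OF z(1)] cell_sets[OF base_in] by (meson less_imp_le order_trans)
 qed
 have D_eq: "D = (\<Union>n. cell b (real n))"
 proof
  show "D \<subseteq> (\<Union>n. cell b (real n))"
   using sets.sets_into_space[of D M] reals_Archimedean2 by (fastforce simp: cell_def)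
 qed (use cD in auto)
 have "(SUP n. \<mu> (cell b (real n))) = \<mu> D"
  unfolding D_eq using cell_sets[OF base_in] by (intro SUP_emeasure_incseq) (auto intro!: incseq_SucI cell_mono)
 then show ?thesis using cv by (metis SUP_least)
next
 case True
 show ?thesis
 proof (cases "D = {} \<or> v = \<infinity>")
  case False
  have Dm: "D \<in> sets M" "D \<subseteq> pts" using D sets.sets_into_space by (auto simp: downset_def)
  define r where "r = Sup (d b ` D)"
  let ?V = "\<lambda>t. measure M {z \<in> pts. d b z <= t}"
  obtain w where w: "v = ennreal w" "0 <= w" using False by (cases v) auto
  have "?V r <= w"
  proof (rule ccontr)
   assume "\<not> ?V r <= w"
   then have "\<forall>\<^sub>F t in at r. w < ?V t"
    using volume_isCont[of r] by (intro order_tendstoD(1)[where y = "?V r"]) (auto simp: isCont_def)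
   then obtain \<delta> where \<delta>: "0 < \<delta>" "!!t. t ~= r ==> dist t r < \<delta> ==> w < ?V t" by (auto simp: eventually_at)
   have "r - \<delta> / 2 < Sup (d b ` D)" using \<delta>(1) by (simp add: r_def)
   then obtain z where z: "z \<in> D" "r - \<delta> / 2 < d b z" using less_cSupD[of "d b ` D"] False by auto
   have "ennreal (?V (r - \<delta> / 2)) <= \<mu> (cell b (d b z))"
    using emeasure_mono[OF cell_mono[of "r - \<delta> / 2" "d b z" b]] z cell_sets[OF base_in]
    by (simp add: emeasure_cell_eq_volume[symmetric])
   also have "... <= ennreal w" using v[OF z(1)] w by simp
   finally have "?V (r - \<delta> / 2) <= w" using w by simp
   then show False using \<delta>(2)[of "r - \<delta> / 2"] \<delta>(1) by (simp add: dist_real_def)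
  qed
  have "D \<subseteq> {z \<in> pts. d b z <= r}" unfolding r_def using Dm True by (auto intro: cSup_upper)
  then have "\<mu> D <= \<mu> {z \<in> pts. d b z <= r}" using base_in by (intro emeasure_mono) auto
  then show ?thesis using \<open>?V r <= w\<close> w volume_finite[of r] by (metis ennreal_leI order_trans)
 qed auto
qed

lemma emeasure_downset_ge:
 assumes D: "downset D" and v: "!!z. z \<in> pts ==> z \<notin> D ==> v <= \<mu> (cell b (d b z))"
  and "v <= \<mu> (pts)"
 shows "v <= \<mu> D"
proof (cases "D = pts")
 case False
 have Dm: "D \<in> sets M" "D \<subseteq> pts" using D sets.sets_into_space by (auto simp: downset_def)
 let ?C = "d b ` (pts - D)"
 have C: "?C ~= {}" "bdd_below ?C" using False Dm dist_nonneg[OF base_in] by (auto intro!: bdd_belowI2[of _ 0])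
 define r where "r = Inf ?C"
 let ?V = "\<lambda>t. measure M {z \<in> pts. d b z <= t}"
 have "v < \<infinity>" using C(1) v emeasure_cell_finite[OF base_in] by (metis DiffD1 DiffD2 ex_in_conv image_is_empty order_le_less_trans)
 then obtain w where w: "v = ennreal w" "0 <= w" by (cases v) auto
 have "w <= ?V r"
 proof (rule ccontr)
  assume "\<not> w <= ?V r"
  then have "\<forall>\<^sub>F t in at r. ?V t < w"
   using volume_isCont[of r] by (intro order_tendstoD(2)[where y = "?V r"]) (auto simp: isCont_def)
  then obtain \<delta> where \<delta>: "0 < \<delta>" "!!t. t ~= r ==> dist t r < \<delta> ==> ?V t < w" by (auto simp: eventually_at)
  have "Inf ?C < r + \<delta> / 2" using \<delta>(1) by (simp add: r_def)
  then obtain z where z: "z \<in> pts" "z \<notin> D" "d b z < r + \<delta> / 2" using cInf_lessD[OF C(1)] by auto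
  have "ennreal w <= \<mu> (cell b (d b z))" using v[OF z(1,2)] w by simp
  also have "... <= ennreal (?V (r + \<delta> / 2))"
   using emeasure_mono[OF cell_mono[of "d b z" "r + \<delta> / 2" b]] z cell_sets[OF base_in]
   by (simp add: emeasure_cell_eq_volume[symmetric])
  finally have "w <= ?V (r + \<delta> / 2)" using w by (simp add: ennreal_le_iff)
  then show False using \<delta>(2)[of "r + \<delta> / 2"] \<delta>(1) by (simp add: dist_real_def)
 qed
 have "cell b r \<subseteq> D"
 proof
  fix z assume z: "z \<in> cell b r"
  show "z \<in> D"
  proof (rule ccontr)
   assume "z \<notin> D"
   then have "r <= d b z" unfolding r_def using z C(2) by (intro cInf_lower) (auto simp: cell_def)
   then show False using z by (simp add: cell_def)
  qed
 qed
 then have "\<mu> (cell b r) <= \<mu> D" using Dm by (intro emeasure_mono)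
 then show ?thesis using \<open>w <= ?V r\<close> w emeasure_cell_eq_volume[of r] by (metis ennreal_leI order_trans)
qed (use assms in simp)

text \<open>Points of the set carry balls of volume at most the distribution at \<open>c\<close>.
  Points outside carry balls larger than the distribution at every level above \<open>c\<close>, and
  these levels may decrease to \<open>c\<close>.\<close>

lemma emeasure_star_level:
 assumes [measurable]: "u \<in> borel_measurable M"
 shows "\<mu> (star_level u c) = distribution X u c"
proof (rule antisym)
 show "\<mu> (star_level u c) <= distribution X u c"
  by (rule emeasure_downset_le[OF downset_star_level]) (rule star_levelD[OF assms])
 show "distribution X u c <= \<mu> (star_level u c)"
 proof (rule emeasure_downset_ge[OF downset_star_level])
  fix z assume z: "z \<in> pts" "z \<notin> star_level u c"
  let ?A = "\<lambda>n. {x \<in> pts. c + 1 / real (Suc n) < u x}"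
  have "(\<Union>n. ?A n) = {x \<in> pts. c < u x}"
  proof (intro set_eqI iffI)
   fix x assume x: "x \<in> {x \<in> pts. c < u x}"
   then have "0 < u x - c" by simp
   then obtain n where "1 / real (Suc n) < u x - c" by (rule nat_approx_posE)
   then have "x \<in> ?A n" using x by (simp del: of_nat_Suc)
   then show "x \<in> (\<Union>n. ?A n)" by (rule UN_I[OF UNIV_I])
  next
   fix x assume "x \<in> (\<Union>n. ?A n)"
   then obtain n where n: "x \<in> pts" "c + 1 / real (Suc n) < u x" by auto
   have "c < c + 1 / real (Suc n)" by simp
   also note n(2)
   finally show "x \<in> {x \<in> pts. c < u x}" using n(1) by simp
  qed
  moreover have "incseq ?A"
  proof (rule incseq_SucI, rule subsetI)
   fix n x assume "x \<in> ?A n"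
   moreover have "1 / real (Suc (Suc n)) <= 1 / real (Suc n)" by (intro divide_left_mono) auto
   ultimately show "x \<in> ?A (Suc n)" by (auto simp del: of_nat_Suc)
  qed
  ultimately have "distribution X u c = (SUP n. \<mu> (?A n))"
   unfolding distribution_def by (subst SUP_emeasure_incseq) auto
  also have "... <= \<mu> (cell b (d b z))"
  proof (rule SUP_least)
   fix n
   have "c < c + 1 / real (Suc n)" by simp
   then have "distribution X u (c + 1 / real (Suc n)) < \<mu> (cell b (d b z))"
    using z unfolding star_level_def by (auto simp: not_le simp del: of_nat_Suc)
   then show "\<mu> (?A n) <= \<mu> (cell b (d b z))" by (simp add: distribution_def)
  qed
  finally show "distribution X u c <= \<mu> (cell b (d b z))" .
 next
  show "distribution X u c <= \<mu> (pts)" unfolding distribution_def by (intro emeasure_mono) auto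
 qed
qed

lemma distribution_rearrangement:
 assumes u: "u \<in> borel_measurable M" "vanishes_at_infinity X u" and c: "0 <= c"
 shows "distribution X (symm_decr_rearrangement X u) c = distribution X u c"
proof -
 note [measurable] = rearrangement_measurable[of u]
 have [measurable]: "star_level u c \<in> sets M" using downset_star_level by (simp add: downset_def)
 have "\<mu> {x \<in> pts. c < symm_decr_rearrangement X u x} = \<mu> (star_level u c)"
  using AE_less_rearrangement_iff[OF u c] sets.sets_into_space[of "star_level u c" M]
  by (intro emeasure_eq_AE) (auto elim!: eventually_mono)
 then show ?thesis using emeasure_star_level[OF u(1)] by (simp add: distribution_def)
qed

lemma rearrangement_mono:
 assumes u: "u \<in> borel_measurable M" and v: "v \<in> borel_measurable M" "vanishes_at_infinity X v"
  and le: "!!z. z \<in> pts ==> u z <= v z"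
 shows "AE z in M. symm_decr_rearrangement X u z <= symm_decr_rearrangement X v z"
 using AE_not_in[OF base_null]
proof (rule AE_mp, intro AE_I2 impI)
 fix z assume z: "z \<in> pts" "z \<notin> {b}"
 have "distribution X u t <= distribution X v t" for t
  unfolding distribution_def using v le by (intro emeasure_mono) (auto intro: less_le_trans)
 then have "star u z <= star v z" unfolding star_def by (intro SUP_subset_mono) (auto intro: order_trans)
 then show "symm_decr_rearrangement X u z <= symm_decr_rearrangement X v z"
  using star_finite[OF v z(1)] z(2) by (simp add: rearrangement_star enn2real_mono)
qed

lemma rearrangement_cong_distribution:
 "(!!t. 0 <= t ==> distribution X u t = distribution X v t) ==> symm_decr_rearrangement X u = symm_decr_rearrangement X v"
 by (intro ext) (simp add: symm_decr_rearrangement_def cong: conj_cong)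

lemma distribution_polarize:
 assumes xy: "x \<in> pts" "y \<in> pts" "x ~= y" and u[measurable]: "u \<in> borel_measurable M"
 shows "distribution X (polarize (x, y) u) t = distribution X u t"
proof -
 note [measurable] = polarize_measurable[OF xy u]
 have *: "distribution X f t = (\<integral>M z. indicator {t<..} (f z))" if [measurable]: "f \<in> borel_measurable M" for f
 proof -
  have "(\<integral>M z. indicator {t<..} (f z)) = (\<integral>M z. indicator {x \<in> pts. f x > t} z)"
   by (intro nn_integral_cong) (auto simp: indicator_def)
  then show ?thesis by (simp add: distribution_def)
 qed
 show ?thesis by (subst (1 2) *) (auto intro: polarize_equimeasurable[OF xy u])
qed

end

section \<open>The product functional\<close>

lemma borel_measurable_vec_components:
 fixes f :: "'m::finite => 'b => real"
 assumes "!!i. f i \<in> borel_measurable N"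
 shows "(\<lambda>x. \<chi> i. f i x) \<in> borel_measurable N"
 using assms by (subst borel_measurable_euclidean_space) (auto simp: Basis_vec_def inner_axis)

locale kernel_model = reflection_model X refl
 for X :: "'a::euclidean_space model_space" and refl +
 fixes K :: "'m::{finite,linorder} => 'm => real => real"
 assumes K_antimono: "!!i j. i < j ==> antimono_on {0..} (K i j)"
  and K_nonneg: "!!i j t. i < j ==> 0 <= t ==> 0 <= K i j t"
begin

abbreviation P :: "('m => 'a) measure" where "P \<equiv> vol_power X"
abbreviation integral_P :: "(('m => 'a) => ennreal) => ennreal" (binder "\<integral>P" 10) where "integral_P \<equiv> nn_integral P"
abbreviation "energy F u \<equiv> \<integral>P p. ennreal (integrand X F K u p)"

lemma product_sigma_finite_vol: "product_sigma_finite (\<lambda>_. M)"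
 by (simp add: product_sigma_finite_def sigma_finite_vol)

lemma space_P: "p \<in> space P \<longleftrightarrow> (\<forall>l. p l \<in> pts)"
 by (auto simp: vol_power_def space_PiM PiE_def Pi_def)

lemma component_measurable [measurable]: "(\<lambda>p. p l) \<in> P \<rightarrow>\<^sub>M M"
 unfolding vol_power_def by measurable

lemma into_P_measurable: "(!!l. (\<lambda>x. f x l) \<in> N \<rightarrow>\<^sub>M M) ==> f \<in> N \<rightarrow>\<^sub>M P"
 unfolding vol_power_def by (rule measurable_PiM_single') (auto simp: measurable_space space_PiM PiE_def Pi_def intro: measurable_space)

lemma kernel_measurable:
 assumes [measurable]: "f \<in> N \<rightarrow>\<^sub>M M" "g \<in> N \<rightarrow>\<^sub>M M" and ij: "i < j"
 shows "(\<lambda>x. K i j (d (f x) (g x))) \<in> borel_measurable N"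
proof -
 have "mono (\<lambda>t. - K i j (max 0 t))" using K_antimono[OF ij] by (auto simp: mono_def monotone_on_def)
 then have "(\<lambda>t. - K i j (max 0 t)) \<in> borel_measurable borel" by (rule borel_measurable_mono)
 then have "(\<lambda>t. - (- K i j (max 0 t))) \<in> borel_measurable borel" by measurable
 then have [measurable]: "(\<lambda>t. K i j (max 0 t)) \<in> borel_measurable borel" by simp
 have "(\<lambda>x. K i j (max 0 (d (f x) (g x)))) \<in> borel_measurable N" by measurable
 moreover have "max 0 (d (f x) (g x)) = d (f x) (g x)" if "x \<in> space N" for x
  using dist_nonneg that assms(1,2)[THEN measurable_space] by auto
 ultimately show ?thesis by (simp cong: measurable_cong)
qed

lemma kernel_product_measurable [measurable]: "kernel_product X K \<in> borel_measurable P"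
proof -
 have "(\<lambda>p. \<Prod>x\<in>{(i, j). i < j}. (case x of (i, j) => \<lambda>p. K i j (d (p i) (p j))) p) \<in> borel_measurable P"
  by (intro borel_measurable_prod) (auto intro!: kernel_measurable)
 then show ?thesis by (simp add: kernel_product_def[abs_def] case_prod_unfold)
qed

lemma kernel_product_nonneg: "p \<in> space P ==> 0 <= kernel_product X K p"
 unfolding kernel_product_def using K_nonneg dist_nonneg by (auto intro!: prod_nonneg simp: space_P)

lemma values_measurable:
 assumes F: "F \<in> borel_measurable (restrict_space borel nonneg_cone)"
  and u: "!!i. u i \<in> borel_measurable M" "!!i x. x \<in> pts ==> 0 <= u i x"
 shows "(\<lambda>p. F (\<chi> i. u i (p i))) \<in> borel_measurable P"
proof -
 have "(\<lambda>p. \<chi> i. u i (p i)) \<in> P \<rightarrow>\<^sub>M restrict_space borel nonneg_cone"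
  using u by (intro measurable_restrict_space2 borel_measurable_vec_components)
   (auto simp: nonneg_cone_def space_P intro: measurable_compose[OF component_measurable])
 from measurable_compose[OF this F] show ?thesis .
qed

lemma integrand_measurable:
 assumes "F \<in> borel_measurable (restrict_space borel nonneg_cone)"
  and "!!i. u i \<in> borel_measurable M" "!!i x. x \<in> pts ==> 0 <= u i x"
 shows "integrand X F K u \<in> borel_measurable P"
 using values_measurable[OF assms] unfolding integrand_def[abs_def] by measurable

lemma distr_PiM_componentwise:
 fixes g :: "'i => 'a => 'a"
 assumes "finite I" and g: "!!i. i \<in> I ==> g i \<in> M \<rightarrow>\<^sub>M M" "!!i. i \<in> I ==> distr M M (g i) = M"
 shows "distr (PiM I (\<lambda>_. M)) (PiM I (\<lambda>_. M)) (\<lambda>x. \<lambda>i\<in>I. g i (x i)) = PiM I (\<lambda>_. M)"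
proof -
 interpret product_sigma_finite "\<lambda>_::'i. M" by (simp add: product_sigma_finite_def sigma_finite_vol)
 have meas[measurable]: "(\<lambda>x. \<lambda>i\<in>I. g i (x i)) \<in> PiM I (\<lambda>_. M) \<rightarrow>\<^sub>M PiM I (\<lambda>_. M)"
  by (intro measurable_restrict measurable_compose[OF measurable_component_singleton]) (auto intro: g)
 show ?thesis
 proof (rule PiM_eqI[OF assms(1)])
  fix A assume A: "!!i. i \<in> I ==> A i \<in> sets M"
  have pre: "(\<lambda>x. \<lambda>i\<in>I. g i (x i)) -` Pi\<^sub>E I A \<inter> space (PiM I (\<lambda>_. M)) = Pi\<^sub>E I (\<lambda>i. g i -` A i \<inter> pts)"
   by (auto simp: space_PiM PiE_def Pi_def)
  have "emeasure (distr (PiM I (\<lambda>_. M)) (PiM I (\<lambda>_. M)) (\<lambda>x. \<lambda>i\<in>I. g i (x i))) (Pi\<^sub>E I A)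
    = emeasure (PiM I (\<lambda>_. M)) (Pi\<^sub>E I (\<lambda>i. g i -` A i \<inter> pts))"
   using A assms(1) by (subst emeasure_distr) (auto simp: pre intro!: sets_PiM_I_finite)
  also have "... = (\<Prod>i\<in>I. \<mu> (g i -` A i \<inter> pts))"
   using A g(1) by (intro emeasure_PiM assms(1)) (auto intro: measurable_sets)
  also have "... = (\<Prod>i\<in>I. \<mu> (A i))"
   using A g emeasure_distr[of "g _" M M "A _"] by (intro prod.cong refl) metis
  finally show "emeasure (distr (PiM I (\<lambda>_. M)) (PiM I (\<lambda>_. M)) (\<lambda>x. \<lambda>i\<in>I. g i (x i))) (Pi\<^sub>E I A)
    = (\<Prod>i\<in>I. \<mu> (A i))" .
 qed simp
qed

lemma AE_component:
 assumes "AE z in M. Q z" shows "AE p in P. Q (p l)"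
proof -
 interpret product_sigma_finite "\<lambda>_::'m. M" by (rule product_sigma_finite_vol)
 obtain N where N: "N \<in> null_sets M" "{z \<in> pts. \<not> Q z} \<subseteq> N" using assms by (auto elim!: AE_E)
 let ?A = "\<lambda>i. if i = l then N else pts"
 have "emeasure P (Pi\<^sub>E UNIV ?A) = (\<Prod>i\<in>UNIV. \<mu> (?A i))"
  unfolding vol_power_def using N by (intro emeasure_PiM) auto
 also have "... = 0" using N by (intro prod_zero) (auto intro!: bexI[of _ l])
 finally have "Pi\<^sub>E UNIV ?A \<in> null_sets P"
  using N by (auto simp: null_sets_def vol_power_def intro!: sets_PiM_I_finite)
 then show ?thesis by (rule AE_I') (use N in \<open>auto simp: space_P PiE_def Pi_def\<close>)
qed

text \<open>Fubini in the single coordinate \<open>i\<close>, with all other coordinates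
  frozen.\<close>

lemma AE_pair_component:
 assumes ij: "i ~= j" and Q: "Measurable.pred (M \<Otimes>\<^sub>M M) (\<lambda>(z, w). Q z w)"
  and AE: "!!w. w \<in> pts ==> AE z in M. Q z w"
 shows "AE p in P. Q (p i) (p j)"
proof -
 interpret product_sigma_finite "\<lambda>_::'m. M" by (rule product_sigma_finite_vol)
 have Q': "Measurable.pred N (\<lambda>x. Q (f x) (g x))" if "f \<in> N \<rightarrow>\<^sub>M M" "g \<in> N \<rightarrow>\<^sub>M M" for f g and N :: "'x measure"
  using measurable_compose[OF measurable_Pair[OF that] Q] by simp
 note [measurable] = Q'[of "\<lambda>p. p i" P "\<lambda>p. p j", OF component_measurable component_measurable]
 let ?f = "\<lambda>p::'m => 'a. indicator {p. \<not> Q (p i) (p j)} p :: ennreal"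
 have ins: "insert i (UNIV - {i}) = (UNIV :: 'm set)" by auto
 have fm: "?f \<in> borel_measurable P"
 proof -
  have "{p \<in> space P. \<not> Q (p i) (p j)} \<in> sets P" by measurable
  then show ?thesis by (intro borel_measurable_indicator') (auto simp: vimage_def Int_def conj_commute)
 qed
 have "(\<integral>P p. ?f p) = (\<integral>\<^sup>+x. (\<integral>M y. ?f (x(i := y))) \<partial>PiM (UNIV - {i}) (\<lambda>_. M))"
  using product_nn_integral_insert[of "UNIV - {i}" i ?f] fm unfolding ins vol_power_def by simp
 also have "... = (\<integral>\<^sup>+x. 0 \<partial>PiM (UNIV - {i}) (\<lambda>_. M))"
 proof (rule nn_integral_cong)
  fix x assume "x \<in> space (PiM (UNIV - {i}) (\<lambda>_. M))"
  then have xj: "x j \<in> pts" using ij by (auto simp: space_PiM PiE_def Pi_def)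
  have "(\<integral>M y. ?f (x(i := y))) = (\<integral>M y. 0)"
   using AE[OF xj] ij by (intro nn_integral_cong_AE) (auto elim!: eventually_mono simp: indicator_def)
  then show "(\<integral>M y. ?f (x(i := y))) = 0" by simp
 qed
 finally have "AE p in P. ?f p = 0" using fm by (simp add: nn_integral_0_iff_AE)
 then show ?thesis by (auto elim!: eventually_mono simp: indicator_def split: if_splits)
qed

text \<open>A finite diameter is attained only on a sphere about \<open>w\<close>, which is null.
  Positivity of the kernels below the diameter is therefore positivity almost everywhere.\<close>

lemma AE_less_diam:
 assumes w: "w \<in> pts" shows "AE z in M. ereal (d w z) < diam X"
proof -
 have le: "ereal (d w z) <= diam X" if "z \<in> pts" for z
  unfolding diam_def using w that by (meson SUP_upper2 order_refl)
 show ?thesis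
 proof (cases "diam X")
  case (real r)
  show ?thesis
   using AE_dist_ne[OF w, of r] by (rule AE_mp, intro AE_I2) (use le real in \<open>force simp: less_le\<close>)
 qed (use le base_in in auto)
qed

section \<open>Folding configurations along one reflection\<close>

context
 fixes x y :: 'a
 assumes x: "x \<in> pts" and y: "y \<in> pts" and xy: "x ~= y"
begin

definition reflect_on :: "'m set => ('m => 'a) => 'm => 'a" where
 "reflect_on E p = (\<lambda>l. if l \<in> E then refl x y (p l) else p l)"

lemma reflect_on_space: "p \<in> space P ==> reflect_on E p \<in> space P"
 using refl_in[OF x y xy] by (auto simp: reflect_on_def space_P)

lemma reflect_on_measurable [measurable]: "reflect_on E \<in> P \<rightarrow>\<^sub>M P"
proof (rule into_P_measurable)
 fix l
 show "(\<lambda>p. reflect_on E p l) \<in> P \<rightarrow>\<^sub>M M"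
  using measurable_compose[OF component_measurable refl_measurable[OF x y xy], of l]
  by (cases "l \<in> E") (simp_all add: reflect_on_def)
qed

lemma nn_integral_reflect_on:
 assumes [measurable]: "h \<in> borel_measurable P"
 shows "(\<integral>P p. h (reflect_on E p)) = (\<integral>P p. h p)"
proof -
 have "distr P P (\<lambda>p. \<lambda>l\<in>UNIV. (if l \<in> E then refl x y else (\<lambda>z. z)) (p l)) = P"
  unfolding vol_power_def using refl_measurable[OF x y xy] refl_distr[OF x y xy]
  by (intro distr_PiM_componentwise) (auto simp: distr_id2)
 also have "(\<lambda>p. \<lambda>l\<in>UNIV. (if l \<in> E then refl x y else (\<lambda>z. z)) (p l)) = reflect_on E"
  by (auto simp: reflect_on_def fun_eq_iff)
 finally have "distr P P (reflect_on E) = P" .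
 then have "(\<integral>P p. h p) = (\<integral>\<^sup>+p. h p \<partial>distr P P (reflect_on E))" by simp
 also have "... = (\<integral>P p. h (reflect_on E p))" by (rule nn_integral_distr) auto
 finally show ?thesis by simp
qed

text \<open>Each choice of reflected variables preserves the product measure, so integrals can be
  compared through sums over whole reflection orbits.\<close>

lemma nn_integral_fold:
 assumes [measurable]: "h \<in> borel_measurable P"
 shows "(\<integral>P p. (\<Sum>E\<in>UNIV. h (reflect_on E p))) = of_nat (card (UNIV :: 'm set set)) * (\<integral>P p. h p)"
 by (subst nn_integral_sum) (simp_all add: nn_integral_reflect_on)

text \<open>The representative of the reflection orbit with no point closer to \<open>y\<close> than
  to \<open>x\<close>.\<close>

definition gather :: "('m => 'a) => 'm => 'a" where
 "gather p = reflect_on {l. d (p l) y < d (p l) x} p"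

lemma gather_space: "p \<in> space P ==> gather p \<in> space P"
 unfolding gather_def by (rule reflect_on_space)

lemma gather_side: "p \<in> space P ==> d (gather p l) x <= d (gather p l) y"
 using refl_dist_ends[OF x y xy, of "p l"] by (auto simp: gather_def reflect_on_def space_P)

lemma gather_cases: "gather p l = p l \<or> gather p l = refl x y (p l)"
 by (auto simp: gather_def reflect_on_def)

lemma sum_gather:
 assumes p: "p \<in> space P"
 shows "(\<Sum>E\<in>UNIV. h (reflect_on E (gather p))) = (\<Sum>E\<in>UNIV. h (reflect_on E p))"
proof -
 let ?D = "{l. d (p l) y < d (p l) x}"
 have "reflect_on E (gather p) = reflect_on (sym_diff E ?D) p" for E
  using refl_refl[OF x y xy] p by (auto simp: gather_def reflect_on_def space_P)
 moreover have "bij_betw (\<lambda>E. sym_diff E ?D) UNIV UNIV"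
  by (rule bij_betw_byWitness[of _ "\<lambda>E. sym_diff E ?D"]) auto
 ultimately show ?thesis
  using sum.reindex_bij_betw[of "\<lambda>E. sym_diff E ?D" UNIV UNIV "\<lambda>E. h (reflect_on E p)"] by simp
qed

definition near_weight :: "('m => 'a) => 'm => 'm => real" where
 "near_weight p i j = K i j (d (p i) (p j))"

definition far_weight :: "('m => 'a) => 'm => 'm => real" where
 "far_weight p i j = K i j (d (p i) (refl x y (p j)))"

text \<open>Two points on one side are at most as far apart as one of them and the mirror image of
  the other, and the kernels are nonincreasing. For a point on the bisector the two distances
  agree.\<close>

lemma weight_order:
 assumes p: "p \<in> space P" "!!l. d (p l) x <= d (p l) y" and ij: "i < j"
 shows "0 <= far_weight p i j \<and> far_weight p i j <= near_weight p i j"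
proof -
 have pi: "p i \<in> pts" "p j \<in> pts" "refl x y (p j) \<in> pts"
  using p refl_in[OF x y xy] by (auto simp: space_P)
 have "d (p i) (p j) <= d (p i) (refl x y (p j))"
 proof (cases "d (p i) x = d (p i) y")
  case True
  then have "d (p i) (refl x y (p j)) = d (p i) (p j)"
   using refl_dist1[OF x y xy pi(1,2)] refl_fixes_bisector[OF x y xy pi(1)] by simp
  then show ?thesis by simp
 next
  case False
  then show ?thesis using refl_farther[OF x y xy pi(1,2)] p(2)[of i] p(2)[of j] by simp
 qed
 then show ?thesis using K_antimono[OF ij] K_nonneg[OF ij] dist_nonneg pi
  unfolding near_weight_def far_weight_def by (auto simp: monotone_on_def)
qed

text \<open>Reflecting both members of a pair keeps their distance, reflecting one of them turns the
  near into the far distance; only whether \<open>E\<close> separates the pair matters.\<close>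

lemma kernel_product_reflect_on:
 assumes p: "p \<in> space P"
 shows "kernel_product X K (reflect_on E p) = ising_weight (near_weight p) (far_weight p) E"
proof -
 show ?thesis unfolding ising_weight_def kernel_product_def
 proof (intro prod.cong refl, clarify)
  fix i j :: 'm assume "i < j"
  have pi: "p i \<in> pts" "p j \<in> pts" using p by (auto simp: space_P)
  show "K i j (d (reflect_on E p i) (reflect_on E p j)) =
   (if i \<in> E \<longleftrightarrow> j \<in> E then near_weight p i j else far_weight p i j)"
   using refl_dist[OF x y xy pi] refl_dist1[OF x y xy pi]
   by (auto simp: reflect_on_def near_weight_def far_weight_def)
 qed
qed

lemma integrand_reflect_on:
 assumes p: "p \<in> space P"
 shows "integrand X F K u (reflect_on E p) = ising_weight (near_weight p) (far_weight p) E *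
  F (between (\<lambda>l. u l (p l)) (\<lambda>l. u l (refl x y (p l))) E)"
proof -
 have "(\<chi> l. u l (reflect_on E p l)) = between (\<lambda>l. u l (p l)) (\<lambda>l. u l (refl x y (p l))) E"
  by (auto simp: reflect_on_def between_def vec_eq_iff)
 then show ?thesis by (simp add: integrand_def kernel_product_reflect_on[OF p])
qed

lemma integrand_polarize_reflect_on:
 assumes p: "p \<in> space P" "!!l. d (p l) x <= d (p l) y"
 shows "integrand X F K (\<lambda>l. polarize (x, y) (u l)) (reflect_on E p) =
  ising_weight (near_weight p) (far_weight p) E *
  F (between (\<lambda>l. max (u l (p l)) (u l (refl x y (p l)))) (\<lambda>l. min (u l (p l)) (u l (refl x y (p l)))) E)"
proof -
 have 1: "polarize (x, y) (u l) (p l) = max (u l (p l)) (u l (refl x y (p l)))" for l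
  using p(2) by (simp add: polarize_def)
 have 2: "polarize (x, y) (u l) (refl x y (p l)) = min (u l (p l)) (u l (refl x y (p l)))" for l
 proof -
  have pl: "p l \<in> pts" using p by (simp add: space_P)
  show ?thesis
   using p(2)[of l] refl_dist_ends[OF x y xy pl] refl_refl[OF x y xy pl] refl_fixes_bisector[OF x y xy pl]
   by (auto simp: polarize_def max_def min_def)
 qed
 show ?thesis by (simp add: integrand_reflect_on[OF p(1)] 1 2)
qed

lemma polarize_nonneg:
 "(!!z. z \<in> pts ==> 0 <= f z) ==> z \<in> pts ==> 0 <= polarize (x, y) f z"
 using refl_in[OF x y xy, of z] by (auto simp: polarize_def le_max_iff_disj)

section \<open>The two-point inequality and its equality case\<close>

context
 fixes F :: "(real, 'm) vec => real" and u :: "'m => 'a => real"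
 assumes F: "F \<in> borel_measurable (restrict_space borel nonneg_cone)" "supermodular F" "!!y. y \<in> nonneg_cone ==> 0 <= F y"
  and u: "!!i. u i \<in> borel_measurable M" "!!i x. x \<in> pts ==> 0 <= u i x"
begin

lemma folded_sums:
 assumes p: "p \<in> space P"
 shows "(\<Sum>E\<in>UNIV. integrand X F K u (reflect_on E p)) =
   (\<Sum>E\<in>UNIV. ising_weight (near_weight (gather p)) (far_weight (gather p)) E *
    F (between (\<lambda>l. u l (gather p l)) (\<lambda>l. u l (refl x y (gather p l))) E))"
  and "(\<Sum>E\<in>UNIV. integrand X F K (\<lambda>l. polarize (x, y) (u l)) (reflect_on E p)) =
   (\<Sum>E\<in>UNIV. ising_weight (near_weight (gather p)) (far_weight (gather p)) E *
    F (between (\<lambda>l. max (u l (gather p l)) (u l (refl x y (gather p l))))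
     (\<lambda>l. min (u l (gather p l)) (u l (refl x y (gather p l)))) E))"
 unfolding sum_gather[OF p, symmetric, of "integrand X F K u"]
   sum_gather[OF p, symmetric, of "integrand X F K (\<lambda>l. polarize (x, y) (u l))"]
 by (simp_all only: integrand_reflect_on[OF gather_space[OF p], of F u]
   integrand_polarize_reflect_on[OF gather_space[OF p] gather_side[OF p]])

lemma folded_sum_le:
 assumes p: "p \<in> space P"
 shows "(\<Sum>E\<in>UNIV. integrand X F K u (reflect_on E p))
  <= (\<Sum>E\<in>UNIV. integrand X F K (\<lambda>l. polarize (x, y) (u l)) (reflect_on E p))"
proof -
 note g = gather_space[OF p] gather_side[OF p]
 show ?thesis unfolding folded_sums[OF p] by (rule two_point_sum_le[OF F(2)])
    (use u(2) g refl_in[OF x y xy] weight_order[OF g] in \<open>auto simp: space_P\<close>)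
qed

lemma integrand_nonneg:
 assumes "!!i x. x \<in> pts ==> 0 <= v i x" "p \<in> space P"
 shows "0 <= integrand X F K v p"
 using F(3)[of "\<chi> i. v i (p i)"] assms kernel_product_nonneg[OF assms(2)]
 by (auto simp: integrand_def nonneg_cone_def space_P)

lemma folded_integral:
 assumes v: "!!i. v i \<in> borel_measurable M" "!!i x. x \<in> pts ==> 0 <= v i x"
 shows "(\<integral>P p. ennreal (\<Sum>E\<in>UNIV. integrand X F K v (reflect_on E p)))
  = of_nat (card (UNIV :: 'm set set)) * energy F v"
proof -
 have [measurable]: "integrand X F K v \<in> borel_measurable P" by (rule integrand_measurable[OF F(1) v])
 have "(\<integral>P p. ennreal (\<Sum>E\<in>UNIV. integrand X F K v (reflect_on E p)))
   = (\<integral>P p. (\<Sum>E\<in>UNIV. ennreal (integrand X F K v (reflect_on E p))))"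
  using integrand_nonneg[OF v(2)] reflect_on_space by (intro nn_integral_cong sum_ennreal[symmetric]) auto
 also have "... = of_nat (card (UNIV :: 'm set set)) * energy F v" by (rule nn_integral_fold) measurable
 finally show ?thesis .
qed

lemma two_point_inequality:
 "energy F u
  <= energy F (\<lambda>l. polarize (x, y) (u l))"
proof -
 have "of_nat (card (UNIV :: 'm set set)) * energy F u
  <= of_nat (card (UNIV :: 'm set set)) * energy F (\<lambda>l. polarize (x, y) (u l))"
  using nn_integral_mono[of P "\<lambda>p. ennreal (\<Sum>E\<in>UNIV. integrand X F K u (reflect_on E p))", OF ennreal_leI[OF folded_sum_le]]
  by (simp only: folded_integral[of u, OF u]
   folded_integral[of "\<lambda>l. polarize (x, y) (u l)", OF polarize_measurable[OF x y xy u(1)] polarize_nonneg[OF u(2)]])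
 moreover have "of_nat (card (UNIV :: 'm set set)) < (top :: ennreal)" by (rule of_nat_less_top)
 ultimately show ?thesis by (subst (asm) ennreal_mult_le_mult_iff) (auto simp: less_top)
qed

text \<open>Equality of finite integrals makes the orbit inequality an equality almost everywhere. A
  point of the first set in coordinate \<open>i\<close> together with a point of the second in
  coordinate \<open>j\<close> would make it strict. So the product of the two sets is null, and then
  one factor is.\<close>

lemma two_point_equality:
 assumes eq: "energy F u
   = energy F (\<lambda>l. polarize (x, y) (u l))"
  and fin: "energy F u < \<infinity>"
  and pos: "\<forall>i j t. i < j \<and> 0 <= t \<and> ereal t < diam X --> 0 < K i j t"
  and ij: "i ~= j" "same_component (strict_edges K) i j"
  and strict: "\<forall>y\<in>nonneg_cone. \<forall>h>0. \<forall>k>0.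
       F (y + h *\<^sub>R axis i 1 + k *\<^sub>R axis j 1) + F y
        > F (y + h *\<^sub>R axis i 1) + F (y + k *\<^sub>R axis j 1)"
 shows "\<mu> {z \<in> pts. d z x < d z y \<and> u i (refl x y z) < u i z} = 0 \<or>
  \<mu> {z \<in> pts. d z x < d z y \<and> u j z < u j (refl x y z)} = 0"
proof -
 interpret product_sigma_finite "\<lambda>_::'m. M" by (rule product_sigma_finite_vol)
 let ?v = "\<lambda>l. polarize (x, y) (u l)"
 let ?S = "\<lambda>v p. \<Sum>E\<in>UNIV. integrand X F K v (reflect_on E p)"
 note v = polarize_measurable[OF x y xy u(1)] polarize_nonneg[OF u(2)]
 have [measurable]: "integrand X F K u \<in> borel_measurable P" "integrand X F K ?v \<in> borel_measurable P"
  by (intro integrand_measurable[OF F(1)] u v; assumption)+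
 have nn: "0 <= ?S u p" if "p \<in> space P" for p
  using integrand_nonneg[OF u(2)] reflect_on_space[OF that] by (intro sum_nonneg) auto
 have fin': "(\<integral>P p. ennreal (?S u p)) < \<infinity>"
 proof -
  have "of_nat (card (UNIV :: 'm set set)) < (top :: ennreal)" by (rule of_nat_less_top)
  then show ?thesis by (simp only: folded_integral[of u, OF u]) (use fin in \<open>simp add: ennreal_mult_less_top\<close>)
 qed
 have eq': "(\<integral>P p. ennreal (?S u p)) = (\<integral>P p. ennreal (?S ?v p))"
  by (simp only: folded_integral[of u, OF u] folded_integral[of ?v, OF v] eq)
 have "(\<integral>P p. ennreal (?S ?v p) - ennreal (?S u p)) = (\<integral>P p. ennreal (?S ?v p)) - (\<integral>P p. ennreal (?S u p))"
  using fin' by (intro nn_integral_diff) (auto intro!: AE_I2 ennreal_leI folded_sum_le)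
 also have "... = 0" using eq' fin' by simp
 finally have "AE p in P. ennreal (?S ?v p) - ennreal (?S u p) = 0" by (subst (asm) nn_integral_0_iff_AE) auto
 moreover have "AE p in P. p \<in> space P" by (rule AE_space)
 ultimately have eqS: "AE p in P. ?S ?v p <= ?S u p"
 proof eventually_elim
  case (elim p)
  have "ennreal (?S ?v p) <= ennreal (?S u p)" using elim by (simp add: diff_eq_0_iff_ennreal) 
  then show ?case using nn[OF elim(2)] by (simp add: ennreal_le_iff)
 qed
 \<comment> \<open>Off the null sets of this and the next step all points lie strictly on one side,
   which makes strict edges produce strict weights, and all near and far distances are below the
   diameter, which makes the weights positive.\<close>
 have bis: "AE p in P. \<forall>l\<in>UNIV. d (p l) x ~= d (p l) y"
  using AE_not_in[OF bisector_null[OF x y xy]] by (intro AE_finite_allI AE_component) auto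
 have dm: "AE p in P. \<forall>k\<in>UNIV. \<forall>l\<in>UNIV. k ~= l --> ereal (d (p l) (p k)) < diam X \<and> ereal (d (p l) (refl x y (p k))) < diam X"
 proof (intro AE_finite_allI finite)
  fix k l :: 'm
  note [measurable] = refl_measurable[OF x y xy]
  have "AE p in P. ereal (d (p l) (p k)) < diam X \<and> ereal (d (p l) (refl x y (p k))) < diam X" if kl: "k ~= l"
  proof (rule AE_pair_component)
   show "Measurable.pred (M \<Otimes>\<^sub>M M) (\<lambda>(z, w). ereal (d z w) < diam X \<and> ereal (d z (refl x y w)) < diam X)"
    by measurable
   fix w assume w: "w \<in> pts"
   have "AE z in M. ereal (d w z) < diam X" "AE z in M. ereal (d (refl x y w) z) < diam X" "AE z in M. z \<in> pts"
    using AE_less_diam w refl_in[OF x y xy w] by (auto intro: AE_space)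
   then show "AE z in M. ereal (d z w) < diam X \<and> ereal (d z (refl x y w)) < diam X"
    by eventually_elim (use dist_sym w refl_in[OF x y xy w] in auto)
  qed (use kl in auto)
  then show "AE p in P. k ~= l --> ereal (d (p l) (p k)) < diam X \<and> ereal (d (p l) (refl x y (p k))) < diam X"
   by (cases "k = l") auto
 qed
 have good: "AE p in P. \<not> (u i (refl x y (gather p i)) < u i (gather p i) \<and> u j (gather p j) < u j (refl x y (gather p j)))"
  using eqS bis dm AE_space[of P]
 proof eventually_elim
  case (elim p)
  note p = elim(4)
  note g = gather_space[OF p] gather_side[OF p]
  have gM: "gather p l \<in> pts" "refl x y (gather p l) \<in> pts" for l
   using g(1) refl_in[OF x y xy] by (auto simp: space_P)
  have strictside: "d (gather p l) x < d (gather p l) y" for l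
  proof -
   have "p l \<in> pts" using p by (simp add: space_P)
   then have "d (gather p l) x ~= d (gather p l) y"
    using gather_cases[of p l] elim(2)[rule_format, of l] refl_dist_ends[OF x y xy, of "p l"] by auto
   then show ?thesis using g(2)[of l] by simp
  qed
  have far_pos: "0 < far_weight (gather p) k l" if kl: "k < l" for k l
  proof -
   have pk: "p k \<in> pts" "p l \<in> pts" using p by (auto simp: space_P)
   have "d (gather p k) (refl x y (gather p l)) \<in> {d (p k) (p l), d (p k) (refl x y (p l))}"
    using gather_cases[of p k] gather_cases[of p l] refl_refl[OF x y xy] refl_dist[OF x y xy pk] refl_dist1[OF x y xy pk]
     refl_dist1[OF x y xy pk(1), of "refl x y (p l)"] pk refl_in[OF x y xy pk(2)] by auto
   then have "ereal (d (gather p k) (refl x y (gather p l))) < diam X" using elim(3) kl by auto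
   then show ?thesis unfolding far_weight_def using pos kl dist_nonneg[OF gM(1)[of k] gM(2)[of l]] by blast
  qed
  have S: "strict_edges K \<subseteq> {(i, j). i < j}" by (auto simp: strict_edges_def)
  have Slt: "far_weight (gather p) k l < near_weight (gather p) k l" if kl: "(k, l) \<in> strict_edges K" for k l
  proof -
   have "d (gather p k) (gather p l) < d (gather p k) (refl x y (gather p l))"
    using refl_strictly_farther[OF x y xy gM(1) gM(1) strictside strictside] .
   then show ?thesis using kl dist_nonneg gM unfolding far_weight_def near_weight_def strict_edges_def
    by (auto simp: monotone_on_def)
  qed
  show ?case
  proof
   assume bad: "u i (refl x y (gather p i)) < u i (gather p i) \<and> u j (gather p j) < u j (refl x y (gather p j))"
   have "?S u p < ?S ?v p" unfolding folded_sums[OF p]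
    by (rule two_point_sum_less[OF F(2) _ _ _ S Slt ij(2) _ _ strict])
      (use bad u(2) gM far_pos weight_order[OF g] in auto)
   with elim(1) show False by simp
  qed
 qed
 define A where "A = {z \<in> pts. d z x < d z y \<and> u i (refl x y z) < u i z}"
 define B where "B = {z \<in> pts. d z x < d z y \<and> u j z < u j (refl x y z)}"
 have [measurable]: "A \<in> sets M" "B \<in> sets M"
  unfolding A_def B_def using x y u(1) refl_measurable[OF x y xy] by measurable
 \<comment> \<open>All coordinates other than \<open>i\<close> and \<open>j\<close> run over the
   whole space, which has positive measure.\<close>
 define C where "C l = (if l = i then A else if l = j then B else pts)" for l
 have Cm: "C l \<in> sets M" for l by (simp add: C_def)
 have "Pi\<^sub>E UNIV C \<in> null_sets P"
 proof -
  have Cs: "Pi\<^sub>E UNIV C \<in> sets P" unfolding vol_power_def using Cm by (intro sets_PiM_I_finite) auto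
  have "AE p in P. p \<notin> Pi\<^sub>E UNIV C" using good
  proof eventually_elim
   case (elim p)
   show ?case
   proof
    assume "p \<in> Pi\<^sub>E UNIV C"
    then have "p i \<in> A" "p j \<in> B" using ij(1) by (auto simp: C_def PiE_def Pi_def split: if_splits)
    then show False using elim by (auto simp: A_def B_def gather_def reflect_on_def)
   qed
  qed
  with Cs show ?thesis by (simp add: AE_iff_null_sets)
 qed
 then have "(\<Prod>l\<in>UNIV. \<mu> (C l)) = 0"
  using emeasure_PiM[of "UNIV :: 'm set" C] Cm by (simp add: null_sets_def vol_power_def)
 then obtain l where l: "\<mu> (C l) = 0" by (auto simp: prod_zero_iff)
 have "\<mu> (pts) ~= 0"
  using emeasure_cell_pos[OF base_in, of 1] emeasure_mono[of "cell b 1" "pts" M] by (auto simp: cell_def)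
 then have "\<mu> A = 0 \<or> \<mu> B = 0" using l by (auto simp: C_def split: if_splits)
 then show ?thesis by (simp add: A_def B_def)
qed

end

end

end

section \<open>Convergence of functions with a fixed law\<close>

text \<open>
 If random vectors with a common law converge on a generating system of events, then every integrable
 Borel function of them converges in mean; no continuity of the function is needed.
\<close>

context
 fixes N :: "'o measure" and Y :: "nat => 'o => 'b::topological_space" and Z :: "'o => 'b" and G :: "'b set set"
 assumes N: "finite_measure N"
  and Y [measurable]: "!!n. Y n \<in> borel_measurable N" and Z [measurable]: "Z \<in> borel_measurable N"
  and law: "!!n. distr N borel (Y n) = distr N borel Z"
begin

interpretation finite_measure N by (rule N)

text \<open>The events along which convergence holds are closed under countable disjoint unions: the
  tail of the union has the same small probability under every \<open>Y n\<close> as under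
  \<open>Z\<close>, because the laws agree.\<close>

lemma law_convergence_sets:
 assumes G: "Int_stable G" "sets borel = sigma_sets UNIV G"
  and conv: "!!E. E \<in> G ==> (\<lambda>n. measure N {w \<in> space N. (Y n w \<in> E) ~= (Z w \<in> E)}) \<longlonglongrightarrow> 0"
  and E: "E \<in> sets borel"
 shows "(\<lambda>n. measure N {w \<in> space N. (Y n w \<in> E) ~= (Z w \<in> E)}) \<longlonglongrightarrow> 0"
proof -
 have "E \<in> sigma_sets UNIV G" using E G(2) by simp
 have "G \<subseteq> Pow UNIV" by simp
 from G(1) this \<open>E \<in> sigma_sets UNIV G\<close> show ?thesis
 proof (induction rule: sigma_sets_induct_disjoint)
  case (basic A)
  then show ?case by (rule conv)
 next
  case empty
  then show ?case by simp
 next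
  case (compl A)
  then show ?case by (simp add: eq_commute)
 next
  case (union A)
  have [measurable]: "A i \<in> sets borel" for i using union G(2) by auto
  have [measurable]: "(\<Union>i\<in>I. A i) \<in> sets borel" for I by (intro sets.countable_UN') auto
  let ?D = "\<lambda>n E. measure N {w \<in> space N. (Y n w \<in> E) ~= (Z w \<in> E)}"
  define T where "T k = {w \<in> space N. Z w \<in> (\<Union>i\<in>{k..}. A i)}" for k
  have [measurable]: "T k \<in> sets N" for k unfolding T_def by measurable
  have "(\<lambda>k. measure N (T k)) \<longlonglongrightarrow> measure N (\<Inter>k. T k)"
   by (rule finite_Lim_measure_decseq) (auto simp: T_def decseq_def intro: order_trans)
  moreover have "(\<Inter>k. T k) = {}"
  proof -
   have False if w: "!!k. w \<in> T k" for w
   proof -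
    obtain i where i: "Z w \<in> A i" using w[of 0] by (auto simp: T_def)
    obtain j where j: "Suc i <= j" "Z w \<in> A j" using w[of "Suc i"] by (auto simp: T_def)
    then have "A i \<inter> A j = {}" using union(1) by (intro disjoint_family_onD[OF union(1)]) auto
    then show False using i j by blast
   qed
   then show ?thesis by blast
  qed
  ultimately have T0: "(\<lambda>k. measure N (T k)) \<longlonglongrightarrow> 0" by simp
  have bound: "?D n (\<Union>i. A i) <= (\<Sum>i<k. ?D n (A i)) + 2 * measure N (T k)" for n k
  proof -
   let ?TY = "{w \<in> space N. Y n w \<in> (\<Union>i\<in>{k..}. A i)}"
   have "measure N ?TY = measure (distr N borel (Y n)) (\<Union>i\<in>{k..}. A i)"
    by (subst measure_distr) (auto simp: vimage_def Int_def conj_commute intro!: arg_cong[where f = "measure N"])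
   also have "... = measure N (T k)"
    unfolding law T_def by (subst measure_distr) (auto simp: vimage_def Int_def conj_commute intro!: arg_cong[where f = "measure N"])
   finally have TY: "measure N ?TY = measure N (T k)" .
   have "?D n (\<Union>i. A i) <= measure N ((\<Union>i<k. {w \<in> space N. (Y n w \<in> A i) ~= (Z w \<in> A i)}) \<union> (?TY \<union> T k))"
   proof (rule finite_measure_mono)
    show "{w \<in> space N. (Y n w \<in> (\<Union>i. A i)) ~= (Z w \<in> (\<Union>i. A i))}
     \<subseteq> (\<Union>i<k. {w \<in> space N. (Y n w \<in> A i) ~= (Z w \<in> A i)}) \<union> (?TY \<union> T k)"
    proof
     fix w assume w: "w \<in> {w \<in> space N. (Y n w \<in> (\<Union>i. A i)) ~= (Z w \<in> (\<Union>i. A i))}"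
     then obtain i where i: "(Y n w \<in> A i \<and> (\<forall>j. Z w \<notin> A j)) \<or> (Z w \<in> A i \<and> (\<forall>j. Y n w \<notin> A j))" by blast
     show "w \<in> (\<Union>i<k. {w \<in> space N. (Y n w \<in> A i) ~= (Z w \<in> A i)}) \<union> (?TY \<union> T k)"
     proof (cases "i < k")
      case True
      then show ?thesis using i w by auto
     next
      case False
      then show ?thesis using i w by (auto simp: T_def not_less)
     qed
    qed
   qed measurable
   also have "... <= measure N (\<Union>i<k. {w \<in> space N. (Y n w \<in> A i) ~= (Z w \<in> A i)}) + measure N (?TY \<union> T k)"
    by (rule measure_Un_le) measurable
   also have "measure N (\<Union>i<k. {w \<in> space N. (Y n w \<in> A i) ~= (Z w \<in> A i)}) <= (\<Sum>i<k. ?D n (A i))"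
    by (rule measure_UNION_le) auto
   also have "measure N (?TY \<union> T k) <= measure N ?TY + measure N (T k)"
    by (rule measure_Un_le) measurable
   finally show ?thesis using TY by simp
  qed
  show ?case
  proof (rule LIMSEQ_I)
   fix e :: real assume e: "0 < e"
   obtain k where k: "measure N (T k) < e / 4"
    using order_tendstoD(2)[OF T0, of "e / 4"] e by (auto simp: eventually_sequentially)
   have "(\<lambda>n. \<Sum>i<k. ?D n (A i)) \<longlonglongrightarrow> (\<Sum>i<k. 0)" by (intro tendsto_sum union.IH)
   then have "\<forall>\<^sub>F n in sequentially. (\<Sum>i<k. ?D n (A i)) < e / 2" using e by (intro order_tendstoD(2)) auto
   then obtain n0 where "!!n. n0 <= n ==> (\<Sum>i<k. ?D n (A i)) < e / 2" by (auto simp: eventually_sequentially)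
   then have "?D n (\<Union>i. A i) < e" if "n0 <= n" for n using bound[of n k] k that by fastforce
   then show "\<exists>n0. \<forall>n\<ge>n0. norm (?D n (\<Union>i. A i) - 0) < e" by (intro exI[of _ n0]) auto
  qed
 qed
qed

text \<open>For an approximant \<open>s i\<close> of the function the errors along
  \<open>Y n\<close> and along \<open>Z\<close> have the same mean \<open>a i\<close>, again by the
  common law, so the approximation is uniform in \<open>n\<close>.\<close>

lemma law_convergence:
 fixes h :: "'b => real"
 assumes sets: "!!E. E \<in> sets borel ==> (\<lambda>n. measure N {w \<in> space N. (Y n w \<in> E) ~= (Z w \<in> E)}) \<longlonglongrightarrow> 0"
  and h: "integrable (distr N borel Z) h"
 shows "(\<lambda>n. LINT w|N. \<bar>h (Y n w) - h (Z w)\<bar>) \<longlonglongrightarrow> 0" using h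
proof (induction rule: integrable_induct)
 case (base A c)
 then have [measurable]: "A \<in> sets borel" by simp
 have "(LINT w|N. \<bar>indicat_real A (Y n w) *\<^sub>R c - indicat_real A (Z w) *\<^sub>R c\<bar>)
   = measure N {w \<in> space N. (Y n w \<in> A) ~= (Z w \<in> A)} * \<bar>c\<bar>" for n
 proof -
  have "(LINT w|N. \<bar>indicat_real A (Y n w) *\<^sub>R c - indicat_real A (Z w) *\<^sub>R c\<bar>)
   = (LINT w|N. indicat_real {w \<in> space N. (Y n w \<in> A) ~= (Z w \<in> A)} w * \<bar>c\<bar>)"
   by (intro Bochner_Integration.integral_cong) (auto simp: indicator_def)
  then show ?thesis by simp
 qed
 then show ?case using tendsto_mult_right[OF sets[of A], of "\<bar>c\<bar>"] by simp
next
 case (add f g)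
 have int: "integrable N (\<lambda>w. k (Y n w))" "integrable N (\<lambda>w. k (Z w))" if "integrable (distr N borel Z) k" for k :: "'b => real" and n
  using that law[of n] by (auto simp: integrable_distr_eq dest!: borel_measurable_integrable)
   (metis Y Z integrable_distr law that)+
 show ?case
 proof (rule tendsto_sandwich[where f = "\<lambda>_. 0" and
   h = "\<lambda>n. (LINT w|N. \<bar>f (Y n w) - f (Z w)\<bar>) + (LINT w|N. \<bar>g (Y n w) - g (Z w)\<bar>)"])
  show "(\<lambda>n. (LINT w|N. \<bar>f (Y n w) - f (Z w)\<bar>) + (LINT w|N. \<bar>g (Y n w) - g (Z w)\<bar>)) \<longlonglongrightarrow> 0"
   using tendsto_add[OF add.IH] by simp
  show "\<forall>\<^sub>F n in sequentially. (LINT w|N. \<bar>f (Y n w) + g (Y n w) - (f (Z w) + g (Z w))\<bar>)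
    <= (LINT w|N. \<bar>f (Y n w) - f (Z w)\<bar>) + (LINT w|N. \<bar>g (Y n w) - g (Z w)\<bar>)"
   unfolding Bochner_Integration.integral_add[symmetric, OF integrable_abs[OF Bochner_Integration.integrable_diff[OF int[OF add(1)]]]
    integrable_abs[OF Bochner_Integration.integrable_diff[OF int[OF add(2)]]]]
   by (intro always_eventually allI integral_mono integrable_abs Bochner_Integration.integrable_diff
     Bochner_Integration.integrable_add int[OF add(1)] int[OF add(2)]) auto
 qed (auto intro!: always_eventually)
next
 case (lim f s)
 have int: "integrable N (\<lambda>w. k (Y n w))" "integrable N (\<lambda>w. k (Z w))" if "integrable (distr N borel Z) k" for k :: "'b => real" and n
  using that law[of n] by (metis Y Z integrable_distr)+
 have tr: "(LINT w|N. k (Y n w)) = (LINT y|distr N borel Z. k y)" "(LINT w|N. k (Z w)) = (LINT y|distr N borel Z. k y)"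
  if "integrable (distr N borel Z) k" for k :: "'b => real" and n
 proof -
  have [measurable]: "k \<in> borel_measurable borel" using borel_measurable_integrable[OF that] by simp
  show "(LINT w|N. k (Y n w)) = (LINT y|distr N borel Z. k y)"
   unfolding law[of n, symmetric] by (rule integral_distr[symmetric]) auto
  show "(LINT w|N. k (Z w)) = (LINT y|distr N borel Z. k y)" by (rule integral_distr[symmetric]) auto
 qed
 define a where "a i = (LINT y|distr N borel Z. \<bar>f y - s i y\<bar>)" for i
 have a0: "a \<longlonglongrightarrow> 0"
 proof -
  have "a \<longlonglongrightarrow> (LINT y|distr N borel Z. 0)" unfolding a_def
  proof (rule integral_dominated_convergence[where w = "\<lambda>y. 3 * norm (f y)"])
   show "AE y in distr N borel Z. (\<lambda>i. \<bar>f y - s i y\<bar>) \<longlonglongrightarrow> 0"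
   proof (rule AE_I2)
    fix y assume "y \<in> space (distr N borel Z)"
    then have "(\<lambda>i. \<bar>f y - s i y\<bar>) \<longlonglongrightarrow> \<bar>f y - f y\<bar>" by (intro tendsto_intros lim(2))
    then show "(\<lambda>i. \<bar>f y - s i y\<bar>) \<longlonglongrightarrow> 0" by simp
   qed
   show "AE y in distr N borel Z. norm \<bar>f y - s i y\<bar> <= 3 * norm (f y)" for i
   proof (rule AE_I2)
    fix y assume "y \<in> space (distr N borel Z)"
    then have "norm (s i y) <= 2 * norm (f y)" by (rule lim(3))
    then show "norm \<bar>f y - s i y\<bar> <= 3 * norm (f y)" by auto
   qed
  qed (use lim(1,4) in \<open>auto intro: borel_measurable_integrable\<close>)
  then show ?thesis by simp
 qed
 have ib: "integrable (distr N borel Z) (\<lambda>y. \<bar>f y - s i y\<bar>)" for i using lim(1,4) by auto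
 have bound: "(LINT w|N. \<bar>f (Y n w) - f (Z w)\<bar>) <= 2 * a i + (LINT w|N. \<bar>s i (Y n w) - s i (Z w)\<bar>)" for n i
 proof -
  have I: "integrable N (\<lambda>w. \<bar>f (Y n w) - s i (Y n w)\<bar>)" "integrable N (\<lambda>w. \<bar>f (Z w) - s i (Z w)\<bar>)"
   "integrable N (\<lambda>w. \<bar>s i (Y n w) - s i (Z w)\<bar>)" "integrable N (\<lambda>w. \<bar>f (Y n w) - f (Z w)\<bar>)"
   using int[OF ib] int[OF lim(1)] int[OF lim(4)] by auto
  have "(LINT w|N. \<bar>f (Y n w) - f (Z w)\<bar>)
   <= (LINT w|N. \<bar>f (Y n w) - s i (Y n w)\<bar> + (\<bar>f (Z w) - s i (Z w)\<bar> + \<bar>s i (Y n w) - s i (Z w)\<bar>))"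
   by (intro integral_mono Bochner_Integration.integrable_add I) auto
  also have "... = a i + (a i + (LINT w|N. \<bar>s i (Y n w) - s i (Z w)\<bar>))"
   using I tr[OF ib] by (simp add: a_def)
  finally show ?thesis by simp
 qed
 show ?case
 proof (rule LIMSEQ_I)
  fix e :: real assume e: "0 < e"
  obtain i where i: "a i < e / 4" using order_tendstoD(2)[OF a0, of "e / 4"] e by (auto simp: eventually_sequentially)
  have "\<forall>\<^sub>F n in sequentially. (LINT w|N. \<bar>s i (Y n w) - s i (Z w)\<bar>) < e / 2"
   using e lim.IH[of i] by (intro order_tendstoD(2)) auto
  then obtain n0 where n0: "!!n. n0 <= n ==> (LINT w|N. \<bar>s i (Y n w) - s i (Z w)\<bar>) < e / 2"
   by (auto simp: eventually_sequentially)
  have "(LINT w|N. \<bar>f (Y n w) - f (Z w)\<bar>) < e" if "n0 <= n" for n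
   using bound[of n i] i n0[OF that] by linarith
  then show "\<exists>n0. \<forall>n\<ge>n0. norm ((LINT w|N. \<bar>f (Y n w) - f (Z w)\<bar>) - 0) < e" by (intro exI[of _ n0]) auto
 qed
qed

end

section \<open>The rearrangement inequality\<close>

context reflection_model begin

lemma polarizes_cong:
 assumes "set ps \<subseteq> toward_base" "!!z. z \<in> pts ==> f z = g z"
 shows "\<forall>z\<in>pts. polarizes ps f z = polarizes ps g z" using assms(1)
proof (induction ps rule: polarizes_induct)
 case (Cons x y ps)
 then show ?case using polarize_cong[OF Cons(2-4), of "polarizes ps f" "polarizes ps g"] by auto
qed (use assms(2) in auto)

text \<open>Sorting commutes with nondecreasing functions of the values, in particular with the step
  function at \<open>t\<close>.\<close>

lemma indicator_polarizes:
 assumes ps: "set ps \<subseteq> toward_base" and z: "z \<in> pts"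
 shows "polarizes ps (indicator {x \<in> pts. t < u x}) z = indicator {x \<in> pts. t < polarizes ps u x} z"
proof -
 have "polarizes ps (indicator {x \<in> pts. t < u x}) z = polarizes ps (\<lambda>z. of_bool (t < u z)) z"
  using polarizes_cong[OF ps, of "indicator {x \<in> pts. t < u x}" "\<lambda>z. of_bool (t < u z)"] z by auto
 also have "... = of_bool (t < polarizes ps u z)" by (subst polarizes_compose_mono) auto
 finally show ?thesis using z by auto
qed

lemma distribution_polarizes:
 assumes "set ps \<subseteq> toward_base" and u: "u \<in> borel_measurable M"
 shows "distribution X (polarizes ps u) t = distribution X u t" using assms(1)
proof (induction ps rule: polarizes_induct)
 case (Cons x y ps)
 then show ?case using distribution_polarize[OF Cons(2-4) polarizes_measurable[OF Cons(6) u]] by simp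
qed simp

lemma emeasure_between:
 assumes [measurable]: "v \<in> borel_measurable M" and "t <= t'" "distribution X v t' < \<infinity>"
 shows "\<mu> {z \<in> pts. t < v z \<and> v z <= t'} = distribution X v t - distribution X v t'"
proof -
 have "{z \<in> pts. t < v z \<and> v z <= t'} = {z \<in> pts. t < v z} - {z \<in> pts. t' < v z}" by auto
 moreover have "\<mu> ({z \<in> pts. t < v z} - {z \<in> pts. t' < v z})
   = \<mu> {z \<in> pts. t < v z} - \<mu> {z \<in> pts. t' < v z}"
  using assms(2,3) unfolding distribution_def by (intro emeasure_Diff) auto
 ultimately show ?thesis by (simp add: distribution_def)
qed

lemma distribution_right_continuous:
 assumes [measurable]: "v \<in> borel_measurable M" and fin: "distribution X v t < \<infinity>" and e: "0 < e"
 obtains t' where "t < t'" "!!s. t <= s ==> s <= t' ==> distribution X v t - distribution X v s < ennreal e"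
proof -
 let ?A = "\<lambda>n. {z \<in> pts. t < v z \<and> v z <= t + 1 / real (Suc n)}"
 have finA: "\<mu> (?A n) < \<infinity>" for n
  using fin unfolding distribution_def by (rule order_le_less_trans[rotated]) (intro emeasure_mono; auto)
 have "decseq ?A"
 proof (rule decseq_SucI, rule subsetI)
  fix n z assume "z \<in> ?A (Suc n)"
  moreover have "1 / real (Suc (Suc n)) <= 1 / real (Suc n)" by (intro divide_left_mono) auto
  ultimately show "z \<in> ?A n" by (auto simp del: of_nat_Suc)
 qed
 then have "(\<lambda>n. \<mu> (?A n)) \<longlonglongrightarrow> \<mu> (\<Inter>n. ?A n)"
  using finA by (intro Lim_emeasure_decseq) (auto simp: less_top)
 moreover have "(\<Inter>n. ?A n) = {}"
 proof -
  have False if z: "!!n. z \<in> ?A n" for z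
  proof -
   have "0 < v z - t" using z[of 0] by simp
   then obtain n where "1 / real (Suc n) < v z - t" by (rule nat_approx_posE)
   then show False using z[of n] by (simp del: of_nat_Suc)
  qed
  then show ?thesis by blast
 qed
 ultimately have "(\<lambda>n. \<mu> (?A n)) \<longlonglongrightarrow> 0" by simp
 from order_tendstoD(2)[OF this, of "ennreal e"] obtain n where n: "\<mu> (?A n) < ennreal e"
  using e by (auto simp: eventually_sequentially)
 show thesis
 proof (rule that[of "t + 1 / real (Suc n)"])
  fix s assume s: "t <= s" "s <= t + 1 / real (Suc n)"
  have "distribution X v s < \<infinity>" using distribution_antimono[OF assms(1) s(1)] fin by (rule order_le_less_trans)
  then have "distribution X v t - distribution X v s = \<mu> {z \<in> pts. t < v z \<and> v z <= s}"
   using emeasure_between[OF assms(1) s(1)] by simp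
  also have "... <= \<mu> (?A n)" using s by (intro emeasure_mono) auto
  finally show "distribution X v t - distribution X v s < ennreal e" using n by (rule order_le_less_trans)
 qed simp
qed

lemma downset_AE_cell:
 assumes D: "downset D" and le: "\<mu> D <= \<mu> (cell b R)"
 shows "AE z in M. z \<in> D --> z \<in> cell b R" using downset_nested[OF D downset_cell[of R]]
proof
 assume sub: "cell b R \<subseteq> D"
 have Dm: "D \<in> sets M" using D by (simp add: downset_def)
 have "\<mu> (D - cell b R) = \<mu> D - \<mu> (cell b R)"
  using sub Dm cell_sets[OF base_in] emeasure_cell_finite[OF base_in, of R] by (intro emeasure_Diff) auto
 also have "... = 0" using le emeasure_cell_finite[OF base_in, of R] by (simp add: diff_eq_0_iff_ennreal)
 finally have "D - cell b R \<in> null_sets M" using Dm cell_sets[OF base_in] by auto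
 from AE_not_in[OF this] show ?thesis by eventually_elim auto
qed auto

text \<open>
 Finitely many level sets of finitely many functions are handled by the approximation of down-sets;
 a diagonal choice and right continuity of the distribution functions give all levels.
\<close>

lemma polarizations_converge:
 fixes u :: "'m::finite => 'a => real"
 assumes u: "!!l. u l \<in> borel_measurable M" "!!l z. z \<in> pts ==> 0 <= u l z"
  and supp: "!!l z. z \<in> pts ==> R <= d b z ==> u l z = 0"
 obtains ps where "!!n. set (ps n) \<subseteq> toward_base"
  "!!l t. 0 <= t ==> (\<lambda>n. \<mu> {z \<in> pts. (t < polarizes (ps n) (u l) z) ~=
    (t < symm_decr_rearrangement X (u l) z)}) \<longlonglongrightarrow> 0"
proof -
 \<comment> \<open>An enumeration of the nonnegative rationals; the absolute value keeps every level
   admissible.\<close>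
 define q where "q k = \<bar>real_of_rat (nat_to_rat_surj k)\<bar>" for k
 note [measurable] = u(1) rearrangement_measurable
 have lev: "{z \<in> pts. t < u l z} \<subseteq> cell b R" if "0 <= t" for t l
 proof
  fix z assume "z \<in> {z \<in> pts. t < u l z}"
  then show "z \<in> cell b R" using supp[of z l] that by (cases "R <= d b z") (auto simp: cell_def)
 qed
 have fin: "distribution X (u l) t < \<infinity>" if "0 <= t" for t l
  using emeasure_mono[OF lev[OF that] cell_sets[OF base_in]] emeasure_cell_finite[OF base_in, of R]
  unfolding distribution_def by (rule order_le_less_trans)
 have van: "vanishes_at_infinity X (u l)" for l using fin by (simp add: vanishes_at_infinity_def)
 \<comment> \<open>The \<open>n\<close>-th sequence treats the first \<open>n + 1\<close> levels of
   all functions with error \<open>1 / (n + 1)\<close>, so each fixed level is treated from some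
   \<open>n\<close> on.\<close>
 have "\<forall>n. \<exists>ps. set ps \<subseteq> toward_base \<and> (\<forall>l. \<forall>k\<le>n.
   (\<integral>M z. ennreal \<bar>polarizes ps (indicator {z \<in> pts. q k < u l z}) z - indicator (star_level (u l) (q k)) z\<bar>)
    <= ennreal (1 / real (Suc n)))"
 proof
  fix n
  define A where "A = (\<lambda>(l, k). {z \<in> pts. q k < u l z})"
  define D where "D = (\<lambda>(l, k). star_level (u l) (q k))"
  have "finite (UNIV \<times> {..n} :: ('m \<times> nat) set)" by simp
  then obtain ps where "set ps \<subseteq> toward_base"
   "!!k. k \<in> UNIV \<times> {..n} ==> (\<integral>M z. ennreal \<bar>polarizes ps (indicator (A k)) z - indicator (D k) z\<bar>) <= ennreal (1 / real (Suc n))"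
  proof (rule polarizes_approximate_downsets[of _ A R D "1 / real (Suc n)"])
   fix k :: "'m \<times> nat"
   show "A k \<in> sets M" unfolding A_def by (cases k) simp
   show "A k \<subseteq> cell b R" unfolding A_def using lev[of "q (snd k)" "fst k"] by (cases k) (auto simp: q_def)
   show "downset (D k)" unfolding D_def using downset_star_level by (cases k) simp
   show "\<mu> (D k) = \<mu> (A k)"
    unfolding D_def A_def using emeasure_star_level[OF u(1)] by (cases k) (simp add: distribution_def)
  qed auto
  then show "\<exists>ps. set ps \<subseteq> toward_base \<and> (\<forall>l. \<forall>k\<le>n.
   (\<integral>M z. ennreal \<bar>polarizes ps (indicator {z \<in> pts. q k < u l z}) z - indicator (star_level (u l) (q k)) z\<bar>)
    <= ennreal (1 / real (Suc n)))" by (intro exI[of _ ps]) (auto simp: A_def D_def)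
 qed
 from choice[OF this] obtain ps where ps: "!!n. set (ps n) \<subseteq> toward_base"
  "!!n l k. k <= n ==> (\<integral>M z. ennreal \<bar>polarizes (ps n) (indicator {z \<in> pts. q k < u l z}) z - indicator (star_level (u l) (q k)) z\<bar>)
    <= ennreal (1 / real (Suc n))"
  by blast
 note pm[measurable] = polarizes_measurable[OF ps(1) u(1)]
 let ?s = "\<lambda>n l t. \<mu> {z \<in> pts. (t < polarizes (ps n) (u l) z) ~= (t < symm_decr_rearrangement X (u l) z)}"
 have sq: "?s n l (q k) <= ennreal (1 / real (Suc n))" if k: "k <= n" for n l k
 proof -
  have [measurable]: "star_level (u l) (q k) \<in> sets M" using downset_star_level by (simp add: downset_def)
  have q0: "0 <= q k" by (simp add: q_def)
  have "?s n l (q k) = (\<integral>M z. indicator {z \<in> pts. (q k < polarizes (ps n) (u l) z) ~= (q k < symm_decr_rearrangement X (u l) z)} z)"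
   by simp
  also have "... = (\<integral>M z. ennreal \<bar>polarizes (ps n) (indicator {z \<in> pts. q k < u l z}) z - indicator (star_level (u l) (q k)) z\<bar>)"
  proof (rule nn_integral_cong_AE)
   show "AE z in M. (indicator {z \<in> pts. (q k < polarizes (ps n) (u l) z) ~= (q k < symm_decr_rearrangement X (u l) z)} z :: ennreal)
    = ennreal \<bar>polarizes (ps n) (indicator {z \<in> pts. q k < u l z}) z - indicator (star_level (u l) (q k)) z\<bar>"
    using AE_less_rearrangement_iff[OF u(1) van q0] AE_space
    by eventually_elim (auto simp: indicator_polarizes[OF ps(1)] indicator_def)
  qed
  also have "... <= ennreal (1 / real (Suc n))" by (rule ps(2)[OF k])
  finally show ?thesis .
 qed
 show thesis
 proof (rule that[OF ps(1)])
  fix l and t :: real assume t: "0 <= t"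
  show "(\<lambda>n. ?s n l t) \<longlonglongrightarrow> 0"
  proof (rule order_tendstoI)
   fix e :: ennreal assume "0 < e"
   then obtain e1 where e1: "0 < e1" "e1 < e" using dense by blast
   then obtain e' where e': "0 < e'" "ennreal e' < e" by (cases e1) auto
   \<comment> \<open>A rational level just above \<open>t\<close> leaves little mass in between, for
     the polarized functions and the rearrangement alike, since all have the distribution of
     \<open>u l\<close>. Three errors of size \<open>e' / 4\<close> stay below
     \<open>e\<close>.\<close>
   obtain t' where t': "t < t'" "!!s. t <= s ==> s <= t' ==> distribution X (u l) t - distribution X (u l) s < ennreal (e' / 4)"
    using distribution_right_continuous[OF u(1) fin[OF t], of "e' / 4" l] e'(1) by auto
   obtain r where r: "t < of_rat r" "of_rat r < t'" using of_rat_dense[OF t'(1)] by blast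
   obtain k where k: "nat_to_rat_surj k = r" using surj_nat_to_rat_surj by (metis surjD)
   have "0 < real_of_rat r" using r(1) t by linarith
   then have qk: "q k = of_rat r" by (simp only: q_def k abs_of_pos)
   have bt: "\<mu> {z \<in> pts. t < v z \<and> v z <= q k} <= ennreal (e' / 4)"
    if "v \<in> borel_measurable M" "!!s. 0 <= s ==> distribution X v s = distribution X (u l) s" for v
   proof -
    have tq: "t <= q k" "q k <= t'" "0 <= q k" unfolding qk using r t by linarith+
    then have "\<mu> {z \<in> pts. t < v z \<and> v z <= q k} = distribution X (u l) t - distribution X (u l) (q k)"
     using emeasure_between[OF that(1) tq(1)] that(2) t fin[of "q k" l] by simp
    then show ?thesis using t'(2)[OF tq(1,2)] by simp
   qed
   obtain n0 where n0: "1 / real (Suc n0) < e' / 4" using nat_approx_posE[of "e' / 4"] e'(1) by auto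
   show "\<forall>\<^sub>F n in sequentially. ?s n l t < e" unfolding eventually_sequentially
   proof (intro exI[of _ "max k n0"] allI impI)
    fix n assume n: "max k n0 <= n"
    let ?v = "polarizes (ps n) (u l)" and ?w = "symm_decr_rearrangement X (u l)"
    have "?s n l t <= \<mu> ({z \<in> pts. (q k < ?v z) ~= (q k < ?w z)} \<union>
      ({z \<in> pts. t < ?v z \<and> ?v z <= q k} \<union> {z \<in> pts. t < ?w z \<and> ?w z <= q k}))"
     using r(1) qk by (intro emeasure_mono) auto
    also have "... <= ?s n l (q k) + \<mu> ({z \<in> pts. t < ?v z \<and> ?v z <= q k} \<union> {z \<in> pts. t < ?w z \<and> ?w z <= q k})"
     by (rule emeasure_subadditive) measurable
    also have "... <= ?s n l (q k) + (\<mu> {z \<in> pts. t < ?v z \<and> ?v z <= q k} + \<mu> {z \<in> pts. t < ?w z \<and> ?w z <= q k})"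
     by (intro add_left_mono emeasure_subadditive) measurable
    also have "... <= ennreal (1 / real (Suc n)) + (ennreal (e' / 4) + ennreal (e' / 4))"
     using n by (intro add_mono sq bt) (auto simp: distribution_polarizes[OF ps(1) u(1)] distribution_rearrangement[OF u(1) van])
    also have "... <= ennreal (e' / 4) + (ennreal (e' / 4) + ennreal (e' / 4))"
    proof (intro add_right_mono ennreal_leI)
     have "1 / real (Suc n) <= 1 / real (Suc n0)" using n by (intro divide_left_mono) auto
     then show "1 / real (Suc n) <= e' / 4" using n0 by simp
    qed
    also have "... = ennreal (e' / 4 + (e' / 4 + e' / 4))" using e' by (simp add: ennreal_plus[symmetric] del: ennreal_plus)
    also have "... <= ennreal e'" using e' by (intro ennreal_leI) simp
    also have "... < e" by (rule e')
    finally show "?s n l t < e" .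
   qed
  qed simp
 qed
qed

end

lemma Int_stable_atMost: "Int_stable (range (\<lambda>a :: 'b::ordered_euclidean_space. {..a}))"
 unfolding Int_stable_def
proof safe
 fix a c :: 'b
 have "{..a} \<inter> {..c} = {..inf a c}" by auto
 then show "{..a} \<inter> {..c} \<in> range (\<lambda>a. {..a})" by blast
qed

context kernel_model begin

context
 fixes F :: "(real, 'm) vec => real"
 assumes F: "F \<in> borel_measurable (restrict_space borel nonneg_cone)" "supermodular F" "!!y. y \<in> nonneg_cone ==> 0 <= F y"
begin

lemma polarizes_inequality:
 fixes u :: "'m => 'a => real"
 assumes u: "!!i. u i \<in> borel_measurable M" "!!i x. x \<in> pts ==> 0 <= u i x" and "set ps \<subseteq> toward_base"
 shows "energy F u
  <= energy F (\<lambda>l. polarizes ps (u l))"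
 using assms(3)
proof (induction ps rule: polarizes_induct)
 case (Cons x y ps)
 have "0 <= polarizes ps (u i) z" if "z \<in> pts" for i z
  using polarizes_range[OF Cons(6), of "u i" "{0..}"] u(2) that by auto
 then have "energy F (\<lambda>l. polarizes ps (u l))
  <= energy F (\<lambda>l. polarize (x, y) (polarizes ps (u l)))"
  by (intro two_point_inequality[OF Cons(2-4) F] polarizes_measurable[OF Cons(6) u(1)])
 with Cons(7) show ?case by simp
qed simp

text \<open>
 With bounded supports and a kernel of bounded range only a box of finite measure matters, and the
 polarized functions have the same joint law on this box as their rearrangements.
\<close>

lemma rearrangement_inequality_bounded:
 fixes u :: "'m => 'a => real"
 assumes F0: "F 0 = 0" and C: "!!y. y \<in> nonneg_cone ==> F y <= C"
  and u: "!!i. u i \<in> borel_measurable M" "!!i x. x \<in> pts ==> 0 <= u i x"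
  and supp: "!!l z. z \<in> pts ==> R <= d b z ==> u l z = 0"
  and range: "!!i j t. i < j ==> S < t ==> K i j t = 0"
 shows "energy F u
  <= energy F (\<lambda>l. symm_decr_rearrangement X (u l))"
proof -
 interpret product_sigma_finite "\<lambda>_::'m. M" by (rule product_sigma_finite_vol)
 let ?w = "\<lambda>l. symm_decr_rearrangement X (u l)"
 obtain ps where ps: "!!n. set (ps n) \<subseteq> toward_base"
  "!!l t. 0 <= t ==> (\<lambda>n. \<mu> {z \<in> pts. (t < polarizes (ps n) (u l) z) ~=
    (t < symm_decr_rearrangement X (u l) z)}) \<longlonglongrightarrow> 0"
  by (rule polarizations_converge[of u R, OF u supp]) (assumption | rule that)+
 define U where "U n l = polarizes (ps n) (u l)" for n l
 have Um[measurable]: "U n l \<in> borel_measurable M" for n l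
  unfolding U_def by (rule polarizes_measurable[OF ps(1) u(1)])
 have wm[measurable]: "?w l \<in> borel_measurable M" for l by (rule rearrangement_measurable)
 have Un: "0 <= U n l z" if "z \<in> pts" for n l z
  using polarizes_range[OF ps(1), of "u l" "{0..}"] u(2) that unfolding U_def by auto
 have wn: "0 <= ?w l z" for l z by (rule rearrangement_nonneg)
 have Usupp: "U n l z = 0" if "z \<in> pts" "R <= d b z" for n l z
  using polarizes_support[OF ps(1), of "u l" R] u(2) supp that unfolding U_def by auto
 have fin: "distribution X (u l) t <= \<mu> (cell b R)" if "0 <= t" for t l unfolding distribution_def
 proof (rule emeasure_mono)
  show "{z \<in> pts. t < u l z} \<subseteq> cell b R"
  proof
   fix z assume "z \<in> {z \<in> pts. t < u l z}"
   then show "z \<in> cell b R" using supp[of z l] that by (cases "R <= d b z") (auto simp: cell_def)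
  qed
 qed (rule cell_sets[OF base_in])
 have van: "vanishes_at_infinity X (u l)" for l unfolding vanishes_at_infinity_def
  using order_le_less_trans[OF fin emeasure_cell_finite[OF base_in, of R], of _ l] by simp
 \<comment> \<open>A configuration with nonzero integrand has a coordinate in the ball of radius
   \<open>R\<close>, and the finite range keeps the other coordinates within
   \<open>\<bar>S\<bar>\<close> of it. So it lies in the box over \<open>B\<close>.\<close>
 define R1 where "R1 = R + \<bar>S\<bar> + 1"
 define B where "B = cell b R1"
 have Bm[measurable]: "B \<in> sets M" unfolding B_def by (rule cell_sets[OF base_in])
 have Bfin: "\<mu> B < \<infinity>" unfolding B_def by (rule emeasure_cell_finite[OF base_in])
 have RB: "cell b R \<subseteq> B" unfolding B_def by (rule cell_mono) (simp add: R1_def)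
 define Box where "Box = Pi\<^sub>E (UNIV :: 'm set) (\<lambda>_. B)"
 have Boxm[measurable]: "Box \<in> sets P" unfolding Box_def vol_power_def by (intro sets_PiM_I_finite) auto
 define N where "N = density P (indicator Box)"
 have spN[simp]: "space N = space P" and setsN[measurable_cong]: "sets N = sets P" by (auto simp: N_def)
 have emN: "emeasure N A = emeasure P (Box \<inter> A)" if [measurable]: "A \<in> sets P" for A
 proof -
  have "emeasure N A = (\<integral>P p. indicator Box p * indicator A p)"
   unfolding N_def by (rule emeasure_density) measurable
  also have "... = (\<integral>P p. indicator (Box \<inter> A) p)" by (intro nn_integral_cong) (auto simp: indicator_def)
  finally show ?thesis by simp
 qed
 have emBox: "emeasure P (Pi\<^sub>E UNIV A) = (\<Prod>l\<in>UNIV. \<mu> (A l))" if "!!l. A l \<in> sets M" for A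
  unfolding vol_power_def using that by (intro emeasure_PiM) auto
 have "emeasure N (space N) < \<infinity>"
 proof -
  have "Box \<inter> space P = Box" using sets.sets_into_space[OF Boxm] by auto
  then have "emeasure N (space N) = (\<Prod>l\<in>(UNIV :: 'm set). \<mu> B)"
   using emN[of "space P"] emBox[of "\<lambda>_. B"] by (simp add: Box_def)
  then show ?thesis using Bfin by (cases "\<mu> B") (auto simp: ennreal_power)
 qed
 then have finN: "finite_measure N" by (intro finite_measureI) auto
 interpret N: finite_measure N by (rule finN)
 define Y where "Y n p = (\<chi> l. U n l (p l))" for n and p :: "'m => 'a"
 define Z where "Z p = (\<chi> l. ?w l (p l))" for p :: "'m => 'a"
 have Ym[measurable]: "Y n \<in> borel_measurable N" for n
  unfolding Y_def by (intro borel_measurable_vec_components) measurable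
 have Zm[measurable]: "Z \<in> borel_measurable N"
  unfolding Z_def by (intro borel_measurable_vec_components) measurable
 \<comment> \<open>The function vanishes almost everywhere outside \<open>B\<close>, so its
   distribution inside \<open>B\<close> is determined by the one on the whole space.\<close>
 have levB: "\<mu> {z \<in> B. v z <= t} = (if t < 0 then 0 else \<mu> B - distribution X (u l) t)"
  if v[measurable]: "v \<in> borel_measurable M" and v0: "!!z. z \<in> pts ==> 0 <= v z"
   and vB: "AE z in M. 0 < v z --> z \<in> B" and dv: "!!t. 0 <= t ==> distribution X v t = distribution X (u l) t" for v l t
 proof (cases "t < 0")
  case True
  have "{z \<in> B. v z <= t} = {}"
  proof (rule equals0I)
   fix z assume z: "z \<in> {z \<in> B. v z <= t}"
   then have "z \<in> pts" using sets.sets_into_space[OF Bm] by auto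
   then show False using v0[of z] z True by auto
  qed
  then show ?thesis using True by (simp only: emeasure_empty if_True)
 next
  case False
  have sub: "B \<subseteq> pts" using sets.sets_into_space[OF Bm] .
  have "{z \<in> B. v z <= t} = B - {z \<in> B. t < v z}" by auto
  moreover have [measurable]: "{z \<in> B. t < v z} \<in> sets M"
  proof -
   have "{z \<in> B. t < v z} = B \<inter> {z \<in> pts. t < v z}" using sub by auto
   then show ?thesis by simp
  qed
  moreover have "\<mu> {z \<in> B. t < v z} = distribution X v t"
   unfolding distribution_def using vB sub False by (intro emeasure_eq_AE) (auto elim!: eventually_mono)
  moreover have "\<mu> {z \<in> B. t < v z} <= \<mu> B" by (intro emeasure_mono) auto
  ultimately show ?thesis using False dv[of t] Bfin by (simp add: emeasure_Diff order_le_less_trans less_top)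
 qed
 have levU: "\<mu> {z \<in> B. U n l z <= t} = \<mu> {z \<in> B. ?w l z <= t}" for n l t
 proof -
  have "AE z in M. 0 < U n l z --> z \<in> B"
  proof (rule AE_I2, rule impI)
   fix z assume "z \<in> pts" "0 < U n l z"
   then show "z \<in> B" using Usupp[of z n l] RB by (cases "R <= d b z") (auto simp: cell_def)
  qed
  moreover have "AE z in M. 0 < ?w l z --> z \<in> B"
  proof -
   have "\<mu> (star_level (u l) 0) <= \<mu> (cell b R)"
    using emeasure_star_level[OF u(1)] fin[of 0 l] by simp
   from downset_AE_cell[OF downset_star_level this] AE_less_rearrangement_iff[OF u(1) van order_refl, of l]
   show ?thesis by eventually_elim (use RB in auto)
  qed
  ultimately show ?thesis
   using levB[OF Um Un, of n l l t] levB[OF wm wn, of l l t] distribution_polarizes[OF ps(1) u(1)] distribution_rearrangement[OF u(1) van]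
   by (simp add: U_def)
 qed
 have boxset: "Box \<inter> {p \<in> space P. (\<chi> l. v l (p l)) <= a} = Pi\<^sub>E UNIV (\<lambda>l. {z \<in> B. v l z <= a $ l})"
   for v and a :: "(real, 'm) vec"
  using sets.sets_into_space[OF Bm] by (auto simp: Box_def space_P less_eq_vec_def PiE_def Pi_def)
 have levm[measurable]: "{z \<in> B. v z <= t} \<in> sets M" if [measurable]: "v \<in> borel_measurable M" for v and t :: real
 proof -
  have "{z \<in> B. v z <= t} = B \<inter> {z \<in> pts. v z <= t}" using sets.sets_into_space[OF Bm] by auto
  then show ?thesis by simp
 qed
 have law_set: "emeasure (distr N borel V) {..a} = (\<Prod>l\<in>UNIV. \<mu> {z \<in> B. v l z <= a $ l})"
  if V: "V = (\<lambda>p. \<chi> l. v l (p l))" "V \<in> borel_measurable N" and v[measurable]: "!!l. v l \<in> borel_measurable M"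
   for V :: "('m => 'a) => (real, 'm) vec" and v a
 proof -
  note [measurable] = V(2)
  have "emeasure (distr N borel V) {..a} = emeasure N {p \<in> space P. V p <= a}"
   using V(2) by (subst emeasure_distr) (auto intro!: arg_cong[where f = "emeasure N"])
  also have "... = emeasure P (Box \<inter> {p \<in> space P. V p <= a})"
  proof (rule emN)
   have "V -` {..a} \<inter> space N \<in> sets N" by (rule measurable_sets[OF V(2)]) simp
   then show "{p \<in> space P. V p <= a} \<in> sets P" by (simp add: setsN vimage_def Int_def conj_commute)
  qed
  also have "... = (\<Prod>l\<in>UNIV. \<mu> {z \<in> B. v l z <= a $ l})"
   unfolding V(1) boxset by (intro emBox levm v)
  finally show ?thesis .
 qed
 \<comment> \<open>Lower orthants meet the box in products of one-variable sublevel sets, whose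
   measures agree factor by factor.\<close>
 have law: "distr N borel (Y n) = distr N borel Z" for n
 proof (rule measure_eqI_generator_eq[where \<Omega> = UNIV and E = "range (\<lambda>a. {..a})" and A = "\<lambda>i. {..\<chi> l. real i}"])
  show "Int_stable (range (\<lambda>a :: (real, 'm) vec. {..a}))" by (rule Int_stable_atMost)
  show "sets (distr N borel (Y n)) = sigma_sets UNIV (range (\<lambda>a :: (real, 'm) vec. {..a}))"
   "sets (distr N borel Z) = sigma_sets UNIV (range (\<lambda>a :: (real, 'm) vec. {..a}))"
   by (simp_all add: borel_eq_atMost[where 'a = "(real, 'm) vec"])
  show "emeasure (distr N borel (Y n)) E = emeasure (distr N borel Z) E" if "E \<in> range (\<lambda>a. {..a})" for E
   using that law_set[of "Y n" "U n"] law_set[of Z ?w] levU by (auto simp: Y_def[abs_def] Z_def[abs_def] Ym[unfolded Y_def[abs_def]] Zm[unfolded Z_def[abs_def]])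
  show "(\<Union>i. {..\<chi> l. real i}) = (UNIV :: (real, 'm) vec set)"
  proof (intro set_eqI iffI UNIV_I)
   fix y :: "(real, 'm) vec"
   obtain i where i: "Max (range (\<lambda>l. y $ l)) < real i" using reals_Archimedean2 by blast
   have "y $ l <= real i" for l
   proof -
    have "y $ l <= Max (range (\<lambda>l. y $ l))" by (intro Max_ge) auto
    with i show ?thesis by linarith
   qed
   then show "y \<in> (\<Union>i. {..\<chi> l. real i})" by (auto simp: less_eq_vec_def)
  qed
  show "emeasure (distr N borel (Y n)) {..\<chi> l. real i} ~= \<infinity>" for i
   using finite_measure.emeasure_finite[OF N.finite_measure_distr[OF Ym]] by simp
 qed auto
 \<comment> \<open>A lower orthant separates two vectors only if some coordinate does, and each of
   the other coordinates contributes the finite factor \<open>\<mu> B\<close>.\<close>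
 have conv_gen: "(\<lambda>n. measure N {p \<in> space N. (Y n p \<in> {..a}) ~= (Z p \<in> {..a})}) \<longlonglongrightarrow> 0" for a
 proof -
  let ?T = "\<lambda>n l. {z \<in> pts. (U n l z <= a $ l) ~= (?w l z <= a $ l)}"
  have Tm[measurable]: "?T n l \<in> sets M" for n l by measurable
  have T0: "(\<lambda>n. \<mu> (?T n l)) \<longlonglongrightarrow> 0" for l
  proof (cases "a $ l < 0")
   case True
   have "\<not> U n l z <= a $ l" "\<not> ?w l z <= a $ l" if "z \<in> pts" for n z
    using Un[OF that, of n l] wn[of l z] True by linarith+
   then have "?T n l = {}" for n by auto
   then show ?thesis by (simp only: emeasure_empty tendsto_const)
  next
   case False
   have "?T n l = {z \<in> pts. (a $ l < U n l z) ~= (a $ l < ?w l z)}" for n by auto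
   then show ?thesis using ps(2)[of "a $ l" l] False by (simp add: U_def)
  qed
  have one: "(\<lambda>n. measure N {p \<in> space P. p l \<in> ?T n l}) \<longlonglongrightarrow> 0" for l
  proof -
   have pm: "{p \<in> space P. p l \<in> ?T n l} \<in> sets P" for n by measurable
   define c where "c = (\<Prod>k\<in>UNIV - {l}. \<mu> B)"
   have c: "c < top" unfolding c_def using Bfin by (cases "\<mu> B") (auto simp: ennreal_power)
   have up: "emeasure N {p \<in> space P. p l \<in> ?T n l} <= c * \<mu> (?T n l)" for n
   proof -
    let ?A = "\<lambda>k. if k = l then B \<inter> ?T n l else B"
    have "emeasure N {p \<in> space P. p l \<in> ?T n l} = emeasure P (Box \<inter> {p \<in> space P. p l \<in> ?T n l})" by (rule emN[OF pm])
    also have "Box \<inter> {p \<in> space P. p l \<in> ?T n l} = Pi\<^sub>E UNIV ?A"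
     using sets.sets_into_space[OF Bm] by (auto simp: Box_def space_P PiE_def Pi_def split: if_splits)
    also have "emeasure P (Pi\<^sub>E UNIV ?A) = (\<Prod>k\<in>UNIV. \<mu> (?A k))" by (rule emBox) auto
    also have "... = \<mu> (B \<inter> ?T n l) * c" unfolding c_def by (subst prod.remove[of UNIV l]) auto
    also have "... <= \<mu> (?T n l) * c" by (intro mult_right_mono emeasure_mono) auto
    finally show ?thesis by (simp only: mult.commute)
   qed
   have lim: "(\<lambda>n. c * \<mu> (?T n l)) \<longlonglongrightarrow> 0"
    using ennreal_tendsto_cmult[OF c T0[of l]] by (simp only: mult_zero_right)
   have "(\<lambda>n. emeasure N {p \<in> space P. p l \<in> ?T n l}) \<longlonglongrightarrow> 0"
   proof (rule tendsto_sandwich[OF _ _ tendsto_const lim])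
    show "\<forall>\<^sub>F n in sequentially. 0 <= emeasure N {p \<in> space P. p l \<in> ?T n l}" by (intro always_eventually allI zero_le)
    show "\<forall>\<^sub>F n in sequentially. emeasure N {p \<in> space P. p l \<in> ?T n l} <= c * \<mu> (?T n l)"
     by (intro always_eventually allI up)
   qed
   then have "(\<lambda>n. enn2real (emeasure N {p \<in> space P. p l \<in> ?T n l})) \<longlonglongrightarrow> enn2real 0"
    by (intro tendsto_enn2real) auto
   then show ?thesis by (simp add: measure_def)
  qed
  show ?thesis
  proof (rule tendsto_sandwich[where f = "\<lambda>_. 0" and h = "\<lambda>n. \<Sum>l\<in>UNIV. measure N {p \<in> space P. p l \<in> ?T n l}"])
   show "\<forall>\<^sub>F n in sequentially. measure N {p \<in> space N. (Y n p \<in> {..a}) ~= (Z p \<in> {..a})}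
     <= (\<Sum>l\<in>UNIV. measure N {p \<in> space P. p l \<in> ?T n l})"
   proof (intro always_eventually allI)
    fix n
    have pm: "{p \<in> space P. p l \<in> ?T n l} \<in> sets N" for l unfolding setsN by measurable
    have "measure N {p \<in> space N. (Y n p \<in> {..a}) ~= (Z p \<in> {..a})} <= measure N (\<Union>l. {p \<in> space P. p l \<in> ?T n l})"
    proof (rule N.finite_measure_mono)
     show "{p \<in> space N. (Y n p \<in> {..a}) ~= (Z p \<in> {..a})} \<subseteq> (\<Union>l. {p \<in> space P. p l \<in> ?T n l})"
      by (auto simp: Y_def Z_def less_eq_vec_def space_P)
    qed (use pm in auto)
    also have "... <= (\<Sum>l\<in>UNIV. measure N {p \<in> space P. p l \<in> ?T n l})"
     using pm by (intro measure_UNION_le) auto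
    finally show "measure N {p \<in> space N. (Y n p \<in> {..a}) ~= (Z p \<in> {..a})} <= (\<Sum>l\<in>UNIV. measure N {p \<in> space P. p l \<in> ?T n l})" .
   qed
   show "(\<lambda>n. \<Sum>l\<in>UNIV. measure N {p \<in> space P. p l \<in> ?T n l}) \<longlonglongrightarrow> 0"
    using tendsto_sum[of UNIV "\<lambda>l n. measure N {p \<in> space P. p l \<in> ?T n l}" "\<lambda>_. 0", OF one] by simp
  qed auto
 qed
 \<comment> \<open>\<open>F\<close> is known to be Borel only on the cone; extension by zero makes
   it a Borel function on the whole space.\<close>
 define h where "h y = indicator nonneg_cone y *\<^sub>R F y" for y
 have cone: "nonneg_cone \<in> sets (borel :: (real, 'm) vec measure)"
  by (auto simp: nonneg_cone_def intro!: borel_closed closed_Collect_all closed_Collect_le continuous_intros)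
 then have hm[measurable]: "h \<in> borel_measurable borel"
  using F(1) unfolding h_def by (subst (asm) borel_measurable_restrict_space_iff) auto
 have h0: "0 <= h y" "h y <= max C 0" for y using F(3)[of y] C[of y] by (auto simp: h_def indicator_def)
 have "integrable (distr N borel Z) h"
  using h0 finite_measure.integrable_const_bound[OF N.finite_measure_distr[OF Zm], of h "max C 0"] by auto
 then have D: "(\<lambda>n. LINT p|N. \<bar>h (Y n p) - h (Z p)\<bar>) \<longlonglongrightarrow> 0"
 proof (rule law_convergence[OF finN Ym Zm law, rotated])
  fix E :: "(real, 'm) vec set" assume E: "E \<in> sets borel"
  show "(\<lambda>n. measure N {p \<in> space N. (Y n p \<in> E) ~= (Z p \<in> E)}) \<longlonglongrightarrow> 0"
  proof (rule law_convergence_sets[OF finN Ym Zm law _ _ _ E])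
   show "Int_stable (range (\<lambda>a :: (real, 'm) vec. {..a}))" by (rule Int_stable_atMost)
   show "sets borel = sigma_sets UNIV (range (\<lambda>a :: (real, 'm) vec. {..a}))"
    by (simp add: borel_eq_atMost[where 'a = "(real, 'm) vec"])
  qed (use conv_gen in auto)
 qed
 \<comment> \<open>Nonincreasing kernels are bounded by their values at 0.\<close>
 define Ck where "Ck = (\<Prod>(i, j)\<in>{(i::'m, j). i < j}. K i j 0)"
 have Ck: "0 <= Ck" unfolding Ck_def using K_nonneg by (auto intro!: prod_nonneg)
 have kb: "kernel_product X K p <= Ck" if p: "p \<in> space P" for p unfolding Ck_def kernel_product_def
 proof (rule prod_mono, clarify)
  fix i j :: 'm assume "i < j"
  then show "0 <= K i j (d (p i) (p j)) \<and> K i j (d (p i) (p j)) <= K i j 0"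
   using K_nonneg[of i j] K_antimono[of i j] dist_nonneg p by (auto simp: monotone_on_def space_P)
 qed
 have hU: "integrand X F K (U n) p = h (Y n p) * kernel_product X K p" if p: "p \<in> space P" for n p
  using Un p by (simp add: integrand_def h_def Y_def nonneg_cone_def space_P)
 have hw: "integrand X F K ?w p = h (Z p) * kernel_product X K p" for p
  using wn by (simp add: integrand_def h_def Z_def nonneg_cone_def)
 have outside: "h (Y n p) * kernel_product X K p = 0" if p: "p \<in> space P" "p \<notin> Box" for n p
 proof (rule ccontr)
  assume "h (Y n p) * kernel_product X K p ~= 0"
  then have ne: "F (Y n p) ~= 0" "kernel_product X K p ~= 0" by (auto simp: h_def)
  then have "Y n p ~= 0" using F0 by auto
  then obtain l where l: "U n l (p l) ~= 0" by (auto simp: Y_def vec_eq_iff)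
  have pM: "p k \<in> pts" for k using p by (simp add: space_P)
  have lR: "d b (p l) < R" using Usupp[OF pM, of l n l] l by force
  have near: "d (p i) (p j) <= S" if "i < j" for i j
  proof (rule ccontr)
   assume "\<not> d (p i) (p j) <= S"
   then have "K i j (d (p i) (p j)) = 0" using range[OF that] by simp
   then have "kernel_product X K p = 0" unfolding kernel_product_def using that by (intro prod_zero) auto
   then show False using ne by simp
  qed
  have "p k \<in> B" for k
  proof -
   have "d (p l) (p k) <= \<bar>S\<bar>"
    using near[of l k] near[of k l] dist_sym[OF pM pM, of k l] pM by (cases l k rule: linorder_cases) auto
   then show ?thesis
    using dist_triangle[OF base_in pM[of l] pM[of k]] lR pM by (auto simp: B_def cell_def R1_def)
  qed
  then show False using p(2) by (auto simp: Box_def)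
 qed
 have kn[measurable]: "kernel_product X K \<in> borel_measurable P" by (rule kernel_product_measurable)
 have bound: "energy F u <= energy F ?w
   + ennreal (Ck * (LINT p|N. \<bar>h (Y n p) - h (Z p)\<bar>))" for n
 proof -
  have [measurable]: "Y n \<in> borel_measurable P" "Z \<in> borel_measurable P"
   using Ym[of n] Zm unfolding measurable_cong_sets[OF setsN refl] .
  have "energy F u <= energy F (U n)"
   using polarizes_inequality[OF u ps(1)[of n]] by (simp add: U_def[abs_def])
  also have "... <= (\<integral>P p. ennreal (integrand X F K ?w p) + ennreal Ck * (indicator Box p * ennreal \<bar>h (Y n p) - h (Z p)\<bar>))"
  proof (rule nn_integral_mono)
   fix p assume p: "p \<in> space P"
   note k0 = kernel_product_nonneg[OF p]
   have "integrand X F K (U n) p <= integrand X F K ?w p + Ck * (indicator Box p * \<bar>h (Y n p) - h (Z p)\<bar>)"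
   proof (cases "p \<in> Box")
    case True
    have "h (Y n p) * kernel_product X K p <= h (Z p) * kernel_product X K p + \<bar>h (Y n p) - h (Z p)\<bar> * kernel_product X K p"
     using k0 by (simp add: distrib_right[symmetric] mult_right_mono)
    also have "\<bar>h (Y n p) - h (Z p)\<bar> * kernel_product X K p <= \<bar>h (Y n p) - h (Z p)\<bar> * Ck"
     by (intro mult_left_mono kb p) auto
    finally show ?thesis using True by (simp add: hU[OF p] hw mult.commute)
   next
    case False
    then have ind: "indicator Box p = (0 :: real)" by simp
    have f1: "h (Y n p) * kernel_product X K p = 0" by (rule outside[OF p False])
    have f2: "0 <= h (Z p) * kernel_product X K p" using h0(1) k0 by (rule mult_nonneg_nonneg)
    show ?thesis unfolding hU[OF p] hw ind f1 using f2 by (simp only: mult_zero_left mult_zero_right add_0_right)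
   qed
   then have "ennreal (integrand X F K (U n) p) <= ennreal (integrand X F K ?w p + Ck * (indicator Box p * \<bar>h (Y n p) - h (Z p)\<bar>))"
    by (rule ennreal_leI)
   also have "... = ennreal (integrand X F K ?w p) + ennreal Ck * (indicator Box p * ennreal \<bar>h (Y n p) - h (Z p)\<bar>)"
    using h0 k0 Ck by (subst ennreal_plus) (auto simp: hw ennreal_mult ennreal_indicator)
   finally show "ennreal (integrand X F K (U n) p) <= ennreal (integrand X F K ?w p) + ennreal Ck * (indicator Box p * ennreal \<bar>h (Y n p) - h (Z p)\<bar>)" .
  qed
  also have "... = energy F ?w + ennreal Ck * (\<integral>P p. indicator Box p * ennreal \<bar>h (Y n p) - h (Z p)\<bar>)"
   unfolding hw by (subst nn_integral_add) (auto simp: nn_integral_cmult)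
  also have "(\<integral>P p. indicator Box p * ennreal \<bar>h (Y n p) - h (Z p)\<bar>) = (\<integral>\<^sup>+p. ennreal \<bar>h (Y n p) - h (Z p)\<bar> \<partial>N)"
   unfolding N_def by (subst nn_integral_density) auto
  also have "... = ennreal (LINT p|N. \<bar>h (Y n p) - h (Z p)\<bar>)"
  proof (rule nn_integral_eq_integral)
   have "\<bar>h (Y n p) - h (Z p)\<bar> <= max C 0" for p using h0[of "Y n p"] h0[of "Z p"] by auto
   then show "integrable N (\<lambda>p. \<bar>h (Y n p) - h (Z p)\<bar>)"
    by (intro N.integrable_const_bound[where B = "max C 0"]) auto
  qed auto
  also have "ennreal Ck * ennreal (LINT p|N. \<bar>h (Y n p) - h (Z p)\<bar>) = ennreal (Ck * (LINT p|N. \<bar>h (Y n p) - h (Z p)\<bar>))"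
   using Ck by (subst ennreal_mult) auto
  finally show ?thesis .
 qed
 show ?thesis
 proof (rule ennreal_le_epsilon)
  fix e :: real assume e: "0 < e"
  have "(\<lambda>n. Ck * (LINT p|N. \<bar>h (Y n p) - h (Z p)\<bar>)) \<longlonglongrightarrow> Ck * 0" by (intro tendsto_mult tendsto_const D)
  then have "\<forall>\<^sub>F n in sequentially. Ck * (LINT p|N. \<bar>h (Y n p) - h (Z p)\<bar>) < e" using e by (intro order_tendstoD(2)) auto
  then obtain n where "Ck * (LINT p|N. \<bar>h (Y n p) - h (Z p)\<bar>) < e" by (auto simp: eventually_sequentially)
  then have "ennreal (Ck * (LINT p|N. \<bar>h (Y n p) - h (Z p)\<bar>)) <= ennreal e" by (intro ennreal_leI) simp
  then show "energy F u <= energy F ?w + ennreal e" using bound[of n] by (meson add_left_mono order_trans)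
 qed
qed

end

end

lemma antimono_on_truncate:
 fixes f :: "real => real"
 assumes "antimono_on {0..} f" "!!t. 0 <= t ==> 0 <= f t"
 shows "antimono_on {0..} (\<lambda>t. if t <= c then f t else 0)"
 using assms by (auto simp: monotone_on_def)

section \<open>Removing the bounds on supports, values and kernels\<close>

context kernel_model begin

text \<open>Functions are truncated to balls of radius \<open>n\<close>, arguments of
  \<open>F\<close> at height \<open>n\<close>, kernels to range \<open>n\<close>. Monotonicity
  bounds every truncated right side by the full one. On the left the truncated integrand eventually
  equals the full one at each point, so Fatou applies.\<close>

lemma rearrangement_inequality:
 fixes u :: "'m => 'a => real" and F :: "(real, 'm) vec => real"
 assumes F: "F \<in> borel_measurable (restrict_space borel nonneg_cone)" "supermodular F" "!!y. y \<in> nonneg_cone ==> 0 <= F y"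
  and F0: "F 0 = 0" and mono: "!!y z. (!!l. 0 <= y $ l) ==> (!!l. y $ l <= z $ l) ==> F y <= F z"
  and u: "!!i. u i \<in> borel_measurable M" "!!i x. x \<in> pts ==> 0 <= u i x" "!!i. vanishes_at_infinity X (u i)"
 shows "energy F u
  <= energy F (\<lambda>l. symm_decr_rearrangement X (u l))"
proof -
 let ?w = "\<lambda>v l. symm_decr_rearrangement X (v l)"
 define v where "v n l z = u l z * indicator (cell b (real n)) z" for n :: nat and l z
 define G where "G n y = F (\<chi> l. min (y $ l) (real n))" for n :: nat and y
 define H where "H n i j t = (if t <= real n then K i j t else 0)" for n :: nat and i j t
 have cm: "cell b r \<in> sets M" for r by (rule cell_sets[OF base_in])
 have vm: "v n l \<in> borel_measurable M" for n l unfolding v_def using u(1) cm by measurable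
 have vn: "0 <= v n l z" if "z \<in> pts" for n l z using u(2)[OF that] by (simp add: v_def)
 have vu: "v n l z <= u l z" if "z \<in> pts" for n l z using u(2)[OF that] by (simp add: v_def indicator_def)
 have Hk: "kernel_model X refl (H n)" for n
 proof (unfold_locales)
  fix i j :: 'm assume "i < j"
  then show "antimono_on {0..} (H n i j)" unfolding H_def by (intro antimono_on_truncate K_antimono K_nonneg)
 qed (auto simp: H_def K_nonneg)
 have minm: "(\<lambda>y. \<chi> l. min (y $ l) (real n)) \<in> borel_measurable (borel :: (real, 'm) vec measure)" for n
  by (intro borel_measurable_vec_components borel_measurable_min borel_measurable_continuous_onI continuous_intros)
 have Gm: "G n \<in> borel_measurable (restrict_space borel nonneg_cone)" for n
 proof -
  have "(\<lambda>y :: (real, 'm) vec. \<chi> l. min (y $ l) (real n)) \<in> restrict_space borel nonneg_cone \<rightarrow>\<^sub>M restrict_space borel nonneg_cone"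
   by (rule measurable_restrict_space3[OF minm]) (auto simp: nonneg_cone_def)
  from measurable_compose[OF this F(1)] show ?thesis by (simp add: G_def[abs_def])
 qed
 have Gs: "supermodular (G n)" for n unfolding G_def by (rule supermodular_compose_mono[OF F(2)]) auto
 have cone: "(\<chi> l. min (y $ l) (real n)) \<in> nonneg_cone" if "y \<in> nonneg_cone" for y :: "(real, 'm) vec" and n
  using that by (auto simp: nonneg_cone_def)
 have GF: "G n y <= F y" if "y \<in> nonneg_cone" for n y
  unfolding G_def using that by (intro mono) (auto simp: nonneg_cone_def)
 have step: "(\<integral>\<^sup>+p. ennreal (integrand X (G n) (H n) (v n) p) \<partial>P)
   <= energy F (?w u)" for n
 proof -
  interpret H: kernel_model X refl "H n" by (rule Hk)
  have "(\<integral>\<^sup>+p. ennreal (integrand X (G n) (H n) (v n) p) \<partial>P)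
   <= (\<integral>\<^sup>+p. ennreal (integrand X (G n) (H n) (?w (v n)) p) \<partial>P)"
  proof (rule H.rearrangement_inequality_bounded[OF Gm Gs, where R = "real n" and S = "real n" and C = "F (\<chi> l. real n)"])
   show "0 <= G n y" if "y \<in> nonneg_cone" for y unfolding G_def by (rule F(3)[OF cone[OF that]])
   show "G n 0 = 0" using F0 by (simp add: G_def zero_vec_def)
   show "G n y <= F (\<chi> l. real n)" if "y \<in> nonneg_cone" for y
    unfolding G_def using that by (intro mono) (auto simp: nonneg_cone_def)
   show "v n l z = 0" if "z \<in> pts" "real n <= d b z" for l z using that by (simp add: v_def cell_def)
  qed (auto simp: H_def vm vn)
  also have "... <= energy F (?w u)"
  proof (rule nn_integral_mono_AE)
   have "AE p in P. \<forall>l\<in>UNIV. ?w (v n) l (p l) <= ?w u l (p l)"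
   proof (intro AE_finite_allI finite)
    fix l
    show "AE p in P. ?w (v n) l (p l) <= ?w u l (p l)"
     by (rule AE_component[of "\<lambda>z. ?w (v n) l z <= ?w u l z"], rule rearrangement_mono[OF vm u(1,3)]) (rule vu)
   qed
   then show "AE p in P. ennreal (integrand X (G n) (H n) (?w (v n)) p) <= ennreal (integrand X F K (?w u) p)"
    using AE_space
   proof eventually_elim
    case (elim p)
    have kp: "kernel_product X (H n) p <= kernel_product X K p"
     unfolding kernel_product_def using elim(2) K_nonneg dist_nonneg
     by (intro prod_mono) (auto simp: H_def space_P)
    have c: "(\<chi> l. ?w (v n) l (p l)) \<in> nonneg_cone"
     by (simp add: nonneg_cone_def rearrangement_nonneg)
    have "G n (\<chi> l. ?w (v n) l (p l)) <= F (\<chi> l. ?w (v n) l (p l))" by (rule GF[OF c])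
    also have "... <= F (\<chi> l. ?w u l (p l))"
     using elim(1) by (intro mono) (auto simp: rearrangement_nonneg)
    finally have "G n (\<chi> l. ?w (v n) l (p l)) <= F (\<chi> l. ?w u l (p l))" .
    moreover have "0 <= F (\<chi> l. ?w u l (p l))"
     by (intro F(3)) (simp add: nonneg_cone_def rearrangement_nonneg)
    ultimately have "integrand X (G n) (H n) (?w (v n)) p <= integrand X F K (?w u) p"
     unfolding integrand_def using kp H.kernel_product_nonneg[OF elim(2)] by (intro mult_mono) auto
    then show ?case by (rule ennreal_leI)
   qed
  qed
  finally show ?thesis .
 qed
 have "energy F u = (\<integral>\<^sup>+p. liminf (\<lambda>n. ennreal (integrand X (G n) (H n) (v n) p)) \<partial>P)"
 proof (rule nn_integral_cong)
  fix p assume p: "p \<in> space P"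
  have pM: "p l \<in> pts" for l using p by (simp add: space_P)
  \<comment> \<open>From this \<open>N\<close> on no truncation is active at \<open>p\<close>: the
    sum dominates all radii, values and mutual distances.\<close>
  obtain N where N: "(\<Sum>l\<in>UNIV. d b (p l) + u l (p l)) + (\<Sum>i\<in>UNIV. \<Sum>j\<in>UNIV. d (p i) (p j)) < real N"
   using reals_Archimedean2 by blast
  have nn: "0 <= d b (p l) + u l (p l)" for l using dist_nonneg[OF base_in pM] u(2)[OF pM] by (simp add: add_nonneg_nonneg)
  have nnd: "0 <= d (p i) (p j)" for i j by (rule dist_nonneg[OF pM pM])
  have s1: "0 <= (\<Sum>l\<in>UNIV. d b (p l) + u l (p l))" by (intro sum_nonneg nn)
  have s2: "0 <= (\<Sum>i\<in>UNIV. \<Sum>j\<in>UNIV. d (p i) (p j))" by (intro sum_nonneg nnd)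
  have b1: "d b (p l) + u l (p l) < real N" for l
  proof -
   have "d b (p l) + u l (p l) <= (\<Sum>l\<in>UNIV. d b (p l) + u l (p l))"
    using nn by (intro member_le_sum[of l UNIV "\<lambda>l. d b (p l) + u l (p l)"]) auto
   then show ?thesis using s2 N by linarith
  qed
  have b2: "d (p i) (p j) < real N" for i j
  proof -
   have "d (p i) (p j) <= (\<Sum>j\<in>UNIV. d (p i) (p j))" using nnd by (intro member_le_sum) auto
   also have "... <= (\<Sum>i\<in>UNIV. \<Sum>j\<in>UNIV. d (p i) (p j))"
    using nnd by (intro member_le_sum[of i UNIV "\<lambda>i. \<Sum>j\<in>UNIV. d (p i) (p j)"]) (auto intro: sum_nonneg)
   also have "... < real N" using N s1 by linarith
   finally show ?thesis .
  qed
  have "\<forall>\<^sub>F n in sequentially. ennreal (integrand X (G n) (H n) (v n) p) = ennreal (integrand X F K u p)"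
   unfolding eventually_sequentially
  proof (intro exI[of _ N] allI impI)
   fix n assume n: "N <= n"
   have bd: "d b (p l) < real n" "u l (p l) <= real n" for l
    using b1[of l] n dist_nonneg[OF base_in pM, of l] u(2)[OF pM, of l l] by auto
   have "v n l (p l) = u l (p l)" for l using bd(1)[of l] pM by (simp add: v_def cell_def)
   then have "G n (\<chi> l. v n l (p l)) = F (\<chi> l. u l (p l))" using bd(2) by (simp add: G_def min_absorb1)
   moreover have "kernel_product X (H n) p = kernel_product X K p"
   proof -
    have "d (p i) (p j) <= real n" for i j using b2[of i j] n by simp
    then show ?thesis by (simp add: kernel_product_def H_def)
   qed
   ultimately show "ennreal (integrand X (G n) (H n) (v n) p) = ennreal (integrand X F K u p)"
    by (simp add: integrand_def)
  qed
  then have "(\<lambda>n. ennreal (integrand X (G n) (H n) (v n) p)) \<longlonglongrightarrow> ennreal (integrand X F K u p)"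
   by (rule tendsto_eventually)
  then show "ennreal (integrand X F K u p) = liminf (\<lambda>n. ennreal (integrand X (G n) (H n) (v n) p))"
   by (intro lim_imp_Liminf[symmetric]) auto
 qed
 also have "... <= liminf (\<lambda>n. \<integral>\<^sup>+p. ennreal (integrand X (G n) (H n) (v n) p) \<partial>P)"
 proof (rule nn_integral_liminf)
  fix n
  interpret H: kernel_model X refl "H n" by (rule Hk)
  show "(\<lambda>p. ennreal (integrand X (G n) (H n) (v n) p)) \<in> borel_measurable P"
   using H.integrand_measurable[OF Gm vm vn] by measurable
 qed
 also have "... <= liminf (\<lambda>n::nat. \<integral>\<^sup>+p. ennreal (integrand X F K (?w u) p) \<partial>P)"
  by (intro Liminf_mono always_eventually allI step)
 also have "... = energy F (?w u)" by (rule Liminf_const) simp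
 finally show ?thesis .
qed

text \<open>Above a positive level both laws are finite measures on the line, and they agree on
  half-lines, which generate the Borel sets.\<close>

lemma emeasure_eq_above:
 assumes v: "v \<in> borel_measurable M" and w: "w \<in> borel_measurable M" and \<delta>: "0 < \<delta>"
  and fin: "distribution X v \<delta> < \<infinity>" and eq: "!!t. 0 < t ==> distribution X v t = distribution X w t"
  and E: "E \<in> sets borel"
 shows "\<mu> {z \<in> pts. \<delta> < v z \<and> v z \<in> E} = \<mu> {z \<in> pts. \<delta> < w z \<and> w z \<in> E}"
proof -
 note [measurable] = v w
 define N where "N f = distr (density M (indicator {z \<in> pts. \<delta> < f z})) borel f" for f :: "'a => real"
 have emN: "emeasure (N f) E = \<mu> {z \<in> pts. \<delta> < f z \<and> f z \<in> E}"
  if [measurable]: "f \<in> borel_measurable M" "E \<in> sets borel" for f E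
 proof -
  have "emeasure (N f) E = emeasure (density M (indicator {z \<in> pts. \<delta> < f z})) (f -` E \<inter> pts)"
   unfolding N_def by (subst emeasure_distr) auto
  also have "... = (\<integral>M z. indicator {z \<in> pts. \<delta> < f z} z * indicator (f -` E \<inter> pts) z)"
   by (rule emeasure_density) measurable
  also have "... = (\<integral>M z. indicator {z \<in> pts. \<delta> < f z \<and> f z \<in> E} z)"
   by (intro nn_integral_cong) (auto simp: indicator_def)
  also have "... = \<mu> {z \<in> pts. \<delta> < f z \<and> f z \<in> E}" by (rule nn_integral_indicator) measurable
  finally show ?thesis .
 qed
 have lev: "emeasure (N f) {t<..} = distribution X f (max \<delta> t)" if [measurable]: "f \<in> borel_measurable M" for f t
  unfolding emN[OF that, of "{t<..}", simplified] distribution_def by (rule arg_cong[where f = "\<mu>"]) auto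
 have "N v = N w"
 proof (rule measure_eqI_generator_eq[where \<Omega> = UNIV and E = "range (\<lambda>a. {a<..})" and A = "\<lambda>i. {- real i<..}"])
  show "Int_stable (range (\<lambda>a::real. {a<..}))" unfolding Int_stable_def
  proof safe
   fix a c :: real
   have "{a<..} \<inter> {c<..} = {max a c<..}" by auto
   then show "{a<..} \<inter> {c<..} \<in> range (\<lambda>a. {a<..})" by blast
  qed
  show "sets (N v) = sigma_sets UNIV (range (\<lambda>a::real. {a<..}))" "sets (N w) = sigma_sets UNIV (range (\<lambda>a::real. {a<..}))"
   by (simp_all add: N_def borel_Ioi)
  show "emeasure (N v) E = emeasure (N w) E" if "E \<in> range (\<lambda>a::real. {a<..})" for E
   using that \<delta> by (auto simp: lev v w intro!: eq)
  show "(\<Union>i. {- real i<..}) = UNIV"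
  proof (intro set_eqI iffI UNIV_I)
   fix y :: real
   obtain i where "- y < real i" using reals_Archimedean2 by blast
   then show "y \<in> (\<Union>i. {- real i<..})" by (intro UN_I[of i]) auto
  qed
  show "emeasure (N v) {- real i<..} ~= \<infinity>" for i
   using lev[OF v, of "- real i"] fin \<delta> by (simp add: max_def)
 qed auto
 then show ?thesis using emN[OF v E] emN[OF w E] by simp
qed

text \<open>Values up to \<open>1 / (n + 1)\<close> are cut off first, because small values may
  occupy infinite volume. Since \<open>g 0 = 0\<close>, the full integral is recovered as
  \<open>n\<close> grows.\<close>

lemma nn_integral_equidistributed:
 assumes v: "v \<in> borel_measurable M" "!!z. z \<in> pts ==> 0 <= v z" "vanishes_at_infinity X v"
  and w: "w \<in> borel_measurable M" "!!z. z \<in> pts ==> 0 <= w z"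
  and eq: "!!t. 0 < t ==> distribution X v t = distribution X w t"
  and g: "g \<in> borel_measurable borel" "g 0 = (0::ennreal)"
 shows "(\<integral>M z. g (v z)) = (\<integral>M z. g (w z))"
proof -
 note [measurable] = v(1) w(1) g(1)
 let ?g = "\<lambda>n t. g t * indicator {1 / real (Suc n)<..} t"
 have lim: "(\<integral>M z. g (f z)) = (SUP n. \<integral>\<^sup>+z. ?g n (f z) \<partial>M)"
  if [measurable]: "f \<in> borel_measurable M" and f0: "!!z. z \<in> pts ==> 0 <= f z" for f
 proof -
  have "(\<integral>M z. g (f z)) = (\<integral>M z. (SUP n. ?g n (f z)))"
  proof (rule nn_integral_cong)
   fix z assume z: "z \<in> pts"
   show "g (f z) = (SUP n. ?g n (f z))"
   proof (cases "f z = 0")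
    case False
    then have "0 < f z" using f0[OF z] by simp
    then obtain n where n: "1 / real (Suc n) < f z" by (rule nat_approx_posE)
    show ?thesis
    proof (rule antisym)
     show "g (f z) <= (SUP n. ?g n (f z))" using n by (intro SUP_upper2[of n]) (auto simp del: of_nat_Suc)
     show "(SUP n. ?g n (f z)) <= g (f z)" by (intro SUP_least) (auto simp: indicator_def)
    qed
   qed (simp add: g(2))
  qed
  also have "... = (SUP n. \<integral>\<^sup>+z. ?g n (f z) \<partial>M)"
  proof (rule nn_integral_monotone_convergence_SUP)
   show "incseq (\<lambda>n z. ?g n (f z))"
   proof (rule incseq_SucI, rule le_funI)
    fix n z
    have "1 / real (Suc (Suc n)) <= 1 / real (Suc n)" by (intro divide_left_mono) auto
    then show "?g n (f z) <= ?g (Suc n) (f z)" by (auto simp: indicator_def simp del: of_nat_Suc)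
   qed
  qed measurable
  finally show ?thesis .
 qed
 have "(\<integral>M z. ?g n (v z)) = (\<integral>M z. ?g n (w z))" for n
 proof -
  let ?\<delta> = "1 / real (Suc n)"
  have tr: "(\<integral>M z. ?g n (f z)) = (\<integral>\<^sup>+t. g t \<partial>distr (density M (indicator {z \<in> pts. ?\<delta> < f z})) borel f)"
   if [measurable]: "f \<in> borel_measurable M" for f
  proof -
   have "(\<integral>\<^sup>+t. g t \<partial>distr (density M (indicator {z \<in> pts. ?\<delta> < f z})) borel f)
    = (\<integral>\<^sup>+z. g (f z) \<partial>density M (indicator {z \<in> pts. ?\<delta> < f z}))" by (rule nn_integral_distr) auto
   also have "... = (\<integral>M z. indicator {z \<in> pts. ?\<delta> < f z} z * g (f z))" by (rule nn_integral_density) auto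
   also have "... = (\<integral>M z. ?g n (f z))" by (intro nn_integral_cong) (auto simp: indicator_def simp del: of_nat_Suc)
   finally show ?thesis by simp
  qed
  have "distr (density M (indicator {z \<in> pts. ?\<delta> < v z})) borel v = distr (density M (indicator {z \<in> pts. ?\<delta> < w z})) borel w"
  proof (rule measure_eqI)
   fix E :: "real set" assume "E \<in> sets (distr (density M (indicator {z \<in> pts. ?\<delta> < v z})) borel v)"
   then have [measurable]: "E \<in> sets borel" by simp
   have em: "emeasure (distr (density M (indicator {z \<in> pts. ?\<delta> < f z})) borel f) E = \<mu> {z \<in> pts. ?\<delta> < f z \<and> f z \<in> E}"
    if [measurable]: "f \<in> borel_measurable M" for f
   proof -
    have "emeasure (distr (density M (indicator {z \<in> pts. ?\<delta> < f z})) borel f) E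
     = emeasure (density M (indicator {z \<in> pts. ?\<delta> < f z})) (f -` E \<inter> pts)" by (subst emeasure_distr) auto
    also have "... = (\<integral>M z. indicator {z \<in> pts. ?\<delta> < f z} z * indicator (f -` E \<inter> pts) z)"
     by (rule emeasure_density) measurable
    also have "... = (\<integral>M z. indicator {z \<in> pts. ?\<delta> < f z \<and> f z \<in> E} z)"
     by (intro nn_integral_cong) (auto simp: indicator_def simp del: of_nat_Suc)
    also have "... = \<mu> {z \<in> pts. ?\<delta> < f z \<and> f z \<in> E}" by (rule nn_integral_indicator) measurable
    finally show ?thesis .
   qed
   have "distribution X v ?\<delta> < \<infinity>" using v(3) unfolding vanishes_at_infinity_def by simp
   then show "emeasure (distr (density M (indicator {z \<in> pts. ?\<delta> < v z})) borel v) E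
    = emeasure (distr (density M (indicator {z \<in> pts. ?\<delta> < w z})) borel w) E"
    unfolding em[OF v(1)] em[OF w(1)] by (intro emeasure_eq_above v(1) w(1) eq) auto
  qed simp
  then show ?thesis by (simp only: tr[OF v(1)] tr[OF w(1)])
 qed
 then show ?thesis using lim[OF v(1,2)] lim[OF w] by simp
qed

text \<open>
 By homogeneity the kernel integrated over all variables but one is constant in the remaining variable.
\<close>

lemma one_variable_integral:
 obtains c where "!!g. g \<in> borel_measurable M ==>
  (\<integral>P p. g (p l) * ennreal (kernel_product X K p)) = c * (\<integral>M z. g z)"
proof -
 interpret product_sigma_finite "\<lambda>_::'m. M" by (rule product_sigma_finite_vol)
 let ?Q = "PiM (UNIV - {l}) (\<lambda>_::'m. M)"
 define c where "c z = (\<integral>\<^sup>+q. ennreal (kernel_product X K (q(l := z))) \<partial>?Q)" for z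
 have ins: "insert l (UNIV - {l}) = (UNIV :: 'm set)" by auto
 have Peq: "P = PiM (insert l (UNIV - {l})) (\<lambda>_. M)" unfolding ins vol_power_def ..
 have upd: "(\<lambda>(q, z). q(l := z)) \<in> ?Q \<Otimes>\<^sub>M M \<rightarrow>\<^sub>M P" unfolding Peq by (rule measurable_add_dim)
 have updz: "(\<lambda>q. q(l := z)) \<in> ?Q \<rightarrow>\<^sub>M P" if "z \<in> pts" for z
  using measurable_compose[OF measurable_Pair[OF measurable_ident measurable_const[OF that]] upd] by simp
 have km: "(\<lambda>q. ennreal (kernel_product X K (q(l := z)))) \<in> borel_measurable ?Q" if "z \<in> pts" for z
  using measurable_compose[OF updz[OF that] kernel_product_measurable] by (rule measurable_compose[OF _ measurable_ennreal])
 have const: "c x = c y" if x: "x \<in> pts" and y: "y \<in> pts" for x y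
 proof (cases "x = y")
  case False
  \<comment> \<open>Moving all other variables by the reflection that exchanges \<open>x\<close> and
    \<open>y\<close> changes neither their measure nor any distance.\<close>
  let ?T = "\<lambda>q. \<lambda>i\<in>UNIV - {l}. refl x y (q i)"
  have Tm: "?T \<in> ?Q \<rightarrow>\<^sub>M ?Q"
   by (intro measurable_restrict measurable_compose[OF measurable_component_singleton]) (auto intro: refl_measurable[OF x y False])
  have "distr ?Q ?Q ?T = ?Q"
   by (rule distr_PiM_componentwise) (auto intro: refl_measurable[OF x y False] refl_distr[OF x y False])
  then have "c y = (\<integral>\<^sup>+q. ennreal (kernel_product X K (q(l := y))) \<partial>distr ?Q ?Q ?T)" by (simp add: c_def)
  also have "... = (\<integral>\<^sup>+q. ennreal (kernel_product X K ((?T q)(l := y))) \<partial>?Q)"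
   by (rule nn_integral_distr[OF Tm]) (use km[OF y] in simp)
  also have "... = (\<integral>\<^sup>+q. ennreal (kernel_product X K (q(l := x))) \<partial>?Q)"
  proof (intro nn_integral_cong arg_cong[where f = ennreal])
   fix q assume "q \<in> space ?Q"
   then have qM: "q i \<in> pts" if "i ~= l" for i using that by (auto simp: space_PiM PiE_def Pi_def)
   have T: "((?T q)(l := y)) i = refl x y ((q(l := x)) i)" "(q(l := x)) i \<in> pts" for i
    using refl_swap[OF x y False] qM x by auto
   show "kernel_product X K ((?T q)(l := y)) = kernel_product X K (q(l := x))"
    unfolding kernel_product_def T(1) using refl_dist[OF x y False T(2) T(2)] by simp
  qed
  finally show ?thesis by (simp add: c_def)
 qed simp
 show thesis
 proof (rule that[of "c b"])
  fix g :: "'a => ennreal" assume g[measurable]: "g \<in> borel_measurable M"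
  have "(\<integral>P p. g (p l) * ennreal (kernel_product X K p))
   = (\<integral>M z. (\<integral>\<^sup>+q. g ((q(l := z)) l) * ennreal (kernel_product X K (q(l := z))) \<partial>?Q))"
  proof -
   have "(\<lambda>p. g (p l) * ennreal (kernel_product X K p)) \<in> borel_measurable P" by measurable
   then show ?thesis unfolding Peq by (intro product_nn_integral_insert_rev) simp_all
  qed
  also have "... = (\<integral>M z. c b * g z)"
  proof (rule nn_integral_cong)
   fix z assume z: "z \<in> pts"
   have "(\<integral>\<^sup>+q. g ((q(l := z)) l) * ennreal (kernel_product X K (q(l := z))) \<partial>?Q) = g z * c z"
    unfolding c_def using km[OF z] by (subst nn_integral_cmult[symmetric]) auto
   then show "(\<integral>\<^sup>+q. g ((q(l := z)) l) * ennreal (kernel_product X K (q(l := z))) \<partial>?Q) = c b * g z"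
    using const[OF z base_in] by (simp add: mult.commute)
  qed
  also have "... = c b * (\<integral>M z. g z)" by (rule nn_integral_cmult) measurable
  finally show "(\<integral>P p. g (p l) * ennreal (kernel_product X K p)) = c b * (\<integral>M z. g z)" .
 qed
qed

end

section \<open>Density and transitivity\<close>

context reflection_model begin

lemma AE_eq_of_nn_integral_le:
 assumes [measurable]: "f \<in> borel_measurable M" "g \<in> borel_measurable M"
  and le: "AE z in M. f z <= g z" and int: "(\<integral>M z. g z) <= (\<integral>M z. f z)" "(\<integral>M z. f z) < \<infinity>"
 shows "AE z in M. g z = (f z :: ennreal)"
proof -
 have "(\<integral>M z. g z - f z) = (\<integral>M z. g z) - (\<integral>M z. f z)"
  using int by (intro nn_integral_diff le) auto
 also have "... = 0" using int by (simp add: diff_eq_0_iff_ennreal)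
 finally have "AE z in M. g z - f z = 0" by (subst (asm) nn_integral_0_iff_AE) auto
 with le show ?thesis
 proof eventually_elim
  case (elim z)
  then have "g z <= f z" by (simp add: diff_eq_0_iff_ennreal)
  with elim show ?case by (auto intro: antisym)
 qed
qed

lemma AE_refl:
 assumes x: "x \<in> pts" and y: "y \<in> pts" and xy: "x ~= y" and AE: "AE z in M. Q z"
 shows "AE z in M. Q (refl x y z)"
proof -
 obtain N where N: "N \<in> sets M" "\<mu> N = 0" "{z \<in> pts. \<not> Q z} \<subseteq> N" using AE by (auto elim!: AE_E)
 have "\<mu> {z \<in> pts. refl x y z \<in> N} = 0" using emeasure_refl[OF x y xy N(1)] N(2) by simp
 moreover have "{z \<in> pts. refl x y z \<in> N} \<in> sets M"
  using refl_measurable[OF x y xy] N(1) by measurable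
 ultimately have "{z \<in> pts. refl x y z \<in> N} \<in> null_sets M" by auto
 then show ?thesis by (rule AE_I') (use N(3) refl_in[OF x y xy] in auto)
qed

text \<open>A weak density theorem by Fubini. If every ball of radius \<open>\<rho>\<close> centered
  within \<open>\<rho>\<close> of \<open>C\<close> had at most \<open>3 / 4\<close> of its volume in
  \<open>A\<close>, then \<open>C\<close> would have at most \<open>3 / 4\<close> of the volume of a
  neighbourhood, which is itself at most \<open>5 / 4\<close> of that of \<open>C\<close>; but
  \<open>15 / 16 < 1\<close>. The conclusion covers all small radii, so two sets can be treated with
  a common radius.\<close>

lemma density_cells:
 assumes A: "A \<in> sets M" "0 < \<mu> A"
 obtains C \<rho>0 where "compact C" "C \<subseteq> A" "0 < \<rho>0"
  "!!\<rho>. 0 < \<rho> ==> \<rho> <= \<rho>0 ==> \<exists>x\<in>pts. (\<exists>c\<in>C. d x c < \<rho>) \<and>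
    3 / 4 * measure M (cell b \<rho>) < measure M (A \<inter> cell x \<rho>)"
proof -
 interpret pair_sigma_finite M M ..
 have "(SUP n. \<mu> (A \<inter> cell b (real n))) = \<mu> (\<Union>n. A \<inter> cell b (real n))"
  using A(1) cell_sets[OF base_in] by (intro SUP_emeasure_incseq) (auto intro!: incseq_SucI cell_mono[THEN subsetD] simp: cell_def)
 also have "(\<Union>n. A \<inter> cell b (real n)) = A"
  using sets.sets_into_space[OF A(1)] reals_Archimedean2 by (fastforce simp: cell_def)
 finally have "0 < (SUP n. \<mu> (A \<inter> cell b (real n)))" using A(2) by simp
 then obtain n where n: "0 < \<mu> (A \<inter> cell b (real n))" by (auto simp: less_SUP_iff)
 define A' where "A' = A \<inter> cell b (real n)"
 have A'm: "A' \<in> sets M" using A(1) cell_sets[OF base_in] by (auto simp: A'_def)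
 have A'fin: "\<mu> A' < \<infinity>"
  using emeasure_mono[of A' "cell b (real n)" M] emeasure_cell_finite[OF base_in, of "real n"] cell_sets[OF base_in]
  by (auto simp: A'_def order_le_less_trans)
 have mA': "\<mu> A' = ennreal (measure M A')" using A'fin by (simp add: emeasure_eq_ennreal_measure)
 have posA': "0 < measure M A'" using n mA' by (simp add: A'_def)
 obtain C where C: "C \<subseteq> A'" "compact C" "\<mu> (A' - C) < ennreal (measure M A')"
  using inner_regular_vol[OF A'm A'fin posA'] by auto
 have CM: "C \<subseteq> pts" "C \<subseteq> cell b (real n)" using C(1) sets.sets_into_space[OF A'm] by (auto simp: A'_def)
 have Cm[measurable]: "C \<in> sets M"
  using sets_vol[of C] C(2) CM(1) borel_compact[of C] by (auto simp: Int_absorb2)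
 have Cfin: "\<mu> C < \<infinity>" using emeasure_mono[OF C(1) A'm] A'fin by (rule order_le_less_trans)
 have "\<mu> C ~= 0"
 proof
  assume "\<mu> C = 0"
  then have "\<mu> (A' - C) = \<mu> A'" using A'm Cm by (intro emeasure_Diff_null_set) auto
  then show False using C(3) mA' by simp
 qed
 then have mC: "0 < measure M C" using Cfin by (simp add: measure_def enn2real_positive_iff zero_less_iff_neq_zero)
 then have Cne: "C ~= {}" by auto
 obtain V \<eta> where V: "0 < \<eta>" "V \<in> sets M" "!!z. z \<in> pts ==> (\<exists>c\<in>C. d z c < \<eta>) ==> z \<in> V"
  "\<mu> V < \<mu> C + ennreal (measure M C / 4)"
  by (rule compact_neighbourhood[OF C(2) CM, of "measure M C / 4"]) (use mC in auto)
 show thesis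
 proof (rule that[OF C(2) _ V(1)])
  show "C \<subseteq> A" using C(1) by (auto simp: A'_def)
  fix \<rho> assume \<rho>: "0 < \<rho>" "\<rho> <= \<eta>"
  let ?v = "\<mu> (cell b \<rho>)"
  have v: "0 < ?v" "?v < \<infinity>" "?v = ennreal (measure M (cell b \<rho>))"
   using emeasure_cell_pos[OF base_in \<rho>(1)] emeasure_cell_finite[OF base_in, of \<rho>] by (auto simp: emeasure_eq_ennreal_measure)
  show "\<exists>x\<in>pts. (\<exists>c\<in>C. d x c < \<rho>) \<and> 3 / 4 * measure M (cell b \<rho>) < measure M (A \<inter> cell x \<rho>)"
  proof (rule ccontr)
   assume "\<not> ?thesis"
   then have no: "measure M (A \<inter> cell x \<rho>) <= 3 / 4 * measure M (cell b \<rho>)" if "x \<in> pts" "c \<in> C" "d x c < \<rho>" for x c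
    using that by force
   have "\<mu> C * ?v = (\<integral>M z. indicator C z * ?v)" by (subst nn_integral_multc) auto
   also have "... = (\<integral>M z. (\<integral>M x. indicator C z * indicator {x \<in> pts. d z x < \<rho>} x))"
   proof (rule nn_integral_cong)
    fix z assume z: "z \<in> pts"
    have "(\<integral>M x. indicator C z * indicator {x \<in> pts. d z x < \<rho>} x) = indicator C z * \<mu> (cell z \<rho>)"
     using z cell_sets[OF z] by (subst nn_integral_cmult) (auto simp: cell_def[symmetric])
    then show "indicator C z * ?v = (\<integral>M x. indicator C z * indicator {x \<in> pts. d z x < \<rho>} x)"
     using emeasure_cell[OF z base_in] by simp
   qed
   also have "... = (\<integral>M z. (\<integral>M x. (\<lambda>(x, z). indicator C z * indicator {p \<in> space (M \<Otimes>\<^sub>M M). d (snd p) (fst p) < \<rho>} (x, z)) (x, z)))"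
    by (intro nn_integral_cong) (auto simp: indicator_def space_pair_measure intro!: nn_integral_cong)
   also have "... = (\<integral>M x. (\<integral>M z. (\<lambda>(x, z). indicator C z * indicator {p \<in> space (M \<Otimes>\<^sub>M M). d (snd p) (fst p) < \<rho>} (x, z)) (x, z)))"
    by (rule Fubini') measurable
   also have "... = (\<integral>M x. \<mu> (C \<inter> cell x \<rho>))"
   proof (rule nn_integral_cong)
    fix x assume x: "x \<in> pts"
    have "(\<integral>M z. (\<lambda>(x, z). indicator C z * indicator {p \<in> space (M \<Otimes>\<^sub>M M). d (snd p) (fst p) < \<rho>} (x, z)) (x, z))
     = (\<integral>M z. indicator (C \<inter> cell x \<rho>) z)"
     using x dist_sym[OF x] CM by (intro nn_integral_cong) (auto simp: indicator_def space_pair_measure cell_def)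
    then show "(\<integral>M z. (\<lambda>(x, z). indicator C z * indicator {p \<in> space (M \<Otimes>\<^sub>M M). d (snd p) (fst p) < \<rho>} (x, z)) (x, z))
     = \<mu> (C \<inter> cell x \<rho>)" using cell_sets[OF x] by simp
   qed
   also have "... <= (\<integral>M x. ennreal (3 / 4 * measure M (cell b \<rho>)) * indicator V x)"
   proof (rule nn_integral_mono)
    fix x assume x: "x \<in> pts"
    show "\<mu> (C \<inter> cell x \<rho>) <= ennreal (3 / 4 * measure M (cell b \<rho>)) * indicator V x"
    proof (cases "\<exists>c\<in>C. d x c < \<rho>")
     case False
     then have "C \<inter> cell x \<rho> = {}" by (auto simp: cell_def)
     then show ?thesis by simp
    next
     case True
     then obtain c where c: "c \<in> C" "d x c < \<rho>" by auto
     have "\<mu> (C \<inter> cell x \<rho>) <= \<mu> (A \<inter> cell x \<rho>)"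
      using A(1) C(1) cell_sets[OF x] by (intro emeasure_mono) (auto simp: A'_def)
     also have "... = ennreal (measure M (A \<inter> cell x \<rho>))"
      using emeasure_mono[of "A \<inter> cell x \<rho>" "cell x \<rho>" M] emeasure_cell_finite[OF x, of \<rho>] cell_sets[OF x]
      by (intro emeasure_eq_ennreal_measure) (auto simp: top_unique)
     also have "... <= ennreal (3 / 4 * measure M (cell b \<rho>))" by (rule ennreal_leI[OF no[OF x c]])
     finally show ?thesis using V(3)[OF x] c \<rho> by force
    qed
   qed
   also have "... = ennreal (3 / 4 * measure M (cell b \<rho>)) * \<mu> V"
    using V(2) by (rule nn_integral_cmult_indicator)
   also have "... <= ennreal (3 / 4 * measure M (cell b \<rho>)) * ennreal (measure M C + measure M C / 4)"
   proof (rule mult_left_mono)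
    have "\<mu> C = ennreal (measure M C)" using Cfin by (simp add: emeasure_eq_ennreal_measure)
    then have "\<mu> V < ennreal (measure M C) + ennreal (measure M C / 4)" using V(4) by simp
    then show "\<mu> V <= ennreal (measure M C + measure M C / 4)"
     by (subst ennreal_plus) (auto intro: less_imp_le)
   qed simp
   finally have "ennreal (measure M C) * ennreal (measure M (cell b \<rho>))
     <= ennreal (3 / 4 * measure M (cell b \<rho>)) * ennreal (measure M C + measure M C / 4)"
    using Cfin v(3) by (simp add: emeasure_eq_ennreal_measure)
   then have "ennreal (measure M C * measure M (cell b \<rho>))
     <= ennreal ((3 / 4 * measure M (cell b \<rho>)) * (measure M C + measure M C / 4))"
    using mC by (simp only: ennreal_mult measure_nonneg less_imp_le add_nonneg_nonneg divide_nonneg_nonneg mult_nonneg_nonneg zero_le_numeral)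
   then have "measure M C * measure M (cell b \<rho>) <= (3 / 4 * measure M (cell b \<rho>)) * (measure M C + measure M C / 4)"
    using mC by (subst (asm) ennreal_le_iff) auto
   then have "measure M C * measure M (cell b \<rho>) <= 15 / 16 * (measure M C * measure M (cell b \<rho>))" by (simp add: algebra_simps)
   moreover have "0 < measure M C * measure M (cell b \<rho>)" using mC v by simp
   ultimately show False by linarith
  qed
 qed
qed

text \<open>
 A set invariant under all reflections moving a fixed point into some ball is invariant on the level of
 densities under a transitive group, hence null or conull.
\<close>

lemma invariant_set_trivial:
 assumes B: "B \<in> sets M" and x: "x \<in> pts" and y: "y \<in> pts" and \<epsilon>: "0 < \<epsilon>" "x \<notin> cell y \<epsilon>"
  and inv: "!!y'. y' \<in> cell y \<epsilon> ==> AE z in M. refl x y' z \<in> B \<longleftrightarrow> z \<in> B"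
 shows "\<mu> B = 0 \<or> \<mu> (pts - B) = 0"
proof (rule ccontr)
 assume contra: "\<not> ?thesis"
 have cM: "y' \<in> pts \<and> x ~= y'" if "y' \<in> cell y \<epsilon>" for y' using that \<epsilon>(2) by (auto simp: cell_def)
 define r where "r = {(p, refl x y' p) | p y'. p \<in> pts \<and> y' \<in> cell y \<epsilon>}"
 have r_space: "q \<in> pts" if "(p, q) \<in> r" for p q using that refl_in[OF x] cM by (auto simp: r_def)
 \<comment> \<open>An admissible reflection preserves \<open>B\<close> up to a null set and carries
   balls to balls, so the share of \<open>B\<close> in a ball of given radius is constant along the
   relation.\<close>
 have r_cell: "\<mu> (B \<inter> cell q \<rho>) = \<mu> (B \<inter> cell p \<rho>)" if pq: "(p, q) \<in> r" for p q \<rho>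
 proof -
  obtain y' where y': "y' \<in> cell y \<epsilon>" "q = refl x y' p" "p \<in> pts" using pq by (auto simp: r_def)
  have y'M: "y' \<in> pts" "x ~= y'" using cM[OF y'(1)] by auto
  have q: "q \<in> pts" using r_space[OF pq] .
  have pre[measurable]: "{z \<in> pts. refl x y' z \<in> B \<inter> cell q \<rho>} \<in> sets M"
   using refl_measurable[OF x y'M] B cell_sets[OF q] by measurable
  have "\<mu> (B \<inter> cell q \<rho>) = \<mu> {z \<in> pts. refl x y' z \<in> B \<inter> cell q \<rho>}"
   using emeasure_refl[OF x y'M, of "B \<inter> cell q \<rho>"] B cell_sets[OF q] by simp
  also have "... = \<mu> (B \<inter> cell p \<rho>)"
  proof (rule emeasure_eq_AE)
   show "AE z in M. z \<in> {z \<in> pts. refl x y' z \<in> B \<inter> cell q \<rho>} \<longleftrightarrow> z \<in> B \<inter> cell p \<rho>"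
    using inv[OF y'(1)] AE_space by eventually_elim (use refl_cell[OF x y'M y'(3)] y'(2) in auto)
  qed (use pre B cell_sets[OF y'(3)] in auto)
  finally show ?thesis .
 qed
 have r_sym: "sym r"
 proof (rule symI)
  fix p q assume pq: "(p, q) \<in> r"
  then obtain y' where y': "y' \<in> cell y \<epsilon>" "q = refl x y' p" "p \<in> pts" by (auto simp: r_def)
  then have "p = refl x y' q" using refl_refl[OF x _ _ y'(3)] cM by auto
  then show "(q, p) \<in> r" using y' r_space[OF pq] by (auto simp: r_def)
 qed
 define Orb where "Orb = {p. (x, p) \<in> r\<^sup>*}"
 have Orb: "p \<in> pts \<and> (\<forall>\<rho>. \<mu> (B \<inter> cell p \<rho>) = \<mu> (B \<inter> cell x \<rho>)) \<and> cell p \<epsilon> \<subseteq> Orb" if p: "p \<in> Orb" for p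
 proof -
  have "(x, p) \<in> r\<^sup>*" using p by (simp add: Orb_def)
  then show ?thesis
  proof (induction rule: rtrancl_induct)
   case base
   \<comment> \<open>Two admissible reflections lead from \<open>x\<close> to \<open>q\<close>: the
     one exchanging \<open>x\<close> with the mirror image \<open>q'\<close> of \<open>q\<close>,
     followed by \<open>refl x y\<close>.\<close>
   have "cell x \<epsilon> \<subseteq> Orb"
   proof
    fix q assume q: "q \<in> cell x \<epsilon>"
    have y0: "y \<in> cell y \<epsilon>" "x ~= y" using y \<epsilon> by (auto simp: cell_def)
    have qM: "q \<in> pts" using q by (simp add: cell_def)
    define q' where "q' = refl x y q"
    have q': "q' \<in> cell y \<epsilon>" unfolding q'_def
     using refl_cell[OF x y y0(2) x qM, of \<epsilon>] q refl_swap[OF x y y0(2)] by simp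
    have "(x, q') \<in> r" using q' x refl_swap[OF x] cM[OF q'] unfolding r_def by force
    moreover have "(q', q) \<in> r" using refl_refl[OF x y y0(2) qM] y0(1) cM[OF q'] unfolding r_def q'_def by force
    ultimately show "q \<in> Orb" by (auto simp: Orb_def intro: rtrancl_into_rtrancl)
   qed
   then show ?case using x by simp
  next
   case (step p q)
   obtain y' where y': "y' \<in> cell y \<epsilon>" "q = refl x y' p" "p \<in> pts" using step(2) by (auto simp: r_def)
   have y'M: "y' \<in> pts" "x ~= y'" using cM[OF y'(1)] by auto
   have "cell q \<epsilon> \<subseteq> Orb"
   proof
    fix w assume w: "w \<in> cell q \<epsilon>"
    have wM: "w \<in> pts" using w by (simp add: cell_def)
    have w'M: "refl x y' w \<in> pts" using refl_in[OF x y'M wM] .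
    have "refl x y' w \<in> cell p \<epsilon>"
     using refl_cell[OF x y'M y'(3) w'M, of \<epsilon>] w y'(2) refl_refl[OF x y'M wM] by simp
    then have "(x, refl x y' w) \<in> r\<^sup>*" using step by (auto simp: Orb_def)
    moreover have "(refl x y' w, w) \<in> r" using y'(1) w'M refl_refl[OF x y'M wM] unfolding r_def by force
    ultimately show "w \<in> Orb" by (auto simp: Orb_def intro: rtrancl_into_rtrancl)
   qed
   then show ?case using step r_space[OF step(2)] r_cell[OF step(2)] by simp
  qed
 qed
 have open_cell: "openin (top_of_set (pts)) (cell p e)" if p: "p \<in> pts" for p e
 proof -
  have "continuous_on (pts) (\<lambda>w. (\<lambda>(x, y). d x y) (p, w))"
   using p by (intro continuous_on_compose2[OF dist_continuous] continuous_intros) auto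
  then have "continuous_on (pts) (d p)" by simp
  then have "openin (top_of_set (pts)) (pts \<inter> d p -` {..<e})" by (intro continuous_openin_preimage_gen) auto
  moreover have "pts \<inter> d p -` {..<e} = cell p e" by (auto simp: cell_def)
  ultimately show ?thesis by simp
 qed
 have self: "p \<in> cell p \<epsilon>" if "p \<in> pts" for p using that \<epsilon> by (simp add: cell_def)
 \<comment> \<open>With each point the orbit contains the ball of fixed radius
   \<open>\<epsilon>\<close> about it. So the orbit and its complement are open, and connectedness
   makes the orbit the whole space.\<close>
 have "openin (top_of_set (pts)) Orb"
 proof (subst openin_subopen, intro ballI)
  fix p assume p: "p \<in> Orb"
  show "\<exists>T. openin (top_of_set (pts)) T \<and> p \<in> T \<and> T \<subseteq> Orb"
   using Orb[OF p] open_cell[of p \<epsilon>] self by (intro exI[of _ "cell p \<epsilon>"]) auto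
 qed
 moreover have "openin (top_of_set (pts)) (pts - Orb)"
 proof (subst openin_subopen, intro ballI)
  fix p assume p: "p \<in> pts - Orb"
  have "cell p \<epsilon> \<subseteq> pts - Orb"
  proof
   fix q assume q: "q \<in> cell p \<epsilon>"
   then have "p \<in> cell q \<epsilon>" using p dist_sym by (auto simp: cell_def)
   then show "q \<in> pts - Orb" using Orb[of q] p q by (auto simp: cell_def)
  qed
  then show "\<exists>T. openin (top_of_set (pts)) T \<and> p \<in> T \<and> T \<subseteq> pts - Orb"
   using p open_cell[of p \<epsilon>] self by (intro exI[of _ "cell p \<epsilon>"]) auto
 qed
 moreover have "Orb \<subseteq> pts" using Orb by auto
 ultimately have "Orb = {} \<or> Orb = pts"
  using connected_points unfolding connected_clopen closedin_def by (simp add: topspace_subtopology)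
 moreover have "x \<in> Orb" by (simp add: Orb_def)
 ultimately have all: "Orb = pts" by auto
 have Bc: "pts - B \<in> sets M" using B by auto
 have pos: "0 < \<mu> B" "0 < \<mu> (pts - B)" using contra by (auto simp: zero_less_iff_neq_zero)
 obtain C1 \<rho>1 where "compact C1" "C1 \<subseteq> B" and 1: "0 < \<rho>1" "!!\<rho>. 0 < \<rho> ==> \<rho> <= \<rho>1 ==> \<exists>x\<in>pts. (\<exists>c\<in>C1. d x c < \<rho>) \<and>
    3 / 4 * measure M (cell b \<rho>) < measure M (B \<inter> cell x \<rho>)"
  by (rule density_cells[OF B pos(1)]) (rule that)
 obtain C2 \<rho>2 where "compact C2" "C2 \<subseteq> pts - B" and 2: "0 < \<rho>2" "!!\<rho>. 0 < \<rho> ==> \<rho> <= \<rho>2 ==> \<exists>x\<in>pts. (\<exists>c\<in>C2. d x c < \<rho>) \<and>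
    3 / 4 * measure M (cell b \<rho>) < measure M ((pts - B) \<inter> cell x \<rho>)"
  by (rule density_cells[OF Bc pos(2)]) (rule that)
 \<comment> \<open>One ball is filled to more than \<open>3 / 4\<close> by \<open>B\<close> and
   another of the same radius by its complement, although \<open>B\<close> has the same share in
   both.\<close>
 define \<rho> where "\<rho> = min \<rho>1 \<rho>2"
 have \<rho>: "0 < \<rho>" "\<rho> <= \<rho>1" "\<rho> <= \<rho>2" using 1(1) 2(1) by (auto simp: \<rho>_def)
 obtain p where p: "p \<in> pts" "3 / 4 * measure M (cell b \<rho>) < measure M (B \<inter> cell p \<rho>)" using 1(2)[OF \<rho>(1,2)] by auto
 obtain q where q: "q \<in> pts" "3 / 4 * measure M (cell b \<rho>) < measure M ((pts - B) \<inter> cell q \<rho>)" using 2(2)[OF \<rho>(1,3)] by auto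
 have "\<mu> (B \<inter> cell p \<rho>) = \<mu> (B \<inter> cell q \<rho>)" using Orb[of p] Orb[of q] all p q by simp
 then have "measure M (B \<inter> cell p \<rho>) = measure M (B \<inter> cell q \<rho>)" by (simp add: measure_def)
 moreover have "measure M (B \<inter> cell q \<rho>) + measure M ((pts - B) \<inter> cell q \<rho>) = measure M (cell q \<rho>)"
 proof -
  have f: "cell q \<rho> \<in> fmeasurable M" using cell_sets[OF q(1)] emeasure_cell_finite[OF q(1), of \<rho>] by (auto simp: fmeasurable_def)
  have "cell q \<rho> = (B \<inter> cell q \<rho>) \<union> ((pts - B) \<inter> cell q \<rho>)" by (auto simp: cell_def)
  then have "measure M (cell q \<rho>) = measure M ((B \<inter> cell q \<rho>) \<union> ((pts - B) \<inter> cell q \<rho>))" by simp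
  also have "... = measure M (B \<inter> cell q \<rho>) + measure M ((pts - B) \<inter> cell q \<rho>)
    - measure M ((B \<inter> cell q \<rho>) \<inter> ((pts - B) \<inter> cell q \<rho>))"
   using f B Bc by (intro measure_Un3) (auto intro: fmeasurable_Int_fmeasurable simp: Int_commute[of _ "cell q \<rho>"])
  also have "(B \<inter> cell q \<rho>) \<inter> ((pts - B) \<inter> cell q \<rho>) = {}" by auto
  finally show ?thesis by simp
 qed
 moreover have "measure M (cell q \<rho>) = measure M (cell b \<rho>)" using emeasure_cell[OF q(1) base_in] by (simp add: measure_def)
 moreover have "0 <= measure M (cell b \<rho>)" by simp
 ultimately show False using p(2) q(2) by linarith
qed

text \<open>Density provides a ball about \<open>x\<close>, well inside the sphere, mostly filled by
  \<open>A\<close>, and one of the same radius about \<open>y\<close>, well outside, mostly filled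
  by \<open>B\<close>. The reflection exchanging \<open>x\<close> and \<open>y'\<close> lays one
  over the other, and the shares of \<open>A\<close> and of the reflected \<open>B\<close> add up to
  more than 1. Moving \<open>y'\<close> a little away from \<open>y\<close> costs little, which
  gives a whole ball of reflections.\<close>

lemma reflections_across_sphere:
 assumes a: "a \<in> pts" and A: "A \<in> sets M" and B: "B \<in> sets M"
  and posA: "0 < \<mu> (A \<inter> cell a s)" and posB: "0 < \<mu> {z \<in> B. s < d a z}"
 obtains x y \<epsilon> where "x \<in> pts" "y \<in> pts" "0 < \<epsilon>" "x \<notin> cell y \<epsilon>"
  "!!y'. y' \<in> cell y \<epsilon> ==> d a x < d a y'"
  "!!y'. y' \<in> cell y \<epsilon> ==> 0 < \<mu> {z \<in> pts. d z x < d z y' \<and> z \<in> A \<and> refl x y' z \<in> B}"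
proof -
 have [measurable]: "(\<lambda>z. d a z) \<in> borel_measurable M" using a by measurable
 have B'eq: "{z \<in> B. s < d a z} = B \<inter> {z \<in> pts. s < d a z}" using sets.sets_into_space[OF B] by auto
 have B'm: "{z \<in> B. s < d a z} \<in> sets M" unfolding B'eq using B by measurable
 have A'm: "A \<inter> cell a s \<in> sets M" using A cell_sets[OF a] by auto
 obtain C1 \<rho>1 where 1: "compact C1" "C1 \<subseteq> A \<inter> cell a s" "0 < \<rho>1" "!!\<rho>. 0 < \<rho> ==> \<rho> <= \<rho>1 ==> \<exists>x\<in>pts. (\<exists>c\<in>C1. d x c < \<rho>) \<and>
    3 / 4 * measure M (cell b \<rho>) < measure M (A \<inter> cell a s \<inter> cell x \<rho>)"
  by (rule density_cells[OF A'm posA]) (rule that)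
 obtain C2 \<rho>2 where 2: "compact C2" "C2 \<subseteq> {z \<in> B. s < d a z}" "0 < \<rho>2" "!!\<rho>. 0 < \<rho> ==> \<rho> <= \<rho>2 ==> \<exists>x\<in>pts. (\<exists>c\<in>C2. d x c < \<rho>) \<and>
    3 / 4 * measure M (cell b \<rho>) < measure M ({z \<in> B. s < d a z} \<inter> cell x \<rho>)"
  by (rule density_cells[OF B'm posB]) (rule that)
 have C1M: "C1 \<subseteq> pts" "C2 \<subseteq> pts" using 1(2) 2(2) sets.sets_into_space[OF A] sets.sets_into_space[OF B] by auto
 have cont: "continuous_on C (d a)" if "C \<subseteq> pts" for C
 proof -
  have "continuous_on C (\<lambda>w. (\<lambda>(x, y). d x y) (a, w))"
   using a that by (intro continuous_on_compose2[OF dist_continuous] continuous_intros) auto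
  then show ?thesis by simp
 qed
 have ne: "C1 ~= {}" "C2 ~= {}" using 1(4)[OF 1(3)] 2(4)[OF 2(3)] by auto
 obtain c1 where c1: "c1 \<in> C1" "!!c. c \<in> C1 ==> d a c <= d a c1"
  using continuous_attains_sup[OF 1(1) ne(1) cont[OF C1M(1)]] by auto
 obtain c2 where c2: "c2 \<in> C2" "!!c. c \<in> C2 ==> d a c2 <= d a c"
  using continuous_attains_inf[OF 2(1) ne(2) cont[OF C1M(2)]] by auto
 \<comment> \<open>The gap between the sphere of radius \<open>s\<close> and the two compact sets;
   most of it survives the passage from their points to the nearby centers.\<close>
 define \<delta> where "\<delta> = min (s - d a c1) (d a c2 - s)"
 have \<delta>: "0 < \<delta>" "d a c1 <= s - \<delta>" "s + \<delta> <= d a c2" using c1(1) c2(1) 1(2) 2(2) by (auto simp: \<delta>_def cell_def)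
 define \<rho> where "\<rho> = min (\<delta> / 4) (min \<rho>1 \<rho>2)"
 have \<rho>: "0 < \<rho>" "\<rho> <= \<delta> / 4" "\<rho> <= \<rho>1" "\<rho> <= \<rho>2" using \<delta>(1) 1(3) 2(3) by (auto simp: \<rho>_def)
 obtain x where x: "x \<in> pts" "\<exists>c\<in>C1. d x c < \<rho>" "3 / 4 * measure M (cell b \<rho>) < measure M (A \<inter> cell a s \<inter> cell x \<rho>)"
  using 1(4)[OF \<rho>(1,3)] by blast
 obtain y where y: "y \<in> pts" "\<exists>c\<in>C2. d y c < \<rho>" "3 / 4 * measure M (cell b \<rho>) < measure M ({z \<in> B. s < d a z} \<inter> cell y \<rho>)"
  using 2(4)[OF \<rho>(1,4)] by blast
 have dx: "d a x < s - 3 / 4 * \<delta>"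
 proof -
  obtain c where c: "c \<in> C1" "d x c < \<rho>" using x(2) by auto
  then show ?thesis using dist_triangle[of a c x] dist_sym[of c x] c1(2)[OF c(1)] a x(1) C1M \<delta> \<rho> by auto
 qed
 have dy: "s + 3 / 4 * \<delta> < d a y"
 proof -
  obtain c where c: "c \<in> C2" "d y c < \<rho>" using y(2) by auto
  then show ?thesis using dist_triangle[of a y c] c2(2)[OF c(1)] a y(1) C1M \<delta> \<rho> by auto
 qed
 let ?V = "\<lambda>t. measure M {z \<in> pts. d b z <= t}"
 have mcell: "measure M (cell p t) = ?V t" if "p \<in> pts" for p t
  using emeasure_cell[OF that base_in, of t] emeasure_cell_eq_volume[of t] by (simp add: measure_def)
 have v: "0 < ?V \<rho>" using emeasure_cell_pos[OF base_in \<rho>(1)] emeasure_cell_eq_volume[of \<rho>] by simp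
 have "\<forall>\<^sub>F t in at \<rho>. ?V \<rho> - ?V \<rho> / 4 < ?V t"
  using volume_isCont[of \<rho>] v by (intro order_tendstoD(1)[where y = "?V \<rho>"]) (auto simp: isCont_def)
 then obtain \<epsilon>0 where \<epsilon>0: "0 < \<epsilon>0" "!!t. t ~= \<rho> ==> dist t \<rho> < \<epsilon>0 ==> ?V \<rho> - ?V \<rho> / 4 < ?V t" by (auto simp: eventually_at)
 \<comment> \<open>So small that reducing the radius by \<open>\<epsilon>\<close> loses less than a
   quarter of the ball. Then \<open>B\<close> still fills more than \<open>1 / 2\<close> of the ball
   about \<open>y'\<close>, against more than \<open>3 / 4\<close> for \<open>A\<close> about
   \<open>x\<close>.\<close>
 define \<epsilon> where "\<epsilon> = min (\<epsilon>0 / 2) (\<delta> / 4)"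
 have \<epsilon>: "0 < \<epsilon>" "\<epsilon> <= \<delta> / 4" "\<epsilon> < \<epsilon>0" using \<epsilon>0(1) \<delta>(1) by (auto simp: \<epsilon>_def)
 have Ve: "3 / 4 * ?V \<rho> < ?V (\<rho> - \<epsilon>)" using \<epsilon>0(2)[of "\<rho> - \<epsilon>"] \<epsilon> by (simp add: dist_real_def)
 have dy': "s + \<delta> / 2 < d a y'" if "y' \<in> cell y \<epsilon>" for y'
  using dist_triangle[of a y' y] dist_sym[of y' y] that a y(1) dy \<epsilon>(2) by (auto simp: cell_def)
 have fm: "D \<inter> cell p t \<in> fmeasurable M" if "D \<in> sets M" "p \<in> pts" for D p t
 proof -
  have "cell p t \<in> fmeasurable M" using cell_sets[OF that(2)] emeasure_cell_finite[OF that(2), of t] by (auto simp: fmeasurable_def)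
  then show ?thesis using that(1) by (metis Int_commute fmeasurable_Int_fmeasurable)
 qed
 show thesis
 proof (rule that[OF x(1) y(1) \<epsilon>(1)])
  show "x \<notin> cell y \<epsilon>" using dy'[of x] dx \<delta>(1) by auto
  fix y' assume y': "y' \<in> cell y \<epsilon>"
  show lt: "d a x < d a y'" using dy'[OF y'] dx \<delta>(1) by simp
  have y'M: "y' \<in> pts" using y' by (simp add: cell_def)
  have ne: "x ~= y'" using lt by auto
  let ?s = "refl x y'"
  note [measurable] = refl_measurable[OF x(1) y'M ne]
  define S where "S = A \<inter> cell x \<rho>"
  define T where "T = {z \<in> pts. ?s z \<in> B \<inter> cell y' \<rho>}"
  have Tm: "T \<in> sets M" unfolding T_def using B cell_sets[OF y'M] by measurable
  have Sf: "S \<in> fmeasurable M" unfolding S_def by (rule fm[OF A x(1)])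
  have Tc: "T \<subseteq> cell x \<rho>" unfolding T_def
   using refl_cell[OF x(1) y'M ne x(1)] refl_swap[OF x(1) y'M ne] by auto
  then have Tf: "T \<in> fmeasurable M" using fm[OF Tm x(1), of \<rho>] by (simp add: Int_absorb2)
  have mS: "3 / 4 * ?V \<rho> < measure M S"
  proof -
   have "measure M (A \<inter> cell a s \<inter> cell x \<rho>) <= measure M S"
    unfolding S_def using fm[OF A x(1)] fm[OF A'm x(1), of \<rho>] by (intro measure_mono_fmeasurable) auto
   then show ?thesis using x(3) mcell[OF base_in] by simp
  qed
  have mT: "1 / 2 * ?V \<rho> < measure M T"
  proof -
   have "measure M T = measure M (B \<inter> cell y' \<rho>)"
    using emeasure_refl[OF x(1) y'M ne, of "B \<inter> cell y' \<rho>"] B cell_sets[OF y'M] by (simp add: T_def measure_def)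
   moreover have "measure M (B \<inter> cell y (\<rho> - \<epsilon>)) <= measure M (B \<inter> cell y' \<rho>)"
   proof (rule measure_mono_fmeasurable)
    show "B \<inter> cell y (\<rho> - \<epsilon>) \<subseteq> B \<inter> cell y' \<rho>"
    proof
     fix z assume z: "z \<in> B \<inter> cell y (\<rho> - \<epsilon>)"
     then have "d y' z < \<rho>" using dist_triangle[of y' y z] dist_sym[of y' y] y' y(1) y'M by (auto simp: cell_def)
     then show "z \<in> B \<inter> cell y' \<rho>" using z by (auto simp: cell_def)
    qed
   qed (use fm[OF B y'M] B cell_sets[OF y(1)] in auto)
   moreover have "measure M (B \<inter> cell y \<rho>) <= measure M (B \<inter> cell y (\<rho> - \<epsilon>)) + (?V \<rho> - ?V (\<rho> - \<epsilon>))"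
   proof -
    have sub: "cell y (\<rho> - \<epsilon>) \<subseteq> cell y \<rho>" using \<epsilon>(1) by (intro cell_mono) simp
    have "measure M (B \<inter> cell y \<rho>) <= measure M ((B \<inter> cell y (\<rho> - \<epsilon>)) \<union> (cell y \<rho> - cell y (\<rho> - \<epsilon>)))"
     using fm[OF B y(1)] fm[OF sets.top y(1)] cell_sets[OF y(1)] B
     by (intro measure_mono_fmeasurable fmeasurable.Un fmeasurable.Diff) (auto simp: cell_def)
    also have "... <= measure M (B \<inter> cell y (\<rho> - \<epsilon>)) + measure M (cell y \<rho> - cell y (\<rho> - \<epsilon>))"
     using B cell_sets[OF y(1)] by (intro measure_Un_le) auto
    also have "measure M (cell y \<rho> - cell y (\<rho> - \<epsilon>)) = ?V \<rho> - ?V (\<rho> - \<epsilon>)"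
    proof -
     have "cell y t \<in> fmeasurable M" for t using cell_sets[OF y(1)] emeasure_cell_finite[OF y(1), of t] by (auto simp: fmeasurable_def)
     then show ?thesis using sub mcell[OF y(1)] by (subst measurable_measure_Diff) auto
    qed
    finally show ?thesis .
   qed
   moreover have "measure M ({z \<in> B. s < d a z} \<inter> cell y \<rho>) <= measure M (B \<inter> cell y \<rho>)"
    using fm[OF B y(1)] fm[OF B'm y(1), of \<rho>] by (intro measure_mono_fmeasurable) auto
   ultimately show ?thesis using y(3) Ve v mcell[OF base_in, of \<rho>] by simp
  qed
  have "0 < measure M (S \<inter> T)"
  proof -
   have "measure M (S \<union> T) <= ?V \<rho>"
   proof -
    have "cell x \<rho> \<in> fmeasurable M" using cell_sets[OF x(1)] emeasure_cell_finite[OF x(1), of \<rho>] by (auto simp: fmeasurable_def)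
    then have "measure M (S \<union> T) <= measure M (cell x \<rho>)"
     using Sf Tf Tc by (intro measure_mono_fmeasurable) (auto simp: S_def)
    then show ?thesis using mcell[OF x(1)] by simp
   qed
   then show ?thesis using measure_Un3[OF Sf Tf] mS mT v by simp
  qed
  then have "0 < \<mu> (S \<inter> T)" using Sf Tf by (simp add: measure_def enn2real_positive_iff)
  also have "... <= \<mu> {z \<in> pts. d z x < d z y' \<and> z \<in> A \<and> ?s z \<in> B}"
  proof (rule emeasure_mono)
   show "S \<inter> T \<subseteq> {z \<in> pts. d z x < d z y' \<and> z \<in> A \<and> ?s z \<in> B}"
   proof
    fix z assume z: "z \<in> S \<inter> T"
    have zM: "z \<in> pts" using z by (auto simp: T_def)
    have "d z x < \<delta> / 4" using z \<rho>(2) dist_sym[OF zM x(1)] by (auto simp: S_def cell_def)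
    moreover have "d a y' <= d a x + d x z + d z y'"
     using dist_triangle[OF a x(1) y'M] dist_triangle[OF x(1) zM y'M] by simp
    ultimately have "d z x < d z y'" using dy'[OF y'] dx dist_sym[OF zM x(1)] \<delta>(1) by linarith
    then show "z \<in> {z \<in> pts. d z x < d z y' \<and> z \<in> A \<and> ?s z \<in> B}" using z zM by (auto simp: S_def T_def)
   qed
   show "{z \<in> pts. d z x < d z y' \<and> z \<in> A \<and> ?s z \<in> B} \<in> sets M"
    using A B x(1) y'M by measurable
  qed
  finally show "0 < \<mu> {z \<in> pts. d z x < d z y' \<and> z \<in> A \<and> ?s z \<in> B}" .
 qed
qed

end

section \<open>Rigidity\<close>

context reflection_model begin

text \<open>The potential is Lipschitz, positive at the base point and small far away, because most
  of the mass of \<open>B\<close> lies in some ball. Hence its supremum is attained on a compact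
  ball.\<close>

lemma center_exists:
 assumes B: "B \<in> sets M" "\<mu> B < \<infinity>" "0 < \<mu> B"
 obtains a where "a \<in> pts"
  "!!z. z \<in> pts ==> (\<integral>M w. indicator B w * ennreal (exp (- d z w))) <= (\<integral>M w. indicator B w * ennreal (exp (- d a w)))"
proof -
 note [measurable] = B(1)
 define V where "V z = (LINT w|M. indicator B w * exp (- d z w))" for z
 have [measurable]: "(\<lambda>w. d z w) \<in> borel_measurable M" if "z \<in> pts" for z using that by measurable
 have iB: "integrable M (indicator B :: 'a => real)" using B by (intro integrable_real_indicator) auto
 have int: "integrable M (\<lambda>w. indicator B w * exp (- d z w))" if z: "z \<in> pts" for z
 proof (rule Bochner_Integration.integrable_bound[OF iB])
  show "AE w in M. norm (indicator B w * exp (- d z w)) <= norm (indicator B w :: real)"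
   using dist_nonneg[OF z] by (intro AE_I2) (auto simp: indicator_def)
 qed (use z in measurable)
 have nnV: "(\<integral>M w. indicator B w * ennreal (exp (- d z w))) = ennreal (V z)" if z: "z \<in> pts" for z
 proof -
  have "(\<integral>M w. indicator B w * ennreal (exp (- d z w))) = (\<integral>M w. ennreal (indicator B w * exp (- d z w)))"
   by (intro nn_integral_cong) (auto simp: indicator_def)
  then show ?thesis unfolding V_def using int[OF z] by (simp add: nn_integral_eq_integral)
 qed
 have V0: "0 <= V z" for z unfolding V_def by (intro integral_nonneg_AE) auto
 have expL: "\<bar>exp (- s) - exp (- t)\<bar> <= \<bar>s - t\<bar>" if "0 <= s" "0 <= t" for s t :: real
 proof -
  have *: "exp (- s) - exp (- t) <= t - s" if "0 <= s" "s <= t" for s t :: real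
  proof -
   have "exp (- s) - exp (- t) = exp (- s) * (1 - exp (- (t - s)))"
    by (simp add: right_diff_distrib exp_add[symmetric])
   also have "... <= 1 * (t - s)"
   proof (rule mult_mono)
    show "1 - exp (- (t - s)) <= t - s" using exp_ge_add_one_self[of "- (t - s)"] by linarith
   qed (use that in auto)
   finally show ?thesis by simp
  qed
  show ?thesis
  proof (cases "s <= t")
   case True
   then show ?thesis using *[of s t] that by (simp add: abs_if)
  next
   case False
   then show ?thesis using *[of t s] that by (simp add: abs_if)
  qed
 qed
 have LipV: "\<bar>V z - V z'\<bar> <= measure M B * d z z'" if z: "z \<in> pts" "z' \<in> pts" for z z'
 proof -
  have "V z - V z' = (LINT w|M. indicator B w * exp (- d z w) - indicator B w * exp (- d z' w))"
   unfolding V_def using int z by simp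
  also have "\<bar>...\<bar> <= (LINT w|M. \<bar>indicator B w * exp (- d z w) - indicator B w * exp (- d z' w)\<bar>)"
   by (rule integral_abs_bound)
  also have "... <= (LINT w|M. indicator B w * d z z')"
  proof (rule integral_mono)
   show "integrable M (\<lambda>w. \<bar>indicator B w * exp (- d z w) - indicator B w * exp (- d z' w)\<bar>)" using int z by auto
   show "integrable M (\<lambda>w. indicator B w * d z z')" using iB by (rule integrable_mult_left)
   fix w assume w: "w \<in> pts"
   have "\<bar>exp (- d z w) - exp (- d z' w)\<bar> <= \<bar>d z w - d z' w\<bar>" using dist_nonneg z w by (intro expL) auto
   also have "... <= d z z'" using dist_Lipschitz[OF w z] dist_sym z w by auto
   finally show "\<bar>indicator B w * exp (- d z w) - indicator B w * exp (- d z' w)\<bar> <= indicator B w * d z z'"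
    by (simp add: indicator_def)
  qed
  also have "... = measure M B * d z z'" using B(2) by simp
  finally show ?thesis .
 qed
 have contV: "continuous_on (pts) V" unfolding continuous_on_def
 proof
  fix z assume z: "z \<in> pts"
  have "continuous_on (pts) (\<lambda>w. (\<lambda>(x, y). d x y) (w, z))"
   using z by (intro continuous_on_compose2[OF dist_continuous] continuous_intros) auto
  from this[unfolded continuous_on_def, rule_format, OF z]
  have "((\<lambda>w. d w z) \<longlongrightarrow> d z z) (at z within pts)" by simp
  then have "((\<lambda>w. measure M B * d w z) \<longlongrightarrow> measure M B * 0) (at z within pts)"
   using z by (intro tendsto_intros) simp
  then have "((\<lambda>w. V w - V z) \<longlongrightarrow> 0) (at z within pts)"
   by (intro Lim_null_comparison[of "\<lambda>w. V w - V z" "\<lambda>w. measure M B * d w z"])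
     (use LipV z in \<open>auto simp: eventually_at_filter\<close>)
  then show "(V \<longlongrightarrow> V z) (at z within pts)" by (simp add: LIM_zero_iff)
 qed
 have Vb: "0 < V b"
 proof (rule ccontr)
  assume "\<not> 0 < V b"
  then have "(\<integral>M w. indicator B w * ennreal (exp (- d b w))) = 0" using nnV[OF base_in] V0[of b] by simp
  moreover have "(\<lambda>w. indicator B w * ennreal (exp (- d b w))) \<in> borel_measurable M" using base_in by measurable
  ultimately have "AE w in M. indicator B w * ennreal (exp (- d b w)) = 0" by (simp add: nn_integral_0_iff_AE)
  then have "AE w in M. w \<notin> B" by eventually_elim (auto simp: indicator_def split: if_splits)
  then have "B \<in> null_sets M" using B(1) by (simp add: AE_iff_null_sets)
  then show False using B(3) by auto
 qed
 have "(\<lambda>n. measure M (B - cell b (real n))) \<longlonglongrightarrow> 0"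
 proof -
  have "(\<lambda>n. \<mu> (B - cell b (real n))) \<longlonglongrightarrow> \<mu> (\<Inter>n. B - cell b (real n))"
  proof (rule Lim_emeasure_decseq)
   show "decseq (\<lambda>n. B - cell b (real n))" by (rule decseq_SucI) (auto simp: cell_def)
   show "\<mu> (B - cell b (real n)) ~= \<infinity>" for n
    using emeasure_mono[of "B - cell b (real n)" B M] B by (auto simp: top_unique)
  qed (use cell_sets[OF base_in] in auto)
  also have "(\<Inter>n. B - cell b (real n)) = {}"
   using sets.sets_into_space[OF B(1)] reals_Archimedean2 by (fastforce simp: cell_def)
  finally have "(\<lambda>n. \<mu> (B - cell b (real n))) \<longlonglongrightarrow> 0" by simp
  then have "(\<lambda>n. enn2real (\<mu> (B - cell b (real n)))) \<longlonglongrightarrow> 0" by (intro tendsto_enn2real) auto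
  then show ?thesis by (simp add: measure_def)
 qed
 from order_tendstoD(2)[OF this, of "V b / 2"] Vb obtain r where r: "measure M (B - cell b (real r)) < V b / 2"
  by (auto simp: eventually_sequentially)
 define mB where "mB = measure M B + 1"
 have mB: "0 < mB" by (simp add: mB_def add_nonneg_pos)
 \<comment> \<open>Beyond \<open>R\<close> the part of \<open>B\<close> within radius
   \<open>r\<close> contributes at most \<open>V b / 2\<close> and the rest less than
   \<open>V b / 2\<close>.\<close>
 define R where "R = max 0 (real r - ln (V b / (2 * mB)))"
 have far: "V z < V b" if z: "z \<in> pts" "R < d b z" for z
 proof -
  have "V z <= (LINT w|M. indicator (B - cell b (real r)) w + indicator B w * exp (- (d b z - real r)))"
   unfolding V_def
  proof (rule integral_mono[OF int[OF z(1)]])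
   show "integrable M (\<lambda>w. indicator (B - cell b (real r)) w + indicator B w * exp (- (d b z - real r)))"
    using iB emeasure_mono[of "B - cell b (real r)" B M] B cell_sets[OF base_in]
    by (intro Bochner_Integration.integrable_add integrable_mult_left integrable_real_indicator) (auto simp: order_le_less_trans)
   fix w assume w: "w \<in> pts"
   show "indicator B w * exp (- d z w) <= indicator (B - cell b (real r)) w + indicator B w * exp (- (d b z - real r))"
   proof (cases "w \<in> cell b (real r)")
    case True
    then have "d b z - real r <= d z w"
     using dist_triangle[of b w z] dist_sym[of w z] base_in w z(1) by (auto simp: cell_def)
    then show ?thesis using True by (auto simp: indicator_def)
   next
    case False
    then show ?thesis using dist_nonneg[OF z(1) w] by (auto simp: indicator_def add_increasing2)
   qed
  qed
  also have "... = measure M (B - cell b (real r)) + measure M B * exp (- (d b z - real r))"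
   using iB emeasure_mono[of "B - cell b (real r)" B M] B cell_sets[OF base_in]
   by (subst Bochner_Integration.integral_add) (auto simp: order_le_less_trans intro!: integrable_real_indicator)
  also have "measure M B * exp (- (d b z - real r)) <= V b / 2"
  proof -
   have "- (d b z - real r) <= ln (V b / (2 * mB))" using z(2) by (simp add: R_def)
   then have "exp (- (d b z - real r)) <= V b / (2 * mB)"
    using Vb mB by (metis divide_pos_pos exp_le_cancel_iff exp_ln mult_pos_pos zero_less_numeral)
   then have "measure M B * exp (- (d b z - real r)) <= mB * (V b / (2 * mB))"
    using Vb mB by (intro mult_mono) (auto simp: mB_def)
   then show ?thesis using mB by simp
  qed
  finally show ?thesis using r by linarith
 qed
 let ?C = "{y \<in> pts. d b y <= R}"
 have "b \<in> ?C" using base_in by (simp add: R_def)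
 then obtain a where a: "a \<in> ?C" "!!y. y \<in> ?C ==> V y <= V a"
  using continuous_attains_sup[OF compact_cball[of R] _ continuous_on_subset[OF contV]] by blast
 show thesis
 proof (rule that[of a])
  show aM: "a \<in> pts" using a by simp
  fix z assume z: "z \<in> pts"
  have "V z <= V a"
  proof (cases "d b z <= R")
   case False
   then show ?thesis using far[OF z] a(2)[OF \<open>b \<in> ?C\<close>] by simp
  qed (use a z in auto)
  then show "(\<integral>M w. indicator B w * ennreal (exp (- d z w))) <= (\<integral>M w. indicator B w * ennreal (exp (- d a w)))"
   using nnV z aM by (simp add: ennreal_leI)
 qed
qed

text \<open>At a maximum of the potential a one-sided comparison of \<open>B\<close> with its mirror image is an equality.\<close>

lemma center_symmetry:
 assumes B: "B \<in> sets M" "\<mu> B < \<infinity>" and a: "a \<in> pts"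
  and max: "!!z. z \<in> pts ==> (\<integral>M w. indicator B w * ennreal (exp (- d z w))) <= (\<integral>M w. indicator B w * ennreal (exp (- d a w)))"
  and xy: "x \<in> pts" "y \<in> pts" "d a x < d a y"
  and le: "AE z in M. d z x < d z y --> z \<in> B --> refl x y z \<in> B"
 shows "AE z in M. refl x y z \<in> B \<longleftrightarrow> z \<in> B"
proof -
 have ne: "x ~= y" using xy(3) by auto
 let ?s = "refl x y"
 note [measurable] = B(1) refl_measurable[OF xy(1,2) ne]
 have [measurable]: "(\<lambda>w. d a w) \<in> borel_measurable M" using a by measurable
 let ?e = "\<lambda>w. ennreal (exp (- d a w))"
 let ?h1 = "\<lambda>w. indicator B w * ?e w" and ?h2 = "\<lambda>w. indicator B (?s w) * ?e w"
 have sM: "?s z \<in> pts" if "z \<in> pts" for z using refl_in[OF xy(1,2) ne that] .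
 have ss: "?s (?s z) = z" if "z \<in> pts" for z using refl_refl[OF xy(1,2) ne that] .
 have le': "AE z in M. (d z x < d z y --> z \<in> B --> ?s z \<in> B) \<and> (d z y < d z x --> ?s z \<in> B --> z \<in> B) \<and> d z x ~= d z y"
  using le AE_refl[OF xy(1,2) ne le] AE_not_in[OF bisector_null[OF xy(1,2) ne]] AE_space
  by eventually_elim (use refl_dist_ends[OF xy(1,2) ne] ss in auto)
 have far: "d a z < d a (?s z)" if "z \<in> pts" "d z x < d z y" for z
  using refl_strictly_farther[OF xy(1,2) ne a that(1) xy(3) that(2)] .
 have near: "d a (?s z) < d a z" if z: "z \<in> pts" "d z y < d z x" for z
  using far[OF sM[OF z(1)]] refl_dist_ends[OF xy(1,2) ne z(1)] ss[OF z(1)] z(2) by simp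
 let ?S1 = "\<lambda>z. ?h1 z + ?h1 (?s z)" and ?S2 = "\<lambda>z. ?h2 z + ?h2 (?s z)"
 \<comment> \<open>On each mirror pair \<open>B\<close> favours the point farther from
   \<open>a\<close>, so its mirror image has at least as large a potential at
   \<open>a\<close>.\<close>
 have S12: "AE z in M. ?S1 z <= ?S2 z" using le' AE_space
 proof eventually_elim
  case (elim z)
  have "d z x < d z y ==> ?e (?s z) <= ?e z" using far[OF elim(2)] by (simp add: ennreal_leI less_imp_le)
  moreover have "d z y < d z x ==> ?e z <= ?e (?s z)" using near[OF elim(2)] by (simp add: ennreal_leI less_imp_le)
  ultimately show ?case using elim ss[OF elim(2)] by (auto simp: indicator_def add.commute neq_iff)
 qed
 have fin: "(\<integral>M z. ?h1 z) < \<infinity>"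
 proof -
  have "(\<integral>M z. ?h1 z) <= (\<integral>M z. indicator B z)"
   using dist_nonneg[OF a] by (intro nn_integral_mono) (auto simp: indicator_def ennreal_le_1)
  also have "... = \<mu> B" by simp
  finally show ?thesis using B(2) by (rule order_le_less_trans)
 qed
 have dbl: "(\<integral>M z. h z + h (?s z)) = 2 * (\<integral>M z. h z)" if [measurable]: "h \<in> borel_measurable M" for h
  by (subst nn_integral_add) (auto simp: nn_integral_refl[OF xy(1,2) ne] mult_2)
 \<comment> \<open>The potential of the mirror image at \<open>a\<close> is that of \<open>B\<close>
   at the mirror image of \<open>a\<close>, hence at most the maximum.\<close>
 have h2: "(\<integral>M z. ?h2 z) = (\<integral>M w. indicator B w * ennreal (exp (- d (?s a) w)))"
 proof -
  have [measurable]: "(\<lambda>w. d (?s a) w) \<in> borel_measurable M" using sM[OF a] by measurable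
  have "(\<integral>M w. indicator B w * ennreal (exp (- d (?s a) w)))
    = (\<integral>M w. indicator B (?s w) * ennreal (exp (- d (?s a) (?s w))))"
   by (subst nn_integral_refl[OF xy(1,2) ne, symmetric]) auto
  also have "... = (\<integral>M w. ?h2 w)"
   using refl_dist[OF xy(1,2) ne a] by (intro nn_integral_cong) simp
  finally show ?thesis by simp
 qed
 have "AE z in M. ?S2 z = ?S1 z"
 proof (rule AE_eq_of_nn_integral_le[OF _ _ S12])
  show "(\<integral>M z. ?S2 z) <= (\<integral>M z. ?S1 z)"
   unfolding dbl[of ?h1, simplified] using dbl[of ?h2] dbl[of ?h1] h2 max[OF sM[OF a]] by (simp add: mult_left_mono)
  show "(\<integral>M z. ?S1 z) < \<infinity>" using dbl[of ?h1] fin by (simp add: ennreal_mult_less_top)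
 qed measurable
 with le' AE_space show ?thesis
 proof eventually_elim
  case (elim z)
  have "d z x < d z y ==> exp (- d a z) ~= exp (- d a (?s z))" using far[OF elim(2)] by simp
  moreover have "d z y < d z x ==> exp (- d a z) ~= exp (- d a (?s z))" using near[OF elim(2)] by simp
  ultimately have "exp (- d a z) ~= exp (- d a (?s z))" using elim(1) by (auto simp: neq_iff)
  then show ?case using elim(3) ss[OF elim(2)] by (cases "z \<in> B"; cases "?s z \<in> B") (auto simp: indicator_def)
 qed
qed

text \<open>\<open>J\<close> collects the radii whose ball lies in \<open>A\<close> up to a null
  set; for every other radius \<open>A\<close> has no mass outside. Rational radii and the null
  sphere at \<open>Sup J\<close> then settle almost every point.\<close>

lemma radial_level:
 assumes a: "a \<in> pts" and A[measurable]: "A \<in> sets M"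
  and rad: "!!s. \<mu> (cell a s - A) = 0 \<or> \<mu> {z \<in> A. s < d a z} = 0"
 obtains J :: "real set" where "!!s t. s \<in> J ==> t <= s ==> t \<in> J" "AE z in M. z \<in> A \<longleftrightarrow> d a z \<in> J"
proof -
 have [measurable]: "(\<lambda>z. d a z) \<in> borel_measurable M" "cell a s \<in> sets M" for s using a cell_sets[OF a] by auto
 define J where "J = {s. \<mu> (cell a s - A) = 0}"
 have down: "t \<in> J" if "s \<in> J" "t <= s" for s t
  using that emeasure_mono[of "cell a t - A" "cell a s - A" M] cell_mono[OF that(2), of a] by (auto simp: J_def)
 have in_ae: "AE z in M. \<forall>q::rat. of_rat q \<in> J --> d a z < of_rat q --> z \<in> A"
  unfolding AE_all_countable
 proof
  fix q :: rat
  show "AE z in M. of_rat q \<in> J --> d a z < of_rat q --> z \<in> A"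
  proof (cases "of_rat q \<in> J")
   case True
   then have "cell a (of_rat q) - A \<in> null_sets M" by (auto simp: J_def)
   from AE_not_in[OF this] AE_space show ?thesis by eventually_elim (auto simp: cell_def)
  qed simp
 qed
 have out_ae: "AE z in M. \<forall>q::rat. of_rat q \<notin> J --> of_rat q < d a z --> z \<notin> A"
  unfolding AE_all_countable
 proof
  fix q :: rat
  have B'eq: "{z \<in> A. of_rat q < d a z} = A \<inter> {z \<in> pts. of_rat q < d a z}" using sets.sets_into_space[OF A] by auto
  show "AE z in M. of_rat q \<notin> J --> of_rat q < d a z --> z \<notin> A"
  proof (cases "of_rat q \<in> J")
   case False
   then have "\<mu> {z \<in> A. of_rat q < d a z} = 0" using rad[of "of_rat q"] by (auto simp: J_def)
   then have "{z \<in> A. of_rat q < d a z} \<in> null_sets M" unfolding B'eq by auto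
   from AE_not_in[OF this] show ?thesis by eventually_elim auto
  qed simp
 qed
 show thesis
 proof (rule that[OF down])
  show "AE z in M. z \<in> A \<longleftrightarrow> d a z \<in> J"
   using in_ae out_ae AE_dist_ne[OF a, of "Sup J"]
  proof eventually_elim
   case (elim z)
   show ?case
   proof (cases "\<exists>s\<in>J. d a z < s")
    case True
    then obtain s where s: "s \<in> J" "d a z < s" by auto
    obtain q where q: "d a z < of_rat q" "of_rat q < s" using of_rat_dense[OF s(2)] by auto
    then have "of_rat q \<in> J" using down[OF s(1)] by simp
    then have "z \<in> A" using elim(1) q by blast
    moreover have "d a z \<in> J" using down[OF s(1)] s(2) by simp
    ultimately show ?thesis by simp
   next
    case False
    then have up: "s <= d a z" if "s \<in> J" for s using that by (simp add: not_less)
    have nJ: "d a z \<notin> J"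
    proof
     assume "d a z \<in> J"
     then have "Sup J = d a z" using up by (intro cSup_eq_maximum)
     then show False using elim(3) by simp
    qed
    have "\<exists>t. t \<notin> J \<and> t < d a z"
    proof (cases "J = {}")
     case True
     then show ?thesis by (intro exI[of _ "d a z - 1"]) auto
    next
     case ne: False
     have "Sup J <= d a z" using ne up by (intro cSup_least)
     then have lt: "Sup J < d a z" using elim(3) by simp
     then obtain t where t: "Sup J < t" "t < d a z" using dense by blast
     have "t \<notin> J"
     proof
      assume "t \<in> J"
      then have "t <= Sup J" using up by (intro cSup_upper bdd_aboveI)
      then show False using t by simp
     qed
     then show ?thesis using t by auto
    qed
    then obtain t where t: "t \<notin> J" "t < d a z" by auto
    obtain q where q: "t < of_rat q" "of_rat q < d a z" using of_rat_dense[OF t(2)] by auto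
    then have "of_rat q \<notin> J" using down[of "of_rat q" t] t(1) by auto
    then have "z \<notin> A" using elim(2) q by blast
    then show ?thesis using nJ by simp
   qed
  qed
 qed
qed

text \<open>Down-closed sets of reals are nested, and nested sets of equal finite measure agree
  almost everywhere.\<close>

lemma radial_unique:
 assumes a: "a \<in> pts" and J: "!!s t. s \<in> J ==> t <= s ==> t \<in> J" "!!s t. s \<in> J' ==> t <= s ==> t \<in> (J' :: real set)"
  and eq: "\<mu> {z \<in> pts. d a z \<in> J} = \<mu> {z \<in> pts. d a z \<in> J'}"
  and fin: "\<mu> {z \<in> pts. d a z \<in> J} < \<infinity>"
 shows "AE z in M. d a z \<in> J \<longleftrightarrow> d a z \<in> J'"
proof -
 have [measurable]: "(\<lambda>z. d a z) \<in> borel_measurable M" using a by measurable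
 have "is_interval J" "is_interval J'" unfolding is_interval_1 using J by blast+
 then have [measurable]: "J \<in> sets borel" "J' \<in> sets borel" by (auto intro: real_interval_borel_measurable)
 have sub: "AE z in M. d a z \<in> K' --> d a z \<in> K"
  if "K \<subseteq> K'" and [measurable]: "K \<in> sets borel" "K' \<in> sets borel"
   and e: "\<mu> {z \<in> pts. d a z \<in> K} = \<mu> {z \<in> pts. d a z \<in> K'}" "\<mu> {z \<in> pts. d a z \<in> K} < \<infinity>"
  for K K' :: "real set"
 proof -
  have "\<mu> ({z \<in> pts. d a z \<in> K'} - {z \<in> pts. d a z \<in> K})
   = \<mu> {z \<in> pts. d a z \<in> K'} - \<mu> {z \<in> pts. d a z \<in> K}"
   using that by (intro emeasure_Diff) auto
  also have "... = 0" using e by simp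
  finally have "{z \<in> pts. d a z \<in> K'} - {z \<in> pts. d a z \<in> K} \<in> null_sets M" by auto
  from AE_not_in[OF this] AE_space show ?thesis by eventually_elim auto
 qed
 have "J \<subseteq> J' \<or> J' \<subseteq> J" using J by (meson linear subsetI)
 then show ?thesis
 proof
  assume JJ: "J \<subseteq> J'"
  have "AE z in M. d a z \<in> J' --> d a z \<in> J" by (rule sub[OF JJ]) (use eq fin in auto)
  then show ?thesis by eventually_elim (use JJ in auto)
 next
  assume JJ: "J' \<subseteq> J"
  have "AE z in M. d a z \<in> J --> d a z \<in> J'" by (rule sub[OF JJ]) (use eq fin in auto)
  then show ?thesis by eventually_elim (use JJ in auto)
 qed
qed

text \<open>Says that superlevel sets are balls about \<open>a\<close> up to null sets without
  naming a radius: no sphere about \<open>a\<close> has mass missing inside and mass present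
  outside.\<close>

definition radial_about :: "'a => ('a => real) => bool" where
 "radial_about a u \<longleftrightarrow> (\<forall>t s. \<mu> (cell a s - {z \<in> pts. t < u z}) = 0 \<or>
   \<mu> {z \<in> {z \<in> pts. t < u z}. s < d a z} = 0)"

text \<open>For each positive level both sides give balls about \<open>a\<close>, of equal volume by
  equimeasurability, hence equal up to null sets. Rational levels determine the values.\<close>

lemma radial_about_rearrangement:
 assumes u: "u \<in> borel_measurable M" "!!z. z \<in> pts ==> 0 <= u z" "vanishes_at_infinity X u"
  and a: "a \<in> pts" and rad: "radial_about a u"
  and \<tau>: "!!x. x \<in> pts ==> \<tau> x \<in> pts \<and> d b (\<tau> x) = d a x"
 shows "AE z in M. u z = symm_decr_rearrangement X u (\<tau> z)"
proof -
 note [measurable] = u(1)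
 let ?w = "symm_decr_rearrangement X u"
 have level: "AE z in M. c < u z \<longleftrightarrow> c < ?w (\<tau> z)" if c: "0 < c" for c
 proof -
  let ?A = "{z \<in> pts. c < u z}"
  have rad': "\<mu> (cell a s - ?A) = 0 \<or> \<mu> {z \<in> ?A. s < d a z} = 0" for s
   using rad unfolding radial_about_def by blast
  obtain J where J: "!!s t. s \<in> J ==> t <= s ==> t \<in> J" "AE z in M. z \<in> ?A \<longleftrightarrow> d a z \<in> J"
   by (rule radial_level[OF a _ rad']) (measurable, rule that)
  define J' where "J' = {r. \<exists>t>c. \<mu> (cell b r) <= distribution X u t}"
  have J': "t \<in> J'" if "s \<in> J'" "t <= s" for s t
   using that emeasure_mono[OF cell_mono[OF that(2), of b] cell_sets[OF base_in]] order_trans unfolding J'_def by blast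
  have star: "star_level u c = {z \<in> pts. d b z \<in> J'}" by (auto simp: star_level_def J'_def)
  have "is_interval J" "is_interval J'" unfolding is_interval_1 using J(1) J' by blast+
  then have [measurable]: "J \<in> sets borel" "J' \<in> sets borel" by (auto intro: real_interval_borel_measurable)
  have [measurable]: "(\<lambda>z. d p z) \<in> borel_measurable M" if "p \<in> pts" for p using that by measurable
  have hom: "\<mu> {z \<in> pts. d a z \<in> J'} = \<mu> {z \<in> pts. d b z \<in> J'}"
  proof (cases "a = b")
   case False
   have "{z \<in> pts. refl a b z \<in> {z \<in> pts. d b z \<in> J'}} = {z \<in> pts. d a z \<in> J'}"
    using refl_dist[OF a base_in False a] refl_swap[OF a base_in False] refl_in[OF a base_in False] by auto
   moreover have "{z \<in> pts. d b z \<in> J'} \<in> sets M" using base_in by measurable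
   ultimately show ?thesis using emeasure_refl[OF a base_in False, of "{z \<in> pts. d b z \<in> J'}"] by simp
  qed simp
  have mA: "\<mu> {z \<in> pts. d a z \<in> J} = distribution X u c"
   unfolding distribution_def using J(2) a by (intro emeasure_eq_AE) (auto elim!: eventually_mono)
  have "AE z in M. d a z \<in> J \<longleftrightarrow> d a z \<in> J'"
  proof (rule radial_unique[OF a J(1) J'])
   show "\<mu> {z \<in> pts. d a z \<in> J} = \<mu> {z \<in> pts. d a z \<in> J'}"
    using mA hom emeasure_star_level[OF u(1), of c] star by simp
   show "\<mu> {z \<in> pts. d a z \<in> J} < \<infinity>" using mA u(3) c by (simp add: vanishes_at_infinity_def)
  qed
  \<comment> \<open>The point \<open>a\<close> is excluded because \<open>\<tau>\<close> sends it to
    the base point, where an infinite supremum has been replaced by 0.\<close>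
  with J(2) AE_dist_ne[OF a, of 0] AE_space show ?thesis
  proof eventually_elim
   case (elim z)
   have tz: "\<tau> z \<in> pts" "d b (\<tau> z) = d a z" using \<tau>[OF elim(3)] by auto
   then have "\<tau> z ~= b" using elim(2) base_in by auto
   then have "c < ?w (\<tau> z) \<longleftrightarrow> d a z \<in> J'"
    using less_rearrangement_iff[OF u(1,3) tz(1) _ less_imp_le[OF c]] star tz by auto
   then show ?case using elim by auto
  qed
 qed
 have "AE z in M. \<forall>q::rat. 0 < q --> (of_rat q < u z \<longleftrightarrow> of_rat q < ?w (\<tau> z))"
  unfolding AE_all_countable using level by auto
 with AE_space show ?thesis
 proof eventually_elim
  case (elim z)
  have no: False if lt: "s < t" "0 <= s" and iff: "!!q::rat. 0 < q ==> (of_rat q < s) = (of_rat q < t)" for s t :: real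
  proof -
   obtain q where q: "s < of_rat q" "of_rat q < t" using of_rat_dense[OF lt(1)] by auto
   then have "0 < real_of_rat q" using lt(2) by linarith
   then have "0 < q" by simp
   then show False using iff[of q] q by auto
  qed
  show ?case
   using no[of "u z" "?w (\<tau> z)"] no[of "?w (\<tau> z)" "u z"] elim u(2)[OF elim(1)] rearrangement_nonneg[of u "\<tau> z"]
   by (cases "u z" "?w (\<tau> z)" rule: linorder_cases) auto
 qed
qed

text \<open>Otherwise every positive level set is null or conull, and the function equals almost
  everywhere the supremum of the conull levels.\<close>

lemma nonconstant_level:
 assumes u: "u \<in> borel_measurable M" "!!z. z \<in> pts ==> 0 <= u z" and nc: "nonconstant X u"
 obtains c where "0 < c" "0 < \<mu> {z \<in> pts. c < u z}" "0 < \<mu> (pts - {z \<in> pts. c < u z})"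
proof (rule ccontr)
 note [measurable] = u(1) and level = that
 assume contr: "\<not> thesis"
 have no: "\<mu> {z \<in> pts. c < u z} = 0 \<or> \<mu> (pts - {z \<in> pts. c < u z}) = 0" if "0 < c" for c
  using contr level[OF that] by (auto simp: zero_less_iff_neq_zero)
 \<comment> \<open>0 is the default if no positive level is conull.\<close>
 define T where "T = insert 0 {c. 0 < c \<and> \<mu> (pts - {z \<in> pts. c < u z}) = 0}"
 have lo: "AE z in M. c <= u z" if "c \<in> T" for c
 proof (cases "c = 0")
  case True
  then show ?thesis using u(2) by (auto intro: AE_I2)
 next
  case False
  then have "pts - {z \<in> pts. c < u z} \<in> null_sets M" using that by (auto simp: T_def)
  from AE_not_in[OF this] AE_space show ?thesis by eventually_elim auto
 qed
 have hi: "AE z in M. u z <= c" if "c \<notin> T" "0 < c" for c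
 proof -
  have "{z \<in> pts. c < u z} \<in> null_sets M" using no[OF that(2)] that by (auto simp: T_def)
  from AE_not_in[OF this] AE_space show ?thesis by eventually_elim auto
 qed
 have ntriv: "\<not> (AE z in M. False)"
 proof
  assume "AE z in M. False"
  then have "\<mu> (pts) = 0" using AE_iff_measurable[of "pts" M "\<lambda>_. False"] by simp
  moreover have "\<mu> (cell b 1) <= \<mu> (pts)" by (intro emeasure_mono) (auto simp: cell_def)
  ultimately show False using emeasure_cell_pos[OF base_in, of 1] by simp
 qed
 have "\<exists>n. real (Suc n) \<notin> T"
 proof (rule ccontr)
  assume "\<nexists>n. real (Suc n) \<notin> T"
  then have "AE z in M. \<forall>n. real (Suc n) <= u z" unfolding AE_all_countable using lo by blast
  then have "AE z in M. False"
  proof eventually_elim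
   case (elim z)
   obtain n where "u z < real n" using reals_Archimedean2 by blast
   then show ?case using elim[rule_format, of n] by simp
  qed
  then show False using ntriv by simp
 qed
 then obtain N where N: "real (Suc N) \<notin> T" by blast
 have bd: "c <= real (Suc N)" if "c \<in> T" for c
 proof (rule ccontr)
  assume "\<not> c <= real (Suc N)"
  have "AE z in M. u z <= real (Suc N)" using hi[OF N] by simp
  with lo[OF that] have "AE z in M. False"
   by eventually_elim (use \<open>\<not> c <= real (Suc N)\<close> in auto)
  then show False using ntriv by simp
 qed
 define c where "c = Sup T"
 have bdd: "bdd_above T" by (rule bdd_aboveI[OF bd])
 have c0: "0 <= c" unfolding c_def by (rule cSup_upper[OF _ bdd]) (simp add: T_def)
 have "AE z in M. \<forall>q::rat. (of_rat q < c --> of_rat q <= u z) \<and> (c < of_rat q --> u z <= of_rat q)"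
  unfolding AE_all_countable
 proof
  fix q :: rat
  show "AE z in M. (of_rat q < c --> of_rat q <= u z) \<and> (c < of_rat q --> u z <= of_rat q)"
  proof (cases "of_rat q < c")
   case True
   then obtain t where t: "t \<in> T" "of_rat q < t" unfolding c_def using less_cSupD[of T] by (auto simp: T_def)
   from lo[OF t(1)] show ?thesis by eventually_elim (use t True in auto)
  next
   case False
   show ?thesis
   proof (cases "c < of_rat q")
    case True
    have "of_rat q \<notin> T"
    proof
     assume "of_rat q \<in> T"
     then have "of_rat q <= c" unfolding c_def by (rule cSup_upper[OF _ bdd])
     then show False using True by simp
    qed
    then have "AE z in M. u z <= of_rat q" by (rule hi) (use c0 True in linarith)
    then show ?thesis by eventually_elim (use False in auto)
   qed (use False in simp)
  qed
 qed
 then have "AE z in M. u z = c"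
 proof eventually_elim
  case (elim z)
  show ?case
  proof (cases "u z" c rule: linorder_cases)
   case less
   then obtain q where "u z < of_rat q" "of_rat q < c" using of_rat_dense by blast
   then show ?thesis using elim by force
  next
   case greater
   then obtain q where "c < of_rat q" "of_rat q < u z" using of_rat_dense by blast
   then show ?thesis using elim by force
  qed simp
 qed
 then show False using nc by (auto simp: nonconstant_def)
qed

text \<open>
 If no reflection can move the mass of \<open>f\<close> and \<open>g\<close> in opposite directions, a failure of radial monotonicity
 of one function makes a level set of the other one symmetric under an open family of reflections.
\<close>

lemma common_center:
 assumes f: "f \<in> borel_measurable M" "!!z. z \<in> pts ==> 0 <= f z" "vanishes_at_infinity X f" "nonconstant X f"
  and g: "g \<in> borel_measurable M" "!!z. z \<in> pts ==> 0 <= g z" "vanishes_at_infinity X g" "nonconstant X g"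
  and opp: "!!x y. x \<in> pts ==> y \<in> pts ==> x ~= y ==>
   (\<mu> {z \<in> pts. d z x < d z y \<and> f (refl x y z) < f z} = 0 \<or>
    \<mu> {z \<in> pts. d z x < d z y \<and> g z < g (refl x y z)} = 0) \<and>
   (\<mu> {z \<in> pts. d z x < d z y \<and> g (refl x y z) < g z} = 0 \<or>
    \<mu> {z \<in> pts. d z x < d z y \<and> f z < f (refl x y z)} = 0)"
 obtains a where "a \<in> pts" "radial_about a f" "radial_about a g"
proof -
 note [measurable] = f(1) g(1)
 obtain c where c: "0 < c" "0 < \<mu> {z \<in> pts. c < f z}" "0 < \<mu> (pts - {z \<in> pts. c < f z})"
  by (rule nonconstant_level[OF f(1,2,4)]) (assumption | rule that)+
 obtain c' where c': "0 < c'" "0 < \<mu> {z \<in> pts. c' < g z}" "0 < \<mu> (pts - {z \<in> pts. c' < g z})"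
  by (rule nonconstant_level[OF g(1,2,4)]) (assumption | rule that)+
 define B where "B = {z \<in> pts. c < f z}"
 define B' where "B' = {z \<in> pts. c' < g z}"
 have Bm[measurable]: "B \<in> sets M" "B' \<in> sets M" by (auto simp: B_def B'_def)
 have Bfin: "\<mu> B < \<infinity>" using f(3) c(1) by (simp add: B_def vanishes_at_infinity_def distribution_def)
 have Bpos: "0 < \<mu> B" "0 < \<mu> (pts - B)" using c by (auto simp: B_def)
 have B'pos: "0 < \<mu> B'" "0 < \<mu> (pts - B')" using c' by (auto simp: B'_def)
 \<comment> \<open>The center belongs to a level set of \<open>f\<close>, but \<open>g\<close> is
   the function first shown to be radial about it.\<close>
 obtain a where a: "a \<in> pts"
  "!!z. z \<in> pts ==> (\<integral>M w. indicator B w * ennreal (exp (- d z w))) <= (\<integral>M w. indicator B w * ennreal (exp (- d a w)))"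
  by (rule center_exists[OF Bm(1) Bfin Bpos(1)]) (rule that)
 have one_sided: "AE z in M. d z x < d z y --> h z <= h (refl x y z)"
  if "\<mu> {z \<in> pts. d z x < d z y \<and> h (refl x y z) < h z} = 0" "x \<in> pts" "y \<in> pts" "x ~= y"
   and h[measurable]: "h \<in> borel_measurable M" for h :: "'a => real" and x y
 proof -
  note [measurable] = refl_measurable[OF that(2,3,4)]
  have "{z \<in> pts. d z x < d z y \<and> h (refl x y z) < h z} \<in> sets M" using that(2,3) by measurable
  then have "{z \<in> pts. d z x < d z y \<and> h (refl x y z) < h z} \<in> null_sets M" using that(1) by auto
  from AE_not_in[OF this] AE_space show ?thesis by eventually_elim auto
 qed
 have off_center: "\<exists>x y \<epsilon>. x \<in> pts \<and> y \<in> pts \<and> 0 < \<epsilon> \<and> x \<notin> cell y \<epsilon> \<and>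
   (\<forall>y'\<in>cell y \<epsilon>. y' \<in> pts \<and> x ~= y' \<and> d a x < d a y' \<and> \<mu> {z \<in> pts. d z x < d z y' \<and> h z < h (refl x y' z)} ~= 0)"
  if nr: "\<not> radial_about a h" and h[measurable]: "h \<in> borel_measurable M" for h :: "'a => real"
 proof -
  obtain t s where ts: "\<mu> (cell a s - {z \<in> pts. t < h z}) ~= 0" "\<mu> {z \<in> {z \<in> pts. t < h z}. s < d a z} ~= 0"
   using nr unfolding radial_about_def by blast
  have Q: "{z \<in> pts. t < h z} \<in> sets M" and Pm: "pts - {z \<in> pts. t < h z} \<in> sets M" by auto
  have eq: "(pts - {z \<in> pts. t < h z}) \<inter> cell a s = cell a s - {z \<in> pts. t < h z}" by (auto simp: cell_def)
  have p1: "0 < \<mu> ((pts - {z \<in> pts. t < h z}) \<inter> cell a s)"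
   unfolding eq using ts(1) by (simp add: zero_less_iff_neq_zero)
  have p2: "0 < \<mu> {z \<in> {z \<in> pts. t < h z}. s < d a z}" using ts(2) by (simp add: zero_less_iff_neq_zero)
  obtain x y \<epsilon> where xy: "x \<in> pts" "y \<in> pts" "0 < \<epsilon>" "x \<notin> cell y \<epsilon>"
   "!!y'. y' \<in> cell y \<epsilon> ==> d a x < d a y'"
   "!!y'. y' \<in> cell y \<epsilon> ==> 0 < \<mu> {z \<in> pts. d z x < d z y' \<and> z \<in> pts - {z \<in> pts. t < h z} \<and> refl x y' z \<in> {z \<in> pts. t < h z}}"
   by (rule reflections_across_sphere[OF a(1) Pm Q p1 p2]) (rule that)
  have "\<mu> {z \<in> pts. d z x < d z y' \<and> h z < h (refl x y' z)} ~= 0" if y': "y' \<in> cell y \<epsilon>" for y'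
  proof -
   have y'M: "y' \<in> pts" "x ~= y'" using y' xy(5)[OF y'] by (auto simp: cell_def)
   note [measurable] = refl_measurable[OF xy(1) y'M]
   have "{z \<in> pts. d z x < d z y' \<and> h z < h (refl x y' z)} \<in> sets M" using xy(1) y'M(1) by measurable
   then have "\<mu> {z \<in> pts. d z x < d z y' \<and> z \<in> pts - {z \<in> pts. t < h z} \<and> refl x y' z \<in> {z \<in> pts. t < h z}}
    <= \<mu> {z \<in> pts. d z x < d z y' \<and> h z < h (refl x y' z)}"
    by (intro emeasure_mono) auto
   then show ?thesis using xy(6)[OF y'] by auto
  qed
  then show ?thesis using xy(1-5) by (intro exI[of _ x] exI[of _ y] exI[of _ \<epsilon>]) (auto simp: cell_def)
 qed
 \<comment> \<open>If \<open>g\<close> is larger on the far side on a set of positive measure,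
   \<open>f\<close> is almost nowhere larger on the near side. So \<open>B\<close> favours the far
   side, and the maximality of the center makes it symmetric.\<close>
 have rg: "radial_about a g"
 proof (rule ccontr)
  assume "\<not> radial_about a g"
  from off_center[OF this g(1)] obtain x y \<epsilon> where xy: "x \<in> pts" "y \<in> pts" "0 < \<epsilon>" "x \<notin> cell y \<epsilon>"
   "!!y'. y' \<in> cell y \<epsilon> ==> y' \<in> pts \<and> x ~= y' \<and> d a x < d a y' \<and> \<mu> {z \<in> pts. d z x < d z y' \<and> g z < g (refl x y' z)} ~= 0"
   by blast
  have "AE z in M. refl x y' z \<in> B \<longleftrightarrow> z \<in> B" if y': "y' \<in> cell y \<epsilon>" for y'
  proof (rule center_symmetry[OF Bm(1) Bfin a xy(1)])
   note y'' = xy(5)[OF y']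
   show "y' \<in> pts" "d a x < d a y'" using y'' by auto
   have "\<mu> {z \<in> pts. d z x < d z y' \<and> f (refl x y' z) < f z} = 0"
    using opp[OF xy(1), of y'] y'' by blast
   then have "AE z in M. d z x < d z y' --> f z <= f (refl x y' z)" using xy(1) y'' f(1) by (intro one_sided) auto
   then show "AE z in M. d z x < d z y' --> z \<in> B --> refl x y' z \<in> B"
    using AE_space by eventually_elim (use refl_in[OF xy(1)] y'' in \<open>auto simp: B_def\<close>)
  qed
  from invariant_set_trivial[OF Bm(1) xy(1-4) this] Bpos show False by auto
 qed
 \<comment> \<open>Now the center acts through \<open>g\<close>: the level set \<open>B'\<close> is
   a ball about \<open>a\<close> and favours the near side, while the failure for \<open>f\<close>
   makes it favour the far side.\<close>
 have "radial_about a f"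
 proof (rule ccontr)
  assume "\<not> radial_about a f"
  from off_center[OF this f(1)] obtain x y \<epsilon> where xy: "x \<in> pts" "y \<in> pts" "0 < \<epsilon>" "x \<notin> cell y \<epsilon>"
   "!!y'. y' \<in> cell y \<epsilon> ==> y' \<in> pts \<and> x ~= y' \<and> d a x < d a y' \<and> \<mu> {z \<in> pts. d z x < d z y' \<and> f z < f (refl x y' z)} ~= 0"
   by blast
  have rad': "\<mu> (cell a s - B') = 0 \<or> \<mu> {z \<in> B'. s < d a z} = 0" for s
   using rg unfolding radial_about_def B'_def by blast
  obtain J where J: "!!s t. s \<in> J ==> t <= s ==> t \<in> J" "AE z in M. z \<in> B' \<longleftrightarrow> d a z \<in> J"
   by (rule radial_level[OF a(1) Bm(2) rad']) (rule that)
  have "AE z in M. refl x y' z \<in> B' \<longleftrightarrow> z \<in> B'" if y': "y' \<in> cell y \<epsilon>" for y'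
  proof -
   note y'' = xy(5)[OF y']
   have y'M: "y' \<in> pts" "x ~= y'" using y'' by auto
   have "\<mu> {z \<in> pts. d z x < d z y' \<and> g (refl x y' z) < g z} = 0"
    using opp[OF xy(1), of y'] y'' by blast
   then have gle: "AE z in M. d z x < d z y' --> g z <= g (refl x y' z)" using xy(1) y'' g(1) by (intro one_sided) auto
   have H: "AE z in M. d z x < d z y' --> (refl x y' z \<in> B' \<longleftrightarrow> z \<in> B')"
    using gle J(2) AE_refl[OF xy(1) y'M J(2)] AE_space
   proof eventually_elim
    case (elim z)
    show ?case
    proof (intro impI iffI)
     assume side: "d z x < d z y'"
     { assume "refl x y' z \<in> B'"
      then have "d a (refl x y' z) \<in> J" using elim by simp
      moreover have "d a z < d a (refl x y' z)"
       using refl_strictly_farther[OF xy(1) y'M a(1) elim(4)] y'' side by simp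
      ultimately have "d a z \<in> J" using J(1) by (meson less_imp_le)
      then show "z \<in> B'" using elim by simp }
     { assume "z \<in> B'"
      then show "refl x y' z \<in> B'" using elim(1) side refl_in[OF xy(1) y'M elim(4)] by (auto simp: B'_def) }
    qed
   qed
   show ?thesis using H AE_refl[OF xy(1) y'M H] AE_not_in[OF bisector_null[OF xy(1) y'M]] AE_space
   proof eventually_elim
    case (elim z)
    then show ?case using refl_dist_ends[OF xy(1) y'M elim(4)] refl_refl[OF xy(1) y'M elim(4)]
     by (cases "d z x" "d z y'" rule: linorder_cases) auto
   qed
  qed
  from invariant_set_trivial[OF Bm(2) xy(1-4) this] B'pos show False by auto
 qed
 then show thesis by (rule that[OF a(1) _ rg])
qed

end

section \<open>Invariance of volume\<close>

text \<open>
 A map that multiplies infinitesimal lengths by \<open>w x / w (f x)\<close> maps small balls almost into balls, so by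
 Vitali's covering theorem it does not increase the measure \<open>w\<^sup>n dx\<close>; being an involution it preserves it.
\<close>

locale conformal_involution =
 fixes S :: "'a::euclidean_space set" and w :: "'a => real" and f :: "'a => 'a"
 assumes open_S: "open S" and w_cont: "continuous_on S w" and w_pos: "!!x. x \<in> S ==> 0 < w x"
  and f_cont: "continuous_on S f" and f_in: "!!x. x \<in> S ==> f x \<in> S" and f_f: "!!x. x \<in> S ==> f (f x) = x"
  and f_dist: "!!x y. x \<in> S ==> y \<in> S ==> (dist (f x) (f y))\<^sup>2 * (w (f x) * w (f y)) = (dist x y)\<^sup>2 * (w x * w y)"
begin

definition mu :: "'a measure" where
 "mu = density (restrict_space lborel S) (\<lambda>x. ennreal (w x ^ DIM('a)))"

lemma space_mu [simp]: "space mu = S"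
 by (simp add: mu_def space_restrict_space)

lemma sets_mu: "A \<in> sets mu \<longleftrightarrow> A \<in> sets borel \<and> A \<subseteq> S"
 using open_S by (auto simp: mu_def sets_restrict_space_iff)

lemma sets_mu_borel: "sets mu = sets (restrict_space borel S)"
 by (simp add: mu_def sets_restrict_space)

lemma w_measurable: "w \<in> borel_measurable (restrict_space lborel S)"
 using borel_measurable_continuous_on_restrict[OF w_cont] by (simp cong: measurable_cong_sets add: sets_restrict_space)

lemma emeasure_mu:
 assumes "A \<in> sets borel" "A \<subseteq> S"
 shows "emeasure mu A = (\<integral>\<^sup>+x. ennreal (w x ^ DIM('a)) * indicator A x \<partial>restrict_space lborel S)"
proof -
 have [measurable]: "w \<in> borel_measurable (restrict_space lborel S)" by (rule w_measurable)
 show ?thesis unfolding mu_def using assms open_S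
  by (intro emeasure_density) (auto simp: sets_restrict_space_iff)
qed

lemma sets_restrict: "A \<in> sets borel ==> A \<subseteq> S ==> A \<in> sets (restrict_space lborel S)"
 using open_S by (auto simp: sets_restrict_space_iff)

lemma emeasure_restrict: "A \<in> sets borel ==> A \<subseteq> S ==> emeasure (restrict_space lborel S) A = emeasure lborel A"
 using open_S by (intro emeasure_restrict_space) auto

lemma emeasure_mu_le:
 assumes A: "A \<in> sets borel" "A \<subseteq> S" and c: "!!x. x \<in> A ==> w x <= c" "0 <= c"
 shows "emeasure mu A <= ennreal (c ^ DIM('a)) * emeasure lborel A"
proof -
 have "emeasure mu A <= (\<integral>\<^sup>+x. ennreal (c ^ DIM('a)) * indicator A x \<partial>restrict_space lborel S)"
  unfolding emeasure_mu[OF A]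
 proof (rule nn_integral_mono)
  fix x assume "x \<in> space (restrict_space lborel S)"
  show "ennreal (w x ^ DIM('a)) * indicator A x <= ennreal (c ^ DIM('a)) * indicator A x"
  proof (cases "x \<in> A")
   case True
   then have "0 <= w x" "w x <= c" using A c w_pos[of x] by auto
   then show ?thesis using True by (simp add: ennreal_leI power_mono)
  qed simp
 qed
 also have "... = ennreal (c ^ DIM('a)) * emeasure lborel A"
  using sets_restrict[OF A] emeasure_restrict[OF A] by (simp add: nn_integral_cmult_indicator)
 finally show ?thesis .
qed

lemma emeasure_mu_ge:
 assumes A: "A \<in> sets borel" "A \<subseteq> S" and c: "!!x. x \<in> A ==> c <= w x" "0 <= c"
 shows "ennreal (c ^ DIM('a)) * emeasure lborel A <= emeasure mu A"
proof -
 have "ennreal (c ^ DIM('a)) * emeasure lborel A = (\<integral>\<^sup>+x. ennreal (c ^ DIM('a)) * indicator A x \<partial>restrict_space lborel S)"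
  using sets_restrict[OF A] emeasure_restrict[OF A] by (simp add: nn_integral_cmult_indicator)
 also have "... <= emeasure mu A" unfolding emeasure_mu[OF A]
 proof (rule nn_integral_mono)
  fix x assume "x \<in> space (restrict_space lborel S)"
  show "ennreal (c ^ DIM('a)) * indicator A x <= ennreal (w x ^ DIM('a)) * indicator A x"
   using c by (cases "x \<in> A") (simp_all add: ennreal_leI power_mono)
 qed
 finally show ?thesis .
qed

lemma emeasure_mu_null:
 assumes A: "A \<in> sets borel" "A \<subseteq> S" and 0: "emeasure lborel A = 0"
 shows "emeasure mu A = 0"
proof -
 have "A \<in> null_sets (restrict_space lborel S)"
  using sets_restrict[OF A] emeasure_restrict[OF A] 0 by (simp add: null_sets_def)
 then show ?thesis unfolding emeasure_mu[OF A] by (rule nn_integral_null_set)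
qed

definition pre :: "'a set => 'a set" where "pre A = {y \<in> S. f y \<in> A}"

lemma pre_subset: "pre A \<subseteq> S" by (auto simp: pre_def)

lemma pre_open: "open A ==> open (pre A)"
 using continuous_open_preimage[OF f_cont open_S] by (simp add: pre_def vimage_def Int_def)

lemma f_measurable_mu: "f \<in> mu \<rightarrow>\<^sub>M mu"
proof -
 have "f \<in> restrict_space borel S \<rightarrow>\<^sub>M restrict_space borel S"
  using borel_measurable_continuous_on_restrict[OF f_cont] f_in
  by (intro measurable_restrict_space2) (auto simp: space_restrict_space)
 then show ?thesis by (simp cong: measurable_cong_sets add: sets_mu_borel)
qed

lemma pre_borel: "A \<in> sets borel ==> A \<subseteq> S ==> pre A \<in> sets borel"
 using measurable_sets[OF f_measurable_mu, of A] sets_mu[of A] sets_mu[of "pre A"]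
 by (simp add: pre_def vimage_def Int_def conj_commute)

lemma pre_image: "A \<subseteq> S ==> pre A = f ` A"
 using f_in f_f by (force simp: pre_def image_iff)

lemma pre_pre: "A \<subseteq> S ==> pre (pre A) = A"
 using f_in f_f by (auto simp: pre_def)

text \<open>Near \<open>x\<close> the weights vary by at most a factor \<open>q\<close>, which turns
  the quadratic relation between the distances into a Lipschitz bound at \<open>x\<close>.\<close>

lemma local_estimate:
 assumes x: "x \<in> S" and q: "1 < q"
 obtains r where "0 < r" "ball x r \<subseteq> S"
  "!!y. y \<in> ball x r ==> dist (f y) (f x) <= q * w x / w (f x) * dist y x"
  "!!y. y \<in> ball x r ==> w x / q <= w y" "!!y. y \<in> ball x r ==> w (f y) <= q * w (f x)"
proof -
 have wf: "continuous_on S (\<lambda>y. w (f y))"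
  using f_in by (intro continuous_on_compose2[OF w_cont f_cont]) auto
 have pos: "0 < w x" "0 < w (f x)" using w_pos f_in x by auto
 have tend: "(w \<longlongrightarrow> w x) (at x)" "((\<lambda>y. w (f y)) \<longlongrightarrow> w (f x)) (at x)"
  using continuous_on_eq_continuous_at[OF open_S] w_cont wf x by (auto simp: isCont_def)
 have "w x < q * w x" "w (f x) < q * w (f x)" "w x / q < w x" "w (f x) / q < w (f x)"
  using pos q by (simp_all add: divide_less_eq)
 then have "\<forall>\<^sub>F y in at x. w y < q * w x \<and> w x / q < w y \<and> w (f y) < q * w (f x) \<and> w (f x) / q < w (f y)"
  by (intro eventually_conj order_tendstoD[OF tend(1)] order_tendstoD[OF tend(2)])
 then obtain r1 where r1: "0 < r1" "!!y. y ~= x ==> dist y x < r1 ==> w y < q * w x \<and> w x / q < w y \<and> w (f y) < q * w (f x) \<and> w (f x) / q < w (f y)"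
  by (auto simp: eventually_at)
 obtain r2 where r2: "0 < r2" "ball x r2 \<subseteq> S" using open_S x openE by blast
 define r where "r = min r1 r2"
 have est: "w y <= q * w x" "w x / q <= w y" "w (f y) <= q * w (f x)" "w (f x) / q <= w (f y)" if "y \<in> ball x r" for y
 proof -
  have "w y <= q * w x \<and> w x / q <= w y \<and> w (f y) <= q * w (f x) \<and> w (f x) / q <= w (f y)"
  proof (cases "y = x")
   case True
   then show ?thesis using pos q by (simp add: divide_le_eq)
  next
   case False
   then show ?thesis using r1(2)[OF False] that by (auto simp: r_def dist_commute less_imp_le)
  qed
  then show "w y <= q * w x" "w x / q <= w y" "w (f y) <= q * w (f x)" "w (f x) / q <= w (f y)" by auto
 qed
 show thesis
 proof (rule that[of r])
  show "0 < r" "ball x r \<subseteq> S" using r1 r2 by (auto simp: r_def)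
  fix y assume y: "y \<in> ball x r"
  have yS: "y \<in> S" using y r2 by (auto simp: r_def)
  have "(dist (f y) (f x))\<^sup>2 * (w (f x) / q * w (f x)) <= (dist (f y) (f x))\<^sup>2 * (w (f y) * w (f x))"
   using est(4)[OF y] pos by (intro mult_left_mono mult_right_mono) auto
  also have "... = (dist y x)\<^sup>2 * (w y * w x)" by (rule f_dist[OF yS x])
  also have "... <= (dist y x)\<^sup>2 * (q * w x * w x)"
   using est(1)[OF y] pos by (intro mult_left_mono mult_right_mono) auto
  finally have "(dist (f y) (f x))\<^sup>2 * (w (f x) / q * w (f x)) <= (dist y x)\<^sup>2 * (q * w x * w x)" .
  then have "(dist (f y) (f x))\<^sup>2 * (w (f x))\<^sup>2 <= (dist y x)\<^sup>2 * (q * w x)\<^sup>2"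
   using q by (simp add: field_simps power2_eq_square)
  then have "(dist (f y) (f x) * w (f x))\<^sup>2 <= (dist y x * (q * w x))\<^sup>2" by (simp add: power_mult_distrib)
  then have "dist (f y) (f x) * w (f x) <= dist y x * (q * w x)"
   using q pos by (intro power2_le_imp_le[of "dist (f y) (f x) * w (f x)"]) auto
  then show "dist (f y) (f x) <= q * w x / w (f x) * dist y x" using pos by (simp add: field_simps)
 qed (use est in auto)
qed

text \<open>The three factors \<open>q\<close> come from the Lipschitz bound, from the variation of
  \<open>w\<close> on the image and from its variation on the ball itself.\<close>

lemma pre_ball_le:
 assumes x: "x \<in> S" and q: "1 < q"
 obtains r0 where "0 < r0" "ball x r0 \<subseteq> S"
  "!!r. 0 < r ==> r <= r0 ==> emeasure mu (pre (ball x r)) <= ennreal ((q ^ 3) ^ DIM('a)) * emeasure mu (ball x r)"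
proof -
 obtain r0 where r0: "0 < r0" "ball x r0 \<subseteq> S"
  "!!y. y \<in> ball x r0 ==> dist (f y) (f x) <= q * w x / w (f x) * dist y x"
  "!!y. y \<in> ball x r0 ==> w x / q <= w y" "!!y. y \<in> ball x r0 ==> w (f y) <= q * w (f x)"
  by (rule local_estimate[OF x q]) (rule that)
 have pos: "0 < w x" "0 < w (f x)" using w_pos f_in x by auto
 show thesis
 proof (rule that[OF r0(1,2)])
  fix r assume r: "0 < r" "r <= r0"
  have sub: "ball x r \<subseteq> ball x r0" using r by auto
  then have bS: "ball x r \<subseteq> S" using r0(2) by auto
  define R where "R = q * w x / w (f x) * r"
  have R: "0 <= R" using q pos r by (simp add: R_def)
  have "pre (ball x r) \<subseteq> ball (f x) R"
  proof
   fix z assume z: "z \<in> pre (ball x r)"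
   then have "f z \<in> ball x r0" "z = f (f z)" "dist (f z) x < r" using f_f sub by (auto simp: pre_def dist_commute)
   then have "dist z (f x) <= q * w x / w (f x) * dist (f z) x" using r0(3)[of "f z"] by simp
   also have "... < R" unfolding R_def using \<open>dist (f z) x < r\<close> q pos by (intro mult_strict_left_mono) auto
   finally show "z \<in> ball (f x) R" by (simp add: dist_commute)
  qed
  then have "emeasure lborel (pre (ball x r)) <= emeasure lborel (ball (f x) R)" by (intro emeasure_mono) auto
  then have vol: "emeasure lborel (pre (ball x r)) <= ennreal (unit_ball_vol (DIM('a)) * R ^ DIM('a))"
   by (simp add: emeasure_ball[OF R])
  have "emeasure mu (pre (ball x r)) <= ennreal ((q * w (f x)) ^ DIM('a)) * emeasure lborel (pre (ball x r))"
  proof (rule emeasure_mu_le)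
   show "pre (ball x r) \<in> sets borel" using pre_borel[OF _ bS] by simp
   fix z assume z: "z \<in> pre (ball x r)"
   then have "f z \<in> ball x r0" "z = f (f z)" using f_f sub by (auto simp: pre_def)
   then show "w z <= q * w (f x)" using r0(5)[of "f z"] by simp
  qed (use pre_subset q pos in auto)
  also have "... <= ennreal ((q * w (f x)) ^ DIM('a)) * ennreal (unit_ball_vol (DIM('a)) * R ^ DIM('a))"
   by (intro mult_left_mono vol) simp
  also have "... = ennreal ((q ^ 3) ^ DIM('a)) * (ennreal ((w x / q) ^ DIM('a)) * ennreal (unit_ball_vol (DIM('a)) * r ^ DIM('a)))"
  proof -
   have "(q * w (f x)) ^ DIM('a) * (unit_ball_vol (DIM('a)) * R ^ DIM('a))
    = unit_ball_vol (DIM('a)) * (q * w (f x) * R) ^ DIM('a)" by (simp add: power_mult_distrib)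
   also have "q * w (f x) * R = q ^ 3 * (w x / q) * r"
    using q pos by (simp add: R_def field_simps power3_eq_cube)
   also have "unit_ball_vol (DIM('a)) * (q ^ 3 * (w x / q) * r) ^ DIM('a)
    = (q ^ 3) ^ DIM('a) * ((w x / q) ^ DIM('a) * (unit_ball_vol (DIM('a)) * r ^ DIM('a)))"
    by (simp only: power_mult_distrib mult_ac)
   finally have "(q * w (f x)) ^ DIM('a) * (unit_ball_vol (DIM('a)) * R ^ DIM('a))
    = (q ^ 3) ^ DIM('a) * ((w x / q) ^ DIM('a) * (unit_ball_vol (DIM('a)) * r ^ DIM('a)))" .
   moreover have "0 <= unit_ball_vol (real DIM('a))" by simp
   ultimately show ?thesis using q pos r R by (subst ennreal_mult[symmetric], simp, simp)+ simp
  qed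
  also have "... <= ennreal ((q ^ 3) ^ DIM('a)) * emeasure mu (ball x r)"
  proof (rule mult_left_mono)
   show "ennreal ((w x / q) ^ DIM('a)) * ennreal (unit_ball_vol (DIM('a)) * r ^ DIM('a)) <= emeasure mu (ball x r)"
    using emeasure_mu_ge[OF _ bS, of "w x / q"] r0(4) sub q pos emeasure_ball[of r x] r by auto
  qed simp
  finally show "emeasure mu (pre (ball x r)) <= ennreal ((q ^ 3) ^ DIM('a)) * emeasure mu (ball x r)" .
 qed
qed

lemma pre_null:
 assumes A: "A \<in> sets borel" "A \<subseteq> S" and neg: "negligible A"
 shows "emeasure mu (pre A) = 0"
proof -
 have "negligible (f ` A)"
 proof (rule negligible_locally_Lipschitz_image[OF _ neg])
  fix x assume x: "x \<in> A"
  then have xS: "x \<in> S" using A by auto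
  obtain r where r: "0 < r" "ball x r \<subseteq> S"
   "!!y. y \<in> ball x r ==> dist (f y) (f x) <= 2 * w x / w (f x) * dist y x"
   "!!y. y \<in> ball x r ==> w x / 2 <= w y" "!!y. y \<in> ball x r ==> w (f y) <= 2 * w (f x)"
   by (rule local_estimate[OF xS, of 2]) (simp, rule that)
  show "\<exists>T B. open T \<and> x \<in> T \<and> (\<forall>y\<in>A \<inter> T. norm (f y - f x) <= B * norm (y - x))"
   using r by (intro exI[of _ "ball x r"] exI[of _ "2 * w x / w (f x)"]) (auto simp: dist_norm[symmetric])
 qed simp
 then have "emeasure lborel (pre A) = 0"
  using pre_borel[OF A] pre_image[OF A(2)] by (simp add: negligible_iff_null_sets null_sets_def)
 then show ?thesis using pre_borel[OF A] pre_subset by (intro emeasure_mu_null)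
qed

text \<open>Vitali fills \<open>U\<close> up to a null set by disjoint small balls that satisfy the
  local estimate; the null remainder has a null preimage because the map is locally
  Lipschitz.\<close>

lemma pre_open_le:
 assumes U: "open U" "U \<subseteq> S" and q: "1 < q"
 shows "emeasure mu (pre U) <= ennreal ((q ^ 3) ^ DIM('a)) * emeasure mu U"
proof -
 define K where "K = {(x, r). x \<in> U \<and> 0 < r \<and> ball x r \<subseteq> U \<and>
  emeasure mu (pre (ball x r)) <= ennreal ((q ^ 3) ^ DIM('a)) * emeasure mu (ball x r)}"
 obtain C where C: "countable C" "C \<subseteq> K"
  "pairwise (\<lambda>i j. disjnt (ball (fst i) (snd i)) (ball (fst j) (snd j))) C"
  "negligible (U - (\<Union>i\<in>C. ball (fst i) (snd i)))"
 proof (rule Vitali_covering_theorem_balls[of U K fst snd])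
  fix x e assume x: "x \<in> U" and e: "(0::real) < e"
  then have xS: "x \<in> S" using U by auto
  obtain r0 where r0: "0 < r0" "ball x r0 \<subseteq> S"
   "!!r. 0 < r ==> r <= r0 ==> emeasure mu (pre (ball x r)) <= ennreal ((q ^ 3) ^ DIM('a)) * emeasure mu (ball x r)"
   by (rule pre_ball_le[OF xS q]) (rule that)
  obtain r1 where r1: "0 < r1" "ball x r1 \<subseteq> U" using U x openE by blast
  define r where "r = min (e / 2) (min r0 r1)"
  have "0 < r" "r < e" "r <= r0" "r <= r1" using e r0 r1 by (auto simp: r_def)
  then have "(x, r) \<in> K" using x r1 r0(3)[of r] by (auto simp: K_def)
  then show "\<exists>i. i \<in> K \<and> x \<in> ball (fst i) (snd i) \<and> snd i < e"
   using \<open>0 < r\<close> \<open>r < e\<close> by (intro exI[of _ "(x, r)"]) auto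
 qed blast
 let ?B = "\<lambda>i. ball (fst i) (snd i)"
 let ?N = "U - (\<Union>i\<in>C. ?B i)"
 have CB: "?B i \<subseteq> U" "emeasure mu (pre (?B i)) <= ennreal ((q ^ 3) ^ DIM('a)) * emeasure mu (?B i)" if "i \<in> C" for i
  using subsetD[OF C(2) that] by (cases i; simp add: K_def)+
 have mB: "?B i \<in> sets mu" "pre (?B i) \<in> sets mu" if "i \<in> C" for i
  using CB[OF that] U pre_subset pre_borel[of "?B i"] by (auto simp: sets_mu)
 have NB: "?N \<in> sets borel" using U by (intro sets.Diff borel_open open_UN) auto
 have NS: "?N \<subseteq> S" using U by auto
 have mN: "pre ?N \<in> sets mu" using pre_subset[of ?N] pre_borel[OF NB NS] by (simp add: sets_mu)
 have disj: "disjoint_family_on ?B C" using C(3) by (auto simp: disjoint_family_on_def pairwise_def disjnt_def)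
 have disj': "disjoint_family_on (\<lambda>i. pre (?B i)) C" using disj by (fastforce simp: disjoint_family_on_def pre_def)
 have mU: "(\<Union>i\<in>C. pre (?B i)) \<in> sets mu" using mB C(1) by (intro sets.countable_UN') auto
 have "emeasure mu (pre U) <= emeasure mu (pre ?N \<union> (\<Union>i\<in>C. pre (?B i)))"
  using mN mU by (intro emeasure_mono) (auto simp: pre_def)
 also have "... <= emeasure mu (pre ?N) + emeasure mu (\<Union>i\<in>C. pre (?B i))"
  by (rule emeasure_subadditive[OF mN mU])
 also have "emeasure mu (pre ?N) = 0" by (rule pre_null[OF NB NS C(4)])
 also have "emeasure mu (\<Union>i\<in>C. pre (?B i)) = (\<integral>\<^sup>+i. emeasure mu (pre (?B i)) \<partial>count_space C)"
  by (rule emeasure_UN_countable[OF mB(2) C(1) disj'])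
 also have "... <= (\<integral>\<^sup>+i. ennreal ((q ^ 3) ^ DIM('a)) * emeasure mu (?B i) \<partial>count_space C)"
  by (intro nn_integral_mono CB) simp
 also have "... = ennreal ((q ^ 3) ^ DIM('a)) * (\<integral>\<^sup>+i. emeasure mu (?B i) \<partial>count_space C)"
  by (rule nn_integral_cmult) simp
 also have "(\<integral>\<^sup>+i. emeasure mu (?B i) \<partial>count_space C) = emeasure mu (\<Union>i\<in>C. ?B i)"
  by (rule emeasure_UN_countable[OF mB(1) C(1) disj, symmetric])
 also have "ennreal ((q ^ 3) ^ DIM('a)) * emeasure mu (\<Union>i\<in>C. ?B i) <= ennreal ((q ^ 3) ^ DIM('a)) * emeasure mu U"
  using CB(1) U by (intro mult_left_mono emeasure_mono) (auto simp: sets_mu)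
 finally show ?thesis by simp
qed

text \<open>Letting \<open>q\<close> tend to 1 gives one inequality. Applied to
  \<open>pre U\<close>, whose preimage is \<open>U\<close> again, it gives the other.\<close>

lemma pre_open_eq:
 assumes U: "open U" "U \<subseteq> S"
 shows "emeasure mu (pre U) = emeasure mu U"
proof -
 have le: "emeasure mu (pre U) <= emeasure mu U" if U: "open U" "U \<subseteq> S" for U
 proof (cases "emeasure mu U")
  case (real m)
  have "(\<lambda>k. ((1 + inverse (real (Suc k))) ^ 3) ^ DIM('a) * m) \<longlonglongrightarrow> ((1 + 0) ^ 3) ^ DIM('a) * m"
   by (intro tendsto_intros LIMSEQ_inverse_real_of_nat)
  then have "(\<lambda>k. ennreal (((1 + inverse (real (Suc k))) ^ 3) ^ DIM('a) * m)) \<longlonglongrightarrow> ennreal (1 * m)"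
   by (intro tendsto_ennrealI) simp
  moreover have "emeasure mu (pre U) <= ennreal (((1 + inverse (real (Suc k))) ^ 3) ^ DIM('a) * m)" for k
   using pre_open_le[OF U, of "1 + inverse (real (Suc k))"] real by (simp add: ennreal_mult)
  ultimately have "emeasure mu (pre U) <= ennreal (1 * m)" by (intro LIMSEQ_le_const) auto
  then show ?thesis using real by simp
 qed simp
 show ?thesis using le[OF U] le[OF pre_open[OF U(1)] pre_subset] pre_pre[OF U(2)] by simp
qed

lemma distr_mu: "distr mu mu f = mu"
proof (rule measure_eqI_generator_eq[where \<Omega> = S and E = "{U. open U \<and> U \<subseteq> S}" and
   A = "\<lambda>k. ball 0 (real k) \<inter> (S \<inter> w -` {..<real k})"])
 show "Int_stable {U. open U \<and> U \<subseteq> S}" by (auto simp: Int_stable_def)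
 have gen: "sets mu = sigma_sets S {U. open U \<and> U \<subseteq> S}"
 proof -
  have "sets (restrict_space borel S) = (\<inter>) S ` sigma_sets UNIV {U. open U}"
   by (simp add: sets_restrict_space borel_def)
  also have "... = sigma_sets S ((\<inter>) S ` {U. open U})" using open_S by (intro sigma_sets_Int) auto
  also have "(\<inter>) S ` {U. open U} = {U. open U \<and> U \<subseteq> S}"
  proof -
   have "U \<in> (\<inter>) S ` {U. open U}" if "open U" "U \<subseteq> S" for U using that by (intro image_eqI[of _ _ U]) auto
   then show ?thesis using open_S by auto
  qed
  finally show ?thesis by (simp add: sets_mu_borel)
 qed
 show "sets (distr mu mu f) = sigma_sets S {U. open U \<and> U \<subseteq> S}" "sets mu = sigma_sets S {U. open U \<and> U \<subseteq> S}"
  using gen by auto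
 have dist_eq: "emeasure (distr mu mu f) U = emeasure mu U" if "open U" "U \<subseteq> S" for U
 proof -
  have "f -` U \<inter> space mu = pre U" by (auto simp: pre_def)
  then have "emeasure (distr mu mu f) U = emeasure mu (pre U)"
   using that by (subst emeasure_distr[OF f_measurable_mu]) (auto simp: sets_mu)
  then show ?thesis using pre_open_eq that by simp
 qed
 then show "emeasure (distr mu mu f) U = emeasure mu U" if "U \<in> {U. open U \<and> U \<subseteq> S}" for U using that by auto
 have op: "open (S \<inter> w -` {..<c})" for c by (rule continuous_open_preimage[OF w_cont open_S]) simp
 then show "range (\<lambda>k. ball 0 (real k) \<inter> (S \<inter> w -` {..<real k})) \<subseteq> {U. open U \<and> U \<subseteq> S}" by auto
 show "(\<Union>k. ball 0 (real k) \<inter> (S \<inter> w -` {..<real k})) = S"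
 proof
  show "S \<subseteq> (\<Union>k. ball 0 (real k) \<inter> (S \<inter> w -` {..<real k}))"
  proof
   fix x assume "x \<in> S"
   obtain k where "max (norm x) (w x) < real k" using reals_Archimedean2 by blast
   then show "x \<in> (\<Union>k. ball 0 (real k) \<inter> (S \<inter> w -` {..<real k}))" using \<open>x \<in> S\<close> by (intro UN_I[of k]) auto
  qed
 qed auto
 \<comment> \<open>The weight may be unbounded near the boundary of \<open>S\<close>, so the
   exhausting sets bound \<open>w\<close> as well as the norm.\<close>
 fix k :: nat
 let ?A = "ball 0 (real k) \<inter> (S \<inter> w -` {..<real k})"
 have "emeasure mu ?A <= ennreal (real k ^ DIM('a)) * emeasure lborel ?A"
  using op by (intro emeasure_mu_le) auto
 also have "... <= ennreal (real k ^ DIM('a)) * emeasure lborel (ball (0::'a) (real k))"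
  by (intro mult_left_mono emeasure_mono) auto
 also have "... < \<infinity>" using emeasure_lborel_ball_finite[of "0::'a" "real k"] by (simp add: ennreal_mult_less_top)
 finally have "emeasure mu ?A ~= \<infinity>" by simp
 moreover have "emeasure (distr mu mu f) ?A = emeasure mu ?A" using op[of "real k"] by (intro dist_eq open_Int[of "ball 0 (real k)"]) auto
 ultimately show "emeasure (distr mu mu f) ?A ~= \<infinity>" by simp
qed auto

end

section \<open>Completions of Borel measures\<close>

lemma distr_completion_eq:
 assumes f: "f \<in> M \<rightarrow>\<^sub>M M" and distr: "distr M M f = M"
 shows "f \<in> completion M \<rightarrow>\<^sub>M completion M" and "distr (completion M) (completion M) f = completion M"
proof -
 have null: "f -` N' \<inter> space M \<in> null_sets M" if "N' \<in> null_sets M" for N'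
  using that emeasure_distr[OF f, of N'] measurable_sets[OF f, of N'] distr by (auto simp: null_sets_def)
 show m: "f \<in> completion M \<rightarrow>\<^sub>M completion M"
 proof (rule measurableI)
  fix A assume "A \<in> sets (completion M)"
  then obtain S N N' where A: "A = S \<union> N" "N \<subseteq> N'" "N' \<in> null_sets M" "S \<in> sets M" by (rule sets_completionE)
  have "f -` A \<inter> space M = (f -` S \<inter> space M) \<union> (f -` N \<inter> space M)" using A by auto
  moreover have "f -` N \<inter> space M \<subseteq> f -` N' \<inter> space M" using A(2) by auto
  ultimately show "f -` A \<inter> space (completion M) \<in> sets (completion M)"
   unfolding space_completion using null[OF A(3)] measurable_sets[OF f A(4)] by (intro sets_completionI)
 qed (use measurable_space[OF f] in auto)
 show "distr (completion M) (completion M) f = completion M"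
 proof (rule measure_eqI)
  fix A assume "A \<in> sets (distr (completion M) (completion M) f)"
  then have Ac: "A \<in> sets (completion M)" by simp
  then obtain S N N' where A: "A = S \<union> N" "N \<subseteq> N'" "N' \<in> null_sets M" "S \<in> sets M" by (rule sets_completionE)
  have aeA: "AE x in completion M. x \<in> A \<longleftrightarrow> x \<in> S"
   using AE_not_in[OF null_sets_completionI[OF A(3)]] by eventually_elim (use A in auto)
  have aeP: "AE x in completion M. x \<in> f -` A \<inter> space M \<longleftrightarrow> x \<in> f -` S \<inter> space M"
   using AE_not_in[OF null_sets_completionI[OF null[OF A(3)]]] AE_space by eventually_elim (use A in auto)
  have "emeasure (distr (completion M) (completion M) f) A = emeasure (completion M) (f -` A \<inter> space M)"
   using m Ac by (subst emeasure_distr) auto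
  also have "... = emeasure (completion M) (f -` S \<inter> space M)"
   using aeP measurable_sets[OF m Ac] measurable_sets[OF f A(4)] by (intro emeasure_eq_AE) auto
  also have "... = emeasure M (f -` S \<inter> space M)" using measurable_sets[OF f A(4)] by simp
  also have "... = emeasure M S" using emeasure_distr[OF f A(4)] distr by simp
  also have "... = emeasure (completion M) S" using A(4) by simp
  also have "... = emeasure (completion M) A" using aeA Ac A(4) by (intro emeasure_eq_AE) auto
  finally show "emeasure (distr (completion M) (completion M) f) A = emeasure (completion M) A" .
 qed simp
qed

text \<open>Finite Borel measures on Euclidean space are inner regular. This is applied to the
  restriction of \<open>M\<close> to a Borel set \<open>S\<close> inside \<open>A\<close> that
  differs from \<open>A\<close> by a null set.\<close>

lemma inner_regular_completion:
 fixes M :: "'a::euclidean_space measure"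
 assumes sets: "!!A. A \<in> sets M ==> A \<in> sets borel" "!!A. A \<in> sets borel ==> A \<inter> space M \<in> sets M"
  and A: "A \<in> sets (completion M)" "emeasure (completion M) A < \<infinity>" and e: "0 < e"
 shows "\<exists>C\<subseteq>A. compact C \<and> emeasure (completion M) (A - C) < ennreal e"
proof -
 obtain S N N' where S: "A = S \<union> N" "N \<subseteq> N'" "N' \<in> null_sets M" "S \<in> sets M" using A(1) by (rule sets_completionE)
 have id: "(\<lambda>x. x) \<in> M \<rightarrow>\<^sub>M borel" using sets(2) by (auto intro!: measurableI)
 define Q where "Q = distr (density M (indicator S)) borel (\<lambda>x. x)"
 have Q: "emeasure Q E = emeasure M (S \<inter> E)" if "E \<in> sets borel" for E
 proof -
  have "emeasure Q E = emeasure (density M (indicator S)) (E \<inter> space M)"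
   unfolding Q_def using id that by (subst emeasure_distr) (auto simp: measurable_def vimage_def Int_def conj_commute)
  also have "... = (\<integral>\<^sup>+x. indicator S x * indicator (E \<inter> space M) x \<partial>M)"
   using S(4) sets(2)[OF that] by (intro emeasure_density) auto
  also have "... = (\<integral>\<^sup>+x. indicator (S \<inter> E) x \<partial>M)" by (intro nn_integral_cong) (auto simp: indicator_def)
  also have "... = emeasure M (S \<inter> E)"
  proof (rule nn_integral_indicator)
   have "S \<inter> E = S \<inter> (E \<inter> space M)" using sets.sets_into_space[OF S(4)] by auto
   then show "S \<inter> E \<in> sets M" using S(4) sets(2)[OF that] by simp
  qed
  finally show ?thesis .
 qed
 have SB: "S \<in> sets borel" using sets(1) S(4) by auto
 have fin: "emeasure M S < \<infinity>"
 proof -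
  have "emeasure (completion M) S <= emeasure (completion M) A" using S(1) A(1) by (intro emeasure_mono) auto
  then show ?thesis using A(2) S(4) by simp
 qed
 have sup: "emeasure Q S = (SUP K\<in>{K. K \<subseteq> S \<and> compact K}. emeasure Q K)"
 proof (rule inner_regular)
  show "emeasure Q (space Q) ~= \<infinity>" using Q[of UNIV] fin by (simp add: Q_def[symmetric]) (simp add: Q_def)
 qed (use SB in \<open>auto simp: Q_def\<close>)
 have finQ: "emeasure Q S ~= \<infinity>" using Q[OF SB] fin by simp
 have ne: "{K. K \<subseteq> S \<and> compact K} ~= {}" using compact_empty by blast
 have "\<exists>C\<in>{K. K \<subseteq> S \<and> compact K}. emeasure Q S < emeasure Q C + ennreal e"
  by (rule SUP_approx_ennreal[OF e ne sup finQ])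
 then obtain C where C: "C \<subseteq> S" "compact C" "emeasure Q S < emeasure Q C + ennreal e" by blast
 have CB: "C \<in> sets borel" using C(2) by (rule borel_compact)
 have Cm: "C \<in> sets M" using sets(2)[OF CB] C(1) sets.sets_into_space[OF S(4)] by (simp add: Int_absorb2)
 have QC: "emeasure Q C = emeasure M C" "emeasure Q S = emeasure M S" using Q[OF CB] Q[OF SB] C(1) by (simp_all add: Int_absorb1)
 have Cfin: "emeasure M C < \<infinity>" using emeasure_mono[OF C(1) S(4)] fin by (rule order_le_less_trans)
 have "emeasure M (S - C) < ennreal e"
 proof -
  have "emeasure M S = emeasure M C + emeasure M (S - C)"
   using S(4) Cm C(1) by (subst plus_emeasure) (auto simp: Un_absorb1)
  then have "emeasure M C + emeasure M (S - C) < emeasure M C + ennreal e" using C(3) QC by simp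
  then show ?thesis using Cfin by (simp add: ennreal_add_left_cancel_less)
 qed
 moreover have "emeasure (completion M) (A - C) = emeasure M (S - C)"
 proof -
  have "AE x in completion M. x \<in> A - C \<longleftrightarrow> x \<in> S - C"
   using AE_not_in[OF null_sets_completionI[OF S(3)]] by eventually_elim (use S in auto)
  then have "emeasure (completion M) (A - C) = emeasure (completion M) (S - C)"
   using A(1) S(4) Cm by (intro emeasure_eq_AE) auto
  then show ?thesis using S(4) Cm by simp
 qed
 ultimately show ?thesis using C S(1) by (intro exI[of _ C]) auto
qed

section \<open>Euclidean, spherical and hyperbolic reflections\<close>

lemma emeasure_lborel_open_pos:
 fixes U :: "'a::euclidean_space set"
 assumes "open U" "U ~= {}" shows "0 < emeasure lborel U"
proof -
 obtain x where "x \<in> U" using assms by auto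
 then obtain e where e: "0 < e" "ball x e \<subseteq> U" using assms(1) openE by blast
 have "0 < emeasure lborel (ball x e)" using e(1) by (simp add: emeasure_ball ennreal_zero_less_mult_iff)
 also have "... <= emeasure lborel U" using e(2) assms(1) by (intro emeasure_mono) auto
 finally show ?thesis .
qed

lemma open_infinite:
 fixes U :: "'a::euclidean_space set"
 assumes "open U" "U ~= {}" shows "infinite U"
proof
 assume "finite U"
 then have "emeasure lborel U = 0" using finite_imp_null_set_lborel by blast
 with emeasure_lborel_open_pos[OF assms] show False by simp
qed

lemma sgn_diff_power2:
 fixes a b :: real
 assumes "0 <= a" "0 <= b" shows "sgn (a\<^sup>2 - b\<^sup>2) = sgn (a - b)"
proof -
 have "a\<^sup>2 - b\<^sup>2 = (a - b) * (a + b)" by (simp add: power2_eq_square algebra_simps)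
 moreover have "sgn (a + b) = 1 \<or> a - b = 0" using assms by (auto simp: sgn_if)
 ultimately show ?thesis by (auto simp: sgn_mult)
qed

lemma sigma_finite_by_compact:
 fixes X :: "'a::euclidean_space model_space"
 assumes sets: "!!A. A \<in> sets borel ==> A \<inter> points X \<in> sets (vol X)"
  and compact: "!!r. compact {y \<in> points X. distance X (base X) y <= r}"
  and finite: "!!r. emeasure (vol X) {y \<in> points X. distance X (base X) y <= r} < \<infinity>"
 shows "sigma_finite_measure (vol X)"
proof -
 define B where "B r = {y \<in> points X. distance X (base X) y <= r}" for r
 have "B r \<in> sets (vol X)" for r
  using sets[of "B r"] borel_compact[OF compact[of r]] by (simp add: B_def Int_absorb2 Collect_restrict)
 moreover have "(\<Union>n. B (real n)) = points X" using real_arch_simple by (auto simp: B_def)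
 moreover have "emeasure (vol X) (B r) ~= \<infinity>" for r using finite[of r] by (simp add: B_def)
 ultimately show ?thesis
  unfolding sigma_finite_measure_def by (intro exI[of _ "range (\<lambda>n. B (real n))"]) auto
qed

lemma completion_sets_restrict:
 assumes sets: "sets M = sets (restrict_space borel S)" and S: "S \<in> sets borel"
 shows "A \<in> sets M ==> A \<in> sets borel" and "A \<in> sets borel ==> A \<inter> space M \<in> sets M" and "space M = S"
proof -
 show sp: "space M = S" using sets_eq_imp_space_eq[OF sets] by (simp add: space_restrict_space)
 show "A \<in> sets M ==> A \<in> sets borel" using S by (simp add: sets sets_restrict_space_iff)
 show "A \<in> sets borel ==> A \<inter> space M \<in> sets M" using S by (simp add: sets sp sets_restrict_space_iff)
qed

lemma involution_isometry:
 assumes "!!x. x \<in> S ==> f x \<in> S" "!!x. x \<in> S ==> f (f x) = x"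
  and "!!x y. x \<in> S ==> y \<in> S ==> d (f x) (f y) = d x y"
 shows "f \<in> isometries S d"
proof -
 have "bij_betw f S S" using assms by (intro bij_betw_byWitness[where f' = f]) auto
 then show ?thesis using assms(3) by (simp add: isometries_def)
qed

lemma dist_preserving_involution_lborel:
 fixes f :: "'a::euclidean_space => 'a"
 assumes f: "!!x y. dist (f x) (f y) = dist x y" "!!x. f (f x) = x"
 shows "f \<in> lborel \<rightarrow>\<^sub>M lborel" and "distr lborel lborel f = lborel"
proof -
 have cont: "continuous_on UNIV f" unfolding continuous_on_iff using f(1) by auto
 interpret conformal_involution "UNIV :: 'a set" "\<lambda>_. 1" f by standard (use f cont in auto)
 have "mu = (lborel :: 'a measure)"
 proof (rule measure_eqI)
  fix A assume "A \<in> sets mu"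
  then have "A \<in> sets borel" by (simp add: sets_mu)
  then show "emeasure mu A = emeasure lborel A"
   using emeasure_mu_le[of A 1] emeasure_mu_ge[of A 1] by (simp add: antisym)
 qed (simp add: sets_mu_borel)
 then show "f \<in> lborel \<rightarrow>\<^sub>M lborel" "distr lborel lborel f = lborel"
  using f_measurable_mu distr_mu by simp_all
qed

text \<open>Reflection in the perpendicular bisector: the numerator is twice the scalar product of
  \<open>x - y\<close> with the difference of \<open>z\<close> and the midpoint.\<close>

definition euc_refl :: "'a::euclidean_space => 'a => 'a => 'a" where
 "euc_refl x y z = z - (((dist z y)\<^sup>2 - (dist z x)\<^sup>2) / ((x - y) \<bullet> (x - y))) *\<^sub>R (x - y)"

lemmas inner_diffs = inner_diff_left inner_diff_right inner_commute

lemma dist_sq: "(dist x y)\<^sup>2 = (x - y) \<bullet> (x - y)" for x y :: "'a::real_inner"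
 by (simp add: dist_norm power2_norm_eq_inner)

context
 fixes x y :: "'a::euclidean_space" assumes xy: "x ~= y"
begin

private definition normal where "normal = x - y"
private definition side where "side z = 2 * (z \<bullet> normal) + (y \<bullet> y - x \<bullet> x)" for z

private lemma normal_pos: "0 < normal \<bullet> normal" using xy by (simp add: normal_def)

private lemma side_dist: "side z = (dist z y)\<^sup>2 - (dist z x)\<^sup>2"
 by (simp add: dist_sq side_def normal_def algebra_simps inner_commute)

private lemma refl_s: "euc_refl x y z = z - (side z / (normal \<bullet> normal)) *\<^sub>R normal"
 by (simp add: euc_refl_def side_dist normal_def)

private lemma side_refl: "side (euc_refl x y z) = - side z"
 using normal_pos by (simp add: refl_s side_def inner_diff_left field_simps)

lemma euc_refl_involution: "euc_refl x y (euc_refl x y z) = z"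
 using side_refl[of z] by (simp add: refl_s)

text \<open>An exact form of the sign rule. Applied twice it also yields the isometry, because
  \<open>side\<close> changes sign under the reflection.\<close>

lemma euc_refl_dist_sq:
 "(dist z (euc_refl x y w))\<^sup>2 - (dist z w)\<^sup>2 = side z * side w / (normal \<bullet> normal)"
proof -
 have "(dist z (euc_refl x y w))\<^sup>2 - (dist z w)\<^sup>2
  = (side w / (normal \<bullet> normal)) * (2 * (z \<bullet> normal) - 2 * (w \<bullet> normal) + (side w / (normal \<bullet> normal)) * (normal \<bullet> normal))"
  unfolding dist_sq refl_s by (simp add: algebra_simps inner_commute power2_eq_square)
 also have "(side w / (normal \<bullet> normal)) * (normal \<bullet> normal) = side w" using normal_pos by simp
 also have "2 * (z \<bullet> normal) - 2 * (w \<bullet> normal) + side w = side z" by (simp add: side_def)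
 finally show ?thesis by simp
qed

lemma euc_refl_isometry: "dist (euc_refl x y z) (euc_refl x y w) = dist z w"
proof -
 let ?f = "euc_refl x y"
 have "(dist (?f z) (?f w))\<^sup>2 - (dist (?f z) w)\<^sup>2 = - (side z * side w / (normal \<bullet> normal))"
  using euc_refl_dist_sq[of "?f z" w] by (simp add: side_refl)
 moreover have "(dist (?f z) w)\<^sup>2 - (dist z w)\<^sup>2 = side z * side w / (normal \<bullet> normal)"
  using euc_refl_dist_sq[of w z] by (simp only: dist_commute[of w] mult.commute[of "side w"])
 ultimately have "(dist (?f z) (?f w))\<^sup>2 = (dist z w)\<^sup>2" by linarith
 then show ?thesis by simp
qed

lemma euc_refl_swap: "euc_refl x y x = y"
 using normal_pos by (simp add: euc_refl_def dist_sq normal_def)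

lemma euc_refl_side:
 "sgn (dist z (euc_refl x y w) - dist z w) = sgn ((dist z y - dist z x) * (dist w y - dist w x))"
proof -
 have "sgn (dist z (euc_refl x y w) - dist z w) = sgn (side z * side w / (normal \<bullet> normal))"
  unfolding euc_refl_dist_sq[symmetric] by (simp add: sgn_diff_power2)
 also have "... = sgn (side z) * sgn (side w)" using normal_pos by (simp add: sgn_mult sgn_divide)
 also have "... = sgn ((dist z y - dist z x) * (dist w y - dist w x))"
  by (simp add: side_dist sgn_diff_power2 sgn_mult)
 finally show ?thesis .
qed

lemma euclidean_bisector_null: "{z. dist z x = dist z y} \<in> null_sets lebesgue"
proof -
 have "{z. dist z x = dist z y} = {z. normal \<bullet> z = (x \<bullet> x - y \<bullet> y) / 2}"
 proof (intro Collect_cong)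
  fix z
  have "dist z x = dist z y \<longleftrightarrow> side z = 0" by (auto simp: side_dist power2_eq_iff_nonneg)
  then show "dist z x = dist z y \<longleftrightarrow> normal \<bullet> z = (x \<bullet> x - y \<bullet> y) / 2"
   by (auto simp: side_def inner_commute field_simps)
 qed
 moreover have "negligible {z. normal \<bullet> z = (x \<bullet> x - y \<bullet> y) / 2}"
  using xy by (intro negligible_hyperplane) (simp add: normal_def)
 ultimately show ?thesis by (simp only: negligible_iff_null_sets)
qed

end

lemma euclidean_reflection_model: "reflection_model (euclidean_model :: 'a::euclidean_space model_space) euc_refl"
proof -
 let ?X = "euclidean_model :: 'a model_space"
 have sel: "vol ?X = lebesgue" "distance ?X = dist" "base ?X = 0" "translation_maps ?X = range (\<lambda>v x. x + v)"
  by (simp_all add: euclidean_model_def)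
 have cball: "{y \<in> points ?X. distance ?X (base ?X) y <= r} = cball 0 r" for r by (auto simp: sel)
 have ball: "model_ball ?X r = ball 0 r" for r by (auto simp: sel model_ball_def)
 have sets: "!!A. A \<in> sets borel ==> A \<inter> points ?X \<in> sets (vol ?X)" by (simp add: sel)
 have fin: "!!r. emeasure (vol ?X) {y \<in> points ?X. distance ?X (base ?X) y <= r} < \<infinity>"
  unfolding cball using emeasure_lborel_cball_finite by (simp add: sel(1))
 have comp: "!!r. compact {y \<in> points ?X. distance ?X (base ?X) y <= r}" unfolding cball by simp
 show ?thesis
 proof (rule reflection_model.intro)
  show "base ?X \<in> points ?X" by simp
  show "continuous_on (points ?X \<times> points ?X) (\<lambda>(x, y). distance ?X x y)"
   unfolding sel split_beta by (intro continuous_intros)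
  show "connected (points ?X)" by (simp add: convex_connected)
  show "sigma_finite_measure (vol ?X)" by (rule sigma_finite_by_compact[OF sets comp fin])
  show "infinite (model_ball ?X r)" if "0 < r" for r unfolding ball using that by (intro open_infinite) auto
  show "0 < emeasure (vol ?X) (model_ball ?X r)" if "0 < r" for r
   unfolding ball sel(1) using that emeasure_lborel_open_pos[of "ball (0::'a) r"] by simp
  show "\<exists>C\<subseteq>A. compact C \<and> emeasure (vol ?X) (A - C) < ennreal e"
   if "A \<in> sets (vol ?X)" "emeasure (vol ?X) A < \<infinity>" "0 < e" for A e
   using inner_regular_completion[of lborel A e] that unfolding sel(1) by simp
  fix x y :: 'a
  show "distance ?X x y = 0 \<longleftrightarrow> x = y" by (simp add: sel)
  show "0 <= distance ?X x y" by (simp add: sel)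
  show "distance ?X x y = distance ?X y x" by (simp add: sel dist_commute)
  show "distance ?X x z <= distance ?X x y + distance ?X y z" for z by (simp add: sel dist_triangle)
  assume xy: "x ~= y"
  note m = distr_completion_eq[OF dist_preserving_involution_lborel[of "euc_refl x y",
    OF euc_refl_isometry[OF xy] euc_refl_involution[OF xy]]]
  show "euc_refl x y \<in> vol ?X \<rightarrow>\<^sub>M vol ?X" "distr (vol ?X) (vol ?X) (euc_refl x y) = vol ?X"
   unfolding sel(1) by (rule m)+
  show "{z \<in> points ?X. distance ?X z x = distance ?X z y} \<in> null_sets (vol ?X)"
   using euclidean_bisector_null[OF xy] by (simp add: sel)
  show "euc_refl x y x = y" by (rule euc_refl_swap[OF xy])
  fix z :: 'a
  show "euc_refl x y z \<in> points ?X" by simp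
  show "euc_refl x y (euc_refl x y z) = z" by (rule euc_refl_involution[OF xy])
  fix w
  show "distance ?X (euc_refl x y z) (euc_refl x y w) = distance ?X z w"
   unfolding sel by (rule euc_refl_isometry[OF xy])
  show "sgn (distance ?X z (euc_refl x y w) - distance ?X z w) =
   sgn ((distance ?X z y - distance ?X z x) * (distance ?X w y - distance ?X w x))"
   unfolding sel by (rule euc_refl_side[OF xy])
 next
  fix a :: 'a
  have "\<forall>x\<in>points ?X. x + - a \<in> points ?X \<and> distance ?X (base ?X) (x + - a) = distance ?X a x"
   by (simp add: sel dist_norm norm_minus_commute)
  then show "\<exists>\<tau>\<in>translation_maps ?X. \<forall>x\<in>points ?X. \<tau> x \<in> points ?X \<and> distance ?X (base ?X) (\<tau> x) = distance ?X a x"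
   unfolding sel(4) by (rule rev_bexI[OF rangeI[of "\<lambda>v x. x + v" "- a"]])
 qed (use sets comp fin in auto)
qed

text \<open>A linear reflection: on the unit sphere the bisector of two points is cut out by the
  hyperplane through the origin orthogonal to their difference.\<close>

definition sph_refl :: "'a::euclidean_space => 'a => 'a => 'a" where
 "sph_refl x y z = z - (2 * (z \<bullet> (x - y)) / ((x - y) \<bullet> (x - y))) *\<^sub>R (x - y)"

context
 fixes x y :: "'a::euclidean_space" assumes xy: "x ~= y"
begin

private lemma diff_pos: "0 < (x - y) \<bullet> (x - y)" using xy by simp

lemma sph_refl_inner_diff:
 "z \<bullet> sph_refl x y w - z \<bullet> w = - 2 * (z \<bullet> (x - y)) * (w \<bullet> (x - y)) / ((x - y) \<bullet> (x - y))"
proof -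
 define n where "n = x - y"
 show ?thesis unfolding sph_refl_def n_def[symmetric] by (simp add: inner_diff_right mult_ac)
qed

lemma sph_refl_normal: "sph_refl x y z \<bullet> (x - y) = - (z \<bullet> (x - y))"
 using diff_pos by (simp only: sph_refl_def inner_diff_left[of z] inner_scaleR_left) simp

lemma sph_refl_involution: "sph_refl x y (sph_refl x y z) = z"
proof -
 have "sph_refl x y (sph_refl x y z) = sph_refl x y z
  - (2 * (sph_refl x y z \<bullet> (x - y)) / ((x - y) \<bullet> (x - y))) *\<^sub>R (x - y)"
  by (rule sph_refl_def)
 also have "... = z" unfolding sph_refl_normal by (simp add: sph_refl_def)
 finally show ?thesis .
qed

lemma sph_refl_inner: "sph_refl x y z \<bullet> sph_refl x y w = z \<bullet> w"
 using sph_refl_inner_diff[of "sph_refl x y z" w]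
  sph_refl_inner_diff[of w z] sph_refl_normal[of z]
 by (simp add: inner_commute mult.commute mult.left_commute)

lemma sph_refl_dist: "dist (sph_refl x y z) (sph_refl x y w) = dist z w"
proof -
 have "(dist (sph_refl x y z) (sph_refl x y w))\<^sup>2 = (dist z w)\<^sup>2"
  unfolding dist_sq inner_diff_left inner_diff_right sph_refl_inner ..
 then show ?thesis by simp
qed

lemma sph_refl_scaleR: "sph_refl x y (c *\<^sub>R z) = c *\<^sub>R sph_refl x y z"
proof -
 define n where "n = x - y"
 show ?thesis unfolding sph_refl_def n_def[symmetric] by (simp add: scaleR_diff_right mult_ac)
qed

lemma sph_refl_norm: "norm (sph_refl x y z) = norm z"
 by (simp add: norm_eq_sqrt_inner sph_refl_inner)

lemma sph_refl_sgn: "sgn (sph_refl x y z) = sph_refl x y (sgn z)"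
 by (simp add: sgn_div_norm sph_refl_norm sph_refl_scaleR)

end

section \<open>Distance and area on the sphere\<close>

lemma sphere_inner_self: "x \<in> sphere 0 1 ==> x \<bullet> x = 1"
 by (simp add: norm_eq_sqrt_inner)

lemma sphere_inner_bounds:
 assumes "x \<in> sphere 0 1" "y \<in> sphere 0 1"
 shows "- 1 <= x \<bullet> y" and "x \<bullet> y <= 1" using Cauchy_Schwarz_ineq2[of x y] assms by auto

lemma sphere_inner_eq_1:
 assumes "x \<in> sphere 0 1" "y \<in> sphere 0 1"
 shows "x \<bullet> y = 1 \<longleftrightarrow> x = y"
proof
 assume "x \<bullet> y = 1"
 then have "(x - y) \<bullet> (x - y) = 0" using sphere_inner_self[OF assms(1)] sphere_inner_self[OF assms(2)]
  by (simp add: inner_diffs)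
 then show "x = y" by simp
qed (use sphere_inner_self assms in auto)

lemma sph_refl_swap:
 assumes "x \<in> sphere 0 1" "y \<in> sphere 0 1" "x ~= y"
 shows "sph_refl x y x = y"
proof -
 define n where "n = x - y"
 have e: "2 * (x \<bullet> n) = n \<bullet> n"
  using sphere_inner_self[OF assms(1)] sphere_inner_self[OF assms(2)] by (simp add: n_def inner_diffs)
 have "n ~= 0" using assms(3) by (simp add: n_def)
 then have "sph_refl x y x = x - n" unfolding sph_refl_def n_def[symmetric] e by simp
 then show ?thesis by (simp add: n_def)
qed

lemma sgn_arccos_diff:
 assumes "- 1 <= a" "a <= 1" "- 1 <= c" "c <= 1"
 shows "sgn (arccos a - arccos c) = sgn (c - a)"
proof -
 have "arccos a < arccos c \<longleftrightarrow> c < a" "arccos c < arccos a \<longleftrightarrow> a < c"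
  using assms by (intro arccos_less_mono; simp)+
 then show ?thesis by (cases a c rule: linorder_cases) (auto simp: sgn_if)
qed

text \<open>Angles adding up to more than \<open>pi\<close> exceed every value of
  \<open>arccos\<close>. Otherwise Cauchy-Schwarz for the components orthogonal to \<open>y\<close>
  bounds \<open>x \<bullet> z\<close> from below by the cosine of the sum.\<close>

lemma spherical_triangle:
 fixes x y z :: "'a::euclidean_space"
 assumes "x \<in> sphere 0 1" "y \<in> sphere 0 1" "z \<in> sphere 0 1"
 shows "arccos (x \<bullet> z) <= arccos (x \<bullet> y) + arccos (y \<bullet> z)"
proof -
 have one: "x \<bullet> x = 1" "y \<bullet> y = 1" "z \<bullet> z = 1" using assms by (auto intro: sphere_inner_self)
 define p q where "p = x \<bullet> y" and "q = y \<bullet> z"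
 have bd: "- 1 <= p" "p <= 1" "- 1 <= q" "q <= 1" "- 1 <= x \<bullet> z" "x \<bullet> z <= 1"
  unfolding p_def q_def using assms by (auto intro: sphere_inner_bounds)
 show ?thesis
 proof (cases "arccos p + arccos q <= pi")
  case True
  define x' z' where "x' = x - p *\<^sub>R y" and "z' = z - q *\<^sub>R y"
  have "x' \<bullet> x' = 1 - p\<^sup>2" "z' \<bullet> z' = 1 - q\<^sup>2" "x' \<bullet> z' = x \<bullet> z - p * q"
   using one by (simp_all add: x'_def z'_def p_def q_def inner_diffs power2_eq_square)
  then have "- (sqrt (1 - p\<^sup>2) * sqrt (1 - q\<^sup>2)) <= x \<bullet> z - p * q"
   using Cauchy_Schwarz_ineq2[of x' z'] by (simp add: norm_eq_sqrt_inner abs_le_iff)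
  then have "cos (arccos p + arccos q) <= x \<bullet> z" using bd by (simp add: cos_add sin_arccos)
  then have "arccos (x \<bullet> z) <= arccos (cos (arccos p + arccos q))"
   using bd by (subst arccos_le_mono) (auto simp: abs_le_iff intro: order_trans[OF _ cos_ge_minus_one])
  also have "... = arccos p + arccos q" using bd True by (intro arccos_cos) (auto simp: arccos_lbound)
  finally show ?thesis by (simp add: p_def q_def)
 next
  case False
  then show ?thesis using arccos_ubound[OF bd(5,6)] by (simp add: p_def q_def)
 qed
qed

lemma sets_sphere_area: "sets (sphere_area :: 'a::euclidean_space measure) = sets (restrict_space borel (sphere 0 1))"
 by (simp add: sphere_area_def)

text \<open>A linear isometry commutes with \<open>sgn\<close>, so the cone over a preimage is the
  preimage of the cone, and Lebesgue measure is invariant.\<close>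

lemma sphere_area_reflection:
 fixes x y :: "'a::euclidean_space"
 assumes xy: "x ~= y"
 shows "sph_refl x y \<in> sphere_area \<rightarrow>\<^sub>M sphere_area"
  and "distr sphere_area sphere_area (sph_refl x y) = sphere_area"
proof -
 let ?f = "sph_refl x y" and ?S = "sphere 0 1 :: 'a set"
 have SB: "?S \<in> sets borel" by simp
 have sp: "space sphere_area = ?S" by (rule completion_sets_restrict(3)[OF sets_sphere_area SB])
 note lb = dist_preserving_involution_lborel[of ?f, OF sph_refl_dist[OF xy] sph_refl_involution[OF xy]]
 have "?f \<in> restrict_space borel ?S \<rightarrow>\<^sub>M restrict_space borel ?S"
  using lb(1) sph_refl_norm[OF xy] by (intro measurable_restrict_space3) auto
 then show m: "?f \<in> sphere_area \<rightarrow>\<^sub>M sphere_area" by (simp cong: measurable_cong_sets add: sets_sphere_area)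
 show "distr sphere_area sphere_area ?f = sphere_area"
 proof (rule measure_eqI)
  fix A assume "A \<in> sets (distr sphere_area sphere_area ?f)"
  then have A: "A \<in> sets sphere_area" by simp
  have AB: "A \<in> sets borel" "A \<subseteq> ?S"
   using completion_sets_restrict(1)[OF sets_sphere_area SB A] sets.sets_into_space[OF A] sp by auto
  define C where "C = {z \<in> ball 0 1 - {0}. sgn z \<in> A}"
  have "sgn \<in> borel_measurable (borel :: 'a measure)" 
  proof -
   have "(\<lambda>x::'a. x /\<^sub>R norm x) \<in> borel_measurable borel" by measurable
   then show ?thesis by (simp add: sgn_div_norm[abs_def])
  qed
  then have "sgn -` A \<inter> space borel \<in> sets (borel :: 'a measure)" using AB(1) by (rule measurable_sets)
  moreover have "C = (sgn -` A \<inter> space borel) \<inter> (ball 0 1 - {0})" by (auto simp: C_def)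
  ultimately have CB: "C \<in> sets lborel" by simp
  have pB: "?f -` A \<inter> ?S \<in> sets borel"
   using completion_sets_restrict(1)[OF sets_sphere_area SB measurable_sets[OF m A]] sp by simp
  have z0: "?f z = 0 \<longleftrightarrow> z = 0" for z using sph_refl_norm[OF xy, of z] by (metis norm_eq_zero)
  have "emeasure (distr sphere_area sphere_area ?f) A = emeasure sphere_area (?f -` A \<inter> ?S)"
   using emeasure_distr[OF m A] sp by simp
  also have "... = of_nat DIM('a) * emeasure lborel {z \<in> ball 0 1 - {0}. sgn z \<in> ?f -` A \<inter> ?S}"
   by (rule emeasure_sphere_area[OF pB]) simp
  also have "{z \<in> ball 0 1 - {0}. sgn z \<in> ?f -` A \<inter> ?S} = ?f -` C \<inter> space lborel"
   using sph_refl_norm[OF xy] sph_refl_sgn[OF xy] z0 by (auto simp: C_def norm_sgn)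
  also have "emeasure lborel (?f -` C \<inter> space lborel) = emeasure lborel C"
   using emeasure_distr[OF lb(1) CB] lb(2) by simp
  also have "of_nat DIM('a) * emeasure lborel C = emeasure sphere_area A"
   unfolding C_def by (rule emeasure_sphere_area[OF AB, symmetric])
  finally show "emeasure (distr sphere_area sphere_area ?f) A = emeasure sphere_area A" .
 qed simp
qed

text \<open>The cone over a great sphere lies in a hyperplane.\<close>

lemma sphere_bisector_null:
 fixes N :: "'a::euclidean_space"
 assumes "N ~= 0"
 shows "{z \<in> sphere 0 1. N \<bullet> z = 0} \<in> null_sets sphere_area"
proof -
 let ?A = "{z \<in> sphere 0 1. N \<bullet> z = 0}"
 have "?A = sphere 0 1 \<inter> {z. N \<bullet> z = 0}" by auto
 then have "closed ?A" by (simp only: closed_Int closed_sphere closed_hyperplane)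
 then have AB: "?A \<in> sets borel" by (rule borel_closed)
 have H: "emeasure lborel {z. N \<bullet> z = 0} = 0"
 proof -
  have "{z. N \<bullet> z = 0} \<in> null_sets lebesgue"
   using negligible_hyperplane[of N 0] assms by (simp add: negligible_iff_null_sets)
  moreover have "{z. N \<bullet> z = 0} \<in> sets borel" by (intro borel_closed closed_hyperplane)
  ultimately show ?thesis by (simp add: null_sets_def)
 qed
 have "emeasure sphere_area ?A = of_nat DIM('a) * emeasure lborel {z \<in> ball 0 1 - {0}. sgn z \<in> ?A}"
  by (rule emeasure_sphere_area[OF AB]) auto
 moreover have "emeasure lborel {z \<in> ball 0 1 - {0}. sgn z \<in> ?A} <= emeasure lborel {z. N \<bullet> z = 0}"
  by (intro emeasure_mono) (auto simp: sgn_div_norm intro!: borel_closed closed_hyperplane)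
 moreover have "?A \<in> sets sphere_area" using AB by (auto simp: sets_sphere_area sets_restrict_space_iff)
 ultimately show ?thesis using H by (simp add: null_sets_def)
qed

lemma spherical_reflection_model:
 fixes p :: "'a::euclidean_space"
 assumes dim: "2 <= DIM('a)" and p: "p \<in> sphere 0 1"
 shows "reflection_model (spherical_model p) sph_refl"
proof -
 let ?X = "spherical_model p" and ?S = "sphere 0 1 :: 'a set"
 have sel: "vol ?X = completion sphere_area" "distance ?X = (\<lambda>x y. arccos (x \<bullet> y))" "base ?X = p"
  "translation_maps ?X = isometries ?S spherical_distance"
  by (simp_all add: spherical_model_def spherical_distance_def[abs_def])
 have SB: "?S \<in> sets borel" by simp
 note cs = completion_sets_restrict[OF sets_sphere_area SB]
 have cont: "continuous_on (?S \<times> ?S) (\<lambda>(x, y). arccos (x \<bullet> y))"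
  unfolding split_beta using sphere_inner_bounds by (intro continuous_on_arccos continuous_intros) auto
 have contp: "continuous_on ?S (\<lambda>y. arccos (p \<bullet> y))"
  using sphere_inner_bounds[OF p] by (intro continuous_on_arccos continuous_intros) auto
 have sets: "A \<inter> points ?X \<in> sets (vol ?X)" if "A \<in> sets borel" for A
  using cs(2)[OF that] cs(3) by (simp add: sel(1))
 have comp: "compact {y \<in> points ?X. distance ?X (base ?X) y <= r}" for r
 proof -
  have "closed {y \<in> ?S. arccos (p \<bullet> y) <= r}"
   by (rule continuous_on_closed_Collect_le[OF contp continuous_on_const]) simp
  moreover have "bounded {y \<in> ?S. arccos (p \<bullet> y) <= r}" by (rule bounded_subset[OF bounded_sphere[of 0 1]]) auto
  ultimately show ?thesis by (simp add: sel(2,3) compact_eq_bounded_closed)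
 qed
 have fin: "emeasure (vol ?X) {y \<in> points ?X. distance ?X (base ?X) y <= r} < \<infinity>" for r
 proof -
  have "emeasure sphere_area ?S <= of_nat DIM('a) * emeasure lborel (ball (0::'a) 1)"
   unfolding emeasure_sphere_area[OF SB order_refl] by (intro mult_left_mono emeasure_mono) auto
  also have "... < \<infinity>" using emeasure_lborel_ball_finite[of "0::'a" 1] by (simp add: ennreal_mult_less_top ennreal_of_nat_eq_real_of_nat)
  finally have fin: "emeasure sphere_area ?S < \<infinity>" .
  have S: "?S \<in> sets sphere_area" using sets.top[of "sphere_area :: 'a measure"] cs(3) by simp
  have "emeasure (vol ?X) {y \<in> points ?X. distance ?X (base ?X) y <= r} <= emeasure (vol ?X) ?S"
  proof (rule emeasure_mono)
   show "?S \<in> sets (vol ?X)" using S by (simp add: sel(1))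
  qed auto
  also have "... = emeasure sphere_area ?S" using S by (simp add: sel(1))
  finally show ?thesis using fin by (rule order_le_less_trans)
 qed
 have sym: "distance ?X x y = distance ?X y x" for x y by (simp add: sel inner_commute)
 have side: "sgn (distance ?X z (sph_refl x y w) - distance ?X z w) =
   sgn ((distance ?X z y - distance ?X z x) * (distance ?X w y - distance ?X w x))"
  if x: "x \<in> ?S" "y \<in> ?S" "x ~= y" "z \<in> ?S" "w \<in> ?S" for x y z w
 proof -
  have "sph_refl x y w \<in> ?S" using x(5) sph_refl_norm[OF x(3)] by simp
  then have "sgn (distance ?X z (sph_refl x y w) - distance ?X z w)
   = sgn (- (z \<bullet> sph_refl x y w - z \<bullet> w))"
   unfolding sel using x sphere_inner_bounds by (subst sgn_arccos_diff) auto
  also have "... = sgn (2 * (z \<bullet> (x - y)) * (w \<bullet> (x - y)) / ((x - y) \<bullet> (x - y)))"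
   unfolding sph_refl_inner_diff[OF x(3)] by simp
  also have "... = sgn (z \<bullet> (x - y)) * sgn (w \<bullet> (x - y))"
  proof -
   have "sgn ((x - y) \<bullet> (x - y)) = 1" using x(3) by simp
   then show ?thesis by (simp only: sgn_mult sgn_divide) simp
  qed
  also have "... = sgn ((distance ?X z y - distance ?X z x) * (distance ?X w y - distance ?X w x))"
  proof -
   have "sgn (distance ?X v y - distance ?X v x) = sgn (v \<bullet> (x - y))" if "v \<in> ?S" for v
    unfolding sel inner_diff_right
    by (rule sgn_arccos_diff[OF sphere_inner_bounds[OF that x(2)] sphere_inner_bounds[OF that x(1)]])
   then show ?thesis using x by (simp only: sgn_mult)
  qed
  finally show ?thesis .
 qed
 have iso: "distance ?X (sph_refl x y z) (sph_refl x y w) = distance ?X z w"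
  if "x ~= y" for x y z w unfolding sel sph_refl_inner[OF that] ..
 have refl_in: "sph_refl x y z \<in> ?S" if "x ~= y" "z \<in> ?S" for x y z
  using that sph_refl_norm[OF that(1)] by simp
 show ?thesis
 proof (rule reflection_model.intro, unfold points_spherical_model)
  show "base ?X \<in> ?S" using p by (simp add: sel)
  show "continuous_on (?S \<times> ?S) (\<lambda>(x, y). distance ?X x y)" using cont by (simp add: sel)
  show "connected ?S" using dim by (rule connected_sphere)
  show "sigma_finite_measure (vol ?X)" by (rule sigma_finite_by_compact[OF sets comp fin])
  show "\<exists>C\<subseteq>A. compact C \<and> emeasure (vol ?X) (A - C) < ennreal e"
   if "A \<in> sets (vol ?X)" "emeasure (vol ?X) A < \<infinity>" "0 < e" for A e
   using inner_regular_completion[of sphere_area A e, OF cs(1,2)] that unfolding sel(1) by simp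
  show "infinite (model_ball ?X r)" if r: "0 < r" for r
  proof -
   obtain q :: 'a where q: "q ~= 0" "orthogonal p q"
    using orthogonal_to_vector_exists[OF dim, of p] by blast
   define n where "n = sgn q"
   have "norm n = 1" using q(1) by (simp add: n_def norm_sgn)
   then have n: "p \<bullet> n = 0" "n \<bullet> n = 1" "p \<bullet> p = 1"
    using q(2) sphere_inner_self[OF p] by (simp_all add: n_def orthogonal_def sgn_div_norm dot_square_norm)
   \<comment> \<open>A great circle through the pole; dimension at least 2 provides the orthogonal
     direction \<open>n\<close>.\<close>
   define g where "g t = cos t *\<^sub>R p + sin t *\<^sub>R n" for t
   have pg: "p \<bullet> g t = cos t" for t using n by (simp add: g_def inner_add_right)
   have "g t \<bullet> g t = (cos t)\<^sup>2 + (sin t)\<^sup>2" for t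
    using n by (simp add: g_def inner_add_right inner_add_left inner_commute power2_eq_square)
   then have gS: "g t \<in> ?S" for t by (simp add: norm_eq_sqrt_inner)
   have acos: "arccos (p \<bullet> g t) = t" if "t \<in> {0<..<min r pi}" for t using that by (simp add: pg arccos_cos)
   have "inj_on g {0<..<min r pi}" by (rule inj_onI) (metis acos)
   moreover have "infinite {0<..<min r pi}" using r by simp
   ultimately have "infinite (g ` {0<..<min r pi})" using finite_imageD by blast
   moreover have "g ` {0<..<min r pi} \<subseteq> model_ball ?X r" using gS acos by (auto simp: model_ball_def sel(2,3))
   ultimately show ?thesis using finite_subset by blast
  qed
  show "0 < emeasure (vol ?X) (model_ball ?X r)" if r: "0 < r" for r
  proof -
   let ?B = "{y \<in> ?S. arccos (p \<bullet> y) < r}"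
   have "closed {y \<in> ?S. r <= arccos (p \<bullet> y)}"
    by (rule continuous_on_closed_Collect_le[OF continuous_on_const contp closed_sphere])
   then have "?S - {y \<in> ?S. r <= arccos (p \<bullet> y)} \<in> sets borel" by (rule sets.Diff[OF SB borel_closed])
   also have "?S - {y \<in> ?S. r <= arccos (p \<bullet> y)} = ?B" by auto
   finally have BB: "?B \<in> sets borel" .
   \<comment> \<open>The cone over the spherical ball is open and contains half of the pole vector,
     so it has positive Lebesgue measure.\<close>
   define U where "U = {z \<in> ball 0 1 - {0}. sgn z \<in> ?B}"
   have conts: "continuous_on (ball 0 1 - {0}) (\<lambda>z::'a. arccos (p \<bullet> sgn z))"
    using sphere_inner_bounds[OF p] by (intro continuous_on_arccos continuous_intros) (auto simp: norm_sgn)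
   have "U = (ball 0 1 - {0}) \<inter> (\<lambda>z::'a. arccos (p \<bullet> sgn z)) -` {..<r}" by (auto simp: U_def norm_sgn)
   then have "open U" using continuous_open_preimage[OF conts _ open_lessThan[of r]] by (simp add: open_delete)
   moreover have "(1/2) *\<^sub>R p \<in> U"
   proof -
    have "p ~= 0" "sgn p = p" "p \<bullet> p = 1" using p sphere_inner_self[OF p] by (auto simp: sgn_div_norm)
    then show ?thesis using p r by (simp add: U_def sgn_scaleR)
   qed
   ultimately have "0 < emeasure lborel U" by (intro emeasure_lborel_open_pos) auto
   then have "0 < emeasure sphere_area ?B"
    using emeasure_sphere_area[OF BB Collect_restrict] unfolding U_def[symmetric]
    by (simp only: ennreal_zero_less_mult_iff) simp
   moreover have "?B \<in> sets sphere_area" using BB by (auto simp: sets_sphere_area sets_restrict_space_iff)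
   moreover have "model_ball ?X r = ?B" by (simp add: model_ball_def sel(2,3))
   ultimately show ?thesis by (simp add: sel(1))
  qed
  fix x y :: 'a
  assume x: "x \<in> ?S" and y: "y \<in> ?S"
  show "distance ?X x y = 0 \<longleftrightarrow> x = y"
   unfolding sel using sphere_inner_bounds[OF x y] sphere_inner_eq_1[OF x y] by (simp add: arccos_eq_0_iff)
  show "0 <= distance ?X x y" unfolding sel using sphere_inner_bounds[OF x y] by (rule arccos_lbound)
  show "distance ?X x y = distance ?X y x" by (rule sym)
  show "distance ?X x z <= distance ?X x y + distance ?X y z" if "z \<in> ?S" for z
   unfolding sel by (rule spherical_triangle[OF x y that])
  assume xy: "x ~= y"
  note m = distr_completion_eq[OF sphere_area_reflection[OF xy]]
  show "sph_refl x y \<in> vol ?X \<rightarrow>\<^sub>M vol ?X" "distr (vol ?X) (vol ?X) (sph_refl x y) = vol ?X"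
   unfolding sel(1) by (rule m)+
  show "{z \<in> ?S. distance ?X z x = distance ?X z y} \<in> null_sets (vol ?X)"
  proof -
   have "{z \<in> ?S. distance ?X z x = distance ?X z y} = {z \<in> ?S. (x - y) \<bullet> z = 0}"
   proof (intro Collect_cong conj_cong refl)
    fix z assume z: "z \<in> ?S"
    have "arccos (z \<bullet> x) = arccos (z \<bullet> y) \<longleftrightarrow> z \<bullet> x = z \<bullet> y"
     using sphere_inner_bounds z x y by (intro arccos_eq_iff) (auto simp: abs_le_iff)
    then show "distance ?X z x = distance ?X z y \<longleftrightarrow> (x - y) \<bullet> z = 0"
     unfolding sel by (auto simp: inner_diff_right inner_commute)
   qed
   then show ?thesis using sphere_bisector_null[of "x - y"] xy by (simp add: sel(1) null_sets_completionI)
  qed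
  show "sph_refl x y x = y" by (rule sph_refl_swap[OF x y xy])
  fix z :: 'a assume z: "z \<in> ?S"
  show "sph_refl x y z \<in> ?S" by (rule refl_in[OF xy z])
  show "sph_refl x y (sph_refl x y z) = z" by (rule sph_refl_involution[OF xy])
  fix w assume w: "w \<in> ?S"
  show "distance ?X (sph_refl x y z) (sph_refl x y w) = distance ?X z w" by (rule iso[OF xy])
  show "sgn (distance ?X z (sph_refl x y w) - distance ?X z w) =
   sgn ((distance ?X z y - distance ?X z x) * (distance ?X w y - distance ?X w x))"
   by (rule side[OF x y xy z w])
 next
  fix a :: 'a assume a: "a \<in> ?S"
  show "\<exists>\<tau>\<in>translation_maps ?X. \<forall>x\<in>?S. \<tau> x \<in> ?S \<and> distance ?X (base ?X) (\<tau> x) = distance ?X a x"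
  proof (cases "a = p")
   case True
   have "(\<lambda>x. x) \<in> isometries ?S spherical_distance" by (rule involution_isometry) auto
   then show ?thesis using True by (intro bexI[of _ "\<lambda>x. x"]) (auto simp: sel)
  next
   case False
   have "sph_refl a p \<in> isometries ?S spherical_distance"
    using refl_in[OF False] sph_refl_involution[OF False] iso[OF False]
    by (intro involution_isometry) (auto simp: sel spherical_distance_def)
   moreover have "distance ?X p (sph_refl a p x) = distance ?X a x" for x
    using iso[OF False, of a x] sph_refl_swap[OF a p False] by simp
   ultimately show ?thesis using refl_in[OF False] by (intro bexI[of _ "sph_refl a p"]) (auto simp: sel)
  qed
 qed (use sets comp fin in auto)
qed

section \<open>Reflections of the Poincare ball\<close>

text \<open>
 In the hyperboloid model the bisector of \<open>x\<close> and \<open>y\<close> is the hyperplane orthogonal to the difference of their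
 lifts \<open>(2 x, 1 + |x|\<^sup>2) / (1 - |x|\<^sup>2)\<close>. The spatial part of half this difference is the normal, its time part the
 offset below.
\<close>

definition hyperbolic_normal :: "'a::euclidean_space => 'a => 'a" where
 "hyperbolic_normal x y = (1 / (1 - x \<bullet> x)) *\<^sub>R x - (1 / (1 - y \<bullet> y)) *\<^sub>R y"

definition hyperbolic_offset :: "'a::euclidean_space => 'a => real" where
 "hyperbolic_offset x y = 1 / (1 - x \<bullet> x) - 1 / (1 - y \<bullet> y)"

text \<open>Lorentz product of the lift of \<open>z\<close> with the normal, divided by the Lorentz
  square of the normal. The factor \<open>1 - z \<bullet> z\<close> clears the denominator of the
  lift.\<close>

definition hyperbolic_coefficient :: "'a::euclidean_space => 'a => 'a => real" where
 "hyperbolic_coefficient x y z = (2 * (z \<bullet> hyperbolic_normal x y) - hyperbolic_offset x y * (1 + z \<bullet> z))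
  / (hyperbolic_normal x y \<bullet> hyperbolic_normal x y - (hyperbolic_offset x y)\<^sup>2)"

text \<open>Lorentz reflection of the lift of \<open>z\<close>, followed by the projection of
  \<open>(v, t)\<close> to \<open>v / (1 + t)\<close>, which leads from the hyperboloid back to the
  ball.\<close>

definition hyp_refl :: "'a::euclidean_space => 'a => 'a => 'a" where
 "hyp_refl x y z = (1 / (1 - hyperbolic_coefficient x y z * hyperbolic_offset x y)) *\<^sub>R
  (z - hyperbolic_coefficient x y z *\<^sub>R hyperbolic_normal x y)"

text \<open>The square of \<open>sinh (d / 2)\<close> for points at hyperbolic distance
  \<open>d\<close>; as a rational expression it can be computed with.\<close>

definition hyp_ratio :: "'a::euclidean_space => 'a => real" where
 "hyp_ratio z w = (dist z w)\<^sup>2 / ((1 - z \<bullet> z) * (1 - w \<bullet> w))"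

lemma unit_ball_iff: "z \<in> ball 0 1 \<longleftrightarrow> z \<bullet> z < 1" for z :: "'a::euclidean_space"
 by (simp add: norm_eq_sqrt_inner)

lemma unit_ball_inner: "z \<in> ball 0 1 ==> z \<bullet> z < 1" for z :: "'a::euclidean_space"
 by (simp only: unit_ball_iff)

lemma hyp_dist_ratio: "hyperbolic_distance z w = arcosh (1 + 2 * hyp_ratio z w)"
 by (simp add: hyperbolic_distance_def hyp_ratio_def dist_norm power2_norm_eq_inner)

lemma hyp_ratio_nonneg: "z \<in> ball 0 1 ==> w \<in> ball 0 1 ==> 0 <= hyp_ratio z w"
 unfolding unit_ball_iff hyp_ratio_def by (intro divide_nonneg_pos mult_pos_pos) auto

lemma hyp_ratio_commute: "hyp_ratio z w = hyp_ratio w z"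
 by (simp add: hyp_ratio_def dist_commute mult.commute)

lemma sgn_arcosh_diff:
 fixes a c :: real
 assumes "0 <= a" "0 <= c"
 shows "sgn (arcosh (1 + 2 * a) - arcosh (1 + 2 * c)) = sgn (a - c)"
proof -
 have "arcosh (1 + 2 * a) < arcosh (1 + 2 * c) \<longleftrightarrow> a < c" "arcosh (1 + 2 * c) < arcosh (1 + 2 * a) \<longleftrightarrow> c < a"
  using assms by (subst arcosh_less_iff_real; simp)+
 then show ?thesis by (cases a c rule: linorder_cases) (auto simp: sgn_if)
qed

context
 fixes x y :: "'a::euclidean_space"
 assumes x: "x \<in> ball 0 1" and y: "y \<in> ball 0 1" and xy: "x ~= y"
begin

private definition N where "N = hyperbolic_normal x y"
private definition k where "k = hyperbolic_offset x y"
private definition p where "p = 1 / (1 - x \<bullet> x)"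
private definition q where "q = 1 / (1 - y \<bullet> y)"
private definition Q where "Q = N \<bullet> N - k\<^sup>2"
private definition a where "a = hyperbolic_coefficient x y"
private definition D where "D z = 1 - a z * k"
private definition g where "g z = z - a z *\<^sub>R N"
private abbreviation f where "f \<equiv> hyp_refl x y"

private lemma pq: "0 < p" "0 < q" "p * (1 - x \<bullet> x) = 1" "q * (1 - y \<bullet> y) = 1"
 using unit_ball_inner[OF x] unit_ball_inner[OF y] by (auto simp: p_def q_def)

private lemma pxx: "p * (x \<bullet> x) = p - 1" "q * (y \<bullet> y) = q - 1"
 using pq(3,4) by (simp_all add: algebra_simps)

private lemma Nk: "N = p *\<^sub>R x - q *\<^sub>R y" "k = p - q"
 by (simp_all add: N_def k_def p_def q_def hyperbolic_normal_def hyperbolic_offset_def)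

text \<open>The normal is spacelike: \<open>p * (x \<bullet> x) = p - 1\<close>, and likewise for
  \<open>q\<close>, turns its Lorentz square into a positive multiple of a squared distance.\<close>

private lemma Q_eq: "Q = p * q * ((x - y) \<bullet> (x - y))"
proof -
 have "N \<bullet> N = p * (p * (x \<bullet> x)) - 2 * p * q * (x \<bullet> y) + q * (q * (y \<bullet> y))"
  by (simp add: Nk inner_diffs algebra_simps)
 then have "Q = p * (p - 1) - 2 * p * q * (x \<bullet> y) + q * (q - 1) - (p - q)\<^sup>2"
  unfolding Q_def pxx Nk(2) by simp
 also have "... = q * (p - 1) + p * (q - 1) - 2 * p * q * (x \<bullet> y)" by (simp add: algebra_simps power2_eq_square)
 also have "... = q * (p * (x \<bullet> x)) + p * (q * (y \<bullet> y)) - 2 * p * q * (x \<bullet> y)" unfolding pxx ..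
 also have "... = p * q * ((x - y) \<bullet> (x - y))" by (simp add: inner_diffs algebra_simps)
 finally show ?thesis .
qed

private lemma Q_pos: "0 < Q"
 unfolding Q_eq using pq xy by simp

private lemma zN: "2 * (z \<bullet> N) = a z * Q + k * (1 + z \<bullet> z)"
 using Q_pos by (simp add: a_def hyperbolic_coefficient_def N_def[symmetric] k_def[symmetric] Q_def[symmetric])

private lemma NN: "N \<bullet> N = Q + k\<^sup>2" by (simp add: Q_def)

private lemma f_eq: "f z = (1 / D z) *\<^sub>R g z"
 by (simp add: hyp_refl_def D_def g_def a_def N_def k_def)

text \<open>Up to the positive factor \<open>Q\<close> the denominator is the squared norm of
  \<open>N - k *\<^sub>R z\<close>. This cannot vanish, because
  \<open>k\<^sup>2 < N \<bullet> N\<close> and \<open>z\<close> lies in the unit ball.\<close>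

private lemma D_pos:
 assumes "z \<in> ball 0 1" shows "0 < D z"
proof -
 have "(N - k *\<^sub>R z) \<bullet> (N - k *\<^sub>R z) = N \<bullet> N - k * (2 * (z \<bullet> N)) + k\<^sup>2 * (z \<bullet> z)"
  by (simp add: inner_diffs algebra_simps power2_eq_square)
 also have "... = Q * D z" unfolding NN zN D_def by (simp add: algebra_simps power2_eq_square)
 finally have eq: "(N - k *\<^sub>R z) \<bullet> (N - k *\<^sub>R z) = Q * D z" .
 have "N ~= k *\<^sub>R z"
 proof
  assume "N = k *\<^sub>R z"
  then have "N \<bullet> N = k\<^sup>2 * (z \<bullet> z)" by (simp add: power2_eq_square)
  also have "... <= k\<^sup>2 * 1" using unit_ball_inner[OF assms] by (intro mult_left_mono) auto
  finally show False using Q_pos by (simp add: Q_def)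
 qed
 then have "0 < Q * D z" unfolding eq[symmetric] by simp
 then show ?thesis using Q_pos by (simp add: zero_less_mult_iff)
qed

private lemma inner_g: "2 * (g z \<bullet> g w) = 2 * (z \<bullet> w) - a w * k * (1 + z \<bullet> z) - a z * k * (1 + w \<bullet> w) + 2 * (a z * a w * k\<^sup>2)"
proof -
 have "2 * (g z \<bullet> g w) = 2 * (z \<bullet> w) - a w * (2 * (z \<bullet> N)) - a z * (2 * (w \<bullet> N)) + 2 * (a z * a w * (N \<bullet> N))"
  by (simp add: g_def inner_diffs algebra_simps)
 also have "... = 2 * (z \<bullet> w) - a w * k * (1 + z \<bullet> z) - a z * k * (1 + w \<bullet> w) + 2 * (a z * a w * k\<^sup>2)"
  unfolding NN zN by (simp add: algebra_simps)
 finally show ?thesis .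
qed

private lemma inner_gg: "g z \<bullet> g z = D z * (D z - (1 - z \<bullet> z))"
proof -
 have "2 * (g z \<bullet> g z) = 2 * (D z * (D z - (1 - z \<bullet> z)))"
  unfolding inner_g D_def by (simp add: algebra_simps power2_eq_square)
 then show ?thesis by simp
qed

private lemma inner_ff:
 assumes "z \<in> ball 0 1" shows "1 - f z \<bullet> f z = (1 - z \<bullet> z) / D z"
proof -
 have "f z \<bullet> f z = (g z \<bullet> g z) / (D z * D z)" by (simp add: f_eq)
 also have "... = (D z - (1 - z \<bullet> z)) / D z" unfolding inner_gg using D_pos[OF assms] by simp
 finally show ?thesis using D_pos[OF assms] by (simp add: field_simps)
qed

lemma hyp_refl_in: "z \<in> ball 0 1 ==> f z \<in> ball 0 1"
 using inner_ff[of z] D_pos[of z] unfolding unit_ball_iff by (smt (verit) divide_pos_pos)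

text \<open>The reflection is conformal with factor \<open>1 / D z\<close>. With
  \<open>inner_ff\<close> this gives both the invariance of \<open>hyp_ratio\<close> and the
  hypothesis of the volume argument.\<close>

private lemma dist_ff:
 assumes z: "z \<in> ball 0 1" and w: "w \<in> ball 0 1"
 shows "(dist (f z) (f w))\<^sup>2 * (D z * D w) = (dist z w)\<^sup>2"
proof -
 have D: "D z ~= 0" "D w ~= 0" using D_pos[OF z] D_pos[OF w] by auto
 have "(dist (f z) (f w))\<^sup>2 = f z \<bullet> f z + f w \<bullet> f w - 2 * (f z \<bullet> f w)"
  unfolding dist_sq by (simp add: inner_diffs)
 also have "2 * (f z \<bullet> f w) = 2 * (g z \<bullet> g w) / (D z * D w)" by (simp add: f_eq)
 also have "f z \<bullet> f z = 1 - (1 - z \<bullet> z) / D z" using inner_ff[OF z] by simp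
 also have "f w \<bullet> f w = 1 - (1 - w \<bullet> w) / D w" using inner_ff[OF w] by simp
 finally have "(dist (f z) (f w))\<^sup>2 * (D z * D w)
  = (1 - (1 - z \<bullet> z) / D z + (1 - (1 - w \<bullet> w) / D w) - 2 * (g z \<bullet> g w) / (D z * D w)) * (D z * D w)"
  by (simp only:)
 also have "... = 2 * D z * D w - (1 - z \<bullet> z) * D w - (1 - w \<bullet> w) * D z - 2 * (g z \<bullet> g w)"
  using D by (simp add: field_simps)
 also have "... = z \<bullet> z + w \<bullet> w - 2 * (z \<bullet> w)" unfolding inner_g D_def by (simp add: algebra_simps power2_eq_square)
 also have "... = (dist z w)\<^sup>2" unfolding dist_sq by (simp add: inner_diffs)
 finally show ?thesis .
qed

text \<open>The sign of \<open>a z * a w\<close> tells whether \<open>z\<close> and \<open>w\<close>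
  lie on the same side, so the sign rule can be read off from the extra term.\<close>

private lemma dist_f:
 assumes w: "w \<in> ball 0 1"
 shows "(dist z (f w))\<^sup>2 * D w = (dist z w)\<^sup>2 + a z * a w * Q"
proof -
 have D: "D w ~= 0" using D_pos[OF w] by auto
 have "(dist z (f w))\<^sup>2 = z \<bullet> z + f w \<bullet> f w - 2 * (z \<bullet> f w)"
  unfolding dist_sq by (simp add: inner_diffs)
 also have "2 * (z \<bullet> f w) = 2 * (z \<bullet> g w) / D w" by (simp add: f_eq)
 also have "f w \<bullet> f w = 1 - (1 - w \<bullet> w) / D w" using inner_ff[OF w] by simp
 finally have "(dist z (f w))\<^sup>2 * D w = (z \<bullet> z + (1 - (1 - w \<bullet> w) / D w) - 2 * (z \<bullet> g w) / D w) * D w"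
  by (simp only:)
 also have "... = (z \<bullet> z + 1) * D w - (1 - w \<bullet> w) - 2 * (z \<bullet> g w)"
  using D by (simp add: field_simps)
 also have "2 * (z \<bullet> g w) = 2 * (z \<bullet> w) - a w * (2 * (z \<bullet> N))"
  by (simp add: g_def inner_diff_right algebra_simps)
 finally have "(dist z (f w))\<^sup>2 * D w = z \<bullet> z + w \<bullet> w - 2 * (z \<bullet> w) + a z * a w * Q"
  unfolding zN D_def by (simp add: algebra_simps)
 then show ?thesis unfolding dist_sq by (simp add: inner_diffs)
qed

private lemma a_f:
 assumes z: "z \<in> ball 0 1" shows "a (f z) = - a z / D z"
proof -
 have D: "D z ~= 0" using D_pos[OF z] by auto
 have "a (f z) * Q = 2 * (f z \<bullet> N) - k * (1 + f z \<bullet> f z)" using zN[of "f z"] by simp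
 also have "f z \<bullet> f z = 1 - (1 - z \<bullet> z) / D z" using inner_ff[OF z] by simp
 also have "2 * (f z \<bullet> N) = (2 * (z \<bullet> N) - 2 * a z * (N \<bullet> N)) / D z"
  by (simp add: f_eq g_def inner_diff_left right_diff_distrib diff_divide_distrib)
 finally have "a (f z) * Q * D z
  = ((2 * (z \<bullet> N) - 2 * a z * (N \<bullet> N)) / D z - k * (1 + (1 - (1 - z \<bullet> z) / D z))) * D z"
  by (simp only:)
 also have "... = 2 * (z \<bullet> N) - 2 * a z * (N \<bullet> N) - k * (2 * D z - (1 - z \<bullet> z))"
  using D by (simp add: field_simps)
 also have "... = - a z * Q" unfolding zN NN D_def by (simp add: algebra_simps power2_eq_square)
 finally have "(a (f z) * D z) * Q = (- a z) * Q" by (simp add: mult_ac)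
 then have "a (f z) * D z = - a z" using Q_pos by (metis mult_cancel_right less_irrefl)
 then show ?thesis using D by (simp add: field_simps)
qed

lemma hyp_refl_involution:
 assumes z: "z \<in> ball 0 1" shows "f (f z) = z"
proof -
 have D: "D z ~= 0" using D_pos[OF z] by auto
 have "D (f z) = 1 + a z / D z * k" unfolding D_def[of "f z"] a_f[OF z] by simp
 also have "... = (D z + a z * k) / D z" using D by (simp add: field_simps)
 also have "... = 1 / D z" by (simp add: D_def)
 finally have Df: "D (f z) = 1 / D z" .
 have "g (f z) = (1 / D z) *\<^sub>R g z + (a z / D z) *\<^sub>R N" unfolding g_def[of "f z"] a_f[OF z] by (simp add: f_eq)
 also have "... = (1 / D z) *\<^sub>R z" by (simp add: g_def scaleR_diff_right)
 finally show ?thesis unfolding f_eq[of "f z"] Df using D by simp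
qed

private lemma s_eq: "a z * Q = q * (dist z y)\<^sup>2 - p * (dist z x)\<^sup>2"
proof -
 have "a z * Q = 2 * (z \<bullet> N) - k * (1 + z \<bullet> z)" using zN[of z] by simp
 also have "... = q * (z \<bullet> z) - 2 * q * (z \<bullet> y) + (q - 1) - (p * (z \<bullet> z) - 2 * p * (z \<bullet> x) + (p - 1))"
  by (simp add: Nk inner_diff_right algebra_simps)
 also have "... = q * (z \<bullet> z) - 2 * q * (z \<bullet> y) + q * (y \<bullet> y) - (p * (z \<bullet> z) - 2 * p * (z \<bullet> x) + p * (x \<bullet> x))"
  unfolding pxx ..
 also have "... = q * (dist z y)\<^sup>2 - p * (dist z x)\<^sup>2"
  unfolding dist_sq by (simp add: inner_diffs algebra_simps)
 finally show ?thesis .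
qed

lemma hyp_refl_swap: "f x = y"
proof -
 have "a x * Q = (1 - x \<bullet> x) * Q"
 proof -
  have "a x * Q = q * ((x - y) \<bullet> (x - y))" unfolding s_eq by (simp add: dist_sq)
  also have "... = (p * (1 - x \<bullet> x)) * q * ((x - y) \<bullet> (x - y))" unfolding pq by simp
  also have "... = (1 - x \<bullet> x) * Q" unfolding Q_eq by (simp add: mult_ac)
  finally show ?thesis .
 qed
 then have ax: "a x = 1 - x \<bullet> x" using Q_pos by (metis mult_cancel_right less_irrefl)
 have ap: "a x * p = 1" using pq(3) by (simp add: ax mult.commute)
 have "D x = a x * q" unfolding D_def Nk using ap by (simp add: right_diff_distrib)
 moreover have "g x = (a x * q) *\<^sub>R y" unfolding g_def Nk using ap by (simp add: scaleR_diff_right)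
 moreover have "a x * q ~= 0" using pq(2) unit_ball_inner[OF x] by (simp add: ax)
 ultimately show ?thesis by (simp add: f_eq)
qed

lemma hyp_refl_isometry:
 assumes z: "z \<in> ball 0 1" and w: "w \<in> ball 0 1"
 shows "hyperbolic_distance (f z) (f w) = hyperbolic_distance z w"
proof -
 have "hyp_ratio (f z) (f w) = (dist (f z) (f w))\<^sup>2 / ((1 - z \<bullet> z) / D z * ((1 - w \<bullet> w) / D w))"
  unfolding hyp_ratio_def inner_ff[OF z] inner_ff[OF w] ..
 also have "... = ((dist (f z) (f w))\<^sup>2 * (D z * D w)) / ((1 - z \<bullet> z) * (1 - w \<bullet> w))" by simp
 also have "... = hyp_ratio z w" unfolding dist_ff[OF z w] hyp_ratio_def ..
 finally show ?thesis by (simp add: hyp_dist_ratio)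
qed

private lemma sgn_a: 
 assumes z: "z \<in> ball 0 1"
 shows "sgn (hyperbolic_distance z y - hyperbolic_distance z x) = sgn (a z)"
proof -
 have "hyp_ratio z y - hyp_ratio z x = (q * (dist z y)\<^sup>2 - p * (dist z x)\<^sup>2) / (1 - z \<bullet> z)"
  by (simp add: hyp_ratio_def p_def q_def divide_simps)
 also have "... = a z * Q / (1 - z \<bullet> z)" unfolding s_eq ..
 finally have "sgn (hyp_ratio z y - hyp_ratio z x) = sgn (a z)"
  using unit_ball_inner[OF z] Q_pos by (simp add: sgn_mult sgn_divide)
 then show ?thesis unfolding hyp_dist_ratio using hyp_ratio_nonneg x y z by (subst sgn_arcosh_diff) auto
qed

lemma hyp_refl_side:
 assumes z: "z \<in> ball 0 1" and w: "w \<in> ball 0 1"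
 shows "sgn (hyperbolic_distance z (f w) - hyperbolic_distance z w) =
  sgn ((hyperbolic_distance z y - hyperbolic_distance z x) * (hyperbolic_distance w y - hyperbolic_distance w x))"
proof -
 have "hyp_ratio z (f w) = ((dist z (f w))\<^sup>2 * D w) / ((1 - z \<bullet> z) * (1 - w \<bullet> w))"
  unfolding hyp_ratio_def inner_ff[OF w] by simp
 also have "... = hyp_ratio z w + a z * a w * Q / ((1 - z \<bullet> z) * (1 - w \<bullet> w))"
  unfolding dist_f[OF w] hyp_ratio_def by (rule add_divide_distrib)
 finally have "sgn (hyp_ratio z (f w) - hyp_ratio z w) = sgn (a z) * sgn (a w)"
  using unit_ball_inner[OF z] unit_ball_inner[OF w] Q_pos by (simp add: sgn_mult sgn_divide)
 then have "sgn (hyperbolic_distance z (f w) - hyperbolic_distance z w) = sgn (a z) * sgn (a w)"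
  unfolding hyp_dist_ratio using hyp_ratio_nonneg hyp_refl_in[OF w] z w by (subst sgn_arcosh_diff) auto
 then show ?thesis unfolding sgn_mult sgn_a[OF z] sgn_a[OF w] .
qed

lemma conformal_hyperbolic_reflection: "conformal_involution (ball 0 1) (\<lambda>x. 2 / (1 - (norm x)\<^sup>2)) f"
proof
 show "continuous_on (ball 0 1) (\<lambda>x::'a. 2 / (1 - (norm x)\<^sup>2))"
  by (intro continuous_intros) (auto simp: power2_norm_eq_inner norm_eq_sqrt_inner)
 have a: "continuous_on (ball 0 1) a"
  unfolding a_def hyperbolic_coefficient_def[abs_def] N_def[symmetric] k_def[symmetric] Q_def[symmetric]
  using Q_pos by (intro continuous_intros) auto
 have "f = (\<lambda>z. (1 / (1 - a z * k)) *\<^sub>R (z - a z *\<^sub>R N))" by (simp add: fun_eq_iff f_eq D_def g_def)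
 moreover have "1 - a z * k ~= 0" if "z \<in> ball 0 1" for z using D_pos[OF that] by (simp add: D_def)
 ultimately show "continuous_on (ball 0 1) f" using a by (simp only:) (intro continuous_intros; simp)
 show "0 < 2 / (1 - (norm z)\<^sup>2)" if "z \<in> ball 0 1" for z :: 'a
  using unit_ball_inner[OF that] by (simp add: power2_norm_eq_inner)
 fix z w :: 'a assume z: "z \<in> ball 0 1" and w: "w \<in> ball 0 1"
 have D: "D z ~= 0" "D w ~= 0" using D_pos[OF z] D_pos[OF w] by auto
 have "(dist (f z) (f w))\<^sup>2 * (2 / (1 - (norm (f z))\<^sup>2) * (2 / (1 - (norm (f w))\<^sup>2)))
  = ((dist (f z) (f w))\<^sup>2 * (D z * D w)) * (2 / (1 - z \<bullet> z) * (2 / (1 - w \<bullet> w)))"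
  unfolding power2_norm_eq_inner inner_ff[OF z] inner_ff[OF w] by simp
 then show "(dist (f z) (f w))\<^sup>2 * (2 / (1 - (norm (f z))\<^sup>2) * (2 / (1 - (norm (f w))\<^sup>2)))
  = (dist z w)\<^sup>2 * (2 / (1 - (norm z)\<^sup>2) * (2 / (1 - (norm w)\<^sup>2)))"
  unfolding dist_ff[OF z w] power2_norm_eq_inner .
next
 show "f z \<in> ball 0 1" "f (f z) = z" if "z \<in> ball 0 1" for z
  by (rule hyp_refl_in[OF that], rule hyp_refl_involution[OF that])
qed simp

text \<open>Depending on \<open>k\<close> the bisector is part of a hyperplane through the origin or
  of a sphere about \<open>N / k\<close>; both are negligible.\<close>

lemma hyperbolic_bisector:
 "\<exists>B. closed B \<and> negligible B \<and> {z \<in> ball 0 1. hyperbolic_distance z x = hyperbolic_distance z y} = ball 0 1 \<inter> B"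
proof -
 let ?B = "{z. 2 * (z \<bullet> N) - k * (1 + z \<bullet> z) = 0}"
 have "closed ?B" by (intro closed_Collect_eq continuous_intros)
 moreover have "negligible ?B"
 proof (cases "k = 0")
  case True
  then have "N ~= 0" using Q_pos by (auto simp: Q_def)
  then have "negligible {z. N \<bullet> z = 0}" by (intro negligible_hyperplane) auto
  moreover have "?B = {z. N \<bullet> z = 0}" using True by (simp add: inner_commute)
  ultimately show ?thesis by simp
 next
  case False
  have "?B \<subseteq> sphere ((1 / k) *\<^sub>R N) (sqrt (Q / k\<^sup>2))"
  proof
   fix z assume "z \<in> ?B"
   then have e: "2 * (z \<bullet> N) = k * (1 + z \<bullet> z)" by simp
   have "(z - (1 / k) *\<^sub>R N) \<bullet> (z - (1 / k) *\<^sub>R N) = z \<bullet> z - (2 * (z \<bullet> N)) / k + (N \<bullet> N) / k\<^sup>2"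
    by (simp add: inner_diffs power2_eq_square field_simps)
   also have "... = Q / k\<^sup>2" unfolding e NN using False by (simp add: field_simps)
   finally show "z \<in> sphere ((1 / k) *\<^sub>R N) (sqrt (Q / k\<^sup>2))"
    by (simp add: dist_commute dist_norm[of z] norm_eq_sqrt_inner)
  qed
  then show ?thesis using negligible_subset negligible_sphere by blast
 qed
 moreover have "{z \<in> ball 0 1. hyperbolic_distance z x = hyperbolic_distance z y} = ball 0 1 \<inter> ?B"
 proof -
  have "hyperbolic_distance z x = hyperbolic_distance z y \<longleftrightarrow> z \<in> ?B" if "z \<in> ball 0 1" for z
  proof -
   have "hyperbolic_distance z x = hyperbolic_distance z y \<longleftrightarrow> sgn (hyperbolic_distance z y - hyperbolic_distance z x) = 0"
    by (auto simp: sgn_zero_iff)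
   also have "... \<longleftrightarrow> a z * Q = 0" unfolding sgn_a[OF that] using Q_pos by (simp add: sgn_zero_iff)
   also have "... \<longleftrightarrow> z \<in> ?B" using zN[of z] by auto
   finally show ?thesis .
  qed
  then show ?thesis by blast
 qed
 ultimately show ?thesis by blast
qed

end

section \<open>The hyperbolic distance as a metric\<close>

lemma cosh_hyperbolic_distance:
 "z \<in> ball 0 1 ==> w \<in> ball 0 1 ==> cosh (hyperbolic_distance z w) = 1 + 2 * hyp_ratio z w"
 using hyp_ratio_nonneg[of z w] by (simp add: hyp_dist_ratio)

lemma hyp_dist_nonneg: "z \<in> ball 0 1 ==> w \<in> ball 0 1 ==> 0 <= hyperbolic_distance z w"
 using hyp_ratio_nonneg[of z w] by (simp add: hyp_dist_ratio)

lemma hyp_dist_commute: "hyperbolic_distance z w = hyperbolic_distance w z"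
 by (simp add: hyp_dist_ratio hyp_ratio_commute)

text \<open>With the middle point at the origin the hyperbolic law of cosines is explicit, and
  Cauchy-Schwarz replaces the angle by the worst case of opposite directions.\<close>

lemma hyperbolic_triangle_0:
 fixes x z :: "'a::euclidean_space"
 assumes x: "x \<in> ball 0 1" and z: "z \<in> ball 0 1"
 shows "hyperbolic_distance x z <= hyperbolic_distance x 0 + hyperbolic_distance 0 z"
proof -
 have 0: "0 \<in> ball (0::'a) 1" by simp
 define p q where "p = 1 / (1 - x \<bullet> x)" and "q = 1 / (1 - z \<bullet> z)"
 have pos: "0 < p" "0 < q" using unit_ball_inner[OF x] unit_ball_inner[OF z] by (auto simp: p_def q_def)
 have "p * (1 - x \<bullet> x) = 1" "q * (1 - z \<bullet> z) = 1"
  using unit_ball_inner[OF x] unit_ball_inner[OF z] by (auto simp: p_def q_def)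
 then have pxx: "p * (x \<bullet> x) = p - 1" "q * (z \<bullet> z) = q - 1" by (simp_all add: algebra_simps)
 have r0: "hyp_ratio x 0 = p - 1" "hyp_ratio 0 z = q - 1"
  unfolding pxx[symmetric] by (simp_all add: hyp_ratio_def power2_norm_eq_inner p_def q_def)
 have sinh: "sinh (hyperbolic_distance x 0) = 2 * p * norm x" "sinh (hyperbolic_distance 0 z) = 2 * q * norm z"
 proof -
  have *: "sqrt ((1 + 2 * (r - 1))\<^sup>2 - 1) = 2 * r * norm v" if "0 < r" "r * (v \<bullet> v) = r - 1" for r and v :: 'a
  proof -
   have "(1 + 2 * (r - 1))\<^sup>2 - 1 = 4 * r * (r - 1)" by (simp add: power2_eq_square algebra_simps)
   also have "... = (2 * r * norm v)\<^sup>2"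
    unfolding that(2)[symmetric] power_mult_distrib power2_norm_eq_inner by (simp add: power2_eq_square)
   finally show ?thesis using that(1) by (simp add: real_sqrt_abs)
  qed
  have "0 <= p - 1" "0 <= q - 1" using hyp_ratio_nonneg[OF x 0] hyp_ratio_nonneg[OF 0 z] r0 by auto
  then show "sinh (hyperbolic_distance x 0) = 2 * p * norm x" "sinh (hyperbolic_distance 0 z) = 2 * q * norm z"
   unfolding hyp_dist_ratio r0 using *[OF pos(1) pxx(1)] *[OF pos(2) pxx(2)]
   by (subst sinh_arcosh_real; simp)+
 qed
 have "hyp_ratio x z = p * q * ((x - z) \<bullet> (x - z))" by (simp add: hyp_ratio_def p_def q_def dist_sq)
 also have "... = q * (p * (x \<bullet> x)) + p * (q * (z \<bullet> z)) - 2 * p * q * (x \<bullet> z)"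
  by (simp add: inner_diffs algebra_simps)
 finally have rxz: "hyp_ratio x z = q * (p - 1) + p * (q - 1) - 2 * p * q * (x \<bullet> z)" unfolding pxx .
 have "cosh (hyperbolic_distance x z) = (1 + 2 * (p - 1)) * (1 + 2 * (q - 1)) - 4 * p * q * (x \<bullet> z)"
  unfolding cosh_hyperbolic_distance[OF x z] rxz by (simp add: algebra_simps)
 also have "... <= (1 + 2 * (p - 1)) * (1 + 2 * (q - 1)) + 4 * p * q * (norm x * norm z)"
 proof -
  have "4 * p * q * - (x \<bullet> z) <= 4 * p * q * (norm x * norm z)"
   using Cauchy_Schwarz_ineq2[of x z] pos by (intro mult_left_mono) (auto simp: abs_le_iff)
  then show ?thesis by simp
 qed
 also have "... = cosh (hyperbolic_distance x 0 + hyperbolic_distance 0 z)"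
  unfolding cosh_add sinh cosh_hyperbolic_distance[OF x 0] cosh_hyperbolic_distance[OF 0 z] r0 by simp
 finally show ?thesis using hyp_dist_nonneg x z 0 by (subst (asm) cosh_real_nonneg_le_iff) auto
qed

text \<open>The reflection exchanging \<open>y\<close> with the origin moves the middle point there
  without changing distances.\<close>

lemma hyperbolic_triangle:
 fixes x y z :: "'a::euclidean_space"
 assumes x: "x \<in> ball 0 1" and y: "y \<in> ball 0 1" and z: "z \<in> ball 0 1"
 shows "hyperbolic_distance x z <= hyperbolic_distance x y + hyperbolic_distance y z"
proof (cases "y = 0")
 case True
 then show ?thesis using hyperbolic_triangle_0[OF x z] by simp
next
 case False
 have 0: "0 \<in> ball (0::'a) 1" by simp
 note iso = hyp_refl_isometry[OF y 0 False] and hin = hyp_refl_in[OF y 0 False]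
 show ?thesis using hyperbolic_triangle_0[OF hin[OF x] hin[OF z]] iso[OF x z] iso[OF x y] iso[OF y z]
  by (simp add: hyp_refl_swap[OF y 0 False])
qed

lemma hyperbolic_cball:
 fixes r :: real
 obtains \<rho> where "\<bar>\<rho>\<bar> < 1" "{y \<in> ball (0::'a::euclidean_space) 1. hyperbolic_distance 0 y <= r} = cball 0 \<rho>"
proof (cases "0 <= r")
 case False
 \<comment> \<open>A ball of negative radius stands for the empty set.\<close>
 have "{y \<in> ball (0::'a) 1. hyperbolic_distance 0 y <= r} = cball 0 (- 1 / 2)"
  using False hyp_dist_nonneg[of "0::'a"] by force
 then show ?thesis using that[of "- 1 / 2"] by simp
next
 case True
 define C where "C = cosh r"
 have C: "1 <= C" by (simp add: C_def cosh_real_ge_1)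
 \<comment> \<open>The Euclidean radius is \<open>tanh (r / 2)\<close>, expressed through
   \<open>cosh r\<close>.\<close>
 define \<rho> where "\<rho> = sqrt ((C - 1) / (C + 1))"
 have \<rho>: "\<rho> < 1" "0 <= \<rho>" using C by (simp_all add: \<rho>_def)
 have 0: "0 \<in> ball (0::'a) 1" by simp
 have "hyperbolic_distance 0 y <= r \<longleftrightarrow> norm y <= \<rho>" if y: "y \<in> ball 0 1" for y :: 'a
 proof -
  have yy: "0 < 1 - y \<bullet> y" using unit_ball_inner[OF y] by simp
  have "hyperbolic_distance 0 y <= r \<longleftrightarrow> cosh (hyperbolic_distance 0 y) <= C"
   unfolding C_def using True hyp_dist_nonneg[OF 0 y] by (simp add: cosh_real_nonneg_le_iff)
  also have "... \<longleftrightarrow> 1 + 2 * ((y \<bullet> y) / (1 - y \<bullet> y)) <= C"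
   unfolding cosh_hyperbolic_distance[OF 0 y] by (simp add: hyp_ratio_def power2_norm_eq_inner)
  also have "... \<longleftrightarrow> (1 - y \<bullet> y) + 2 * (y \<bullet> y) <= C * (1 - y \<bullet> y)"
   using yy by (simp add: field_simps)
  also have "... \<longleftrightarrow> y \<bullet> y <= (C - 1) / (C + 1)" using C by (simp add: field_simps)
  also have "... \<longleftrightarrow> norm y <= \<rho>" unfolding \<rho>_def norm_eq_sqrt_inner by simp
  finally show ?thesis .
 qed
 then have "{y \<in> ball (0::'a) 1. hyperbolic_distance 0 y <= r} = cball 0 \<rho>" using \<rho> by auto
 moreover have "\<bar>\<rho>\<bar> < 1" using \<rho> by simp
 ultimately show ?thesis using that by blast
qed

lemma hyperbolic_reflection_model:
 "reflection_model (hyperbolic_model :: 'a::euclidean_space model_space) hyp_refl"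
proof -
 let ?X = "hyperbolic_model :: 'a model_space" and ?S = "ball 0 1 :: 'a set"
 have sel: "vol ?X = completion hyperbolic_volume" "distance ?X = hyperbolic_distance" "base ?X = 0"
  "translation_maps ?X = isometries ?S hyperbolic_distance" by (simp_all add: hyperbolic_model_def)
 have 0: "0 \<in> ?S" by simp
 have SB: "?S \<in> sets borel" by simp
 have hv: "sets hyperbolic_volume = sets (restrict_space borel ?S)"
  by (simp add: hyperbolic_volume_def sets_restrict_space)
 note cs = completion_sets_restrict[OF hv SB]
 have den: "1 - (norm z)\<^sup>2 > 0" if "z \<in> ?S" for z
  using unit_ball_inner[OF that] by (simp add: power2_norm_eq_inner)
 \<comment> \<open>The identity is a conformal involution; this instance makes the estimates of the
   weighted volume available before any reflection is chosen.\<close>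
 interpret vol: conformal_involution ?S "\<lambda>x. 2 / (1 - (norm x)\<^sup>2)" "\<lambda>x. x"
 proof
  show "continuous_on ?S (\<lambda>x. 2 / (1 - (norm x)\<^sup>2))" using den by (intro continuous_intros) force
 qed (use den in auto)
 have mu: "vol.mu = hyperbolic_volume" by (simp add: vol.mu_def hyperbolic_volume_def)
 have cont: "continuous_on (?S \<times> ?S) (\<lambda>(x, y). hyperbolic_distance x y)"
 proof -
  have ge: "1 <= 1 + 2 * (norm (fst v - snd v))\<^sup>2 / ((1 - (norm (fst v))\<^sup>2) * (1 - (norm (snd v))\<^sup>2))"
   if "v \<in> ?S \<times> ?S" for v :: "'a \<times> 'a"
  proof -
   have "0 < 1 - (norm (fst v))\<^sup>2" "0 < 1 - (norm (snd v))\<^sup>2" using that den by (auto simp del: mem_ball mem_ball_0)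
   then show ?thesis by simp
  qed
  have ne: "(1 - (norm (fst v))\<^sup>2) * (1 - (norm (snd v))\<^sup>2) ~= 0" if "v \<in> ?S \<times> ?S" for v :: "'a \<times> 'a"
   using den[of "fst v"] den[of "snd v"] that by (auto simp del: mem_ball mem_ball_0)
  show ?thesis unfolding split_beta hyperbolic_distance_def
  proof (rule continuous_on_compose2[OF continuous_on_arcosh[OF order_refl]])
   show "continuous_on (?S \<times> ?S) (\<lambda>v. 1 + 2 * (norm (fst v - snd v))\<^sup>2 / ((1 - (norm (fst v))\<^sup>2) * (1 - (norm (snd v))\<^sup>2)))"
    using ne by (intro continuous_intros ballI)
  qed (use ge in blast)
 qed
 have sets: "A \<inter> points ?X \<in> sets (vol ?X)" if "A \<in> sets borel" for A
  using cs(2)[OF that] cs(3) by (simp add: sel(1))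
 have comp: "compact {y \<in> points ?X. distance ?X (base ?X) y <= r}" for r
 proof -
  obtain \<rho> where \<rho>: "{y \<in> ?S. hyperbolic_distance 0 y <= r} = cball 0 \<rho>" by (rule hyperbolic_cball)
  show ?thesis unfolding points_hyperbolic_model sel(2,3) \<rho> by (rule compact_cball)
 qed
 have fin: "emeasure (vol ?X) {y \<in> points ?X. distance ?X (base ?X) y <= r} < \<infinity>" for r
 proof -
  obtain \<rho> where \<rho>: "\<bar>\<rho>\<bar> < 1" "{y \<in> ?S. hyperbolic_distance 0 y <= r} = cball 0 \<rho>" by (rule hyperbolic_cball)
  have B: "cball (0::'a) \<rho> \<in> sets borel" "cball (0::'a) \<rho> \<subseteq> ?S" using \<rho>(1) by auto
  have "emeasure hyperbolic_volume (cball (0::'a) \<rho>) <= ennreal ((2 / (1 - \<rho>\<^sup>2)) ^ DIM('a)) * emeasure lborel (cball (0::'a) \<rho>)"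
  proof (rule vol.emeasure_mu_le[unfolded mu, OF B])
   show "2 / (1 - (norm z)\<^sup>2) <= 2 / (1 - \<rho>\<^sup>2)" if "z \<in> cball 0 \<rho>" for z :: 'a
   proof -
    have "(norm z)\<^sup>2 <= \<rho>\<^sup>2" "0 <= \<rho>" using that by (auto intro!: power_mono order_trans[OF norm_ge_zero[of z]])
    then show ?thesis using \<rho>(1) by (intro divide_left_mono mult_pos_pos) (auto simp: abs_square_less_1)
   qed
   show "0 <= 2 / (1 - \<rho>\<^sup>2)" using \<rho>(1) by (simp add: abs_square_le_1)
  qed
  also have "... < \<infinity>" using emeasure_lborel_cball_finite[of "0::'a" \<rho>] by (simp add: ennreal_mult_less_top)
  finally have "emeasure hyperbolic_volume (cball (0::'a) \<rho>) < \<infinity>" .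
  moreover have "cball (0::'a) \<rho> \<in> sets hyperbolic_volume" unfolding vol.sets_mu[unfolded mu] using B by blast
  ultimately show ?thesis unfolding points_hyperbolic_model sel(2,3) \<rho>(2) by (simp add: sel(1))
 qed
 have ball: "\<exists>U. open U \<and> 0 \<in> U \<and> U \<subseteq> ?S \<and> model_ball ?X r = U" if r: "0 < r" for r
 proof -
  have "continuous_on ?S (\<lambda>y. (\<lambda>(x, y). hyperbolic_distance x y) (0, y))"
   by (rule continuous_on_compose2[OF cont]) (auto intro!: continuous_intros)
  then have "continuous_on ?S (\<lambda>y. hyperbolic_distance 0 y)" by simp
  then have "open (?S \<inter> (\<lambda>y. hyperbolic_distance 0 y) -` {..<r})" by (intro continuous_open_preimage) auto
  moreover have "model_ball ?X r = ?S \<inter> (\<lambda>y. hyperbolic_distance 0 y) -` {..<r}" by (auto simp: model_ball_def sel(2,3))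
  ultimately show ?thesis using r by (auto simp: hyperbolic_distance_def)
 qed
 show ?thesis
 proof (rule reflection_model.intro, unfold points_hyperbolic_model)
  show "base ?X \<in> ?S" using 0 by (simp add: sel)
  show "continuous_on (?S \<times> ?S) (\<lambda>(x, y). distance ?X x y)" using cont by (simp add: sel)
  show "connected ?S" by simp
  show "sigma_finite_measure (vol ?X)" by (rule sigma_finite_by_compact[OF sets comp fin])
  show "\<exists>C\<subseteq>A. compact C \<and> emeasure (vol ?X) (A - C) < ennreal e"
   if "A \<in> sets (vol ?X)" "emeasure (vol ?X) A < \<infinity>" "0 < e" for A e
   using inner_regular_completion[of hyperbolic_volume A e, OF cs(1,2)] that unfolding sel(1) by simp
  show "infinite (model_ball ?X r)" if r: "0 < r" for r using ball[OF r] open_infinite by blast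
  show "0 < emeasure (vol ?X) (model_ball ?X r)" if r: "0 < r" for r
  proof -
   obtain U where U: "open U" "0 \<in> U" "U \<subseteq> ?S" "model_ball ?X r = U" using ball[OF r] by blast
   have UB: "U \<in> sets borel" using U(1) by (rule borel_open)
   have "0 < ennreal (2 ^ DIM('a)) * emeasure lborel U"
    using emeasure_lborel_open_pos[OF U(1)] U(2) by (auto simp: ennreal_zero_less_mult_iff)
   also have "... <= emeasure hyperbolic_volume U"
   proof (rule vol.emeasure_mu_ge[unfolded mu, OF UB U(3)])
    show "2 <= 2 / (1 - (norm z)\<^sup>2)" if "z \<in> U" for z using den[of z] U(3) that by (auto simp: field_simps)
   qed simp
   finally show ?thesis using UB U(3) vol.sets_mu[of U, unfolded mu] by (simp add: sel(1) U(4))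
  qed
  fix x y :: 'a
  assume x: "x \<in> ?S" and y: "y \<in> ?S"
  show "distance ?X x y = 0 \<longleftrightarrow> x = y"
   unfolding sel hyp_dist_ratio using hyp_ratio_nonneg[OF x y] den[OF x] den[OF y]
   by (auto simp: hyp_ratio_def power2_norm_eq_inner)
  show "0 <= distance ?X x y" unfolding sel by (rule hyp_dist_nonneg[OF x y])
  show "distance ?X x y = distance ?X y x" unfolding sel by (rule hyp_dist_commute)
  show "distance ?X x z <= distance ?X x y + distance ?X y z" if "z \<in> ?S" for z
   unfolding sel by (rule hyperbolic_triangle[OF x y that])
  assume xy: "x ~= y"
  interpret R: conformal_involution ?S "\<lambda>x. 2 / (1 - (norm x)\<^sup>2)" "hyp_refl x y"
   by (rule conformal_hyperbolic_reflection[OF x y xy])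
  have R: "R.mu = hyperbolic_volume" by (simp add: R.mu_def hyperbolic_volume_def)
  note m = distr_completion_eq[OF R.f_measurable_mu R.distr_mu, unfolded R]
  show "hyp_refl x y \<in> vol ?X \<rightarrow>\<^sub>M vol ?X" "distr (vol ?X) (vol ?X) (hyp_refl x y) = vol ?X"
   unfolding sel(1) by (rule m)+
  show "{z \<in> ?S. distance ?X z x = distance ?X z y} \<in> null_sets (vol ?X)"
  proof -
   obtain B where B: "closed B" "negligible B"
    "{z \<in> ?S. hyperbolic_distance z x = hyperbolic_distance z y} = ?S \<inter> B"
    using hyperbolic_bisector[OF x y xy] by blast
   have BB: "?S \<inter> B \<in> sets borel" using B(1) by auto
   have "negligible (?S \<inter> B)" using B(2) by (rule negligible_subset) auto
   then have "emeasure lborel (?S \<inter> B) = 0" using BB by (simp add: negligible_iff_null_sets null_sets_def)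
   then have "emeasure hyperbolic_volume (?S \<inter> B) = 0"
    using BB by (intro vol.emeasure_mu_null[unfolded mu]) auto
   then have "?S \<inter> B \<in> null_sets hyperbolic_volume"
    using BB vol.sets_mu[of "?S \<inter> B", unfolded mu] by (simp add: null_sets_def)
   then show ?thesis unfolding sel B(3) by (rule null_sets_completionI)
  qed
  show "hyp_refl x y x = y" by (rule hyp_refl_swap[OF x y xy])
  fix z :: 'a assume z: "z \<in> ?S"
  show "hyp_refl x y z \<in> ?S" by (rule hyp_refl_in[OF x y xy z])
  show "hyp_refl x y (hyp_refl x y z) = z" by (rule hyp_refl_involution[OF x y xy z])
  fix w assume w: "w \<in> ?S"
  show "distance ?X (hyp_refl x y z) (hyp_refl x y w) = distance ?X z w"
   unfolding sel by (rule hyp_refl_isometry[OF x y xy z w])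
  show "sgn (distance ?X z (hyp_refl x y w) - distance ?X z w) =
   sgn ((distance ?X z y - distance ?X z x) * (distance ?X w y - distance ?X w x))"
   unfolding sel by (rule hyp_refl_side[OF x y xy z w])
 next
  fix a :: 'a assume a: "a \<in> ?S"
  show "\<exists>\<tau>\<in>translation_maps ?X. \<forall>x\<in>?S. \<tau> x \<in> ?S \<and> distance ?X (base ?X) (\<tau> x) = distance ?X a x"
  proof (cases "a = 0")
   case True
   have "(\<lambda>x. x) \<in> isometries ?S hyperbolic_distance" by (rule involution_isometry) auto
   then show ?thesis using True by (intro bexI[of _ "\<lambda>x. x"]) (auto simp: sel)
  next
   case False
   note hin = hyp_refl_in[OF a 0 False] and iso = hyp_refl_isometry[OF a 0 False]
   have "hyp_refl a 0 \<in> isometries ?S hyperbolic_distance"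
   proof (rule involution_isometry)
    fix z w assume z: "z \<in> ?S"
    show "hyp_refl a 0 z \<in> ?S" by (rule hin[OF z])
    show "hyp_refl a 0 (hyp_refl a 0 z) = z" by (rule hyp_refl_involution[OF a 0 False z])
    show "hyperbolic_distance (hyp_refl a 0 z) (hyp_refl a 0 w) = hyperbolic_distance z w"
     if "w \<in> ?S" by (rule iso[OF z that])
   qed
   moreover have "hyperbolic_distance 0 (hyp_refl a 0 x) = hyperbolic_distance a x" if "x \<in> ?S" for x
    using iso[OF a that] hyp_refl_swap[OF a 0 False] by simp
   ultimately show ?thesis using hin by (intro bexI[of _ "hyp_refl a 0"]) (auto simp: sel simp del: mem_ball mem_ball_0)
  qed
 qed (use sets comp fin in \<open>auto simp del: mem_ball mem_ball_0\<close>)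
qed

section \<open>The rearrangement theorem\<close>

text \<open>\<open>A\<close> and \<open>B\<close> are positive and negative parts, \<open>C\<close>
  is the energy of the vanishing part, \<open>N\<close> and \<open>P\<close> are one-variable parts
  shared by both sides. If \<open>A'\<close> is infinite, so is the right side; otherwise everything
  is finite and real arithmetic decides.\<close>

lemma ext_integral_comparison:
 fixes A A' B B' C C' N P :: ennreal
 assumes eq: "A + N = B + C + P" and eq': "A' + N = B' + C' + P"
  and fin: "N < \<infinity>" "B < \<infinity>" "B' < \<infinity>" and le: "C <= C'"
 shows "enn2ereal A - enn2ereal B <= enn2ereal A' - enn2ereal B'"
  and "enn2ereal A - enn2ereal B = enn2ereal A' - enn2ereal B' ==> \<bar>enn2ereal A' - enn2ereal B'\<bar> ~= \<infinity> ==>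
   C = C' \<and> C' < \<infinity>"
proof -
 have "enn2ereal A - enn2ereal B <= enn2ereal A' - enn2ereal B' \<and>
  (enn2ereal A - enn2ereal B = enn2ereal A' - enn2ereal B' --> \<bar>enn2ereal A' - enn2ereal B'\<bar> ~= \<infinity> -->
   C = C' \<and> C' < \<infinity>)"
 proof (cases A')
  case top
  obtain b' where "0 <= b'" "B' = ennreal b'" using fin(3) by (cases B') auto
  then have "enn2ereal A' - enn2ereal B' = \<infinity>" using top by (simp add: enn2ereal_ennreal)
  then show ?thesis by simp
 next
  case (real a')
  have "A' + N < \<infinity>" using real fin by simp
  then have f': "C' < \<infinity>" "P < \<infinity>" unfolding eq' by simp_all
  have "C < \<infinity>" by (rule order_le_less_trans[OF le f'(1)])
  then have "A + N < \<infinity>" unfolding eq using fin f' by simp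
  then have "A < \<infinity>" by simp
  obtain a where a: "0 <= a" "A = ennreal a" using \<open>A < \<infinity>\<close> by (cases A) auto
  obtain c where c: "0 <= c" "C = ennreal c" using \<open>C < \<infinity>\<close> by (cases C) auto
  obtain c' where c': "0 <= c'" "C' = ennreal c'" using f' by (cases C') auto
  obtain p where p: "0 <= p" "P = ennreal p" using f' by (cases P) auto
  obtain n where n: "0 <= n" "N = ennreal n" using fin by (cases N) auto
  obtain b where b: "0 <= b" "B = ennreal b" using fin by (cases B) auto
  obtain b' where b': "0 <= b'" "B' = ennreal b'" using fin by (cases B') auto
  note nn = a(1) b(1) c(1) b'(1) c'(1) n(1) p(1) real(1)
  have "ennreal (a + n) = A + N" "ennreal (a' + n) = A' + N" unfolding a(2) n(2) real(2) using nn by simp_all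
  moreover have "ennreal (b + c + p) = B + C + P" "ennreal (b' + c' + p) = B' + C' + P"
   unfolding b(2) c(2) b'(2) c'(2) p(2) using nn by simp_all
  ultimately have "ennreal (a + n) = ennreal (b + c + p)" "ennreal (a' + n) = ennreal (b' + c' + p)"
   using eq eq' by (simp_all only:)
  then have "a + n = b + c + p" "a' + n = b' + c' + p"
   using nn ennreal_inj[of "a + n" "b + c + p"] ennreal_inj[of "a' + n" "b' + c' + p"]
   by (simp_all del: ennreal_plus)
  moreover have "c <= c'" using le nn by (simp add: c(2) c'(2))
  moreover have "enn2ereal A - enn2ereal B = ereal (a - b)" "enn2ereal A' - enn2ereal B' = ereal (a' - b')"
   unfolding a(2) b(2) real(2) b'(2) using nn by (simp_all add: enn2ereal_ennreal)
  moreover have "C = C' \<longleftrightarrow> c = c'" unfolding c(2) c'(2) using nn by simp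
  ultimately show ?thesis using f'(1) by auto
 qed
 note both = this
 show "enn2ereal A - enn2ereal B <= enn2ereal A' - enn2ereal B'" by (rule both[THEN conjunct1])
 show "C = C' \<and> C' < \<infinity>"
  if "enn2ereal A - enn2ereal B = enn2ereal A' - enn2ereal B'" "\<bar>enn2ereal A' - enn2ereal B'\<bar> ~= \<infinity>"
  by (rule both[THEN conjunct2, THEN mp, THEN mp, OF that])
qed

lemma axis_measurable:
 fixes l :: "'m::finite"
 shows "(\<lambda>y::real ^ 'm. y $ l *\<^sub>R (axis l 1 :: real ^ 'm)) \<in>
  restrict_space borel nonneg_cone \<rightarrow>\<^sub>M restrict_space borel nonneg_cone"
proof (rule measurable_restrict_space3)
 have "continuous_on UNIV (\<lambda>y::real ^ 'm. y $ l *\<^sub>R (axis l 1 :: real ^ 'm))" by (intro continuous_intros)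
 then show "(\<lambda>y::real ^ 'm. y $ l *\<^sub>R (axis l 1 :: real ^ 'm)) \<in> borel_measurable borel"
  by (rule borel_measurable_continuous_onI)
qed (auto simp: nonneg_cone_def axis_def)

lemma vanishing_part_measurable:
 assumes "F \<in> borel_measurable (restrict_space borel nonneg_cone)"
 shows "vanishing_part F \<in> borel_measurable (restrict_space borel nonneg_cone)"
 unfolding vanishing_part_def[abs_def]
 using measurable_compose[OF axis_measurable assms] by (intro borel_measurable_diff borel_measurable_sum assms)

context kernel_model begin

context
 fixes F :: "(real, 'm) vec => real" and u :: "'m => 'a => real"
 assumes F: "F \<in> borel_measurable (restrict_space borel nonneg_cone)" "supermodular F" "F 0 = 0"
  and u: "!!i. u i \<in> borel_measurable M" "!!i x. x \<in> points X ==> 0 <= u i x" "!!i. vanishes_at_infinity X (u i)"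
begin

text \<open>Integrating out the other variables turns the kernel into a constant factor, and what
  remains depends only on the distribution. The intended \<open>\<phi>\<close> are the positive and
  the negative part.\<close>

lemma one_variable_rearrangement:
 fixes \<phi> :: "real => real"
 assumes \<phi>: "\<phi> \<in> borel_measurable borel" "\<phi> 0 = 0" "!!t. 0 <= \<phi> t"
 shows "(\<integral>P p. ennreal (\<phi> (F (symm_decr_rearrangement X (u l) (p l) *\<^sub>R axis l 1)) * kernel_product X K p))
  = (\<integral>P p. ennreal (\<phi> (F (u l (p l) *\<^sub>R axis l 1)) * kernel_product X K p))"
proof -
 obtain c where c: "!!g. g \<in> borel_measurable M ==>
  (\<integral>P p. g (p l) * ennreal (kernel_product X K p)) = c * (\<integral>M z. g z)"
  by (rule one_variable_integral[of l]) (rule that)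
 define h where "h t = ennreal (\<phi> (F (max t 0 *\<^sub>R axis l 1)))" for t
 have "(\<lambda>t::real. max t 0 *\<^sub>R (axis l 1 :: (real, 'm) vec)) \<in> borel \<rightarrow>\<^sub>M restrict_space borel nonneg_cone"
 proof (rule measurable_restrict_space2)
  have "continuous_on UNIV (\<lambda>t::real. max t 0 *\<^sub>R (axis l 1 :: (real, 'm) vec))" by (intro continuous_intros)
  then show "(\<lambda>t::real. max t 0 *\<^sub>R (axis l 1 :: (real, 'm) vec)) \<in> borel_measurable borel"
   by (rule borel_measurable_continuous_onI)
 qed (auto simp: nonneg_cone_def axis_def)
 then have hm: "h \<in> borel_measurable borel"
  unfolding h_def using F(1) \<phi>(1) by (intro measurable_compose[OF _ measurable_ennreal] measurable_compose[OF _ \<phi>(1)] measurable_compose[OF _ F(1)])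
 have h0: "h 0 = 0" using F(3) \<phi>(2) by (simp add: h_def)
 have eq: "(\<integral>P p. ennreal (\<phi> (F (v (p l) *\<^sub>R axis l 1)) * kernel_product X K p)) = c * (\<integral>M z. h (v z))"
  if v: "v \<in> borel_measurable M" "!!z. z \<in> pts ==> 0 <= v z" for v
 proof -
  have "(\<integral>P p. ennreal (\<phi> (F (v (p l) *\<^sub>R axis l 1)) * kernel_product X K p))
   = (\<integral>P p. h (v (p l)) * ennreal (kernel_product X K p))"
  proof (rule nn_integral_cong)
   fix p assume p: "p \<in> space P"
   then have "0 <= v (p l)" using v(2) by (simp add: space_P)
   then show "ennreal (\<phi> (F (v (p l) *\<^sub>R axis l 1)) * kernel_product X K p) = h (v (p l)) * ennreal (kernel_product X K p)"
    using kernel_product_nonneg[OF p] \<phi>(3) by (simp add: h_def ennreal_mult max_absorb1)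
  qed
  also have "... = c * (\<integral>M z. h (v z))" by (rule c[OF measurable_compose[OF v(1) hm]])
  finally show ?thesis .
 qed
 have "(\<integral>M z. h (u l z)) = (\<integral>M z. h (symm_decr_rearrangement X (u l) z))"
 proof (rule nn_integral_equidistributed[OF u(1) u(2) u(3) rearrangement_measurable _ _ hm h0])
  show "distribution X (u l) t = distribution X (symm_decr_rearrangement X (u l)) t" if "0 < t" for t
   using distribution_rearrangement[OF u(1,3), of t l] that by simp
 qed (auto simp: rearrangement_nonneg)
 then show ?thesis
  using eq[OF u(1) u(2), of l] eq[OF rearrangement_measurable rearrangement_nonneg, of "u l"] by simp
qed

text \<open>
 With \<open>F = F\<^sub>0 + \<Sum>\<^sub>l F\<^sub>l\<close>, where \<open>F\<^sub>0\<close> is the vanishing part and \<open>F\<^sub>l y = F (y\<^sub>l e\<^sub>l)\<close>, the identity of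
 positive and negative parts is written without subtractions.
\<close>

lemma integral_decomposition:
 assumes v: "!!i. v i \<in> borel_measurable M" "!!i x. x \<in> points X ==> 0 <= v i x"
 defines "Pos \<equiv> \<lambda>l. \<integral>\<^sup>+p. ennreal (max (F (v l (p l) *\<^sub>R axis l 1)) 0 * kernel_product X K p) \<partial>P"
  and "Neg \<equiv> \<lambda>l. \<integral>\<^sup>+p. ennreal (max (- F (v l (p l) *\<^sub>R axis l 1)) 0 * kernel_product X K p) \<partial>P"
 shows "(\<integral>P p. ennreal (pos_part (integrand X F K v) p)) + (\<Sum>l\<in>UNIV. Neg l)
   = (\<integral>P p. ennreal (neg_part (integrand X F K v) p))
    + energy (vanishing_part F) v + (\<Sum>l\<in>UNIV. Pos l)"
  and "(\<integral>P p. ennreal (neg_part (integrand X F K v) p)) <= (\<Sum>l\<in>UNIV. Neg l)"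
proof -
 let ?W = "kernel_product X K"
 let ?G = "integrand X (vanishing_part F) K v"
 define f where "f l p = F (v l (p l) *\<^sub>R axis l 1)" for l and p :: "'m => 'a"
 have im[measurable]: "integrand X F K v \<in> borel_measurable P" "?G \<in> borel_measurable P"
  using integrand_measurable[OF F(1) v] integrand_measurable[OF vanishing_part_measurable[OF F(1)] v] by auto
 have fm[measurable]: "f l \<in> borel_measurable P" for l
 proof -
  have "(\<lambda>p. F ((\<chi> i. v i (p i)) $ l *\<^sub>R axis l 1)) \<in> borel_measurable P"
   by (rule values_measurable[OF measurable_compose[OF axis_measurable F(1)] v])
  then show ?thesis by (simp add: f_def[abs_def])
 qed
 have pm[measurable]: "(\<lambda>p. pos_part (integrand X F K v) p) \<in> borel_measurable P"
  "(\<lambda>p. neg_part (integrand X F K v) p) \<in> borel_measurable P"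
  unfolding pos_part_def neg_part_def by measurable
 have W0: "0 <= ?W p" if "p \<in> space P" for p using kernel_product_nonneg[OF that] .
 have G0: "0 <= ?G p" if p: "p \<in> space P" for p
 proof -
  have "0 <= vanishing_part F (\<chi> i. v i (p i))"
   using p v(2) by (intro vanishing_part_nonneg[OF F(2,3)]) (simp add: space_P)
  then show ?thesis using W0[OF p] by (simp add: integrand_def)
 qed
 have split: "integrand X F K v p = ?G p + (\<Sum>l\<in>UNIV. f l p * ?W p)" for p
  by (simp add: integrand_def vanishing_part_def f_def algebra_simps sum_distrib_left)
 \<comment> \<open>All terms are nonnegative on \<open>space P\<close>, so the identity can be
   integrated even when some integrals are infinite.\<close>
 have pn: "pos_part (integrand X F K v) p + (\<Sum>l\<in>UNIV. max (- f l p) 0 * ?W p)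
  = neg_part (integrand X F K v) p + ?G p + (\<Sum>l\<in>UNIV. max (f l p) 0 * ?W p)" for p
 proof -
  have "(\<Sum>l\<in>UNIV. max (f l p) 0 * ?W p) - (\<Sum>l\<in>UNIV. max (- f l p) 0 * ?W p) = (\<Sum>l\<in>UNIV. f l p * ?W p)"
   unfolding sum_subtractf[symmetric] left_diff_distrib[symmetric] by (intro sum.cong) (auto simp: max_def)
  moreover have "pos_part (integrand X F K v) p - neg_part (integrand X F K v) p = integrand X F K v p"
   by (auto simp: pos_part_def neg_part_def max_def)
  ultimately show ?thesis using split[of p] by linarith
 qed
 have sums: "(\<integral>P p. ennreal (\<Sum>l\<in>UNIV. \<psi> (f l p) * ?W p)) = (\<Sum>l\<in>UNIV. \<integral>\<^sup>+p. ennreal (\<psi> (f l p) * ?W p) \<partial>P)"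
  if [measurable]: "\<psi> \<in> borel_measurable borel" and "!!t. 0 <= \<psi> t" for \<psi> :: "real => real"
 proof -
  have "(\<integral>P p. ennreal (\<Sum>l\<in>UNIV. \<psi> (f l p) * ?W p)) = (\<integral>P p. (\<Sum>l\<in>UNIV. ennreal (\<psi> (f l p) * ?W p)))"
   using W0 that(2) by (intro nn_integral_cong) (simp add: sum_ennreal)
  also have "... = (\<Sum>l\<in>UNIV. \<integral>\<^sup>+p. ennreal (\<psi> (f l p) * ?W p) \<partial>P)" by (rule nn_integral_sum) measurable
  finally show ?thesis .
 qed
 have NegS: "(\<Sum>l\<in>UNIV. Neg l) = (\<integral>P p. ennreal (\<Sum>l\<in>UNIV. max (- f l p) 0 * ?W p))"
  unfolding Neg_def f_def[symmetric] by (rule sums[symmetric, of "\<lambda>t. max (- t) 0"]) auto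
 have PosS: "(\<Sum>l\<in>UNIV. Pos l) = (\<integral>P p. ennreal (\<Sum>l\<in>UNIV. max (f l p) 0 * ?W p))"
  unfolding Pos_def f_def[symmetric] by (rule sums[symmetric, of "\<lambda>t. max t 0"]) auto
 have pos0: "0 <= pos_part (integrand X F K v) p" "0 <= neg_part (integrand X F K v) p" for p
  by (auto simp: pos_part_def neg_part_def)
 have S0: "0 <= (\<Sum>l\<in>UNIV. max (- f l p) 0 * ?W p)" "0 <= (\<Sum>l\<in>UNIV. max (f l p) 0 * ?W p)" if "p \<in> space P" for p
  using W0[OF that] by (auto intro!: sum_nonneg)
 have "(\<integral>P p. ennreal (pos_part (integrand X F K v) p)) + (\<Sum>l\<in>UNIV. Neg l)
  = (\<integral>P p. ennreal (pos_part (integrand X F K v) p) + ennreal (\<Sum>l\<in>UNIV. max (- f l p) 0 * ?W p))"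
  unfolding NegS by (rule nn_integral_add[symmetric]) measurable
 also have "... = (\<integral>P p. ennreal (neg_part (integrand X F K v) p) + ennreal (?G p) + ennreal (\<Sum>l\<in>UNIV. max (f l p) 0 * ?W p))"
  using pos0 S0 G0 pn by (intro nn_integral_cong) (simp flip: ennreal_plus)
 also have "... = (\<integral>P p. ennreal (neg_part (integrand X F K v) p) + ennreal (?G p)) + (\<Sum>l\<in>UNIV. Pos l)"
  unfolding PosS by (rule nn_integral_add) measurable
 also have "(\<integral>P p. ennreal (neg_part (integrand X F K v) p) + ennreal (?G p))
  = (\<integral>P p. ennreal (neg_part (integrand X F K v) p)) + (\<integral>P p. ennreal (?G p))"
  by (rule nn_integral_add) measurable
 finally show "(\<integral>P p. ennreal (pos_part (integrand X F K v) p)) + (\<Sum>l\<in>UNIV. Neg l)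
   = (\<integral>P p. ennreal (neg_part (integrand X F K v) p)) + (\<integral>P p. ennreal (?G p)) + (\<Sum>l\<in>UNIV. Pos l)" .
 \<comment> \<open>The vanishing part is nonnegative, so negative values of the integrand come from
   the one-variable terms.\<close>
 show "(\<integral>P p. ennreal (neg_part (integrand X F K v) p)) <= (\<Sum>l\<in>UNIV. Neg l)"
  unfolding NegS
 proof (intro nn_integral_mono ennreal_leI)
  fix p assume p: "p \<in> space P"
  show "neg_part (integrand X F K v) p <= (\<Sum>l\<in>UNIV. max (- f l p) 0 * ?W p)"
   using pn[of p] G0[OF p] S0[OF p] by (auto simp: pos_part_def neg_part_def max_def split: if_splits)
 qed
qed

theorem rearrangement_theorem:
 assumes F_neg: "!!l. (\<integral>P p. ennreal (neg_part F (u l (p l) *\<^sub>R axis l 1) * kernel_product X K p)) < \<infinity>"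
 defines "ustar \<equiv> \<lambda>i. symm_decr_rearrangement X (u i)"
 shows "ext_integral_exists P (integrand X F K u)" and "ext_integral_exists P (integrand X F K ustar)"
  and "ext_integral P (integrand X F K u) <= ext_integral P (integrand X F K ustar)"
  and "ext_integral P (integrand X F K u) = ext_integral P (integrand X F K ustar) ==>
   \<bar>ext_integral P (integrand X F K ustar)\<bar> ~= \<infinity> ==>
   \<forall>i j t. i < j \<and> 0 <= t \<and> ereal t < diam X --> 0 < K i j t ==>
   i ~= j ==> same_component (strict_edges K) i j ==>
   \<forall>y\<in>nonneg_cone. \<forall>h>0. \<forall>k>0. F (y + h *\<^sub>R axis i 1 + k *\<^sub>R axis j 1) + F y
    > F (y + h *\<^sub>R axis i 1) + F (y + k *\<^sub>R axis j 1) ==>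
   nonconstant X (u i) ==> nonconstant X (u j) ==>
   \<exists>\<tau>\<in>translation_maps X. (AE x in M. u i x = ustar i (\<tau> x)) \<and> (AE x in M. u j x = ustar j (\<tau> x))"
proof -
 let ?G = "vanishing_part F"
 have star: "ustar i \<in> borel_measurable M" "0 <= ustar i x" for i x
  by (simp_all add: ustar_def rearrangement_measurable rearrangement_nonneg)
 define Pos where "Pos v l = (\<integral>P p. ennreal (max (F (v l (p l) *\<^sub>R axis l 1)) 0 * kernel_product X K p))"
  for v :: "'m => 'a => real" and l
 define Neg where "Neg v l = (\<integral>P p. ennreal (max (- F (v l (p l) *\<^sub>R axis l 1)) 0 * kernel_product X K p))"
  for v :: "'m => 'a => real" and l
 have Pos_eq: "Pos ustar l = Pos u l" for l
  unfolding Pos_def ustar_def by (rule one_variable_rearrangement[of "\<lambda>t. max t 0"]) auto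
 have Neg_eq: "Neg ustar l = Neg u l" for l
  unfolding Neg_def ustar_def by (rule one_variable_rearrangement[of "\<lambda>t. max (- t) 0"]) auto
 have Neg_fin: "(\<Sum>l\<in>UNIV. Neg u l) < \<infinity>" using F_neg by (simp add: Neg_def neg_part_def)
 note dec = integral_decomposition[of u, OF u(1,2), folded Pos_def Neg_def]
 note dec' = integral_decomposition[of ustar, OF star, folded Pos_def Neg_def, unfolded Pos_eq Neg_eq]
 have fin: "(\<integral>P p. ennreal (neg_part (integrand X F K u) p)) < \<infinity>"
  "(\<integral>P p. ennreal (neg_part (integrand X F K ustar) p)) < \<infinity>"
  using order_le_less_trans[OF dec(2) Neg_fin] order_le_less_trans[OF dec'(2) Neg_fin] by auto
 show "ext_integral_exists P (integrand X F K u)" "ext_integral_exists P (integrand X F K ustar)"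
  unfolding ext_integral_exists_def using fin integrand_measurable[OF F(1) u(1,2)] integrand_measurable[OF F(1) star] by auto
 have Gm: "?G \<in> borel_measurable (restrict_space borel nonneg_cone)" by (rule vanishing_part_measurable[OF F(1)])
 have Gs: "supermodular ?G" by (rule supermodular_vanishing_part[OF F(2)])
 have Gn: "0 <= ?G y" if "y \<in> nonneg_cone" for y
  using that by (intro vanishing_part_nonneg[OF F(2,3)]) (simp add: nonneg_cone_def)
 have G0: "?G 0 = 0" using vanishing_part_axis[where F = F, OF F(3), of 0] by simp
 have Gmono: "?G y <= ?G z" if "!!l. 0 <= y $ l" "!!l. y $ l <= z $ l" for y z
  by (rule vanishing_part_mono[OF F(2,3) that])
 have le: "energy ?G v
  <= energy ?G (\<lambda>l. symm_decr_rearrangement X (v l))"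
  if "!!i. v i \<in> borel_measurable M" "!!i x. x \<in> pts ==> 0 <= v i x" "!!i. vanishes_at_infinity X (v i)" for v
  by (rule rearrangement_inequality[of ?G v, OF Gm Gs Gn G0 Gmono that])
 note cmp = ext_integral_comparison[OF dec(1) dec'(1) Neg_fin fin le[of u, OF u, folded ustar_def]]
 show "ext_integral P (integrand X F K u) <= ext_integral P (integrand X F K ustar)"
  unfolding ext_integral_def by (rule cmp(1))
 assume eq: "ext_integral P (integrand X F K u) = ext_integral P (integrand X F K ustar)"
  and finI: "\<bar>ext_integral P (integrand X F K ustar)\<bar> ~= \<infinity>"
  and pos: "\<forall>i j t. i < j \<and> 0 <= t \<and> ereal t < diam X --> 0 < K i j t"
  and ij: "i ~= j" "same_component (strict_edges K) i j"
  and strict: "\<forall>y\<in>nonneg_cone. \<forall>h>0. \<forall>k>0. F (y + h *\<^sub>R axis i 1 + k *\<^sub>R axis j 1) + F y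
    > F (y + h *\<^sub>R axis i 1) + F (y + k *\<^sub>R axis j 1)"
  and nc: "nonconstant X (u i)" "nonconstant X (u j)"
 have GG: "energy ?G u = energy ?G ustar"
  "energy ?G ustar < \<infinity>" using cmp(2) eq finI unfolding ext_integral_def by blast+
 have strictG: "\<forall>y\<in>nonneg_cone. \<forall>h>0. \<forall>k>0. ?G (y + h *\<^sub>R axis i 1 + k *\<^sub>R axis j 1) + ?G y
    > ?G (y + h *\<^sub>R axis i 1) + ?G (y + k *\<^sub>R axis j 1)"
 proof (intro ballI allI impI)
  fix y :: "(real, 'm) vec" and h k :: real assume "y \<in> nonneg_cone" "0 < h" "0 < k"
  then have "F (y + h *\<^sub>R axis i 1) + F (y + k *\<^sub>R axis j 1) < F (y + h *\<^sub>R axis i 1 + k *\<^sub>R axis j 1) + F y"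
   using strict by blast
  then show "?G (y + h *\<^sub>R axis i 1) + ?G (y + k *\<^sub>R axis j 1) < ?G (y + h *\<^sub>R axis i 1 + k *\<^sub>R axis j 1) + ?G y"
   using vanishing_part_supermodular_gap[OF ij(1), of F y h k] by linarith
 qed
 have strictG': "\<forall>y\<in>nonneg_cone. \<forall>h>0. \<forall>k>0. ?G (y + h *\<^sub>R axis j 1 + k *\<^sub>R axis i 1) + ?G y
    > ?G (y + h *\<^sub>R axis j 1) + ?G (y + k *\<^sub>R axis i 1)"
 proof (intro ballI allI impI)
  fix y :: "(real, 'm) vec" and h k :: real assume "y \<in> nonneg_cone" "0 < h" "0 < k"
  then have "?G (y + k *\<^sub>R axis i 1) + ?G (y + h *\<^sub>R axis j 1) < ?G (y + k *\<^sub>R axis i 1 + h *\<^sub>R axis j 1) + ?G y"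
   using strictG by blast
  moreover have "y + k *\<^sub>R axis i 1 + h *\<^sub>R axis j 1 = y + h *\<^sub>R axis j 1 + k *\<^sub>R axis i 1" by (simp add: add_ac)
  ultimately show "?G (y + h *\<^sub>R axis j 1) + ?G (y + k *\<^sub>R axis i 1) < ?G (y + h *\<^sub>R axis j 1 + k *\<^sub>R axis i 1) + ?G y"
   by (simp only: add.commute[of "?G (y + k *\<^sub>R axis i 1)"])
 qed
 \<comment> \<open>The polarized functions have the same rearrangements, so their energy lies
   between that of \<open>u\<close> and that of \<open>ustar\<close>, which are equal.\<close>
 have fold_eq: "energy ?G u
   = energy ?G (\<lambda>l. polarize (x, y) (u l))"
  if x: "x \<in> pts" "y \<in> pts" "x ~= y" for x y
 proof (rule antisym)
  show "energy ?G u
   <= energy ?G (\<lambda>l. polarize (x, y) (u l))"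
   by (rule two_point_inequality[OF x Gm Gs Gn u(1,2)])
  have dist: "distribution X (polarize (x, y) (u l)) t = distribution X (u l) t" for l t
   by (rule distribution_polarize[OF x u(1)])
  have "symm_decr_rearrangement X (polarize (x, y) (u l)) = ustar l" for l
   unfolding ustar_def by (rule rearrangement_cong_distribution) (rule dist)
  moreover have "vanishes_at_infinity X (polarize (x, y) (u l))" for l
   using u(3)[of l] by (simp add: vanishes_at_infinity_def dist)
  ultimately have "energy ?G (\<lambda>l. polarize (x, y) (u l))
   <= energy ?G ustar"
   using le[of "\<lambda>l. polarize (x, y) (u l)", OF polarize_measurable[OF x u(1)] polarize_nonneg[OF x u(2)]] by simp
  then show "energy ?G (\<lambda>l. polarize (x, y) (u l))
   <= energy ?G u" unfolding GG(1) .
 qed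
 have finG: "energy ?G u < \<infinity>" using GG by simp
 have ji: "j ~= i" "same_component (strict_edges K) j i" using ij same_component_sym[OF ij(2)] by auto
 \<comment> \<open>The two-point equality case is used for \<open>(i, j)\<close> and for
   \<open>(j, i)\<close>, which excludes both ways of moving the two functions in opposite
   directions.\<close>
 obtain a where a: "a \<in> pts" "radial_about a (u i)" "radial_about a (u j)"
 proof (rule common_center[of "u i" "u j", OF u(1) u(2) u(3) nc(1) u(1) u(2) u(3) nc(2)])
  fix x y assume x: "x \<in> pts" "y \<in> pts" "x ~= y"
  show "(\<mu> {z \<in> pts. d z x < d z y \<and> u i (refl x y z) < u i z} = 0 \<or>
    \<mu> {z \<in> pts. d z x < d z y \<and> u j z < u j (refl x y z)} = 0) \<and>
   (\<mu> {z \<in> pts. d z x < d z y \<and> u j (refl x y z) < u j z} = 0 \<or>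
    \<mu> {z \<in> pts. d z x < d z y \<and> u i z < u i (refl x y z)} = 0)"
   using two_point_equality[OF x Gm Gs Gn u(1,2) fold_eq[OF x] finG pos ij strictG]
    two_point_equality[OF x Gm Gs Gn u(1,2) fold_eq[OF x] finG pos ji strictG'] by (rule conjI)
 qed (auto intro: that)
 obtain \<tau> where \<tau>: "\<tau> \<in> translation_maps X" "\<forall>x\<in>points X. \<tau> x \<in> points X \<and> d b (\<tau> x) = d a x"
  using translation_to_base[OF a(1)] by blast
 have "AE x in M. u i x = ustar i (\<tau> x)" "AE x in M. u j x = ustar j (\<tau> x)"
  unfolding ustar_def using \<tau>(2)
  by (intro radial_about_rearrangement[OF u(1,2,3) a(1,2)] radial_about_rearrangement[OF u(1,2,3) a(1,3)]; blast)+
 with \<tau>(1) show "\<exists>\<tau>\<in>translation_maps X. (AE x in M. u i x = ustar i (\<tau> x)) \<and> (AE x in M. u j x = ustar j (\<tau> x))"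
  by blast
qed

end

end

theorem theorem2:
  fixes X :: "'a::euclidean_space model_space"
    and F :: "real ^ 'm::{finite,linorder} \<Rightarrow> real"
    and K :: "'m \<Rightarrow> 'm \<Rightarrow> real \<Rightarrow> real"
    and u :: "'m \<Rightarrow> 'a \<Rightarrow> real"
  assumes X: "X = euclidean_model
        \<or> (DIM('a) \<ge> 2 \<and> (\<exists>p\<in>sphere 0 1. X = spherical_model p))
        \<or> X = hyperbolic_model"
    and F_measurable: "F \<in> borel_measurable (restrict_space borel nonneg_cone)"
    and F_supermodular: "supermodular F"
    and F_zero: "F 0 = 0"
    and K_antimono: "\<And>i j. i < j \<Longrightarrow> antimono_on {0..} (K i j)"
    and K_nonneg: "\<And>i j t. i < j \<Longrightarrow> 0 \<le> t \<Longrightarrow> 0 \<le> K i j t"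
    and u_measurable: "\<And>i. u i \<in> borel_measurable (vol X)"
    and u_nonneg: "\<And>i x. x \<in> points X \<Longrightarrow> 0 \<le> u i x"
    and u_vanishes: "\<And>i. vanishes_at_infinity X (u i)"
    and F_neg: "\<And>l. (\<integral>\<^sup>+x. ennreal (neg_part F (u l (x l) *\<^sub>R axis l 1) * kernel_product X K x)
        \<partial>vol_power X) < \<infinity>"
  defines "ustar \<equiv> \<lambda>i. symm_decr_rearrangement X (u i)"
  defines "I \<equiv> ext_integral (vol_power X) (integrand X F K u)"
    and "Istar \<equiv> ext_integral (vol_power X) (integrand X F K ustar)"
  shows "ext_integral_exists (vol_power X) (integrand X F K u)
    \<and> ext_integral_exists (vol_power X) (integrand X F K ustar)
    \<and> I \<le> Istar
    \<and> (I = Istar \<and> \<bar>I\<bar> \<noteq> \<infinity> \<and> \<bar>Istar\<bar> \<noteq> \<infinity>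
        \<and> (\<forall>i j t. i < j \<and> 0 \<le> t \<and> ereal t < diam X \<longrightarrow> 0 < K i j t)
      \<longrightarrow> (\<forall>i j. i \<noteq> j
          \<and> same_component (strict_edges K) i j
          \<and> (\<forall>y\<in>nonneg_cone. \<forall>h>0. \<forall>k>0.
              F (y + h *\<^sub>R axis i 1 + k *\<^sub>R axis j 1) + F y
                > F (y + h *\<^sub>R axis i 1) + F (y + k *\<^sub>R axis j 1))
          \<and> nonconstant X (u i) \<and> nonconstant X (u j)
        \<longrightarrow> (\<exists>\<tau>\<in>translation_maps X.
            (AE x in vol X. u i x = ustar i (\<tau> x)) \<and>
            (AE x in vol X. u j x = ustar j (\<tau> x)))))"
proof -
 obtain refl where "reflection_model X refl"
  using X euclidean_reflection_model spherical_reflection_model hyperbolic_reflection_model by blast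
 then interpret kernel_model X refl K
  by (rule kernel_model.intro) (use K_antimono K_nonneg in \<open>simp add: kernel_model_axioms_def\<close>)
 note rt = rearrangement_theorem[of F u, OF F_measurable F_supermodular F_zero u_measurable u_nonneg u_vanishes F_neg]
 show ?thesis unfolding I_def Istar_def ustar_def
  by (intro conjI rt(1-3) impI allI; (assumption | (elim conjE; rule rt(4); assumption)))
qed

end
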